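(* Let $\alpha\in(0,1]$, let $c,\varepsilon\in\mathbb{R}$ with $|\varepsilon|<1$, and let $0<\delta<1$. Let $\Omega=\{(x,y)\in\mathbb{R}^2: 0<x<1,\ -\pi<y<\pi\}$. Let $\varphi\in C^{3+\delta}[-\pi,\pi]$ and $\psi\in C^{2+\delta}[-\pi,\pi]$ satisfy $\varphi'(-\pi)=\varphi'(\pi)=0$ and $\psi'(-\pi)=\psi'(\pi)=0$. Then there exists a unique regular solution $u$, with $u_y\in C(\bar\Omega)$, of $$D_x^\alpha D_x^\alpha u(x,y)+u_{yy}(x,y)-\varepsilon u_{yy}(x,-y)-c^2u(x,y)=0,\quad (x,y)\in\Omega,$$ satisfying $$u(0,y)=\varphi(y),\quad u(1,y)=\psi(y),\quad -\pi\le y\le\pi,$$ $$u_y(x,-\pi)=u_y(x,\pi)=0,\quad 0\le x\le 1,$$ and it can be written in the form $$u(x,y)=(1-x^\alpha)\varphi_0+x^\alpha\psi_0+\sum_{k=0}^\infty\left[\varphi_{2k+1}C_{\mu_{2k+1}}(x)+\psi_{2k+1}S_{\mu_{2k+1}}(x)\right]Y_{2k+1}(y)+\sum_{k=1}^\infty\left[\varphi_{2k}C_{\mu_{2k}}(x)+\psi_{2k}S_{\mu_{2k}}(x)\right]Y_{2k}(y).$$ Here, for $k=0,1,\dots$, $Y_{2k+1}(y)=\sin\left(k+\tfrac12\right)y$, $Y_{2k}(y)=\cos ky$, $\lambda_{2k+1}=(1+\varepsilon)\left(k+\tfrac12\right)^2$, $\lambda_{2k}=(1-\varepsilon)k^2$;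 for every index $n\ge 1$, $\mu_n>0$ is given by $\mu_n^2=\lambda_n+c^2$; and for every $n\ge0$, $\varphi_n=(\varphi,Y_n)$ and $\psi_n=(\psi,Y_n)$ are the Fourier coefficients of $\varphi$ and $\psi$ with respect to the system $\{Y_n\}$.
   Context: $D_x^\alpha$ is the Caputo derivative in $x$ of order $\alpha$: for $0<\alpha<1$, $D_x^\alpha u(x,y)=\frac{1}{\Gamma(1-\alpha)}\int_0^x (x-s)^{-\alpha}\frac{\partial u}{\partial s}(s,y)\,ds$, and $D_x^1=\partial/\partial x$. A regular solution of the equation is a function $u\in C(\bar\Omega)$ such that $D_x^\alpha u,\ D_x^\alpha D_x^\alpha u,\ u_{yy}\in C(\Omega)$ and the equation holds in $\Omega$. $C^{m+\delta}[-\pi,\pi]$ is the Hölder space of $m$ times continuously differentiable functions whose $m$-th derivative is Hölder continuous with exponent $\delta$. $(\cdot,\cdot)$ is the inner product of $L_2(-\pi,\pi)$. The $Y_n$ and $\lambda_n$ are the eigenfunctions and eigenvalues of $Y''(y)-\varepsilon Y''(-y)+\lambda Y(y)=0$, $-\pi<y<\pi$, $Y'(-\pi)=Y'(\pi)=0$. The Mittag-Leffler type function is $E_{\alpha,\beta}(z)=\sum_{k=0}^\infty\frac{z^k}{\Gamma(\alpha k+\beta)}$. For $\mu>0$ and $t\in[0,1]$, $$C_\mu(t)=\frac{E_{\alpha,1}(\mu)E_{\alpha,1}(-\mu t^\alpha)-E_{\alpha,1}(-\mu)E_{\alpha,1}(\mu t^\alpha)}{2\mu E_{2\alpha,\alpha+1}(\mu^2)},\qquad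 S_\mu(t)=\frac{t^\alpha E_{2\alpha,\alpha+1}(\mu^2t^{2\alpha})}{E_{2\alpha,\alpha+1}(\mu^2)}.$$
   Formalization: For c≠0 the term (1−x^α)φ_0+x^αψ_0 is replaced by φ_0 C_{|c|}(x)+ψ_0 S_{|c|}(x) (the printed one fails, e.g. α=c=1, φ=ψ=1), and the Fourier coefficients are normalized: φ_n=(φ,Y_n)/(Y_n,Y_n), ψ_n=(ψ,Y_n)/(Y_n,Y_n). *)

theory Defs
  imports "HOL-Analysis.Analysis"
begin

section \<open>Caputo derivative\<close>

text \<open>
  The derivative has base point 0 and order \<open>a\<close> with \<open>0 < a \<le> 1\<close>.  It exists at \<open>x > 0\<close> when the
  pointwise derivative exists on the open interval \<open>(0, x)\<close> and the defining integrand is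
  Lebesgue integrable there.  The value of the function at 0 is irrelevant, so that the operator can
  be applied to a function known only on \<open>(0, 1)\<close>, such as the Caputo derivative of another one.
\<close>

definition caputo_differentiable :: "real \<Rightarrow> (real \<Rightarrow> real) \<Rightarrow> real \<Rightarrow> bool" where
  "caputo_differentiable a f x \<longleftrightarrow>
     (if a = 1 then f field_differentiable (at x)
      else (\<forall>s\<in>{0<..<x}. f field_differentiable (at s)) \<and>
           set_integrable lborel {0<..<x} (\<lambda>s. (x - s) powr (- a) * deriv f s))"

definition caputo_deriv :: "real \<Rightarrow> (real \<Rightarrow> real) \<Rightarrow> real \<Rightarrow> real" where
  "caputo_deriv a f x =
     (if a = 1 then deriv f x
      else 1 / Gamma (1 - a) * (LBINT s:{0<..<x}. (x - s) powr (- a) * deriv f s))"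


section \<open>Regular solutions\<close>

definition Omega :: "(real \<times> real) set" where
  "Omega = {0<..<1} \<times> {- pi<..<pi}"

lemma closure_Omega: "closure Omega = {0..1} \<times> {- pi..pi}"
  by (simp add: Omega_def closure_Times)

definition caputo_dx :: "real \<Rightarrow> (real \<Rightarrow> real \<Rightarrow> real) \<Rightarrow> real \<Rightarrow> real \<Rightarrow> real" where
  "caputo_dx a u x y = caputo_deriv a (\<lambda>t. u t y) x"

text \<open>
  Derivatives in the second variable are taken within \<open>[-\<pi>, \<pi>]\<close>: they are the ordinary two-sided ones
  for \<open>-\<pi> < y < \<pi>\<close> and the one-sided ones for \<open>y = \<plusminus>\<pi>\<close>.
\<close>

definition dy :: "(real \<Rightarrow> real \<Rightarrow> real) \<Rightarrow> real \<Rightarrow> real \<Rightarrow> real" where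
  "dy u x y = vector_derivative (u x) (at y within {- pi..pi})"

definition dy_exists :: "(real \<Rightarrow> real \<Rightarrow> real) \<Rightarrow> real \<Rightarrow> real \<Rightarrow> bool" where
  "dy_exists u x y \<longleftrightarrow> u x differentiable (at y within {- pi..pi})"

lemma dy_interior:
  assumes "- pi < y" "y < pi"
  shows "dy u x y = deriv (u x) y"
    and "dy_exists u x y \<longleftrightarrow> u x field_differentiable (at y)"
proof -
  have at: "at y within {- pi..pi} = at y"
    using assms by (intro at_within_interior) (simp add: interior_atLeastAtMost_real)
  show "dy u x y = deriv (u x) y"
    by (simp add: dy_def at vector_derivative_def deriv_def
        has_real_derivative_iff_has_vector_derivative)
  show "dy_exists u x y \<longleftrightarrow> u x field_differentiable (at y)"
    by (simp add: dy_exists_def at field_differentiable_def real_differentiable_def)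
qed

definition regular_solution ::
    "real \<Rightarrow> real \<Rightarrow> real \<Rightarrow> (real \<Rightarrow> real \<Rightarrow> real) \<Rightarrow> bool" where
  "regular_solution a e c u \<longleftrightarrow>
     continuous_on (closure Omega) (\<lambda>(x, y). u x y) \<and>
     (\<forall>(x, y)\<in>Omega. caputo_differentiable a (\<lambda>t. u t y) x) \<and>
     continuous_on Omega (\<lambda>(x, y). caputo_dx a u x y) \<and>
     (\<forall>(x, y)\<in>Omega. caputo_differentiable a (\<lambda>t. caputo_dx a u t y) x) \<and>
     continuous_on Omega (\<lambda>(x, y). caputo_dx a (caputo_dx a u) x y) \<and>
     (\<forall>(x, y)\<in>Omega. dy_exists u x y \<and> dy_exists (dy u) x y) \<and>
     continuous_on Omega (\<lambda>(x, y). dy (dy u) x y) \<and>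
     (\<forall>(x, y)\<in>Omega.
        caputo_dx a (caputo_dx a u) x y + dy (dy u) x y - e * dy (dy u) x (- y)
          - c\<^sup>2 * u x y = 0)"

definition dy_continuous_closure :: "(real \<Rightarrow> real \<Rightarrow> real) \<Rightarrow> bool" where
  "dy_continuous_closure u \<longleftrightarrow>
     (\<forall>(x, y)\<in>closure Omega. dy_exists u x y) \<and>
     continuous_on (closure Omega) (\<lambda>(x, y). dy u x y)"

definition boundary_conditions ::
    "(real \<Rightarrow> real) \<Rightarrow> (real \<Rightarrow> real) \<Rightarrow> (real \<Rightarrow> real \<Rightarrow> real) \<Rightarrow> bool" where
  "boundary_conditions \<phi> \<psi> u \<longleftrightarrow>
     (\<forall>y\<in>{- pi..pi}. u 0 y = \<phi> y \<and> u 1 y = \<psi> y) \<and>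
     (\<forall>x\<in>{0..1}. dy u x (- pi) = 0 \<and> dy u x pi = 0)"


section \<open>Hoelder spaces\<close>

text \<open>\<open>D i\<close> is the \<open>i\<close>-th derivative, one-sided at the end points.\<close>

definition holder_space :: "nat \<Rightarrow> real \<Rightarrow> real \<Rightarrow> real \<Rightarrow> (real \<Rightarrow> real) \<Rightarrow> bool" where
  "holder_space m \<delta> l r f \<longleftrightarrow>
     (\<exists>D. (\<forall>x\<in>{l..r}. D 0 x = f x) \<and>
          (\<forall>i<m. \<forall>x\<in>{l..r}. (D i has_real_derivative D (Suc i) x) (at x within {l..r})) \<and>
          (\<exists>L. \<forall>x\<in>{l..r}. \<forall>y\<in>{l..r}. \<bar>D m x - D m y\<bar> \<le> L * \<bar>x - y\<bar> powr \<delta>))"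


section \<open>Eigenfunctions and Fourier coefficients\<close>

definition Y :: "nat \<Rightarrow> real \<Rightarrow> real" where
  "Y n y = (if even n then cos (real (n div 2) * y) else sin ((real (n div 2) + 1 / 2) * y))"

definition eigenval :: "real \<Rightarrow> nat \<Rightarrow> real" where
  "eigenval e n = (if even n then (1 - e) * (real (n div 2))\<^sup>2
                   else (1 + e) * (real (n div 2) + 1 / 2)\<^sup>2)"

definition mu :: "real \<Rightarrow> real \<Rightarrow> nat \<Rightarrow> real" where
  "mu e c n = sqrt (eigenval e n + c\<^sup>2)"

lemma Y_simps:
  "Y (2 * k) y = cos (real k * y)"
  "Y (2 * k + 1) y = sin ((real k + 1 / 2) * y)"
  by (simp_all add: Y_def)

lemma eigenval_simps:
  "eigenval e (2 * k) = (1 - e) * (real k)\<^sup>2"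
  "eigenval e (2 * k + 1) = (1 + e) * (real k + 1 / 2)\<^sup>2"
  by (simp_all add: eigenval_def)

lemma mu_pos_square:
  assumes "\<bar>e\<bar> < 1" "n \<ge> 1"
  shows "mu e c n > 0" "(mu e c n)\<^sup>2 = eigenval e n + c\<^sup>2"
proof -
  have "even n \<Longrightarrow> n div 2 > 0" using assms(2) by auto
  then have "eigenval e n > 0"
    using assms(1) by (auto simp: eigenval_def add_pos_nonneg intro!: mult_pos_pos)
  then have "eigenval e n + c\<^sup>2 > 0" by (simp add: add_pos_nonneg)
  then show "mu e c n > 0" "(mu e c n)\<^sup>2 = eigenval e n + c\<^sup>2"
    by (simp_all add: mu_def)
qed

definition l2_inner :: "(real \<Rightarrow> real) \<Rightarrow> (real \<Rightarrow> real) \<Rightarrow> real" where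
  "l2_inner f g = (LBINT y:{- pi..pi}. f y * g y)"

text \<open>
  The functions \<open>Y n\<close> are orthogonal but not normalised (their squared norms are \<open>2\<pi>\<close> for \<open>n = 0\<close> and
  \<open>\<pi>\<close> otherwise), hence the division.
\<close>

definition fourier_coeff :: "(real \<Rightarrow> real) \<Rightarrow> nat \<Rightarrow> real" where
  "fourier_coeff f n = l2_inner f (Y n) / l2_inner (Y n) (Y n)"


section \<open>Mittag-Leffler type functions\<close>

definition mittag_leffler :: "real \<Rightarrow> real \<Rightarrow> real \<Rightarrow> real" where
  "mittag_leffler a b z = (\<Sum>k. z ^ k / Gamma (a * real k + b))"

definition C_fun :: "real \<Rightarrow> real \<Rightarrow> real \<Rightarrow> real" where
  "C_fun a \<mu> t =
     (mittag_leffler a 1 \<mu> * mittag_leffler a 1 (- \<mu> * t powr a)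
        - mittag_leffler a 1 (- \<mu>) * mittag_leffler a 1 (\<mu> * t powr a))
     / (2 * \<mu> * mittag_leffler (2 * a) (a + 1) (\<mu>\<^sup>2))"

definition S_fun :: "real \<Rightarrow> real \<Rightarrow> real \<Rightarrow> real" where
  "S_fun a \<mu> t =
     t powr a * mittag_leffler (2 * a) (a + 1) (\<mu>\<^sup>2 * t powr (2 * a))
     / mittag_leffler (2 * a) (a + 1) (\<mu>\<^sup>2)"

text \<open>
  The component along \<open>Y 0 = 1\<close> of the solution with boundary values \<open>p\<close> at 0 and \<open>q\<close> at 1.  Since
  \<open>eigenval e 0 = 0\<close>, it satisfies \<open>D\<^sup>a D\<^sup>a w = c\<^sup>2 w\<close>, of which \<open>(1 - t\<^sup>a) p + t\<^sup>a q\<close> is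
  the solution only for \<open>c = 0\<close>; for \<open>c \<noteq> 0\<close> the parameter is \<open>mu e c 0 = \<bar>c\<bar> > 0\<close>.
\<close>

definition zero_mode :: "real \<Rightarrow> real \<Rightarrow> real \<Rightarrow> real \<Rightarrow> real \<Rightarrow> real" where
  "zero_mode a c p q t =
     (if c = 0 then (1 - t powr a) * p + t powr a * q
      else p * C_fun a \<bar>c\<bar> t + q * S_fun a \<bar>c\<bar> t)"

end

theory Submission
  imports Defs "HOL-Real_Asymp.Real_Asymp"
begin

text \<open>
  Existence is separation of variables.  The coefficient of \<open>Y n\<close> solves \<open>D\<^sup>a D\<^sup>a w = \<mu>\<^sup>2 w\<close> and is
  a combination of \<open>E\<^sub>a(-\<mu> x\<^sup>a)\<close> and \<open>E\<^sub>a(\<mu> x\<^sup>a) / E\<^sub>a(\<mu>)\<close>.  Both lie in \<open>[0, 1]\<close>, and the second is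
  \<open>O(\<mu>\<^sup>-\<^sup>2)\<close> locally uniformly for \<open>x < 1\<close>.  The Hoelder conditions make \<open>\<Sum> n\<^sup>2 \<bar>\<phi>\<^sub>n\<bar>\<close> and \<open>\<Sum> n \<bar>\<psi>\<^sub>n\<bar>\<close> finite, so the
  series for \<open>u\<close> and \<open>u\<^sub>y\<close> converge up to the boundary and the one for \<open>u\<^sub>y\<^sub>y\<close> in the interior.

  For uniqueness let \<open>v\<close> be the difference of two solutions and \<open>v\<^sub>n\<close> its coefficients.  For fixed \<open>y\<close> the
  equation integrates to \<open>I\<^bsup>2-2a\<^esup> v = B(y) x\<^bsup>2-a\<^esup> + I\<^sup>2 (c\<^sup>2 v - v\<^sub>y\<^sub>y + \<epsilon> v\<^sub>y\<^sub>y(x, -y))\<close>, but \<open>v\<^sub>y\<^sub>y\<close> is not controlled near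
  \<open>x = 0\<close>, so pairing with \<open>Y n\<close> yields only
  \<open>I\<^bsup>2-2a\<^esup> v\<^sub>n = q x + B x\<^bsup>2-a\<^esup> + \<mu>\<^sup>2 I\<^sup>2 v\<^sub>n\<close> with an unknown \<open>q\<close>.  The averages \<open>2 h\<^sup>-\<^sup>2 I\<^bsup>3-2a\<^esup> v(h, y)\<close>
  tend to \<open>0\<close> for every \<open>y\<close> as \<open>h \<rightarrow> 0\<close>, and their coefficients tend to \<open>q\<close>; since \<open>v\<^sub>y\<close> is bounded, so
  is \<open>\<Sum> \<mu>\<^sub>n\<^sup>2 v\<^sub>n(x)\<^sup>2\<close>, which makes the averages bounded in \<open>L\<^sup>2\<close> and forces \<open>q = 0\<close>.  Hence
  \<open>v\<^sub>n = B' x\<^sup>a + \<mu>\<^sup>2 I\<^bsup>2a\<^esup> v\<^sub>n\<close>, whose only solution with \<open>v\<^sub>n(1) = 0\<close> is \<open>0\<close>, and \<open>v = 0\<close> because the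
  \<open>Y n\<close> are complete.
\<close>

subsection \<open>Riemann-Liouville integrals\<close>

text \<open>The equation is integrated to order exactly 2 because only an integral of integer order
  can move its base point for the price of a polynomial: the second integral of h becomes p + q x
  plus an integral between 1/2 and x (\<open>Jint\<close>). There \<open>v_yy\<close> is continuous,
  so Fubini in y applies; near x = 0 it would not. The unknown q is the cost of this move. For a <=
  1/2 continuity of v_n at 0 removes q: the averages are at most a constant times h^(1 - 2a) times
  the maximum of |v_n| on (0, h). For a > 1/2 that power blows up. The averages still vanish for
  each fixed y, but passing to coefficients needs equi-integrability in y, hence an L^2 bound
  uniform in h, hence control of single modes uniform in mu. This is where the scale mu h^a = 1
  comes from. For a = 1 nothing has to vanish, since x and x^a coincide. On the existence side the
  delicate bounds are 0 <= E_a(-t) <= 1. They are obtained from D^a f = -f by comparing a minimum of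
  f with a later maximum, not from complete monotonicity.\<close>

definition rlint :: "real \<Rightarrow> (real \<Rightarrow> real) \<Rightarrow> real \<Rightarrow> real" where
  "rlint a f x = (LBINT s:{0<..<x}. (x - s) powr (a - 1) * f s) / Gamma a"

text \<open>A Bochner integral has the value 0 when its integrand is not integrable, so existence of
  the fractional integral is tracked by a predicate of its own.\<close>

abbreviation rl_ok :: "real \<Rightarrow> (real \<Rightarrow> real) \<Rightarrow> real \<Rightarrow> bool" where
  "rl_ok a f x \<equiv> set_integrable lborel {0<..<x} (\<lambda>s. (x - s) powr (a - 1) * f s)"

text \<open>Euler's Beta integral, carried from (0, 1) to (s, x) by an affine substitution. It is
  the inner integral in the semigroup law.\<close>

lemma beta_kernel:
  fixes a b s x :: real
  assumes "0 < a" "0 < b" "s < x"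
  shows "set_integrable lborel {s<..<x} (\<lambda>t. (x - t) powr (a - 1) * (t - s) powr (b - 1))"
    and "(LBINT t:{s<..<x}. (x - t) powr (a - 1) * (t - s) powr (b - 1))
           = Beta a b * (x - s) powr (a + b - 1)"
proof -
  define c where "c = x - s"
  have c: "c > 0" using assms by (simp add: c_def)
  define g where "g t = indicator {s<..<x} t *\<^sub>R ((x - t) powr (a - 1) * (t - s) powr (b - 1))" for t
  define w where "w t = t powr (b - 1) * (1 - t) powr (a - 1)" for t :: real
  have w1: "set_integrable lborel {0..1} w"
    unfolding w_def by (rule integrable_Beta) (use assms in auto)
  have w2: "set_integrable lborel {0<..<1} w"
    by (rule set_integrable_subset[OF w1]) auto
  have "(LBINT t:{0<..<1}. w t) = integral {0<..<1} w"
    by (rule set_borel_integral_eq_integral(2)[OF w2])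
  also have "\<dots> = integral {0..1} w"
    by (simp add: integral_open_interval_real)
  also have "\<dots> = Beta b a"
    using has_integral_Beta_real[OF assms(2,1)] unfolding w_def by blast
  finally have w3: "(LBINT t:{0<..<1}. w t) = Beta a b" by (simp add: Beta_commute)
  have eq: "g (s + c * t) = c powr (a + b - 2) * (indicator {0<..<1} t *\<^sub>R w t)" for t
  proof (cases "t \<in> {0<..<1}")
    case True
    then have t: "0 < t" "t < 1" by auto
    have "0 < c * t" "c * t < c * 1" using c t by (simp_all del: mult_1_right)
    then have "s + c * t \<in> {s<..<x}" by (simp add: c_def)
    moreover have "x - (s + c * t) = c * (1 - t)" by (simp add: c_def algebra_simps)
    moreover have "c powr (a - 1) * c powr (b - 1) = c powr (a + b - 2)"
      by (simp add: powr_add[symmetric])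
    ultimately show ?thesis using True c t
      by (simp add: g_def w_def powr_mult mult.assoc[symmetric] mult.commute[of "t powr _"])
  next
    case False
    then have "t \<le> 0 \<or> 1 \<le> t" by auto
    then have "c * t \<le> 0 \<or> c * 1 \<le> c * t"
      using c by (auto simp: mult_le_0_iff)
    then have "s + c * t \<notin> {s<..<x}" by (auto simp: c_def)
    then show ?thesis using False by (simp add: g_def)
  qed
  have i1: "integrable lborel (\<lambda>t. g (s + c * t))"
    unfolding eq using w2 by (simp add: set_integrable_def)
  then have "integrable lborel g"
    using lborel_integrable_real_affine_iff[of c g s] c by simp
  then show "set_integrable lborel {s<..<x} (\<lambda>t. (x - t) powr (a - 1) * (t - s) powr (b - 1))"
    by (simp add: set_integrable_def g_def[abs_def])
  have "(LINT t|lborel. g t) = c * (LINT t|lborel. g (s + c * t))"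
    using lborel_integral_real_affine[of c g s] c by simp
  also have "(LINT t|lborel. g (s + c * t)) = c powr (a + b - 2) * Beta a b"
    unfolding eq using w3 by (simp add: set_lebesgue_integral_def)
  also have "c * (c powr (a + b - 2) * Beta a b) = Beta a b * c powr (a + b - 1)"
  proof -
    have "c * c powr (a + b - 2) = c powr (a + b - 1)"
      using c powr_mult_base[of c "a + b - 2"] by (simp add: algebra_simps)
    then show ?thesis by (metis mult.assoc mult.commute)
  qed
  finally show "(LBINT t:{s<..<x}. (x - t) powr (a - 1) * (t - s) powr (b - 1))
           = Beta a b * (x - s) powr (a + b - 1)"
    by (simp add: set_lebesgue_integral_def g_def c_def)
qed

text \<open>The weight is positive on (0, x), so multiplying by its reciprocal recovers
  \<open>f\<close> from the measurable product.\<close>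

lemma rl_ok_measurable:
  assumes "rl_ok a f x"
  shows "set_borel_measurable lborel {0<..<x} f"
proof -
  have "(\<lambda>s. indicator {0<..<x} s *\<^sub>R ((x - s) powr (a - 1) * f s)) \<in> borel_measurable lborel"
    using assms by (auto simp: set_integrable_def)
  then have "(\<lambda>s. (x - s) powr (1 - a) * (indicator {0<..<x} s *\<^sub>R ((x - s) powr (a - 1) * f s)))
      \<in> borel_measurable lborel" by measurable
  moreover have "(x - s) powr (1 - a) * (indicator {0<..<x} s *\<^sub>R ((x - s) powr (a - 1) * f s))
      = indicator {0<..<x} s *\<^sub>R f s" for s
    by (auto simp: indicator_def powr_add[symmetric] mult.assoc[symmetric])
  ultimately show ?thesis unfolding set_borel_measurable_def by (simp only:)
qed

text \<open>Fubini on the triangle 0 < s < t < x, with the Beta integral as the integral over t.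
  Integrability against the kernel of order a + b is enough: it bounds the double integral of the
  absolute values, so the inner fractional integral can fail to exist only on a null set of t. This
  matters for derivatives that may be singular at 0.\<close>

lemma rlint_semigroup:
  fixes f :: "real \<Rightarrow> real"
  assumes a: "0 < a" and b: "0 < b" and ok: "rl_ok (a + b) f x"
  shows "rl_ok a (rlint b f) x" "rlint a (rlint b f) x = rlint (a + b) f x"
proof -
  define f0 where "f0 s = indicator {0<..<x} s *\<^sub>R f s" for s
  have f0m[measurable]: "f0 \<in> borel_measurable lborel"
    using rl_ok_measurable[OF ok] by (simp add: set_borel_measurable_def f0_def[abs_def])
  define K where "K s t = indicator {s<..<x} t * ((x - t) powr (a - 1) * (t - s) powr (b - 1))"
    for s t :: real
  define H where "H s t = f0 s * K s t" for s t
  have Km[measurable]: "(\<lambda>(s, t). K s t) \<in> borel_measurable (lborel \<Otimes>\<^sub>M lborel)"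
  proof -
    have "(\<lambda>p. if fst p < snd p \<and> snd p < x
            then (x - snd p) powr (a - 1) * (snd p - fst p) powr (b - 1) else 0)
          \<in> borel_measurable (borel \<Otimes>\<^sub>M (borel :: real measure))"
      by measurable
    moreover have "(\<lambda>(s, t). K s t) = (\<lambda>p. if fst p < snd p \<and> snd p < x
            then (x - snd p) powr (a - 1) * (snd p - fst p) powr (b - 1) else 0)"
      by (auto simp: K_def fun_eq_iff)
    moreover have "borel_measurable (lborel \<Otimes>\<^sub>M lborel) =
        (borel_measurable (borel \<Otimes>\<^sub>M (borel :: real measure)) :: (real \<times> real \<Rightarrow> real) set)"
      by (intro measurable_cong_sets sets_pair_measure_cong) auto
    ultimately show ?thesis by simp
  qed
  have Kint: "integrable lborel (K s)" "(LINT t|lborel. K s t) = Beta a b * (x - s) powr (a + b - 1)"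
    if "s < x" for s
    using beta_kernel[OF a b that] by (simp_all add: K_def[abs_def] set_integrable_def set_lebesgue_integral_def)
  have Knn: "K s t \<ge> 0" for s t by (simp add: K_def)
  have Hint: "integrable lborel (H s)" for s
    using Kint(1)[of s] by (cases "s < x") (auto simp: H_def[abs_def] f0_def)
  have Hval: "(LINT t|lborel. H s t) = Beta a b * (indicator {0<..<x} s *\<^sub>R ((x - s) powr (a + b - 1) * f s))" for s
    using Kint(2)[of s] by (cases "s \<in> {0<..<x}") (auto simp: H_def f0_def)
  have Hnorm: "(LINT t|lborel. norm (H s t)) = Beta a b * \<bar>indicator {0<..<x} s *\<^sub>R ((x - s) powr (a + b - 1) * f s)\<bar>" for s
    using Kint(2)[of s] Knn by (cases "s \<in> {0<..<x}") (auto simp: H_def f0_def abs_mult)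
  have HI: "integrable (lborel \<Otimes>\<^sub>M lborel) (\<lambda>(s, t). H s t)"
  proof (rule lborel_pair.Fubini_integrable)
    show "(\<lambda>(s, t). H s t) \<in> borel_measurable (lborel \<Otimes>\<^sub>M lborel)"
      unfolding H_def by measurable
    show "integrable lborel (\<lambda>s. LINT t|lborel. norm (case (s, t) of (s, t) \<Rightarrow> H s t))"
      using ok unfolding prod.case Hnorm set_integrable_def by simp
    show "AE s in lborel. integrable lborel (\<lambda>t. case (s, t) of (s, t) \<Rightarrow> H s t)"
      using Hint by simp
  qed
  have slice: "(LINT s|lborel. H s t) = Gamma b * (indicator {0<..<x} t *\<^sub>R ((x - t) powr (a - 1) * rlint b f t))" for t
  proof (cases "t \<in> {0<..<x}")
    case True
    have "H s t = (x - t) powr (a - 1) * (indicator {0<..<t} s *\<^sub>R ((t - s) powr (b - 1) * f s))" for s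
      using True by (auto simp: H_def f0_def K_def indicator_def)
    then have "(LINT s|lborel. H s t) = (x - t) powr (a - 1) * (LBINT s:{0<..<t}. (t - s) powr (b - 1) * f s)"
      by (simp add: set_lebesgue_integral_def)
    then show ?thesis using True Gamma_real_pos[OF b] by (simp add: rlint_def less_imp_neq[symmetric])
  next
    case False
    then have "H s t = 0" for s by (auto simp: H_def f0_def K_def indicator_def)
    then show ?thesis using False by simp
  qed
  have "integrable lborel (\<lambda>t. LINT s|lborel. H s t)"
    using lborel_pair.integrable_snd[OF HI] by simp
  then show "rl_ok a (rlint b f) x"
    using Gamma_real_pos[OF b] unfolding slice set_integrable_def by simp
  have "(LINT t|lborel. LINT s|lborel. H s t) = (LINT s|lborel. LINT t|lborel. H s t)"
    by (rule lborel_pair.Fubini_integral[OF HI])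
  then have "Gamma b * (LBINT t:{0<..<x}. (x - t) powr (a - 1) * rlint b f t)
     = Beta a b * (LBINT s:{0<..<x}. (x - s) powr (a + b - 1) * f s)"
    unfolding slice Hval by (simp add: set_lebesgue_integral_def)
  moreover have "Gamma a > 0" "Gamma b > 0" "Gamma (a + b) > 0" using a b by simp_all
  ultimately show "rlint a (rlint b f) x = rlint (a + b) f x"
    unfolding rlint_def[of a "rlint b f"] rlint_def[of "a + b"] Beta_def
    by (simp add: divide_simps)
qed

lemma rlint_power:
  assumes "0 < a" "0 < b" "0 < x"
  shows "rl_ok a (\<lambda>s. s powr (b - 1)) x"
    and "rlint a (\<lambda>s. s powr (b - 1)) x = Gamma b / Gamma (a + b) * x powr (a + b - 1)"
  using beta_kernel[of a b 0 x] assms less_imp_neq[OF Gamma_real_pos[OF assms(1)], symmetric]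
  by (auto simp: rlint_def Beta_def)

lemma rl_ok_one:
  fixes a x :: real
  assumes "0 < a" "0 < x"
  shows "set_integrable lborel {0<..<x} (\<lambda>s. (x - s) powr (a - 1))"
    and "(LBINT s:{0<..<x}. (x - s) powr (a - 1)) = x powr a / a"
proof -
  have eq: "(x - s) powr (a - 1) * (s - 0) powr (1 - 1) = (x - s) powr (a - 1)"
    if "s \<in> {0<..<x}" for s using that by simp
  have "set_integrable lborel {0<..<x} (\<lambda>s. (x - s) powr (a - 1) * (s - 0) powr (1 - 1))"
    by (rule beta_kernel) (use assms in auto)
  then show "set_integrable lborel {0<..<x} (\<lambda>s. (x - s) powr (a - 1))"
    by (subst (asm) set_integrable_cong[OF refl refl eq]) auto
  have "(LBINT s:{0<..<x}. (x - s) powr (a - 1)) =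
      (LBINT s:{0<..<x}. (x - s) powr (a - 1) * (s - 0) powr (1 - 1))"
    by (rule set_lebesgue_integral_cong) (use eq in auto)
  also have "\<dots> = Beta a 1 * (x - 0) powr (a + 1 - 1)"
    by (rule beta_kernel) (use assms in auto)
  also have "\<dots> = x powr a / a"
    using assms Gamma_real_pos[of a] Gamma_plus1[of a]
    by (simp add: Beta_def field_simps nonpos_Ints_def less_imp_neq[symmetric])
  finally show "(LBINT s:{0<..<x}. (x - s) powr (a - 1)) = x powr a / a" .
qed

lemma rl_ok_bounded:
  assumes "0 < a" "set_borel_measurable lborel {0<..<x} f" "0 \<le> x" "\<And>s. s \<in> {0<..<x} \<Longrightarrow> \<bar>f s\<bar> \<le> M"
  shows "rl_ok a f x" "\<bar>rlint a f x\<bar> \<le> M * x powr a / Gamma (a + 1)"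
proof -
  have g0: "Gamma a > 0" using assms(1) by simp
  show 1: "rl_ok a f x"
  proof (cases "0 < x")
    case True
    have 0: "set_integrable lborel {0<..<x} (\<lambda>s. M * ((x - s) powr (a - 1)))"
      by (intro set_integrable_mult_right rl_ok_one assms True)
    show ?thesis
    proof (rule set_integrable_bound[OF 0])
      have "(\<lambda>s. (x - s) powr (a - 1) * (indicator {0<..<x} s *\<^sub>R f s)) \<in> borel_measurable lborel"
        using assms(2) unfolding set_borel_measurable_def by measurable
      then show "set_borel_measurable lborel {0<..<x} (\<lambda>s. (x - s) powr (a - 1) * f s)"
        by (simp add: set_borel_measurable_def mult.left_commute)
      show "AE s in lborel. s \<in> {0<..<x} \<longrightarrow> norm ((x - s) powr (a - 1) * f s) \<le> norm (M * (x - s) powr (a - 1))"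
        using assms(4) by (auto simp: abs_mult mult.commute intro!: mult_left_mono AE_I2 intro: order_trans[OF _ abs_ge_self])
    qed
  qed simp
  show "\<bar>rlint a f x\<bar> \<le> M * x powr a / Gamma (a + 1)"
  proof (cases "0 < x")
    case True
    have 0: "set_integrable lborel {0<..<x} (\<lambda>s. M * ((x - s) powr (a - 1)))"
      by (intro set_integrable_mult_right rl_ok_one assms True)
    have "\<bar>LBINT s:{0<..<x}. (x - s) powr (a - 1) * f s\<bar> \<le> (LBINT s:{0<..<x}. \<bar>(x - s) powr (a - 1) * f s\<bar>)"
      using set_integral_norm_bound[OF 1] by simp
    also have "\<dots> \<le> (LBINT s:{0<..<x}. M * (x - s) powr (a - 1))"
      using assms(4) by (intro set_integral_mono set_integrable_abs 1 0) (auto simp: abs_mult mult.commute intro!: mult_left_mono)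
    also have "\<dots> = M * (x powr a / a)"
      using rl_ok_one(2)[OF assms(1) True] by simp
    finally have "\<bar>rlint a f x\<bar> \<le> M * (x powr a / a) / Gamma a"
      using divide_right_mono[of _ _ "Gamma a"] g0 by (simp only: rlint_def abs_divide) force
    moreover have "Gamma (a + 1) = a * Gamma a"
      using assms(1) by (intro Gamma_plus1) (auto elim!: nonpos_Ints_cases)
    ultimately show ?thesis by (simp add: field_simps)
  next
    case False
    then show ?thesis using assms(3) by (simp add: rlint_def set_lebesgue_integral_def)
  qed
qed

subsection \<open>Mittag-Leffler functions\<close>

lemma Gamma_plus1_pos: "0 < x \<Longrightarrow> Gamma (x + 1) = x * Gamma (x::real)"
  by (intro Gamma_plus1) (auto elim!: nonpos_Ints_cases)

text \<open>Only the part [M, M + 1] of Euler's integral is kept. Since \<open>M\<close> is free,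
  Gamma outgrows every geometric sequence, which makes the Mittag-Leffler series entire.\<close>

lemma Gamma_ge_powr:
  fixes M x :: real
  assumes "0 < M" "1 \<le> x"
  shows "exp (- (M + 1)) * M powr (x - 1) \<le> Gamma x"
proof -
  let ?f = "\<lambda>t::real. t powr (x - 1) / exp t"
  have I: "(?f has_integral Gamma x) {0..}"
    by (rule Gamma_integral_real) (use assms in auto)
  have J: "?f integrable_on {M..M + 1}"
    by (intro integrable_continuous_interval continuous_intros) (use assms in auto)
  have "exp (- (M + 1)) * M powr (x - 1) = integral {M..M + 1} (\<lambda>t. exp (- (M + 1)) * M powr (x - 1))"
    by simp
  also have "\<dots> \<le> integral {M..M + 1} ?f"
  proof (rule integral_le[OF _ J])
    fix t assume t: "t \<in> {M..M + 1}"
    have "M powr (x - 1) \<le> t powr (x - 1)" using t assms by (intro powr_mono2) auto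
    moreover have "exp (- (M + 1)) \<le> exp (- t)" using t by auto
    ultimately show "exp (- (M + 1)) * M powr (x - 1) \<le> ?f t"
      using mult_mono[of "exp (- (M + 1))" "exp (- t)" "M powr (x - 1)" "t powr (x - 1)"]
      by (simp add: exp_minus field_simps)
  qed auto
  also have "\<dots> \<le> integral {0..} ?f"
    by (rule integral_subset_le) (use assms I J in auto)
  also have "\<dots> = Gamma x" using I by blast
  finally show ?thesis .
qed

lemma summable_norm_ml:
  fixes a b z :: real
  assumes "0 < a" "0 < b"
  shows "summable (\<lambda>k. norm (z ^ k / Gamma (a * real k + b)))"
proof -
  \<comment> \<open>\<open>M\<close> is chosen so that M^a = 2|z| + 1: the lower bound for Gamma
    then beats |z|^k by a factor 2^k, and \<open>C\<close> collects what does not depend on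
    k.\<close>
  define M where "M = (2 * \<bar>z\<bar> + 1) powr (1 / a)"
  have M: "M > 0" by (simp add: M_def)
  have Ma: "M powr a = 2 * \<bar>z\<bar> + 1" using assms by (simp add: M_def powr_powr)
  define C where "C = exp (M + 1) * M powr (1 - b)"
  have ev: "eventually (\<lambda>k. norm (z ^ k / Gamma (a * real k + b)) \<le> C * (1 / 2) ^ k) sequentially"
  proof (rule eventually_sequentiallyI)
    fix k assume k: "k \<ge> nat \<lceil>1 / a\<rceil>"
    then have "1 / a \<le> real k" by linarith
    then have k1: "1 \<le> a * real k + b" using assms by (simp add: field_simps)
    have "\<bar>z\<bar> ^ k * 2 ^ k \<le> (2 * \<bar>z\<bar> + 1) ^ k"
      unfolding power_mult_distrib[symmetric] by (intro power_mono) auto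
    also have "\<dots> = M powr (a * real k)"
      using M by (simp add: Ma[symmetric] powr_powr powr_realpow[symmetric])
    finally have z: "\<bar>z\<bar> ^ k * 2 ^ k \<le> M powr (a * real k)" .
    have "M powr (a * real k) = M powr (a * real k + b - 1) * M powr (1 - b)"
      using M by (simp add: powr_add[symmetric])
    also have "\<dots> = C * (exp (- (M + 1)) * M powr (a * real k + b - 1))"
      unfolding C_def exp_minus by simp
    also have "\<dots> \<le> C * Gamma (a * real k + b)"
      using Gamma_ge_powr[OF M k1] by (intro mult_left_mono) (auto simp: C_def)
    finally have "\<bar>z\<bar> ^ k * 2 ^ k \<le> C * Gamma (a * real k + b)" using z by linarith
    moreover have "Gamma (a * real k + b) > 0" using k1 by (intro Gamma_real_pos) auto
    ultimately show "norm (z ^ k / Gamma (a * real k + b)) \<le> C * (1 / 2) ^ k"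
      by (simp add: power_abs field_simps power_one_over)
  qed
  show ?thesis
    by (rule summable_comparison_test_ev[OF _ summable_mult[of _ C, OF summable_geometric[of "1 / 2 :: real"]]])
       (use ev in auto)
qed

lemma summable_ml:
  fixes a b z :: real
  assumes "0 < a" "0 < b"
  shows "summable (\<lambda>k. z ^ k / Gamma (a * real k + b))"
  using summable_norm_cancel[OF summable_norm_ml[OF assms]] .

lemma ml_sums:
  fixes a b z :: real
  assumes "0 < a" "0 < b"
  shows "(\<lambda>k. z ^ k / Gamma (a * real k + b)) sums mittag_leffler a b z"
  unfolding mittag_leffler_def by (rule summable_sums[OF summable_ml[OF assms]])

lemma Gamma_arg_pos: "0 < a \<Longrightarrow> 0 < b \<Longrightarrow> 0 < Gamma (a * real k + b)"
  by (intro Gamma_real_pos add_nonneg_pos) auto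

lemma ml_0 [simp]: "mittag_leffler a b 0 = 1 / Gamma b"
proof -
  have "mittag_leffler a b 0 = (\<Sum>k. if k = 0 then 1 / Gamma (a * real k + b) else 0)"
    unfolding mittag_leffler_def by (intro suminf_cong) auto
  also have "\<dots> = 1 / Gamma b"
    using suminf_split_initial_segment[of "\<lambda>k. if k = 0 then 1 / Gamma (a * real k + b) else 0" 1]
    by simp
  finally show ?thesis .
qed

lemma ml_has_derivative:
  fixes a b z :: real
  assumes "0 < a" "0 < b"
  shows "(mittag_leffler a b has_real_derivative
           (\<Sum>k. diffs (\<lambda>k. 1 / Gamma (a * real k + b)) k * z ^ k)) (at z)"
proof -
  have "summable (\<lambda>k. 1 / Gamma (a * real k + b) * y ^ k)" for y :: real
    using summable_ml[OF assms, of y] by simp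
  from termdiffs_strong_converges_everywhere[OF this, of z]
  show ?thesis unfolding mittag_leffler_def[abs_def] by simp
qed

lemma isCont_ml: "0 < a \<Longrightarrow> 0 < b \<Longrightarrow> isCont (mittag_leffler a b) z"
  using DERIV_isCont[OF ml_has_derivative] .

lemma continuous_on_ml [continuous_intros]:
  assumes "0 < a" "0 < b" "continuous_on S f"
  shows "continuous_on S (\<lambda>x. mittag_leffler a b (f x))"
  using isCont_ml[OF assms(1,2)]
  by (intro continuous_on_compose2[OF continuous_at_imp_continuous_on assms(3), of UNIV]) auto

text \<open>The factor k + 1 produced by termwise differentiation cancels in Gamma(a(k+1) + 1) =
  a(k+1) Gamma(ak + a).\<close>

lemma ml_1_has_derivative:
  fixes a z :: real
  assumes "0 < a"
  shows "(mittag_leffler a 1 has_real_derivative mittag_leffler a a z / a) (at z)"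
proof -
  have eq: "diffs (\<lambda>k. 1 / Gamma (a * real k + 1)) k = 1 / a * (1 / Gamma (a * real k + a))" for k
  proof -
    have "Gamma (a * real (Suc k) + 1) = a * real (Suc k) * Gamma (a * real (Suc k))"
      using assms by (intro Gamma_plus1_pos) simp
    moreover have "a * real (Suc k) = a * real k + a" by (simp add: algebra_simps)
    ultimately show ?thesis using assms Gamma_arg_pos[OF assms assms, of k]
      add_nonneg_pos[of "a * real k" a]
      by (simp add: diffs_def divide_simps) (simp add: algebra_simps)
  qed
  have "(\<Sum>k. diffs (\<lambda>k. 1 / Gamma (a * real k + 1)) k * z ^ k) = mittag_leffler a a z / a"
    unfolding eq using sums_unique[OF sums_divide[OF ml_sums[OF assms assms, of z], of a]]
    by (simp add: divide_simps mult.commute)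
  then show ?thesis using ml_has_derivative[OF assms, of 1 z] by simp
qed

lemma ml_powr_has_derivative:
  fixes a m x :: real
  assumes "0 < a" "0 < x"
  shows "((\<lambda>x. mittag_leffler a 1 (m * x powr a)) has_real_derivative
           m * (x powr (a - 1) * mittag_leffler a a (m * x powr a))) (at x)"
proof -
  have "((\<lambda>x. m * x powr a) has_real_derivative m * (a * x powr (a - 1))) (at x)"
    using assms by (auto intro!: derivative_eq_intros)
  from DERIV_chain2[OF ml_1_has_derivative[OF assms(1)] this] show ?thesis
    using assms by (simp add: field_simps)
qed

lemma ml_mono:
  fixes a b :: real
  assumes "0 < a" "0 < b" "0 \<le> z" "z \<le> w"
  shows "mittag_leffler a b z \<le> mittag_leffler a b w"
  unfolding mittag_leffler_def using assms Gamma_arg_pos[OF assms(1,2)]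
  by (intro suminf_le summable_ml divide_right_mono power_mono less_imp_le[OF Gamma_arg_pos]) auto

lemma ml_ge_term:
  fixes a b :: real
  assumes "0 < a" "0 < b" "0 \<le> z"
  shows "z ^ k / Gamma (a * real k + b) \<le> mittag_leffler a b z"
proof -
  have "sum (\<lambda>k. z ^ k / Gamma (a * real k + b)) {k} \<le> mittag_leffler a b z"
    unfolding mittag_leffler_def using assms
    by (intro sum_le_suminf summable_ml divide_nonneg_nonneg less_imp_le[OF Gamma_arg_pos]) auto
  then show ?thesis by simp
qed

lemma ml_pos:
  fixes a b :: real
  assumes "0 < a" "0 < b" "0 \<le> z"
  shows "0 < mittag_leffler a b z"
proof -
  have "0 < 1 / Gamma b" using assms(2) by simp
  also have "\<dots> \<le> mittag_leffler a b z" using ml_ge_term[OF assms, of 0] by simp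
  finally show ?thesis .
qed

text \<open>The even terms cancel and the odd ones have Gamma(2ak + a + 1) below. This identifies
  the denominators of \<open>C_fun\<close> and \<open>S_fun\<close> with E(mu) - E(-mu).\<close>

lemma ml_odd_part:
  fixes a z :: real
  assumes "0 < a"
  shows "mittag_leffler a 1 z - mittag_leffler a 1 (- z) = 2 * z * mittag_leffler (2 * a) (a + 1) (z\<^sup>2)"
proof -
  let ?f = "\<lambda>k. z ^ k / Gamma (a * real k + 1) - (- z) ^ k / Gamma (a * real k + 1)"
  have s: "?f sums (mittag_leffler a 1 z - mittag_leffler a 1 (- z))"
    by (intro sums_diff ml_sums) (use assms in auto)
  have "(\<lambda>k. ?f (2 * k + 1)) sums (mittag_leffler a 1 z - mittag_leffler a 1 (- z))"
  proof (subst sums_mono_reindex[of "\<lambda>k. 2 * k + 1" ?f])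
    show "strict_mono (\<lambda>k::nat. 2 * k + 1)" by (auto simp: strict_mono_def)
    show "?f n = 0" if "n \<notin> range (\<lambda>k. 2 * k + 1)" for n
    proof -
      have "even n" using that by (metis oddE rangeI)
      then show ?thesis by simp
    qed
  qed (rule s)
  moreover have "?f (2 * k + 1) = 2 * z * ((z\<^sup>2) ^ k / Gamma (2 * a * real k + (a + 1)))" for k
    by (simp add: power_mult[symmetric] algebra_simps)
  ultimately have "(\<lambda>k. 2 * z * ((z\<^sup>2) ^ k / Gamma (2 * a * real k + (a + 1)))) sums
      (mittag_leffler a 1 z - mittag_leffler a 1 (- z))" by simp
  moreover have "(\<lambda>k. 2 * z * ((z\<^sup>2) ^ k / Gamma (2 * a * real k + (a + 1)))) sums
      (2 * z * mittag_leffler (2 * a) (a + 1) (z\<^sup>2))"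
    by (intro sums_mult ml_sums) (use assms in auto)
  ultimately show ?thesis by (rule sums_unique2)
qed

text \<open>The two Gamma arguments differ by at most 3, so their quotient grows at most like a
  cubic in k, which t^k absorbs.\<close>

lemma Gamma_ratio_bounded:
  fixes a b t :: real
  assumes "0 < a" "a \<le> 1" "0 < b" "0 \<le> t" "t < 1"
  shows "\<exists>C>0. \<forall>k. t ^ k * Gamma (a * real (k + 2) + 1) \<le> C * Gamma (a * real k + b)"
proof -
  let ?X = "\<lambda>k. t ^ k * Gamma (a * real (k + 2) + 1) / Gamma (a * real k + b)"
  have pos: "0 < Gamma (a * real k + b)" for k by (rule Gamma_arg_pos) (use assms in auto)
  have ev: "eventually (\<lambda>k. norm (?X k) \<le> t ^ k * (real k + b + 2) ^ 3) sequentially"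
  proof (rule eventually_sequentiallyI)
    fix k assume k: "k \<ge> nat \<lceil>1 / a\<rceil>"
    then have "1 / a \<le> real k" by linarith
    then have k1: "1 \<le> a * real k" using assms by (simp add: field_simps)
    let ?y = "a * real k + b"
    have y: "?y > 0" using k1 assms by linarith
    \<comment> \<open>Gamma is not monotone on (0, 2); beyond 2 it increases, so the comparison of
      arguments passes to the values.\<close>
    have "2 \<le> a * real (k + 2) + 1" using k1 assms by (simp add: algebra_simps)
    moreover have le: "a * real (k + 2) + 1 \<le> ?y + 3" using assms by (simp add: algebra_simps)
    ultimately have "Gamma (a * real (k + 2) + 1) \<le> Gamma (?y + 3)"
    proof (cases "a * real (k + 2) + 1 < ?y + 3")
      case True
      then show ?thesis
        using Gamma_real_strict_mono[OF _ True] \<open>2 \<le> a * real (k + 2) + 1\<close> by linarith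
    next
      case False
      then have "a * real (k + 2) + 1 = ?y + 3" using le by linarith
      then show ?thesis by (simp only: order_refl)
    qed
    also have "Gamma (?y + 3) = (?y + 2) * ((?y + 1) * (?y * Gamma ?y))"
    proof -
      have "Gamma (?y + 1) = ?y * Gamma ?y" by (rule Gamma_plus1_pos[OF y])
      moreover have "Gamma (?y + 1 + 1) = (?y + 1) * Gamma (?y + 1)" by (rule Gamma_plus1_pos) (use y in linarith)
      moreover have "Gamma (?y + 2 + 1) = (?y + 2) * Gamma (?y + 2)" by (rule Gamma_plus1_pos) (use y in linarith)
      moreover have "?y + 1 + 1 = ?y + 2" "?y + 2 + 1 = ?y + 3" by simp_all
      ultimately show ?thesis by metis
    qed
    also have "\<dots> \<le> (real k + b + 2) * ((real k + b + 2) * ((real k + b + 2) * Gamma ?y))"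
    proof -
      have "?y \<le> real k + b" using assms by (simp add: mult_left_le_one_le)
      then show ?thesis using y pos[of k] by (intro mult_mono) (auto intro!: mult_nonneg_nonneg)
    qed
    also have "\<dots> = (real k + b + 2) ^ 3 * Gamma ?y" by (simp add: power3_eq_cube)
    finally have 1: "Gamma (a * real (k + 2) + 1) \<le> (real k + b + 2) ^ 3 * Gamma ?y" .
    have 2: "0 < Gamma (a * real (k + 2) + 1)" by (rule Gamma_arg_pos) (use assms in auto)
    have "norm (?X k) = t ^ k * (Gamma (a * real (k + 2) + 1) / Gamma ?y)"
      using assms pos[of k] 2 by (simp add: abs_mult)
    also have "\<dots> \<le> t ^ k * (real k + b + 2) ^ 3"
      using 1 pos[of k] assms by (intro mult_left_mono) (auto simp: pos_divide_le_eq)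
    finally show "norm (?X k) \<le> t ^ k * (real k + b + 2) ^ 3" .
  qed
  have "(\<lambda>k. t ^ k * (real k + b + 2) ^ 3) \<longlonglongrightarrow> 0"
  proof (cases "t = 0")
    case True
    then show ?thesis
      by (intro tendsto_eventually eventually_sequentiallyI[of 1]) auto
  next
    case False
    then have t: "0 < t" "t < 1" using assms by auto
    then show ?thesis by real_asymp
  qed
  then have "?X \<longlonglongrightarrow> 0"
    by (rule Lim_null_comparison[OF ev])
  then have "Bseq ?X" by (intro convergent_imp_Bseq convergentI)
  then obtain C where C: "C > 0" "\<And>k. norm (?X k) \<le> C"
    by (blast elim!: BseqE)
  have "t ^ k * Gamma (a * real (k + 2) + 1) \<le> C * Gamma (a * real k + b)" for k
    using C(2)[of k] pos[of k] by (simp add: abs_le_iff pos_divide_le_eq del: of_nat_add)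
  with C(1) show ?thesis by blast
qed

text \<open>Term k on the left is compared with term k + 2 on the right: the shift supplies the
  factor m^2, and the geometric factor t^k pays for the change of Gamma. The constant is uniform in
  m. The first two terms on the right are nonnegative and are dropped.\<close>

lemma ml_growth:
  fixes a b t :: real
  assumes "0 < a" "a \<le> 1" "0 < b" "0 \<le> t" "t < 1"
  shows "\<exists>C>0. \<forall>m>0. \<forall>s\<in>{0..t}. m\<^sup>2 * mittag_leffler a b (m * s) \<le> C * mittag_leffler a 1 m"
proof -
  obtain C where C: "C > 0" "\<And>k. t ^ k * Gamma (a * real (k + 2) + 1) \<le> C * Gamma (a * real k + b)"
    using Gamma_ratio_bounded[OF assms] by blast
  have "m\<^sup>2 * mittag_leffler a b (m * s) \<le> C * mittag_leffler a 1 m" if m: "m > 0" and s: "s \<in> {0..t}" for m s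
  proof -
    have "(\<lambda>k. m\<^sup>2 * ((m * s) ^ k / Gamma (a * real k + b))) sums (m\<^sup>2 * mittag_leffler a b (m * s))"
      by (intro sums_mult ml_sums) (use assms in auto)
    moreover have "(\<lambda>k. C * (m ^ (k + 2) / Gamma (a * real (k + 2) + 1))) sums
        (C * (mittag_leffler a 1 m - (\<Sum>k<2. m ^ k / Gamma (a * real k + 1))))"
      by (intro sums_mult sums_split_initial_segment ml_sums) (use assms in auto)
    moreover have "m\<^sup>2 * ((m * s) ^ k / Gamma (a * real k + b)) \<le> C * (m ^ (k + 2) / Gamma (a * real (k + 2) + 1))" for k
    proof -
      have p: "0 < Gamma (a * real k + b)" "0 < Gamma (a * real (k + 2) + 1)"
        using Gamma_arg_pos[of a b k] Gamma_arg_pos[of a 1 "k + 2"] assms by simp_all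
      have "s ^ k \<le> t ^ k" using s by (intro power_mono) auto
      then have "s ^ k * Gamma (a * real (k + 2) + 1) \<le> C * Gamma (a * real k + b)"
        using C(2)[of k] p(2) mult_right_mono[of "s ^ k" "t ^ k" "Gamma (a * real (k + 2) + 1)"] by linarith
      then have "s ^ k / Gamma (a * real k + b) \<le> C / Gamma (a * real (k + 2) + 1)"
        using p by (simp add: divide_simps del: of_nat_add) 
      then have "m ^ (k + 2) * (s ^ k / Gamma (a * real k + b)) \<le> m ^ (k + 2) * (C / Gamma (a * real (k + 2) + 1))"
        using m by (intro mult_left_mono) auto
      then show ?thesis by (simp add: power_add power_mult_distrib mult_ac power2_eq_square)
    qed
    ultimately have "m\<^sup>2 * mittag_leffler a b (m * s) \<le> C * (mittag_leffler a 1 m - (\<Sum>k<2. m ^ k / Gamma (a * real k + 1)))"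
      by (metis (no_types, lifting) sums_le)
    also have "\<dots> \<le> C * mittag_leffler a 1 m"
      using C(1) m assms Gamma_arg_pos[of a 1]
      by (intro mult_left_mono) (simp_all add: sum_nonneg less_imp_le)
    finally show ?thesis .
  qed
  with C(1) show ?thesis by blast
qed

text \<open>Each power is integrated by the Beta formula, which trades Gamma(ak + b) for Gamma(ak +
  b + d); the series may be integrated termwise because it converges absolutely.\<close>

lemma rlint_ml:
  fixes a b d m x :: real
  assumes "0 < a" "0 < b" "0 < d" "0 < x"
  shows "rl_ok d (\<lambda>s. s powr (b - 1) * mittag_leffler a b (m * s powr a)) x"
    and "rlint d (\<lambda>s. s powr (b - 1) * mittag_leffler a b (m * s powr a)) x
           = x powr (b + d - 1) * mittag_leffler a (b + d) (m * x powr a)"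
proof -
  define g where "g c k s = indicator {0<..<x} s *\<^sub>R ((x - s) powr (d - 1) *
      (s powr (b - 1) * ((c * s powr a) ^ k / Gamma (a * real k + b))))" for c :: real and k s
  have g_eq: "g c k s = c ^ k / Gamma (a * real k + b) *
     (indicator {0<..<x} s *\<^sub>R ((x - s) powr (d - 1) * s powr (a * real k + b - 1)))" for c k s
  proof (cases "s \<in> {0<..<x}")
    case True
    then have "s powr (a * real k + b - 1) = s powr (b - 1) * (s powr a) ^ k"
      by (simp add: powr_add[symmetric] powr_realpow[symmetric] powr_powr algebra_simps)
    then show ?thesis by (simp add: g_def power_mult_distrib)
  qed (simp add: g_def)
  have pos: "0 < a * real k + b" for k using assms by (simp add: add_nonneg_pos)
  define D where "D = Gamma d * x powr (b + d - 1)"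
  have g_int: "integrable lborel (g c k)"
    and g_val: "integral\<^sup>L lborel (g c k) = D * ((c * x powr a) ^ k / Gamma (a * real k + (b + d)))" for c k
  proof -
    have 0: "set_integrable lborel {0<..<x} (\<lambda>s. (x - s) powr (d - 1) * s powr (a * real k + b - 1))"
      using rlint_power(1)[of d "a * real k + b" x] assms pos[of k] by simp
    have 1: "(LBINT s:{0<..<x}. (x - s) powr (d - 1) * s powr (a * real k + b - 1)) =
        Beta d (a * real k + b) * x powr (d + (a * real k + b) - 1)"
      using beta_kernel(2)[of d "a * real k + b" 0 x] assms pos[of k] by simp
    show "integrable lborel (g c k)"
      using 0 unfolding g_eq[abs_def] set_integrable_def by simp
    have x: "x powr (d + (a * real k + b) - 1) = x powr (b + d - 1) * (x powr a) ^ k"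
      using assms by (simp add: powr_add[symmetric] powr_realpow[symmetric] powr_powr algebra_simps)
    have "integral\<^sup>L lborel (g c k) = c ^ k / Gamma (a * real k + b) *
        (Beta d (a * real k + b) * (x powr (b + d - 1) * (x powr a) ^ k))"
      using 1 unfolding g_eq[abs_def] set_lebesgue_integral_def x by simp
    then show "integral\<^sup>L lborel (g c k) = D * ((c * x powr a) ^ k / Gamma (a * real k + (b + d)))"
      using Gamma_real_pos[OF pos[of k]] by (simp add: D_def Beta_def power_mult_distrib add_ac)
  qed
  \<comment> \<open>The absolute values form the same series at |m|. This is why \<open>g\<close>
    carries the coefficient as a parameter: one computation serves the values and the norms.\<close>
  have norm_g: "norm (g m k s) = g \<bar>m\<bar> k s" for k s
    using Gamma_real_pos[OF pos[of k]] by (auto simp: g_def abs_mult indicator_def power_abs)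
  have norm_int: "(LINT s|lborel. norm (g m k s)) = D * ((\<bar>m\<bar> * x powr a) ^ k / Gamma (a * real k + (b + d)))" for k
    using g_val[of "\<bar>m\<bar>" k] by (simp only: norm_g)
  have sums_g: "(\<lambda>k. g c k s) sums (indicator {0<..<x} s *\<^sub>R ((x - s) powr (d - 1) *
      (s powr (b - 1) * mittag_leffler a b (c * s powr a))))" for c s
    unfolding g_def real_scaleR_def by (intro sums_mult ml_sums) (use assms in auto)
  have A: "AE s in lborel. summable (\<lambda>k. norm (g m k s))"
    unfolding norm_g using sums_summable[OF sums_g] by (intro AE_I2)
  have B: "summable (\<lambda>k. LINT s|lborel. norm (g m k s))"
    unfolding norm_int by (intro summable_mult summable_ml) (use assms in auto)
  have eq: "(\<Sum>k. g m k s) = indicator {0<..<x} s *\<^sub>R ((x - s) powr (d - 1) *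
      (s powr (b - 1) * mittag_leffler a b (m * s powr a)))" for s
    using sums_g[of m s] by (simp add: sums_iff)
  show "rl_ok d (\<lambda>s. s powr (b - 1) * mittag_leffler a b (m * s powr a)) x"
    unfolding set_integrable_def eq[symmetric] by (rule integrable_suminf[OF g_int A B])
  have "(\<lambda>k. integral\<^sup>L lborel (g m k)) sums (LINT s|lborel. (\<Sum>k. g m k s))"
    by (rule sums_integral[OF g_int A B])
  then have "(\<lambda>k. D * ((m * x powr a) ^ k / Gamma (a * real k + (b + d)))) sums
     (LINT s|lborel. (\<Sum>k. g m k s))" by (simp only: g_val)
  moreover have "(\<lambda>k. D * ((m * x powr a) ^ k / Gamma (a * real k + (b + d)))) sums
      (D * mittag_leffler a (b + d) (m * x powr a))"
    by (intro sums_mult ml_sums) (use assms in auto)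
  ultimately have "(LINT s|lborel. (\<Sum>k. g m k s)) = D * mittag_leffler a (b + d) (m * x powr a)"
    by (rule sums_unique2)
  then show "rlint d (\<lambda>s. s powr (b - 1) * mittag_leffler a b (m * s powr a)) x
           = x powr (b + d - 1) * mittag_leffler a (b + d) (m * x powr a)"
    using Gamma_real_pos[of d] assms
    by (simp add: rlint_def set_lebesgue_integral_def eq D_def less_imp_neq[symmetric])
qed

lemma ml_shift:
  fixes a b z :: real
  assumes "0 < a" "0 < b"
  shows "mittag_leffler a b z = 1 / Gamma b + z * mittag_leffler a (b + a) z"
proof -
  have "(\<lambda>k. z * (z ^ k / Gamma (a * real k + (b + a)))) sums (z * mittag_leffler a (b + a) z)"
    by (intro sums_mult ml_sums) (use assms in auto)
  moreover have "z * (z ^ k / Gamma (a * real k + (b + a))) = z ^ Suc k / Gamma (a * real (Suc k) + b)" for k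
    by (simp add: algebra_simps)
  ultimately have "(\<lambda>k. z ^ Suc k / Gamma (a * real (Suc k) + b)) sums (z * mittag_leffler a (b + a) z)"
    by (simp only:)
  then have "(\<lambda>k. z ^ k / Gamma (a * real k + b)) sums (z * mittag_leffler a (b + a) z + z ^ 0 / Gamma (a * real 0 + b))"
    by (subst (asm) sums_Suc_iff) simp
  from sums_unique2[OF ml_sums[OF assms] this] show ?thesis by simp
qed

lemma ml_1_1: "mittag_leffler 1 1 z = exp z"
proof -
  have "z ^ k / Gamma (1 * real k + 1) = z ^ k /\<^sub>R fact k" for k
    using Gamma_fact[of k, where 'a = real] by (simp add: add.commute divide_inverse mult.commute)
  then show ?thesis unfolding mittag_leffler_def exp_def by simp
qed

section \<open>Sign and size of Mittag-Leffler functions at negative arguments\<close>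

lemma singular_weight_tendsto:
  fixes f w :: "real \<Rightarrow> real"
  assumes "a < 1" "(f has_real_derivative D) (at b)"
    and "eventually (\<lambda>s. \<bar>w s\<bar> \<le> (b - s) powr (- a)) (at_left b)"
  shows "((\<lambda>s. w s * (f s - f b)) \<longlongrightarrow> 0) (at_left b)"
proof -
  have "((\<lambda>s. (f s - f b) / (s - b)) \<longlongrightarrow> D) (at b)"
    using assms(2) by (simp add: has_field_derivative_iff)
  then have q: "((\<lambda>s. (f s - f b) / (s - b)) \<longlongrightarrow> D) (at_left b)"
    by (rule filterlim_mono) (auto simp: at_within_le_at)
  have p: "((\<lambda>s. (b - s) powr (1 - a)) \<longlongrightarrow> 0) (at_left b)"
  proof (rule tendsto_eq_rhs)
    show "((\<lambda>s. (b - s) powr (1 - a)) \<longlongrightarrow> (b - b) powr (1 - a)) (at_left b)"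
      using assms(1) by (intro tendsto_powr2 tendsto_intros) (auto simp: eventually_at_filter)
  qed (use assms(1) in auto)
  \<comment> \<open>Differentiability at b makes f(s) - f(b) of order b - s, which beats the
    singularity (b - s)^(-a).\<close>
  have "((\<lambda>s. (b - s) powr (1 - a) * \<bar>(f s - f b) / (s - b)\<bar>) \<longlongrightarrow> 0 * \<bar>D\<bar>) (at_left b)"
    by (intro tendsto_mult p tendsto_rabs q)
  then have lim: "((\<lambda>s. (b - s) powr (1 - a) * \<bar>(f s - f b) / (s - b)\<bar>) \<longlongrightarrow> 0) (at_left b)" by simp
  show ?thesis
  proof (rule Lim_null_comparison[OF _ lim])
    have "eventually (\<lambda>s. s < b) (at_left b)" by (simp add: eventually_at_filter)
    with assms(3) show "eventually (\<lambda>s. norm (w s * (f s - f b)) \<le> (b - s) powr (1 - a) * \<bar>(f s - f b) / (s - b)\<bar>) (at_left b)"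
    proof eventually_elim
      case (elim s)
      have "(b - s) powr (1 - a) = (b - s) * (b - s) powr (- a)"
        using powr_mult_base[of "b - s" "- a"] elim by simp
      then have "(b - s) powr (1 - a) * \<bar>(f s - f b) / (s - b)\<bar> = (b - s) powr (- a) * \<bar>f s - f b\<bar>"
        using elim by (simp add: abs_divide)
      then show ?case using elim(1) by (simp add: abs_mult mult_right_mono)
    qed
  qed
qed

text \<open>The product w (f - f(b)) vanishes at b and equals w(p)(f(p) - f(b)) at p. Its derivative
  contains w'(f - f(b)), which has a sign and is discarded. That term need not be Lebesgue
  integrable, so the comparison is made for the gauge integral.\<close>

lemma singular_by_parts_lower:
  fixes f f' w w' :: "real \<Rightarrow> real"
  assumes "p < b" "a < 1"
    and f: "continuous_on {p..b} f" "\<And>s. s \<in> {p<..<b} \<Longrightarrow> (f has_real_derivative f' s) (at s)"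
    and fb: "(f has_real_derivative D) (at b)"
    and w: "continuous_on {p..<b} w" "\<And>s. s \<in> {p<..<b} \<Longrightarrow> (w has_real_derivative w' s) (at s)"
    and wb: "\<And>s. s \<in> {p<..<b} \<Longrightarrow> \<bar>w s\<bar> \<le> (b - s) powr (- a)"
    and sgn: "\<And>s. s \<in> {p<..<b} \<Longrightarrow> w' s * (f s - f b) \<le> 0"
    and int: "set_integrable lborel {p<..<b} (\<lambda>s. w s * f' s)"
  shows "w p * (f b - f p) \<le> (LBINT s:{p<..<b}. w s * f' s)"
proof -
  \<comment> \<open>\<open>w\<close> may be unbounded at b; the product is extended there by its
    limit 0.\<close>
  define G where "G s = (if s < b then w s * (f s - f b) else 0)" for s
  have ev: "eventually (\<lambda>s. s \<in> {p<..<b}) (at_left b)"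
    using assms(1) by (intro eventually_at_leftI[of p]) auto
  have lim: "((\<lambda>s. w s * (f s - f b)) \<longlongrightarrow> 0) (at_left b)"
    by (rule singular_weight_tendsto[OF assms(2) fb]) (use ev wb in \<open>auto elim: eventually_mono\<close>)
  have Gd: "(G has_real_derivative (w' s * (f s - f b) + w s * f' s)) (at s)" if s: "s \<in> {p<..<b}" for s
  proof -
    have "((\<lambda>s. w s * (f s - f b)) has_real_derivative (w' s * (f s - f b) + w s * f' s)) (at s)"
      using w(2)[OF s] f(2)[OF s] by (auto intro!: derivative_eq_intros)
    moreover have "eventually (\<lambda>t. w t * (f t - f b) = G t) (nhds s)"
      using eventually_nhds_in_open[of "{p<..<b}" s] s by (auto simp: G_def elim!: eventually_mono)
    ultimately show ?thesis
      using DERIV_cong_ev[of s s "\<lambda>s. w s * (f s - f b)" G] by blast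
  qed
  have Gc: "continuous_on {p..b} G"
    unfolding continuous_on_eq_continuous_within
  proof
    fix s assume s: "s \<in> {p..b}"
    show "continuous (at s within {p..b}) G"
    proof (cases "s < b")
      case True
      have "continuous_on {p..<b} (\<lambda>s. w s * (f s - f b))"
        by (intro continuous_intros w(1) continuous_on_subset[OF f(1)]) auto
      then have "continuous (at s within {p..<b}) (\<lambda>s. w s * (f s - f b))"
        using True s by (auto simp: continuous_on_eq_continuous_within)
      then have "continuous (at s within {p..<b}) G"
        by (rule continuous_transform_within[where \<delta> = 1]) (use True s in \<open>auto simp: G_def\<close>)
      moreover have "at s within {p..<b} = at s within {p..b}"
        by (rule at_within_nhd[where S = "{..<b}"]) (use True in auto)
      ultimately show ?thesis by (simp add: continuous_within)
    next
      case False
      then have s: "s = b" using s by auto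
      have "(G \<longlongrightarrow> 0) (at_left b)"
        by (rule Lim_transform_eventually[OF lim])
           (use ev in \<open>auto elim!: eventually_mono simp: G_def\<close>)
      moreover have "at b within {p..b} = at_left b"
        using assms(1) by (rule at_within_Icc_at_left)
      ultimately show ?thesis using s by (simp add: continuous_within G_def)
    qed
  qed
  have "((\<lambda>s. w' s * (f s - f b) + w s * f' s) has_integral (G b - G p)) {p..b}"
  proof (rule fundamental_theorem_of_calculus_interior)
    show "(G has_vector_derivative w' s * (f s - f b) + w s * f' s) (at s)" if "s \<in> {p<..<b}" for s
      using Gd[OF that] by (simp add: has_real_derivative_iff_has_vector_derivative)
  qed (use assms(1) Gc in auto)
  then have 1: "((\<lambda>s. w' s * (f s - f b) + w s * f' s) has_integral (G b - G p)) {p<..<b}"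
    by (simp add: has_integral_Icc_iff_Ioo)
  have 2: "((\<lambda>s. w s * f' s) has_integral (LBINT s:{p<..<b}. w s * f' s)) {p<..<b}"
    using set_borel_integral_eq_integral[OF int] by (simp add: has_integral_iff)
  have "G b - G p \<le> (LBINT s:{p<..<b}. w s * f' s)"
    by (rule has_integral_le[OF 1 2]) (use sgn in auto)
  then show ?thesis using assms(1) by (simp add: G_def algebra_simps)
qed

text \<open>
  The function \<open>f\<close> satisfies \<open>D\<^sup>a f = -f\<close>.  If it increased somewhere there would be a minimum \<open>x1\<close> followed
  by a larger maximum \<open>x2\<close>; integrating by parts against the singular kernels shows
  \<open>D\<^sup>a f(x1) \<le> D\<^sup>a f(x2)\<close>, that is \<open>f x2 \<le> f x1\<close>.
\<close>

lemma ml_neg_antimono: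
  fixes a :: real
  assumes a: "0 < a" "a < 1"
  defines "f \<equiv> \<lambda>x. mittag_leffler a 1 (- (x powr a))"
  assumes "0 \<le> p" "p < q"
  shows "f q \<le> f p"
proof (rule ccontr)
  assume "\<not> f q \<le> f p"
  then have pq: "f p < f q" by simp
  \<comment> \<open>With this \<open>r\<close> one has f' = -r and I^(1-a) r = f, which together say
    D^a f = -f.\<close>
  define r where "r x = x powr (a - 1) * mittag_leffler a a (- (x powr a))" for x
  have fder: "(f has_real_derivative - r x) (at x)" if "0 < x" for x
    using ml_powr_has_derivative[OF a(1) that, of "-1"] by (simp add: f_def r_def)
  have fcont: "continuous_on {0..} f"
    unfolding f_def by (intro continuous_intros continuous_on_powr') (use a in auto)
  have ok: "rl_ok (1 - a) r x" and val: "rlint (1 - a) r x = f x" if "0 < x" for x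
    using rlint_ml[OF a(1) a(1) _ that, of "1 - a" "-1"] a that by (simp_all add: r_def[abs_def] f_def)
  have Ival: "(LBINT s:{0<..<x}. (x - s) powr (- a) * r s) = Gamma (1 - a) * f x" if "0 < x" for x
    using val[OF that] Gamma_real_pos[of "1 - a"] a
    by (simp add: rlint_def field_simps less_imp_neq[symmetric])
  have ok: "set_integrable lborel {0<..<x} (\<lambda>s. (x - s) powr (- a) * r s)" if "0 < x" for x
    using ok[OF that] by simp
  \<comment> \<open>Close to 0 the function strictly decreases, so the minimum chosen below cannot
    be at 0, where f need not be differentiable.\<close>
  obtain \<eta> where \<eta>: "\<eta> > 0" "\<And>x. 0 < x \<Longrightarrow> x < \<eta> \<Longrightarrow> 0 < r x"
  proof -
    have "((\<lambda>x. mittag_leffler a a (- (x powr a))) \<longlongrightarrow> mittag_leffler a a (- (0 powr a))) (at_right 0)"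
    proof (rule isCont_tendsto_compose[OF isCont_ml])
      show "((\<lambda>x. - (x powr a)) \<longlongrightarrow> - (0 powr a)) (at_right 0)"
        using a by (intro tendsto_intros tendsto_powr2) (auto simp: eventually_at_filter)
    qed (use a in auto)
    moreover have "0 < mittag_leffler a a (- (0 powr a))" using a by simp
    ultimately have "eventually (\<lambda>x. 0 < mittag_leffler a a (- (x powr a))) (at_right 0)"
      by (metis order_tendstoD(1))
    then obtain \<eta> where "\<eta> > 0" "\<And>x. 0 < x \<Longrightarrow> x < \<eta> \<Longrightarrow> 0 < mittag_leffler a a (- (x powr a))"
      unfolding eventually_at_right_field by auto
    then show ?thesis by (intro that) (auto simp: r_def)
  qed
  have q: "0 < q" using assms by simp
  have "\<exists>x1\<in>{0..q}. \<forall>s\<in>{0..q}. f x1 \<le> f s"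
    by (rule continuous_attains_inf) (use q in \<open>auto intro: continuous_on_subset[OF fcont]\<close>)
  then obtain x1 where x1: "x1 \<in> {0..q}" "\<And>s. s \<in> {0..q} \<Longrightarrow> f x1 \<le> f s" by blast
  have "f x1 < f q" using x1(2)[of p] assms pq by auto
  have x1pos: "0 < x1"
  proof (rule ccontr)
    assume "\<not> 0 < x1"
    then have x10: "x1 = 0" using x1 by auto
    define z where "z = min (\<eta> / 2) q"
    have z: "0 < z" "z < \<eta>" "z \<le> q" using \<eta>(1) q by (auto simp: z_def)
    have "f 0 > f z"
    proof (rule DERIV_neg_imp_decreasing_open[OF z(1)])
      show "\<exists>y. (f has_real_derivative y) (at x) \<and> y < 0" if "0 < x" "x < z" for x
        using fder[of x] \<eta>(2)[of x] that z by fastforce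
    qed (auto intro: continuous_on_subset[OF fcont])
    then show False using x1(2)[of z] z x10 by auto
  qed
  have "\<exists>x2\<in>{x1..q}. \<forall>s\<in>{x1..q}. f s \<le> f x2"
    by (rule continuous_attains_sup) (use x1 in \<open>auto intro: continuous_on_subset[OF fcont]\<close>)
  then obtain x2 where x2: "x2 \<in> {x1..q}" "\<And>s. s \<in> {x1..q} \<Longrightarrow> f s \<le> f x2" by blast
  have f12: "f x1 < f x2" using x2(2)[of q] \<open>f x1 < f q\<close> x1 by auto
  have x12: "x1 < x2" using x2(1) f12 by (cases "x1 = x2") auto
  have x2pos: "0 < x2" using x12 x1pos by simp
  have pw: "((\<lambda>s. (y - s) powr (- a)) has_real_derivative a * (y - s) powr (- a - 1)) (at s)" if "s < y" for y s :: real
    using that by (auto intro!: derivative_eq_intros)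
  have i21: "set_integrable lborel {0<..<x1} (\<lambda>s. (x2 - s) powr (- a) * r s)"
    by (rule set_integrable_subset[OF ok[OF x2pos]]) (use x12 in auto)
  have i22: "set_integrable lborel {x1<..<x2} (\<lambda>s. (x2 - s) powr (- a) * r s)"
    by (rule set_integrable_subset[OF ok[OF x2pos]]) (use x1pos in auto)
  have i1: "set_integrable lborel {0<..<x1} (\<lambda>s. ((x2 - s) powr (- a) - (x1 - s) powr (- a)) * - r s)"
    using set_integral_diff(1)[OF ok[OF x1pos] i21] by (simp add: algebra_simps)
  \<comment> \<open>The weight is the difference of the two kernels. It is nonpositive with
    nonpositive derivative, while f >= f(x1) on (0, x1), so the sign condition holds; the left side
    is nonnegative because f(x1) <= f(0).\<close>
  have "((x2 - 0) powr (- a) - (x1 - 0) powr (- a)) * (f x1 - f 0)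
     \<le> (LBINT s:{0<..<x1}. ((x2 - s) powr (- a) - (x1 - s) powr (- a)) * - r s)"
  proof (rule singular_by_parts_lower[OF x1pos a(2)])
    show "continuous_on {0..x1} f" by (rule continuous_on_subset[OF fcont]) auto
    show "(f has_real_derivative - r s) (at s)" if "s \<in> {0<..<x1}" for s using fder that by auto
    show "(f has_real_derivative - r x1) (at x1)" using fder x1pos .
    show "continuous_on {0..<x1} (\<lambda>s. (x2 - s) powr (- a) - (x1 - s) powr (- a))"
      using x12 by (intro continuous_intros) auto
    show "((\<lambda>s. (x2 - s) powr (- a) - (x1 - s) powr (- a)) has_real_derivative
        a * (x2 - s) powr (- a - 1) - a * (x1 - s) powr (- a - 1)) (at s)" if "s \<in> {0<..<x1}" for s
      using that x12 by (intro DERIV_diff pw) auto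
    fix s assume s: "s \<in> {0<..<x1}"
    have "(x2 - s) powr (- a) \<le> (x1 - s) powr (- a)"
      using s x12 a by (intro powr_mono2') auto
    then show "\<bar>(x2 - s) powr (- a) - (x1 - s) powr (- a)\<bar> \<le> (x1 - s) powr (- a)"
      by (simp add: abs_if)
    have "(x2 - s) powr (- a - 1) \<le> (x1 - s) powr (- a - 1)"
      using s x12 a by (intro powr_mono2') auto
    then have "a * (x2 - s) powr (- a - 1) - a * (x1 - s) powr (- a - 1) \<le> 0" using a by simp
    moreover have "f s - f x1 \<ge> 0" using x1(2)[of s] s x1(1) by auto
    ultimately show "(a * (x2 - s) powr (- a - 1) - a * (x1 - s) powr (- a - 1)) * (f s - f x1) \<le> 0"
      by (rule mult_nonpos_nonneg)
  qed (rule i1)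
  moreover have "0 \<le> ((x2 - 0) powr (- a) - (x1 - 0) powr (- a)) * (f x1 - f 0)"
  proof (rule mult_nonpos_nonpos)
    show "(x2 - 0) powr (- a) - (x1 - 0) powr (- a) \<le> 0"
      using powr_mono2'[of "- a" x1 x2] x12 x1pos a by simp
    show "f x1 - f 0 \<le> 0" using x1(2)[of 0] q by simp
  qed
  moreover have "(LBINT s:{0<..<x1}. ((x2 - s) powr (- a) - (x1 - s) powr (- a)) * - r s)
     = (LBINT s:{0<..<x1}. (x1 - s) powr (- a) * r s) - (LBINT s:{0<..<x1}. (x2 - s) powr (- a) * r s)"
    using set_integral_diff(2)[OF ok[OF x1pos] i21] by (simp add: algebra_simps)
  \<comment> \<open>Between the two extrema only the kernel of x2 acts. It increases, and f stays
    below its maximum f(x2).\<close>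
  moreover have "(x2 - x1) powr (- a) * (f x2 - f x1) \<le> (LBINT s:{x1<..<x2}. (x2 - s) powr (- a) * - r s)"
  proof (rule singular_by_parts_lower[OF x12 a(2)])
    show "continuous_on {x1..x2} f" by (rule continuous_on_subset[OF fcont]) (use x1pos in auto)
    show "(f has_real_derivative - r s) (at s)" if "s \<in> {x1<..<x2}" for s using fder that x1pos by auto
    show "(f has_real_derivative - r x2) (at x2)" using fder x2pos .
    show "continuous_on {x1..<x2} (\<lambda>s. (x2 - s) powr (- a))"
      by (intro continuous_intros) auto
    show "((\<lambda>s. (x2 - s) powr (- a)) has_real_derivative a * (x2 - s) powr (- a - 1)) (at s)" if "s \<in> {x1<..<x2}" for s
      using that by (intro pw) auto
    fix s assume s: "s \<in> {x1<..<x2}"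
    show "\<bar>(x2 - s) powr (- a)\<bar> \<le> (x2 - s) powr (- a)" by simp
    have "f s - f x2 \<le> 0" using x2(2)[of s] s x2(1) by auto
    then show "(a * (x2 - s) powr (- a - 1)) * (f s - f x2) \<le> 0"
      using a by (intro mult_nonneg_nonpos) auto
  qed (use i22 in \<open>simp add: set_integrable_def\<close>)
  moreover have "0 \<le> (x2 - x1) powr (- a) * (f x2 - f x1)" using f12 by simp
  moreover have "(LBINT s:{x1<..<x2}. (x2 - s) powr (- a) * - r s) = - (LBINT s:{x1<..<x2}. (x2 - s) powr (- a) * r s)"
    by (simp add: set_integral_uminus[OF i22, symmetric])
  moreover have "(LBINT s:{0<..<x2}. (x2 - s) powr (- a) * r s) =
     (LBINT s:{0<..<x1}. (x2 - s) powr (- a) * r s) + (LBINT s:{x1<..<x2}. (x2 - s) powr (- a) * r s)"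
  proof -
    have "(LBINT s:{0<..<x2}. (x2 - s) powr (- a) * r s) = (LBINT s:{0<..<x1} \<union> {x1<..<x2}. (x2 - s) powr (- a) * r s)"
    proof (rule set_integral_cong_set)
      have "AE s in lborel. s \<noteq> x1" by (rule AE_lborel_singleton)
      then show "AE s in lborel. (s \<in> {0<..<x1} \<union> {x1<..<x2}) = (s \<in> {0<..<x2})"
        by eventually_elim (use x12 x1pos in auto)
      have "set_borel_measurable lborel {0<..<x2} (\<lambda>s. (x2 - s) powr (- a) * r s)"
        using ok[OF x2pos] by (auto simp: set_integrable_def set_borel_measurable_def)
      then show "set_borel_measurable lborel {0<..<x2} (\<lambda>s. (x2 - s) powr (- a) * r s)"
        "set_borel_measurable lborel ({0<..<x1} \<union> {x1<..<x2}) (\<lambda>s. (x2 - s) powr (- a) * r s)"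
        by (assumption, rule set_borel_measurable_subset) (use x12 x1pos in auto)
    qed
    also have "\<dots> = (LBINT s:{0<..<x1}. (x2 - s) powr (- a) * r s) + (LBINT s:{x1<..<x2}. (x2 - s) powr (- a) * r s)"
      by (rule set_integral_Un[OF _ i21 i22]) auto
    finally show ?thesis .
  qed
  ultimately have "(LBINT s:{0<..<x2}. (x2 - s) powr (- a) * r s) \<le> (LBINT s:{0<..<x1}. (x1 - s) powr (- a) * r s)"
    by linarith
  then have "Gamma (1 - a) * f x2 \<le> Gamma (1 - a) * f x1"
    using Ival x1pos x2pos by simp
  then show False using f12 Gamma_real_pos[of "1 - a"] a by simp
qed

lemma rlint_nonneg:
  assumes "0 < a" "\<And>s. s \<in> {0<..<x} \<Longrightarrow> 0 \<le> f s"
  shows "0 \<le> rlint a f x"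
proof -
  have "0 \<le> (LBINT s:{0<..<x}. (x - s) powr (a - 1) * f s)"
    unfolding set_lebesgue_integral_def using assms(2)
    by (intro Bochner_Integration.integral_nonneg) (auto simp: indicator_def)
  then show ?thesis using Gamma_real_pos[OF assms(1)] by (simp add: rlint_def)
qed

text \<open>Monotonicity of E_a(-x^a) gives the sign of its derivative, hence E_{a,a}(-t) >= 0.
  Integrating this nonnegative function to order 1 - a and to order a gives E_{a,1}(-t) >= 0 and
  E_{a,2a}(-t) >= 0; the latter, through \<open>ml_shift\<close>, is the upper bound for
  E_{a,a}(-t).\<close>

lemma ml_neg_bounds:
  fixes a t :: real
  assumes a: "0 < a" "a \<le> 1" and t: "0 \<le> t"
  shows "0 \<le> mittag_leffler a 1 (- t)" "mittag_leffler a 1 (- t) \<le> 1"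
    and "0 \<le> mittag_leffler a a (- t)" "mittag_leffler a a (- t) \<le> 1 / Gamma a"
proof -
  have "0 \<le> mittag_leffler a 1 (- t) \<and> mittag_leffler a 1 (- t) \<le> 1
      \<and> 0 \<le> mittag_leffler a a (- t) \<and> mittag_leffler a a (- t) \<le> 1 / Gamma a"
  proof (cases "a = 1 \<or> t = 0")
    case True
    then show ?thesis using t a by (auto simp: ml_1_1)
  next
    case False
    then have a1: "a < 1" and t0: "0 < t" using a t by auto
    define f where "f x = mittag_leffler a 1 (- (x powr a))" for x
    define r where "r x = x powr (a - 1) * mittag_leffler a a (- (x powr a))" for x
    have fder: "(f has_real_derivative - r x) (at x)" if "0 < x" for x
      using ml_powr_has_derivative[OF a(1) that, of "-1"] by (simp add: f_def[abs_def] r_def)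
    have anti: "f q \<le> f p" if "0 \<le> p" "p < q" for p q
      using ml_neg_antimono[OF a(1) a1 that] by (simp add: f_def)
    have rnn: "0 \<le> r x" if "0 < x" for x
    proof (rule ccontr)
      assume "\<not> 0 \<le> r x"
      then have "0 < - r x" by simp
      from DERIV_pos_inc_right[OF fder[OF that] this]
      obtain d where "d > 0" "\<And>h. h > 0 \<Longrightarrow> h < d \<Longrightarrow> f x < f (x + h)" by blast
      then have "f x < f (x + d / 2)" by simp
      moreover have "f (x + d / 2) \<le> f x" using anti[of x "x + d / 2"] \<open>d > 0\<close> that by simp
      ultimately show False by simp
    qed
    define x where "x = t powr (1 / a)"
    have x: "0 < x" "x powr a = t" using t0 a by (auto simp: x_def powr_powr)
    have 1: "0 \<le> mittag_leffler a a (- t)"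
      using rnn[OF x(1)] x by (simp add: r_def zero_le_mult_iff)
    have "0 \<le> rlint (1 - a) r x" by (rule rlint_nonneg) (use a1 rnn in auto)
    then have 2: "0 \<le> mittag_leffler a 1 (- t)"
      using rlint_ml(2)[OF a(1) a(1) _ x(1), of "1 - a" "-1"] a1 x by (simp add: r_def[abs_def])
    have "f x \<le> f 0" using anti[of 0 x] x by simp
    then have 3: "mittag_leffler a 1 (- t) \<le> 1" using x a by (simp add: f_def)
    have "0 \<le> rlint a r x" by (rule rlint_nonneg) (use a rnn in auto)
    then have "0 \<le> mittag_leffler a (a + a) (- t)"
      using rlint_ml(2)[OF a(1) a(1) a(1) x(1), of "-1"] x by (simp add: r_def[abs_def] zero_le_mult_iff)
    then have "mittag_leffler a a (- t) \<le> 1 / Gamma a"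
      using ml_shift[OF a(1) a(1), of "- t"] t0 by simp
    with 1 2 3 show ?thesis by simp
  qed
  then show "0 \<le> mittag_leffler a 1 (- t)" "mittag_leffler a 1 (- t) \<le> 1"
    "0 \<le> mittag_leffler a a (- t)" "mittag_leffler a a (- t) \<le> 1 / Gamma a" by auto
qed

subsection \<open>Caputo derivatives and modes\<close>

lemma caputo_deriv_eq_rlint: "a \<noteq> 1 \<Longrightarrow> caputo_deriv a f x = rlint (1 - a) (deriv f) x"
  by (simp add: caputo_deriv_def rlint_def)

lemma caputo_differentiable_iff_rl_ok:
  "a \<noteq> 1 \<Longrightarrow> caputo_differentiable a f x \<longleftrightarrow>
     (\<forall>s\<in>{0<..<x}. f field_differentiable (at s)) \<and> rl_ok (1 - a) (deriv f) x"
  by (simp add: caputo_differentiable_def)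

lemma rlint_cong:
  assumes "\<And>s. s \<in> {0<..<x} \<Longrightarrow> f s = g s"
  shows "rlint a f x = rlint a g x" "rl_ok a f x \<longleftrightarrow> rl_ok a g x"
proof -
  show "rl_ok a f x \<longleftrightarrow> rl_ok a g x"
    by (rule set_integrable_cong) (use assms in auto)
  show "rlint a f x = rlint a g x"
    unfolding rlint_def using assms
    by (auto intro!: arg_cong2[where f = "(/)"] set_lebesgue_integral_cong)
qed

text \<open>The derivatives of the terms may blow up like s^(a-1) at 0, so they are dominated by
  multiples of this one weight. Away from 0 it is bounded, which gives termwise differentiation;
  against (x - s)^(-a) it has a finite Beta integral, which gives termwise integration. The bounds
  are needed only on (0, x0] with x0 < 1.\<close>

lemma caputo_series:
  fixes T T' G :: "nat \<Rightarrow> real \<Rightarrow> real"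
  assumes a: "0 < a" "a \<le> 1"
    and der: "\<And>n s. s \<in> {0<..<1} \<Longrightarrow> (T n has_real_derivative T' n s) (at s)"
    and cont: "\<And>n. continuous_on {0<..<1} (T' n)"
    and sm: "\<And>s. s \<in> {0<..<1} \<Longrightarrow> summable (\<lambda>n. T n s)"
    and bd: "\<And>x0. x0 \<in> {0<..<1} \<Longrightarrow> \<exists>B. summable B \<and> (\<forall>n. \<forall>s\<in>{0<..x0}. \<bar>T' n s\<bar> \<le> B n * s powr (a - 1))"
    and cap: "\<And>n x. x \<in> {0<..<1} \<Longrightarrow> caputo_deriv a (T n) x = G n x"
    and x: "x \<in> {0<..<1}"
  shows "((\<lambda>s. \<Sum>n. T n s) has_real_derivative (\<Sum>n. T' n x)) (at x)"
    and "caputo_differentiable a (\<lambda>s. \<Sum>n. T n s) x"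
    and "caputo_deriv a (\<lambda>s. \<Sum>n. T n s) x = (\<Sum>n. G n x)"
proof -
  have derS: "((\<lambda>s. \<Sum>n. T n s) has_real_derivative (\<Sum>n. T' n x)) (at x)" if x: "x \<in> {0<..<1}" for x
  proof -
    define x0 where "x0 = (x + 1) / 2"
    have x0: "x0 \<in> {0<..<1}" "x < x0" using x by (auto simp: x0_def)
    from bd[OF x0(1)] obtain B where B: "summable B" "\<And>n s. s \<in> {0<..x0} \<Longrightarrow> \<bar>T' n s\<bar> \<le> B n * s powr (a - 1)" by blast
    have Bnn: "0 \<le> B n" for n
      using B(2)[of x0 n] x0 order_trans[OF abs_ge_zero, of "T' n x0" "B n * x0 powr (a - 1)"]
      by (auto simp: zero_le_mult_iff)
    \<comment> \<open>A neighbourhood of x that stays away from 0, where s^(a-1) is at most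
      (x/2)^(a-1).\<close>
    define S where "S = {x / 2<..<x0}"
    have S: "x \<in> S" "open S" "convex S" "S \<subseteq> {0<..x0}" "S \<subseteq> {0<..<1}" using x x0 by (auto simp: S_def)
    have "uniformly_convergent_on S (\<lambda>n s. \<Sum>i<n. T' i s)"
    proof (rule Weierstrass_m_test')
      fix n s assume s: "s \<in> S"
      have "\<bar>T' n s\<bar> \<le> B n * s powr (a - 1)" using B(2) s S by auto
      also have "\<dots> \<le> B n * (x / 2) powr (a - 1)"
      proof (rule mult_left_mono[OF powr_mono2' Bnn])
        show "0 < x / 2" "x / 2 \<le> s" using s x by (simp_all add: S_def)
      qed (use a in simp)
      finally show "norm (T' n s) \<le> B n * (x / 2) powr (a - 1)" by simp
    qed (intro summable_mult2 B)
    moreover have "(T n has_real_derivative T' n s) (at s within S)" if "s \<in> S" for n s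
      by (rule has_field_derivative_at_within[OF der]) (use that S(5) in auto)
    ultimately show ?thesis
      using S(1,2) sm[OF x]
      by (intro has_field_derivative_series'(2)[OF S(3) _ _ S(1)]) (simp_all add: interior_open)
  qed
  show "((\<lambda>s. \<Sum>n. T n s) has_real_derivative (\<Sum>n. T' n x)) (at x)" by (rule derS[OF x])
  have "caputo_differentiable a (\<lambda>s. \<Sum>n. T n s) x \<and> caputo_deriv a (\<lambda>s. \<Sum>n. T n s) x = (\<Sum>n. G n x)"
  proof (cases "a = 1")
    case True
    have "T' n x = G n x" for n
      using DERIV_imp_deriv[OF der[OF x]] cap[OF x] True by (simp add: caputo_deriv_def)
    then show ?thesis using derS[OF x] True DERIV_imp_deriv[OF derS[OF x]]
      by (auto simp: caputo_deriv_def caputo_differentiable_def field_differentiable_def)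
  next
    case False
    then have a1: "a < 1" using a by simp
    from bd[OF x] obtain B where B: "summable B" "\<And>n s. s \<in> {0<..x} \<Longrightarrow> \<bar>T' n s\<bar> \<le> B n * s powr (a - 1)" by blast
    define g where "g n s = indicator {0<..<x} s *\<^sub>R ((x - s) powr (1 - a - 1) * T' n s)" for n s
    define K where "K s = indicator {0<..<x} s *\<^sub>R ((x - s) powr (1 - a - 1) * s powr (a - 1))" for s
    have Kint: "integrable lborel K"
      using rlint_power(1)[of "1 - a" a x] a a1 x by (simp add: K_def[abs_def] set_integrable_def)
    have Knn: "0 \<le> K s" for s by (simp add: K_def)
    have le: "norm (g n s) \<le> B n * K s" for n s
    proof (cases "s \<in> {0<..<x}")
      case True
      then have "\<bar>T' n s\<bar> \<le> B n * s powr (a - 1)" using B(2)[of s n] by auto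
      then show ?thesis using True mult_left_mono[of "\<bar>T' n s\<bar>" "B n * s powr (a - 1)" "(x - s) powr (- a)"]
        by (simp add: g_def K_def abs_mult mult_ac)
    qed (simp add: g_def K_def)
    have gm: "g n \<in> borel_measurable lborel" for n
    proof -
      have "continuous_on {0<..<x} (\<lambda>s. (x - s) powr (1 - a - 1) * T' n s)"
        using x by (intro continuous_intros continuous_on_subset[OF cont]) auto
      then show ?thesis unfolding g_def[abs_def] 
        using borel_measurable_continuous_on_indicator[of "{0<..<x}" "\<lambda>s. (x - s) powr (1 - a - 1) * T' n s"] by simp
    qed
    have gint: "integrable lborel (g n)" for n
      by (rule Bochner_Integration.integrable_bound[OF integrable_mult_right[OF Kint, of "B n"] gm])
         (use le in \<open>auto intro: order_trans[OF _ abs_ge_self]\<close>)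
    have A: "AE s in lborel. summable (\<lambda>n. norm (g n s))"
      by (intro AE_I2 summable_comparison_test'[OF summable_mult2[OF B(1)]]) (use le in auto)
    have Bs: "summable (\<lambda>n. LINT s|lborel. norm (g n s))"
    proof (rule summable_comparison_test'[OF summable_mult2[OF B(1), of "integral\<^sup>L lborel K"]])
      fix n
      have "(LINT s|lborel. norm (g n s)) \<le> (LINT s|lborel. B n * K s)"
        by (intro integral_mono integrable_norm gint integrable_mult_right Kint le)
      then show "norm (LINT s|lborel. norm (g n s)) \<le> B n * integral\<^sup>L lborel K"
        by simp
    qed
    have dT: "deriv (T n) s = T' n s" if "s \<in> {0<..<x}" for n s
      using DERIV_imp_deriv[OF der, of s n] that x by auto
    have dS: "deriv (\<lambda>s. \<Sum>n. T n s) s = (\<Sum>n. T' n s)" if "s \<in> {0<..<x}" for s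
      using DERIV_imp_deriv[OF derS, of s] that x by auto
    have smT': "summable (\<lambda>n. T' n s)" if "s \<in> {0<..<x}" for s
      by (rule summable_comparison_test'[OF summable_mult2[OF B(1), of "s powr (a - 1)"]]) (use B(2)[of s] that in auto)
    have gsum: "(\<Sum>n. g n s) = indicator {0<..<x} s *\<^sub>R ((x - s) powr (1 - a - 1) * (\<Sum>n. T' n s))" for s
    proof (cases "s \<in> {0<..<x}")
      case True
      then show ?thesis using suminf_mult[OF smT'[OF True], of "(x - s) powr (1 - a - 1)"] by (simp add: g_def)
    qed (simp add: g_def)
    have gint_val: "integral\<^sup>L lborel (g n) = Gamma (1 - a) * G n x" for n
    proof -
      have "rlint (1 - a) (T' n) x = G n x"
        using cap[OF x, of n] rlint_cong(1)[of x "deriv (T n)" "T' n" "1 - a"] dT a1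
        by (simp add: caputo_deriv_eq_rlint)
      then show ?thesis using Gamma_real_pos[of "1 - a"] a1
        by (simp add: rlint_def set_lebesgue_integral_def g_def[abs_def] field_simps less_imp_neq[symmetric])
    qed
    have ok: "rl_ok (1 - a) (\<lambda>s. \<Sum>n. T' n s) x"
      unfolding set_integrable_def gsum[symmetric] by (rule integrable_suminf[OF gint A Bs])
    have "(\<lambda>n. integral\<^sup>L lborel (g n)) sums (LINT s|lborel. (\<Sum>n. g n s))"
      by (rule sums_integral[OF gint A Bs])
    then have "(\<lambda>n. Gamma (1 - a) * G n x) sums (Gamma (1 - a) * rlint (1 - a) (\<lambda>s. \<Sum>n. T' n s) x)"
      using Gamma_real_pos[of "1 - a"] a1
      by (simp add: gint_val gsum rlint_def set_lebesgue_integral_def less_imp_neq[symmetric])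
    then have "(\<lambda>n. G n x) sums (rlint (1 - a) (\<lambda>s. \<Sum>n. T' n s) x)"
      using Gamma_real_pos[of "1 - a"] a1 sums_mult_iff[of "Gamma (1 - a)"] by (metis diff_gt_0_iff_gt less_irrefl)
    then have val: "rlint (1 - a) (\<lambda>s. \<Sum>n. T' n s) x = (\<Sum>n. G n x)" by (simp add: sums_iff)
    have "caputo_differentiable a (\<lambda>s. \<Sum>n. T n s) x"
      unfolding caputo_differentiable_iff_rl_ok[OF False]
    proof (intro conjI ballI)
      show "(\<lambda>s. \<Sum>n. T n s) field_differentiable at s" if "s \<in> {0<..<x}" for s
        using derS[of s] that x by (auto simp: field_differentiable_def)
      show "rl_ok (1 - a) (deriv (\<lambda>s. \<Sum>n. T n s)) x"
        using rlint_cong(2)[of x "deriv (\<lambda>s. \<Sum>n. T n s)" "\<lambda>s. \<Sum>n. T' n s" "1 - a"] dS ok by blast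
    qed
    moreover have "caputo_deriv a (\<lambda>s. \<Sum>n. T n s) x = (\<Sum>n. G n x)"
      using rlint_cong(1)[of x "deriv (\<lambda>s. \<Sum>n. T n s)" "\<lambda>s. \<Sum>n. T' n s" "1 - a"] dS val
      by (simp add: caputo_deriv_eq_rlint[OF False])
    ultimately show ?thesis by blast
  qed
  then show "caputo_differentiable a (\<lambda>s. \<Sum>n. T n s) x"
    "caputo_deriv a (\<lambda>s. \<Sum>n. T n s) x = (\<Sum>n. G n x)" by auto
qed

text \<open>\<open>p\<close> and \<open>q\<close> weigh the decaying and the growing solution. They
  are not the boundary values; \<open>C_fun_S_fun_mode\<close> converts one pair into the
  other.\<close>

definition mode :: "real \<Rightarrow> real \<Rightarrow> real \<Rightarrow> real \<Rightarrow> real \<Rightarrow> real" where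
  "mode a \<mu> p q x = p * mittag_leffler a 1 (- \<mu> * x powr a)
     + q * (mittag_leffler a 1 (\<mu> * x powr a) / mittag_leffler a 1 \<mu>)"

definition mode_d :: "real \<Rightarrow> real \<Rightarrow> real \<Rightarrow> real \<Rightarrow> real \<Rightarrow> real" where
  "mode_d a \<mu> p q x = x powr (a - 1) * (\<mu> * (q * (mittag_leffler a a (\<mu> * x powr a) / mittag_leffler a 1 \<mu>)
     - p * mittag_leffler a a (- \<mu> * x powr a)))"

lemma mode_has_derivative:
  assumes "0 < a" "0 < x"
  shows "(mode a \<mu> p q has_real_derivative mode_d a \<mu> p q x) (at x)"
proof -
  note d = ml_powr_has_derivative[OF assms]
  show ?thesis
    unfolding mode_def[abs_def] mode_d_def
    by (rule DERIV_cong[OF DERIV_add[OF DERIV_cmult[OF d[of "- \<mu>"], of p]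
          DERIV_cmult[OF DERIV_cdivide[OF d[of \<mu>], of "mittag_leffler a 1 \<mu>"], of q]]])
       (simp add: algebra_simps)
qed

lemma continuous_on_mode:
  assumes "0 < a" shows "continuous_on {0..} (mode a \<mu> p q)"
  unfolding mode_def[abs_def] divide_inverse
  by (intro continuous_intros continuous_on_powr') (use assms in auto)

lemma continuous_on_mode_d:
  assumes "0 < a" shows "continuous_on {0<..} (mode_d a \<mu> p q)"
  unfolding mode_d_def[abs_def] divide_inverse
  by (intro continuous_intros) (use assms in auto)

text \<open>E_a(m x^a) is an eigenfunction of D^a with eigenvalue m, because I^(1-a) turns s^(a-1)
  E_{a,a}(m s^a) back into E_{a,1}. Thus D^a acts on the pair (p, q) as diag(-mu, mu).\<close>

lemma mode_caputo:
  assumes a: "0 < a" "a \<le> 1" and x: "0 < x"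
  shows "caputo_deriv a (mode a \<mu> p q) x = mode a \<mu> (- \<mu> * p) (\<mu> * q) x"
proof (cases "a = 1")
  case True
  then show ?thesis
    using DERIV_imp_deriv[OF mode_has_derivative[OF a(1) x]] x
    by (simp add: caputo_deriv_def mode_def mode_d_def algebra_simps)
next
  case False
  then have a1: "0 < 1 - a" using a by simp
  have "rlint (1 - a) (deriv (mode a \<mu> p q)) x = rlint (1 - a) (mode_d a \<mu> p q) x"
    by (rule rlint_cong) (use DERIV_imp_deriv[OF mode_has_derivative[OF a(1)]] in auto)
  also have "\<dots> = (LBINT s:{0<..<x}. \<mu> * q / mittag_leffler a 1 \<mu> * ((x - s) powr (1 - a - 1) * (s powr (a - 1) * mittag_leffler a a (\<mu> * s powr a)))
     - \<mu> * p * ((x - s) powr (1 - a - 1) * (s powr (a - 1) * mittag_leffler a a (- \<mu> * s powr a)))) / Gamma (1 - a)"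
    unfolding rlint_def mode_d_def
    by (intro arg_cong2[where f = "(/)"] set_lebesgue_integral_cong refl) (auto simp: field_simps)
  also have "\<dots> = \<mu> * q / mittag_leffler a 1 \<mu> * rlint (1 - a) (\<lambda>s. s powr (a - 1) * mittag_leffler a a (\<mu> * s powr a)) x
     - \<mu> * p * rlint (1 - a) (\<lambda>s. s powr (a - 1) * mittag_leffler a a (- \<mu> * s powr a)) x"
    unfolding rlint_def
    by (subst set_integral_diff(2)[OF set_integrable_mult_right set_integrable_mult_right,
            OF rlint_ml(1)[OF a(1) a(1) a1 x] rlint_ml(1)[OF a(1) a(1) a1 x]])
       (simp add: diff_divide_distrib)
  also have "\<dots> = mode a \<mu> (- \<mu> * p) (\<mu> * q) x"
  proof -
    have e: "a + (1 - a) - 1 = 0" "a + (1 - a) = 1" by simp_all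
    show ?thesis
      unfolding rlint_ml(2)[OF a(1) a(1) a1 x] e mode_def using x by (simp add: algebra_simps)
  qed
  finally show ?thesis using False by (simp add: caputo_deriv_eq_rlint)
qed

lemma caputo_const: "caputo_deriv a (\<lambda>_. p) x = 0"
  by (simp add: caputo_deriv_def)

text \<open>The substitute for \<open>mode_caputo\<close> at mu = 0: the two solutions degenerate to
  1 and x^a, and D^a sends x^a to a constant.\<close>

lemma caputo_linear_power:
  assumes a: "0 < a" "a \<le> 1" and x: "0 < x"
  shows "((\<lambda>x. p + q * x powr a) has_real_derivative q * a * x powr (a - 1)) (at x)"
    and "caputo_deriv a (\<lambda>x. p + q * x powr a) x = q * Gamma (a + 1)"
proof -
  have 1: "((\<lambda>x. p + q * x powr a) has_real_derivative q * a * x powr (a - 1)) (at x)" if "0 < x" for x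
    using that by (auto intro!: derivative_eq_intros)
  show "((\<lambda>x. p + q * x powr a) has_real_derivative q * a * x powr (a - 1)) (at x)"
    by (rule 1[OF x])
  show "caputo_deriv a (\<lambda>x. p + q * x powr a) x = q * Gamma (a + 1)"
  proof (cases "a = 1")
    case True
    then show ?thesis using DERIV_imp_deriv[OF 1[OF x]] x Gamma_plus1_pos[of 1]
      by (simp add: caputo_deriv_def)
  next
    case False
    then have a1: "0 < 1 - a" using a by simp
    have "rlint (1 - a) (deriv (\<lambda>x. p + q * x powr a)) x = rlint (1 - a) (\<lambda>s. q * a * s powr (a - 1)) x"
      by (rule rlint_cong) (use DERIV_imp_deriv[OF 1] in auto)
    also have "\<dots> = q * a * rlint (1 - a) (\<lambda>s. s powr (a - 1)) x"
      by (simp add: rlint_def mult.left_commute)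
    also have "\<dots> = q * Gamma (a + 1)"
      unfolding rlint_power(2)[OF a1 a(1) x] using x Gamma_plus1_pos[OF a(1)] by simp
    finally show ?thesis using False by (simp add: caputo_deriv_eq_rlint)
  qed
qed

lemma mode_bound:
  assumes a: "0 < a" "a \<le> 1" and "0 < \<mu>" "x \<in> {0..1}"
  shows "\<bar>mode a \<mu> p q x\<bar> \<le> \<bar>p\<bar> + \<bar>q\<bar>"
proof -
  have x: "0 \<le> x powr a" "x powr a \<le> 1" using assms powr_le1[of a x] by auto
  have 1: "0 \<le> mittag_leffler a 1 (- \<mu> * x powr a)" "mittag_leffler a 1 (- \<mu> * x powr a) \<le> 1"
    using ml_neg_bounds[OF a, of "\<mu> * x powr a"] assms by auto
  have 2: "0 < mittag_leffler a 1 \<mu>" "0 < mittag_leffler a 1 (\<mu> * x powr a)"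
    by (rule ml_pos; use assms in simp)+
  have 3: "mittag_leffler a 1 (\<mu> * x powr a) \<le> mittag_leffler a 1 \<mu>"
    by (rule ml_mono) (use assms x in \<open>auto intro: mult_left_le\<close>)
  have "\<bar>mode a \<mu> p q x\<bar> \<le> \<bar>p\<bar> * mittag_leffler a 1 (- \<mu> * x powr a)
      + \<bar>q\<bar> * (mittag_leffler a 1 (\<mu> * x powr a) / mittag_leffler a 1 \<mu>)"
    unfolding mode_def using 1 2 by (intro order_trans[OF abs_triangle_ineq]) (simp add: abs_mult)
  also have "\<dots> \<le> \<bar>p\<bar> * 1 + \<bar>q\<bar> * 1"
    using 1 2 3 by (intro add_mono mult_left_mono) auto
  finally show ?thesis by simp
qed

text \<open>The constant depends on x0 only, so the bounds can be summed over the modes. Staying at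
  x0 < 1 earns the growing part the factor 1/mu^2 from \<open>ml_growth\<close>; a derivative costs
  one factor mu and the weight x^(a-1).\<close>

lemma mode_interior_bounds:
  assumes a: "0 < a" "a \<le> 1" and x0: "0 < x0" "x0 < 1"
  shows "\<exists>C>0. \<forall>\<mu>>0. \<forall>p q. \<forall>x\<in>{0<..x0}.
      \<bar>mode a \<mu> p q x\<bar> \<le> C * (\<bar>p\<bar> + \<bar>q\<bar> / \<mu>\<^sup>2) \<and>
      \<bar>mode_d a \<mu> p q x\<bar> \<le> C * (\<mu> * (\<bar>p\<bar> + \<bar>q\<bar> / \<mu>\<^sup>2)) * x powr (a - 1)"
proof -
  have t: "0 \<le> x0 powr a" "x0 powr a < 1" using a x0 powr_less_mono2[of a x0 1] by auto
  obtain C1 where C1: "C1 > 0" "\<And>m s. m > 0 \<Longrightarrow> s \<in> {0..x0 powr a} \<Longrightarrow>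
      m\<^sup>2 * mittag_leffler a 1 (m * s) \<le> C1 * mittag_leffler a 1 m"
    using ml_growth[OF a zero_less_one t] by blast
  obtain C2 where C2: "C2 > 0" "\<And>m s. m > 0 \<Longrightarrow> s \<in> {0..x0 powr a} \<Longrightarrow>
      m\<^sup>2 * mittag_leffler a a (m * s) \<le> C2 * mittag_leffler a 1 m"
    using ml_growth[OF a a(1) t] by blast
  define C where "C = 1 + 1 / Gamma a + C1 + C2"
  have Ga: "0 < 1 / Gamma a" using a by simp
  have C: "0 < C" "1 \<le> C" "1 / Gamma a \<le> C" "C1 \<le> C" "C2 \<le> C"
    unfolding C_def using Ga C1(1) C2(1) by linarith+
  have "\<bar>mode a \<mu> p q x\<bar> \<le> C * (\<bar>p\<bar> + \<bar>q\<bar> / \<mu>\<^sup>2) \<and>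
      \<bar>mode_d a \<mu> p q x\<bar> \<le> C * (\<mu> * (\<bar>p\<bar> + \<bar>q\<bar> / \<mu>\<^sup>2)) * x powr (a - 1)"
    if \<mu>: "\<mu> > 0" and x: "x \<in> {0<..x0}" for \<mu> p q x
  proof -
    have xa: "x powr a \<in> {0..x0 powr a}" using x a by (auto intro: powr_mono2)
    have n: "0 \<le> mittag_leffler a 1 (- \<mu> * x powr a)" "mittag_leffler a 1 (- \<mu> * x powr a) \<le> 1"
      "0 \<le> mittag_leffler a a (- \<mu> * x powr a)" "mittag_leffler a a (- \<mu> * x powr a) \<le> 1 / Gamma a"
      unfolding minus_mult_left[symmetric] by (rule ml_neg_bounds[OF a]; use \<mu> in simp)+
    have E: "0 < mittag_leffler a 1 \<mu>" "0 < mittag_leffler a 1 (\<mu> * x powr a)" "0 < mittag_leffler a a (\<mu> * x powr a)"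
      by (rule ml_pos; use \<mu> a in simp)+
    have g: "mittag_leffler a 1 (\<mu> * x powr a) / mittag_leffler a 1 \<mu> \<le> C / \<mu>\<^sup>2"
      "mittag_leffler a a (\<mu> * x powr a) / mittag_leffler a 1 \<mu> \<le> C / \<mu>\<^sup>2"
    proof -
      have "C1 * mittag_leffler a 1 \<mu> \<le> C * mittag_leffler a 1 \<mu>" "C2 * mittag_leffler a 1 \<mu> \<le> C * mittag_leffler a 1 \<mu>"
        using C E by (auto intro: mult_right_mono)
      then have "\<mu>\<^sup>2 * mittag_leffler a 1 (\<mu> * x powr a) \<le> C * mittag_leffler a 1 \<mu>"
        "\<mu>\<^sup>2 * mittag_leffler a a (\<mu> * x powr a) \<le> C * mittag_leffler a 1 \<mu>"
        using C1(2)[OF \<mu> xa] C2(2)[OF \<mu> xa] by linarith+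
      then show "mittag_leffler a 1 (\<mu> * x powr a) / mittag_leffler a 1 \<mu> \<le> C / \<mu>\<^sup>2"
        "mittag_leffler a a (\<mu> * x powr a) / mittag_leffler a 1 \<mu> \<le> C / \<mu>\<^sup>2"
        using E \<mu> by (simp_all add: divide_simps mult.commute)
    qed
    have "\<bar>mode a \<mu> p q x\<bar> \<le> \<bar>p\<bar> * mittag_leffler a 1 (- \<mu> * x powr a)
        + \<bar>q\<bar> * (mittag_leffler a 1 (\<mu> * x powr a) / mittag_leffler a 1 \<mu>)"
      unfolding mode_def using n E by (intro order_trans[OF abs_triangle_ineq]) (simp add: abs_mult)
    also have "\<dots> \<le> \<bar>p\<bar> * C + \<bar>q\<bar> * (C / \<mu>\<^sup>2)"
      using n g C by (intro add_mono mult_left_mono) auto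
    also have "\<dots> = C * (\<bar>p\<bar> + \<bar>q\<bar> / \<mu>\<^sup>2)" by (simp add: algebra_simps)
    finally have 1: "\<bar>mode a \<mu> p q x\<bar> \<le> C * (\<bar>p\<bar> + \<bar>q\<bar> / \<mu>\<^sup>2)" .
    have "\<bar>q * (mittag_leffler a a (\<mu> * x powr a) / mittag_leffler a 1 \<mu>) - p * mittag_leffler a a (- \<mu> * x powr a)\<bar>
       \<le> \<bar>q\<bar> * (mittag_leffler a a (\<mu> * x powr a) / mittag_leffler a 1 \<mu>) + \<bar>p\<bar> * mittag_leffler a a (- \<mu> * x powr a)"
      using n E by (intro order_trans[OF abs_triangle_ineq4]) (simp add: abs_mult)
    also have "\<dots> \<le> \<bar>q\<bar> * (C / \<mu>\<^sup>2) + \<bar>p\<bar> * C"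
      using n g C by (intro add_mono mult_left_mono) auto
    also have "\<dots> = C * (\<bar>p\<bar> + \<bar>q\<bar> / \<mu>\<^sup>2)" by (simp add: algebra_simps)
    finally have 2: "\<bar>q * (mittag_leffler a a (\<mu> * x powr a) / mittag_leffler a 1 \<mu>) - p * mittag_leffler a a (- \<mu> * x powr a)\<bar>
       \<le> C * (\<bar>p\<bar> + \<bar>q\<bar> / \<mu>\<^sup>2)" .
    have "\<bar>mode_d a \<mu> p q x\<bar> \<le> x powr (a - 1) * (\<mu> * (C * (\<bar>p\<bar> + \<bar>q\<bar> / \<mu>\<^sup>2)))"
      unfolding mode_d_def abs_mult using 2 \<mu> by (simp add: mult_left_mono)
    with 1 show ?thesis by (simp add: mult_ac)
  qed
  with C(1) show ?thesis by blast
qed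

text \<open>By \<open>ml_odd_part\<close> both denominators are D = E(mu) - E(-mu), and the
  numerator of S is the same difference at mu t^a. What remains is the two by two linear system for
  given values at 0 and 1.\<close>

lemma C_fun_S_fun_mode:
  assumes a: "0 < a" and \<mu>: "0 < \<mu>" and t: "0 \<le> t"
  defines "D \<equiv> mittag_leffler a 1 \<mu> - mittag_leffler a 1 (- \<mu>)"
  shows "p * C_fun a \<mu> t + q * S_fun a \<mu> t
    = mode a \<mu> ((p * mittag_leffler a 1 \<mu> - q) / D)
        (mittag_leffler a 1 \<mu> * (q - mittag_leffler a 1 (- \<mu>) * p) / D) t"
proof -
  have pos: "0 < mittag_leffler (2 * a) (a + 1) (\<mu>\<^sup>2)" "0 < mittag_leffler a 1 \<mu>"
    by (rule ml_pos; use a \<mu> in simp)+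
  have D: "D = 2 * \<mu> * mittag_leffler (2 * a) (a + 1) (\<mu>\<^sup>2)"
    unfolding D_def by (rule ml_odd_part[OF a])
  then have Dpos: "0 < D" using pos \<mu> by simp
  have "(\<mu> * t powr a)\<^sup>2 = \<mu>\<^sup>2 * t powr (2 * a)"
    by (simp add: power2_eq_square powr_add[symmetric])
  then have odd: "mittag_leffler a 1 (\<mu> * t powr a) - mittag_leffler a 1 (- \<mu> * t powr a)
     = 2 * \<mu> * t powr a * mittag_leffler (2 * a) (a + 1) (\<mu>\<^sup>2 * t powr (2 * a))"
    using ml_odd_part[OF a, of "\<mu> * t powr a"] by simp
  have S: "S_fun a \<mu> t = (mittag_leffler a 1 (\<mu> * t powr a) - mittag_leffler a 1 (- \<mu> * t powr a)) / D"
    unfolding odd using pos \<mu> by (simp add: S_fun_def D)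
  have alg: "p * ((E * e - F * e') / D) + q * ((e' - e) / D) = (p * E - q) / D * e + E * (q - F * p) / D * (e' / E)"
    if "E \<noteq> 0" "D \<noteq> 0" for e e' E F D :: real
    using that by (simp add: field_simps)
  show ?thesis
    unfolding S C_fun_def D[symmetric] mode_def by (rule alg) (use pos Dpos in auto)
qed

subsection \<open>The trigonometric system\<close>

abbreviation ip :: "(real \<Rightarrow> real) \<Rightarrow> (real \<Rightarrow> real) \<Rightarrow> real" where
  "ip f g \<equiv> integral {- pi..pi} (\<lambda>y. f y * g y)"

abbreviation cpi :: "(real \<Rightarrow> real) \<Rightarrow> bool" where
  "cpi f \<equiv> continuous_on {- pi..pi} f"

text \<open>The companion Dirichlet system: Y n' = (n/2) Z n and Z n' = -(n/2) Y n.\<close>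

definition Z :: "nat \<Rightarrow> real \<Rightarrow> real" where
  "Z n y = (if even n then - sin (real n / 2 * y) else cos (real n / 2 * y))"

text \<open>Sines and cosines both have frequency n/2; up to sign they are the Neumann functions
  cos(n (y + pi)/2) of the interval. This lets one computation treat both parities.\<close>

lemma Y_eq: "Y n y = (if even n then cos (real n / 2 * y) else sin (real n / 2 * y))"
  by (auto simp: Y_def elim!: evenE oddE) (simp add: field_simps)

lemma Y_has_derivative: "(Y n has_real_derivative real n / 2 * Z n y) (at y within S)"
  unfolding Y_eq[abs_def] Z_def
  by (cases "even n") (auto intro!: derivative_eq_intros)

lemma Z_has_derivative: "(Z n has_real_derivative - (real n / 2 * Y n y)) (at y within S)"
  unfolding Y_eq Z_def[abs_def]
  by (cases "even n") (auto intro!: derivative_eq_intros)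

lemma Z_pi: "Z n pi = 0" "Z n (- pi) = 0"
proof -
  have "Z n pi = 0"
  proof (cases "even n")
    case True
    then obtain k where "n = 2 * k" by (elim evenE)
    then show ?thesis by (simp add: Z_def)
  next
    case False
    then obtain k where n: "n = 2 * k + 1" by (elim oddE)
    then have e: "real n / 2 * pi = real k * pi + pi / 2" by (simp add: field_simps)
    show ?thesis unfolding Z_def e using n by (simp add: cos_add)
  qed
  moreover have "\<bar>Z n (- y)\<bar> = \<bar>Z n y\<bar>" for y by (simp add: Z_def)
  ultimately show "Z n pi = 0" "Z n (- pi) = 0" by (auto, metis abs_zero abs_eq_0)
qed

lemma Y_sq_Z_sq: "(Y n y)\<^sup>2 + (Z n y)\<^sup>2 = 1"
  by (simp add: Y_eq Z_def)

lemma abs_Y_le_1: "\<bar>Y n y\<bar> \<le> 1" and abs_Z_le_1: "\<bar>Z n y\<bar> \<le> 1"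
  by (simp_all add: Y_eq Z_def)

lemma Y_neg: "Y n (- y) = (if even n then 1 else - 1) * Y n y"
  by (simp add: Y_eq)

lemma continuous_on_Y [continuous_intros]:
  fixes f :: "'a::t2_space \<Rightarrow> real"
  assumes "continuous_on S f" shows "continuous_on S (\<lambda>x. Y n (f x))"
proof (cases "even n")
  case True
  then have "(\<lambda>x. Y n (f x)) = (\<lambda>x. cos (real n / 2 * f x))" by (simp add: Y_eq)
  moreover have "continuous_on S (\<lambda>x. cos (real n / 2 * f x))" by (intro continuous_intros assms)
  ultimately show ?thesis by (simp only:)
next
  case False
  then have "(\<lambda>x. Y n (f x)) = (\<lambda>x. sin (real n / 2 * f x))" by (simp add: Y_eq)
  moreover have "continuous_on S (\<lambda>x. sin (real n / 2 * f x))" by (intro continuous_intros assms)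
  ultimately show ?thesis by (simp only:)
qed

lemma continuous_on_Z [continuous_intros]:
  fixes f :: "'a::t2_space \<Rightarrow> real"
  assumes "continuous_on S f" shows "continuous_on S (\<lambda>x. Z n (f x))"
proof (cases "even n")
  case True
  then have "(\<lambda>x. Z n (f x)) = (\<lambda>x. - sin (real n / 2 * f x))" by (simp add: Z_def)
  moreover have "continuous_on S (\<lambda>x. - sin (real n / 2 * f x))" by (intro continuous_intros assms)
  ultimately show ?thesis by (simp only:)
next
  case False
  then have "(\<lambda>x. Z n (f x)) = (\<lambda>x. cos (real n / 2 * f x))" by (simp add: Z_def)
  moreover have "continuous_on S (\<lambda>x. cos (real n / 2 * f x))" by (intro continuous_intros assms)
  ultimately show ?thesis by (simp only:)
qed

lemma cpi_YZ: "cpi (Y n)" "cpi (Z n)"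
  by (intro continuous_intros)+

lemma integral_parts:
  fixes f g f' g' :: "real \<Rightarrow> real"
  assumes "l \<le> r" "continuous_on {l..r} f'" "continuous_on {l..r} g'"
    and f: "\<And>y. y \<in> {l..r} \<Longrightarrow> (f has_real_derivative f' y) (at y within {l..r})"
    and g: "\<And>y. y \<in> {l..r} \<Longrightarrow> (g has_real_derivative g' y) (at y within {l..r})"
  shows "integral {l..r} (\<lambda>y. f' y * g y) = f r * g r - f l * g l - integral {l..r} (\<lambda>y. f y * g' y)"
proof -
  have cf: "continuous_on {l..r} f" "continuous_on {l..r} g"
    by (rule DERIV_continuous_on, rule f g, assumption)+
  have "((\<lambda>y. f' y * g y + f y * g' y) has_integral (f r * g r - f l * g l)) {l..r}"
  proof (rule fundamental_theorem_of_calculus[OF assms(1)])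
    show "((\<lambda>y. f y * g y) has_vector_derivative f' y * g y + f y * g' y) (at y within {l..r})" if "y \<in> {l..r}" for y
      unfolding has_real_derivative_iff_has_vector_derivative[symmetric]
      using DERIV_mult[OF f[OF that] g[OF that]] by (simp add: algebra_simps)
  qed
  then have "integral {l..r} (\<lambda>y. f' y * g y + f y * g' y) = f r * g r - f l * g l" by blast
  moreover have "integral {l..r} (\<lambda>y. f' y * g y + f y * g' y)
      = integral {l..r} (\<lambda>y. f' y * g y) + integral {l..r} (\<lambda>y. f y * g' y)"
    by (intro integral_add integrable_continuous_interval continuous_intros assms cf)
  ultimately show ?thesis by simp
qed

lemma int_cpi [intro]: "cpi f \<Longrightarrow> f integrable_on {- pi..pi}"
  by (rule integrable_continuous_interval)

lemma ip_cmult: "ip f (\<lambda>y. c * g y) = c * ip f g"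
  by (simp only: mult.left_commute[of _ c] integral_mult_right)

text \<open>Integration by parts; the boundary terms vanish because Z m is 0 at both end
  points.\<close>

lemma ip_YZ_rel: "real n * ip (Z n) (Z m) = real m * ip (Y n) (Y m)"
proof -
  have "integral {- pi..pi} (\<lambda>y. real n / 2 * Z n y * Z m y)
     = Y n pi * Z m pi - Y n (- pi) * Z m (- pi) - integral {- pi..pi} (\<lambda>y. Y n y * - (real m / 2 * Y m y))"
    by (rule integral_parts[OF _ _ _ Y_has_derivative Z_has_derivative]) (auto intro!: continuous_intros)
  then have "real n / 2 * ip (Z n) (Z m) = real m / 2 * ip (Y n) (Y m)"
    by (simp add: Z_pi mult.assoc mult.left_commute[of "Y n _"])
  then show ?thesis by simp
qed

text \<open>Combining \<open>ip_YZ_rel\<close> with its version for n and m exchanged gives (n^2 -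
  m^2) times each inner product equal to 0.\<close>

lemma ip_YZ_orth:
  assumes "n \<noteq> m" shows "ip (Y n) (Y m) = 0" "ip (Z n) (Z m) = 0"
proof -
  have 1: "real n * ip (Z n) (Z m) = real m * ip (Y n) (Y m)" by (rule ip_YZ_rel)
  have 2: "real m * ip (Z n) (Z m) = real n * ip (Y n) (Y m)"
    using ip_YZ_rel[of m n] by (simp add: mult.commute)
  have ne: "real n * real n \<noteq> real m * real m"
    using assms by (metis of_nat_eq_iff of_nat_mult power2_eq_square power2_eq_iff_nonneg of_nat_0_le_iff)
  have "real n * (real n * ip (Y n) (Y m)) = real m * (real m * ip (Y n) (Y m))"
    unfolding 1[symmetric] 2[symmetric] by simp
  then have "(real n * real n - real m * real m) * ip (Y n) (Y m) = 0" by (simp add: algebra_simps)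
  then show "ip (Y n) (Y m) = 0" using ne by simp
  have "real n * (real n * ip (Z n) (Z m)) = real m * (real m * ip (Z n) (Z m))"
    unfolding 1 2 by simp
  then have "(real n * real n - real m * real m) * ip (Z n) (Z m) = 0" by (simp add: algebra_simps)
  then show "ip (Z n) (Z m) = 0" using ne by simp
qed

text \<open>The two squared norms are equal by \<open>ip_YZ_rel\<close>, and they add up to 2 pi
  because the squares add up to 1 pointwise.\<close>

lemma ip_YZ_self:
  assumes "0 < n" shows "ip (Y n) (Y n) = pi" "ip (Z n) (Z n) = pi"
proof -
  have "ip (Y n) (Y n) + ip (Z n) (Z n) = integral {- pi..pi} (\<lambda>y. Y n y * Y n y + Z n y * Z n y)"
    by (intro integral_add[symmetric] int_cpi continuous_intros)
  also have "\<dots> = integral {- pi..pi} (\<lambda>y. 1)"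
    using Y_sq_Z_sq[of n] by (simp add: power2_eq_square)
  finally have "ip (Y n) (Y n) + ip (Z n) (Z n) = 2 * pi" by simp
  moreover have "ip (Z n) (Z n) = ip (Y n) (Y n)" using ip_YZ_rel[of n n] assms by simp
  ultimately show "ip (Y n) (Y n) = pi" "ip (Z n) (Z n) = pi" by auto
qed

lemma ip_Y_self_ge: "pi \<le> ip (Y n) (Y n)"
proof (cases "n = 0")
  case True
  then show ?thesis by (simp add: Y_def)
next
  case False
  then show ?thesis using ip_YZ_self[of n] by simp
qed

text \<open>Completing the square for arbitrary coefficients. \<open>bessel\<close> takes the
  minimising ones, \<open>parseval_le\<close> the coefficients of an approximant.\<close>

lemma orthogonal_expansion:
  assumes F: "finite F" and f: "cpi f" and e: "\<And>n. n \<in> F \<Longrightarrow> cpi (e n)"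
    and orth: "\<And>n m. n \<in> F \<Longrightarrow> m \<in> F \<Longrightarrow> n \<noteq> m \<Longrightarrow> ip (e n) (e m) = 0"
    and pos: "\<And>n. n \<in> F \<Longrightarrow> 0 < ip (e n) (e n)"
  shows "integral {- pi..pi} (\<lambda>y. (f y - (\<Sum>n\<in>F. c n * e n y))\<^sup>2)
    = ip f f - (\<Sum>n\<in>F. (ip f (e n))\<^sup>2 / ip (e n) (e n))
      + (\<Sum>n\<in>F. ip (e n) (e n) * (c n - ip f (e n) / ip (e n) (e n))\<^sup>2)"
proof -
  have sq: "(f y - (\<Sum>n\<in>F. c n * e n y))\<^sup>2
      = f y * f y - (\<Sum>n\<in>F. 2 * c n * (f y * e n y)) + (\<Sum>n\<in>F. \<Sum>m\<in>F. c n * c m * (e n y * e m y))" for y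
  proof -
    have "(\<Sum>n\<in>F. c n * e n y)\<^sup>2 = (\<Sum>n\<in>F. \<Sum>m\<in>F. c n * c m * (e n y * e m y))"
      by (simp add: power2_eq_square sum_product mult_ac)
    moreover have "2 * f y * (\<Sum>n\<in>F. c n * e n y) = (\<Sum>n\<in>F. 2 * c n * (f y * e n y))"
      by (simp add: sum_distrib_left mult_ac)
    ultimately show ?thesis by (simp add: power2_diff power2_eq_square[of "f y"])
  qed
  have c1: "cpi (\<lambda>y. 2 * c n * (f y * e n y))" if "n \<in> F" for n
    by (intro continuous_intros f e that)
  have c2: "cpi (\<lambda>y. c n * c m * (e n y * e m y))" if "n \<in> F" "m \<in> F" for n m
    by (intro continuous_intros f e that)
  have "integral {- pi..pi} (\<lambda>y. (f y - (\<Sum>n\<in>F. c n * e n y))\<^sup>2)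
     = integral {- pi..pi} (\<lambda>y. f y * f y - (\<Sum>n\<in>F. 2 * c n * (f y * e n y))) +
       integral {- pi..pi} (\<lambda>y. \<Sum>n\<in>F. \<Sum>m\<in>F. c n * c m * (e n y * e m y))"
    unfolding sq by (intro integral_add int_cpi continuous_intros f c1 c2)
  also have "integral {- pi..pi} (\<lambda>y. f y * f y - (\<Sum>n\<in>F. 2 * c n * (f y * e n y)))
     = ip f f - integral {- pi..pi} (\<lambda>y. \<Sum>n\<in>F. 2 * c n * (f y * e n y))"
    by (intro integral_diff int_cpi continuous_intros f c1)
  also have "integral {- pi..pi} (\<lambda>y. \<Sum>n\<in>F. 2 * c n * (f y * e n y)) = (\<Sum>n\<in>F. 2 * c n * ip f (e n))"
    by (subst integral_sum[OF F]) (auto intro!: int_cpi c1)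
  also have "integral {- pi..pi} (\<lambda>y. \<Sum>n\<in>F. \<Sum>m\<in>F. c n * c m * (e n y * e m y))
     = (\<Sum>n\<in>F. integral {- pi..pi} (\<lambda>y. \<Sum>m\<in>F. c n * c m * (e n y * e m y)))"
    by (rule integral_sum[OF F]) (intro int_cpi continuous_intros c2)
  also have "\<dots> = (\<Sum>n\<in>F. \<Sum>m\<in>F. c n * c m * ip (e n) (e m))"
  proof (rule sum.cong[OF refl])
    fix n assume "n \<in> F"
    then have "integral {- pi..pi} (\<lambda>y. \<Sum>m\<in>F. c n * c m * (e n y * e m y))
      = (\<Sum>m\<in>F. integral {- pi..pi} (\<lambda>y. c n * c m * (e n y * e m y)))"
      by (intro integral_sum[OF F] int_cpi c2)
    then show "integral {- pi..pi} (\<lambda>y. \<Sum>m\<in>F. c n * c m * (e n y * e m y))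
      = (\<Sum>m\<in>F. c n * c m * ip (e n) (e m))" by simp
  qed
  also have "\<dots> = (\<Sum>n\<in>F. \<Sum>m\<in>F. if m = n then c n * c n * ip (e n) (e n) else 0)"
    by (intro sum.cong refl) (use orth in auto)
  also have "\<dots> = (\<Sum>n\<in>F. c n * c n * ip (e n) (e n))"
    using F by simp
  finally have 1: "integral {- pi..pi} (\<lambda>y. (f y - (\<Sum>n\<in>F. c n * e n y))\<^sup>2)
     = ip f f - (\<Sum>n\<in>F. 2 * c n * ip f (e n)) + (\<Sum>n\<in>F. c n * c n * ip (e n) (e n))" .
  have "ip (e n) (e n) * (c n - ip f (e n) / ip (e n) (e n))\<^sup>2 =
      c n * c n * ip (e n) (e n) - 2 * c n * ip f (e n) + (ip f (e n))\<^sup>2 / ip (e n) (e n)" if "n \<in> F" for n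
    using pos[OF that] by (simp add: power2_diff power_divide) (simp add: field_simps power2_eq_square)
  then have "(\<Sum>n\<in>F. ip (e n) (e n) * (c n - ip f (e n) / ip (e n) (e n))\<^sup>2) =
      (\<Sum>n\<in>F. c n * c n * ip (e n) (e n) - 2 * c n * ip f (e n) + (ip f (e n))\<^sup>2 / ip (e n) (e n))"
    by (intro sum.cong) auto
  then show ?thesis unfolding 1 by (simp add: sum.distrib sum_subtractf)
qed

text \<open>The index 0 is excluded because Z 0 = 0 and Y 0 has a different norm; all other squared
  norms equal pi.\<close>

lemma bessel:
  assumes "finite F" "cpi f" "\<And>n. n \<in> F \<Longrightarrow> 0 < n"
  shows "(\<Sum>n\<in>F. (ip f (Y n))\<^sup>2) \<le> pi * ip f f" "(\<Sum>n\<in>F. (ip f (Z n))\<^sup>2) \<le> pi * ip f f"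
proof -
  have gen: "(\<Sum>n\<in>F. (ip f (e n))\<^sup>2) \<le> pi * ip f f"
    if e: "\<And>n. cpi (e n)" "\<And>n m. n \<noteq> m \<Longrightarrow> ip (e n) (e m) = 0" "\<And>n. n \<in> F \<Longrightarrow> ip (e n) (e n) = pi"
    for e :: "nat \<Rightarrow> real \<Rightarrow> real"
  proof -
    let ?c = "\<lambda>n. ip f (e n) / ip (e n) (e n)"
    have "0 \<le> integral {- pi..pi} (\<lambda>y. (f y - (\<Sum>n\<in>F. ?c n * e n y))\<^sup>2)"
      by (intro Henstock_Kurzweil_Integration.integral_nonneg int_cpi continuous_intros assms e) auto
    also have "\<dots> = ip f f - (\<Sum>n\<in>F. (ip f (e n))\<^sup>2 / ip (e n) (e n))
      + (\<Sum>n\<in>F. ip (e n) (e n) * (?c n - ip f (e n) / ip (e n) (e n))\<^sup>2)"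
      by (rule orthogonal_expansion) (use assms e in auto)
    also have "\<dots> = ip f f - (\<Sum>n\<in>F. (ip f (e n))\<^sup>2) / pi"
      using e(3) by (simp add: sum_divide_distrib)
    finally show ?thesis by (simp add: field_simps)
  qed
  show "(\<Sum>n\<in>F. (ip f (Y n))\<^sup>2) \<le> pi * ip f f"
    by (rule gen) (use assms(3) ip_YZ_orth ip_YZ_self cpi_YZ in auto)
  show "(\<Sum>n\<in>F. (ip f (Z n))\<^sup>2) \<le> pi * ip f f"
    by (rule gen) (use assms(3) ip_YZ_orth ip_YZ_self cpi_YZ in auto)
qed

section \<open>Density and completeness of the system\<close>

definition Y_comb :: "(real \<Rightarrow> real) \<Rightarrow> bool" where
  "Y_comb f \<longleftrightarrow> (\<exists>N c. (\<forall>n>N. c n = 0) \<and> (\<forall>y. f y = (\<Sum>n\<le>N. c n * Y n y)))"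

lemma Y_comb_lin:
  assumes "Y_comb f" "Y_comb g"
  shows "Y_comb (\<lambda>y. a * f y + b * g y)"
proof -
  obtain N c where 1: "\<forall>n>N. c n = 0" "\<And>y. f y = (\<Sum>n\<le>N. c n * Y n y)"
    using assms(1) unfolding Y_comb_def by blast
  obtain M d where 2: "\<forall>n>M. d n = 0" "\<And>y. g y = (\<Sum>n\<le>M. d n * Y n y)"
    using assms(2) unfolding Y_comb_def by blast
  \<comment> \<open>Coefficients vanish beyond their last index, so both sums can be extended to a
    common length.\<close>
  have f: "f y = (\<Sum>n\<le>max N M. c n * Y n y)" for y
    unfolding 1(2) by (rule sum.mono_neutral_left) (use 1(1) in auto)
  have g: "g y = (\<Sum>n\<le>max N M. d n * Y n y)" for y
    unfolding 2(2) by (rule sum.mono_neutral_left) (use 2(1) in auto)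
  show ?thesis
    unfolding Y_comb_def
    by (intro exI[of _ "max N M"] exI[of _ "\<lambda>n. a * c n + b * d n"])
       (use 1(1) 2(1) in \<open>auto simp: f g sum_distrib_left sum.distrib algebra_simps\<close>)
qed

lemma Y_comb_Y: "Y_comb (Y n)"
  unfolding Y_comb_def
  by (intro exI[of _ n] exI[of _ "\<lambda>k. if k = n then 1 else 0"]) (auto simp: if_distrib[of "\<lambda>c. c * _"] cong: if_cong)

lemma Y_comb_sum:
  assumes "finite F" "\<And>i. i \<in> F \<Longrightarrow> Y_comb (g i)"
  shows "Y_comb (\<lambda>y. \<Sum>i\<in>F. c i * g i y)"
  using assms
proof (induction F rule: finite_induct)
  case empty
  show ?case using Y_comb_lin[OF Y_comb_Y[of 0] Y_comb_Y[of 0], of 0 0] by simp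
next
  case (insert i F)
  then show ?case using Y_comb_lin[of "g i" "\<lambda>y. \<Sum>i\<in>F. c i * g i y" "c i" 1] by simp
qed

text \<open>Y 1 is sin(y/2). By the product formulas it shifts a frequency by 1/2 in both directions
  and exchanges sine and cosine, which lands exactly in the other half of the system.\<close>

lemma Y_comb_mult_Y1:
  assumes "Y_comb f" shows "Y_comb (\<lambda>y. Y 1 y * f y)"
proof -
  have *: "Y_comb (\<lambda>y. Y 1 y * Y n y)" for n
  proof (cases "n = 0")
    case True
    have "(\<lambda>y. Y 1 y * Y n y) = Y 1" using True by (simp add: Y_eq fun_eq_iff)
    then show ?thesis using Y_comb_Y[of 1] by simp
  next
    case False
    then have r: "real (n - 1) = real n - 1" by simp
    have A: "real (n + 1) / 2 * y = real n / 2 * y + y / 2" "real (n - 1) / 2 * y = real n / 2 * y - y / 2" for y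
      using False by (simp_all add: r field_simps)
    show ?thesis
    proof (cases "even n")
      case True
      then have odd: "odd (n + 1)" "odd (n - 1)" using False by auto
      have "Y 1 y * Y n y = (1 / 2) * Y (n + 1) y + (- 1 / 2) * Y (n - 1) y" for y
        unfolding Y_eq using odd True by (simp only: A if_False if_True odd_one of_nat_1) (simp add: sin_add sin_diff add_divide_distrib diff_divide_distrib)
      then show ?thesis using Y_comb_lin[OF Y_comb_Y[of "n + 1"] Y_comb_Y[of "n - 1"]] by presburger
    next
      case odd: False
      then have ev: "even (n + 1)" "even (n - 1)" using False by auto
      have "Y 1 y * Y n y = (- 1 / 2) * Y (n + 1) y + (1 / 2) * Y (n - 1) y" for y
        unfolding Y_eq using odd ev by (simp only: A if_False if_True odd_one of_nat_1) (simp add: cos_add cos_diff add_divide_distrib diff_divide_distrib)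
      then show ?thesis using Y_comb_lin[OF Y_comb_Y[of "n + 1"] Y_comb_Y[of "n - 1"]] by presburger
    qed
  qed
  obtain N c where 1: "\<And>y. f y = (\<Sum>n\<le>N. c n * Y n y)"
    using assms unfolding Y_comb_def by blast
  have "(\<lambda>y. Y 1 y * f y) = (\<lambda>y. \<Sum>n\<le>N. c n * (Y 1 y * Y n y))"
    by (auto simp: 1 sum_distrib_left mult_ac)
  then show ?thesis using Y_comb_sum[of "{..N}" "\<lambda>n y. Y 1 y * Y n y" c] * by simp
qed

lemma Y_comb_power: "Y_comb (\<lambda>y. Y 1 y ^ k)"
proof (induction k)
  case 0
  have "(\<lambda>y. Y 1 y ^ 0) = Y 0" by (simp add: Y_eq fun_eq_iff)
  then show ?case using Y_comb_Y[of 0] by simp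
next
  case (Suc k)
  then show ?case using Y_comb_mult_Y1 by simp
qed

(* The substitution t = sin (y / 2) is injective on [-pi, pi], and Y 1 ^ k is a combination of the Y n. *)
lemma Y_dense:
  assumes f: "cpi f" and "0 < \<epsilon>"
  shows "\<exists>N c. \<forall>y\<in>{- pi..pi}. \<bar>f y - (\<Sum>n\<le>N. c n * Y n y)\<bar> < \<epsilon>"
proof -
  define F where "F t = f (2 * arcsin t)" for t
  have "continuous_on {-1..1} F"
    unfolding F_def
  proof (rule continuous_on_compose2[OF f])
    show "continuous_on {-1..1} (\<lambda>t. 2 * arcsin t :: real)" by (intro continuous_intros) auto
    show "(\<lambda>t. 2 * arcsin t) ` {-1..1} \<subseteq> {- pi..pi}"
    proof
      fix z assume "z \<in> (\<lambda>t. 2 * arcsin t :: real) ` {-1..1}"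
      then obtain t where t: "t \<in> {-1..1}" "z = 2 * arcsin t" by blast
      then show "z \<in> {- pi..pi}" using arcsin_bounded[of t] by auto
    qed
  qed
  then obtain g where g: "real_polynomial_function g" "\<And>t. t \<in> {-1..1} \<Longrightarrow> \<bar>F t - g t\<bar> < \<epsilon>"
    using Stone_Weierstrass_real_polynomial_function[of "{-1..1::real}" F \<epsilon>] \<open>0 < \<epsilon>\<close> by auto
  obtain a m where am: "g = (\<lambda>x. \<Sum>i\<le>m. a i * x ^ i)"
    using g(1) unfolding real_polynomial_function_iff_sum by blast
  have "Y_comb (\<lambda>y. \<Sum>i\<le>m. a i * Y 1 y ^ i)"
    by (intro Y_comb_sum Y_comb_power) auto
  then obtain N c where Nc: "\<And>y. (\<Sum>i\<le>m. a i * Y 1 y ^ i) = (\<Sum>n\<le>N. c n * Y n y)"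
    unfolding Y_comb_def by blast
  have "\<bar>f y - (\<Sum>n\<le>N. c n * Y n y)\<bar> < \<epsilon>" if y: "y \<in> {- pi..pi}" for y
  proof -
    have "Y 1 y \<in> {-1..1}" using abs_Y_le_1[of 1 y] by (auto simp: abs_le_iff)
    moreover have "F (Y 1 y) = f y"
    proof -
      have "2 * arcsin (sin (y / 2)) = y" using arcsin_sin[of "y / 2"] y by simp
      then show ?thesis by (simp only: F_def Y_eq) simp
    qed
    ultimately show ?thesis using g(2)[of "Y 1 y"] Nc[of y] by (simp add: am)
  qed
  then show ?thesis by blast
qed

text \<open>The half of Parseval's identity that needs density: a uniform approximant by finite
  combinations has small mean square error, and the optimal coefficients do no worse. K = 0 gives
  completeness; the general form bounds functions known only through their coefficients.\<close>

lemma parseval_le: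
  assumes f: "cpi f" and K: "\<And>N. (\<Sum>n\<le>N. (ip f (Y n))\<^sup>2) \<le> K"
  shows "ip f f \<le> K / pi"
proof (rule field_le_epsilon)
  fix e :: real assume e: "0 < e"
  \<comment> \<open>Makes the mean square error over an interval of length 2 pi at most e.\<close>
  define \<epsilon> where "\<epsilon> = sqrt (e / (2 * pi))"
  have \<epsilon>: "0 < \<epsilon>" "\<epsilon>\<^sup>2 * (2 * pi) = e" using e by (auto simp: \<epsilon>_def)
  obtain N c where c: "\<And>y. y \<in> {- pi..pi} \<Longrightarrow> \<bar>f y - (\<Sum>n\<le>N. c n * Y n y)\<bar> < \<epsilon>"
    using Y_dense[OF f \<epsilon>(1)] by blast
  have pos: "0 < ip (Y n) (Y n)" for n using ip_Y_self_ge[of n] pi_gt_zero by linarith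
  have "ip f f - (\<Sum>n\<le>N. (ip f (Y n))\<^sup>2 / ip (Y n) (Y n))
      + (\<Sum>n\<le>N. ip (Y n) (Y n) * (c n - ip f (Y n) / ip (Y n) (Y n))\<^sup>2)
      = integral {- pi..pi} (\<lambda>y. (f y - (\<Sum>n\<le>N. c n * Y n y))\<^sup>2)"
    by (rule orthogonal_expansion[symmetric]) (use f cpi_YZ ip_YZ_orth pos in auto)
  also have "\<dots> \<le> integral {- pi..pi} (\<lambda>y. \<epsilon>\<^sup>2)"
    by (intro integral_le int_cpi continuous_intros f)
       (use c in \<open>auto simp: abs_le_square_iff[symmetric] less_imp_le intro: order_trans[OF less_imp_le abs_ge_self]\<close>)
  also have "\<dots> = e" using \<epsilon> by (simp add: mult.commute)
  finally have "ip f f \<le> (\<Sum>n\<le>N. (ip f (Y n))\<^sup>2 / ip (Y n) (Y n)) + e"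
    using sum_nonneg[of "{..N}" "\<lambda>n. ip (Y n) (Y n) * (c n - ip f (Y n) / ip (Y n) (Y n))\<^sup>2"] pos
    by (simp add: less_imp_le)
  also have "(\<Sum>n\<le>N. (ip f (Y n))\<^sup>2 / ip (Y n) (Y n)) \<le> (\<Sum>n\<le>N. (ip f (Y n))\<^sup>2 / pi)"
    using ip_Y_self_ge pos by (intro sum_mono divide_left_mono) auto
  also have "\<dots> \<le> K / pi" using K[of N] by (simp add: sum_divide_distrib[symmetric] divide_right_mono)
  finally show "ip f f \<le> K / pi + e" by simp
qed

lemma Y_complete:
  assumes f: "cpi f" and "\<And>n. ip f (Y n) = 0" and "y \<in> {- pi..pi}"
  shows "f y = 0"
proof -
  have "ip f f \<le> 0 / pi" by (rule parseval_le[OF f]) (use assms in simp)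
  moreover have "0 \<le> ip f f"
    by (intro Henstock_Kurzweil_Integration.integral_nonneg int_cpi continuous_intros f) auto
  ultimately have "ip f f = 0" by simp
  moreover have "cpi (\<lambda>y. f y * f y)" by (intro continuous_intros f)
  ultimately have "\<forall>y\<in>{- pi..pi}. f y * f y = 0"
    using integral_eq_0_iff[of "- pi" pi "\<lambda>y. f y * f y"] pi_gt_zero by simp
  then show ?thesis using assms(3) by simp
qed

lemma l2_inner_eq_ip: "cpi f \<Longrightarrow> cpi g \<Longrightarrow> l2_inner f g = ip f g"
  unfolding l2_inner_def
  by (intro set_borel_integral_eq_integral(2) borel_integrable_atLeastAtMost' continuous_intros)

lemma fourier_coeff_eq: "cpi f \<Longrightarrow> fourier_coeff f n = ip f (Y n) / ip (Y n) (Y n)"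
  by (simp add: fourier_coeff_def l2_inner_eq_ip cpi_YZ)

text \<open>The series converges uniformly, so its sum has the same coefficients as f; completeness
  makes the two equal.\<close>

lemma fourier_series_sums:
  assumes f: "cpi f" and s: "summable (\<lambda>n. \<bar>fourier_coeff f n\<bar>)" and y: "y \<in> {- pi..pi}"
  shows "(\<lambda>n. fourier_coeff f n * Y n y) sums f y"
proof -
  let ?c = "fourier_coeff f"
  define S where "S = (\<lambda>N y. \<Sum>n<N. ?c n * Y n y)"
  define F where "F y = (\<Sum>n. ?c n * Y n y)" for y
  have le: "norm (?c n * Y n y) \<le> \<bar>?c n\<bar>" for n y
    using abs_Y_le_1[of n y] by (simp add: abs_mult mult_left_le)
  have u: "uniform_limit {- pi..pi} S F sequentially"
    unfolding S_def F_def[abs_def] by (rule Weierstrass_m_test[OF le s])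
  have Sc: "cpi (S N)" for N unfolding S_def by (intro continuous_intros)
  have Fc: "cpi F" by (rule uniform_limit_theorem[OF _ u]) (use Sc in auto)
  have "ip F (Y m) = ip f (Y m)" for m
  proof -
    have "uniform_limit {- pi..pi} (\<lambda>N y. S N y * Y m y) (\<lambda>y. F y * Y m y) sequentially"
      by (intro uniform_lim_mult u uniform_limit_const compact_imp_bounded compact_continuous_image Fc cpi_YZ) auto
    then obtain I J where I: "\<And>N. ((\<lambda>y. S N y * Y m y) has_integral I N) {- pi..pi}"
      and J: "((\<lambda>y. F y * Y m y) has_integral J) {- pi..pi}" and IJ: "I \<longlonglongrightarrow> J"
      by (rule uniform_limit_integral) (auto intro!: continuous_intros Sc)
    have "I N = ip f (Y m)" if "N > m" for N
    proof -
      have "I N = integral {- pi..pi} (\<lambda>y. \<Sum>n<N. ?c n * (Y n y * Y m y))"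
        using I[of N] by (simp add: S_def sum_distrib_right mult.assoc has_integral_iff)
      also have "\<dots> = (\<Sum>n<N. ?c n * ip (Y n) (Y m))"
        by (subst integral_sum) (auto intro!: int_cpi continuous_intros)
      also have "\<dots> = (\<Sum>n<N. if n = m then ?c m * ip (Y m) (Y m) else 0)"
        by (intro sum.cong) (auto simp: ip_YZ_orth)
      also have "\<dots> = ?c m * ip (Y m) (Y m)" using that by simp
      also have "\<dots> = ip f (Y m)"
      proof -
        have "0 < ip (Y m) (Y m)" using ip_Y_self_ge[of m] pi_gt_zero by linarith
        then show ?thesis by (simp add: fourier_coeff_eq[OF f])
      qed
      finally show ?thesis .
    qed
    then have "I \<longlonglongrightarrow> ip f (Y m)"
      by (intro tendsto_eventually eventually_sequentiallyI[of "Suc m"]) auto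
    then have "J = ip f (Y m)" using IJ LIMSEQ_unique by blast
    then show ?thesis using J by blast
  qed
  then have "ip (\<lambda>y. F y - f y) (Y m) = 0" for m
    using integral_diff[of "\<lambda>y. F y * Y m y" "{- pi..pi}" "\<lambda>y. f y * Y m y"] Fc f
    by (simp add: left_diff_distrib int_cpi continuous_intros)
  then have "F y - f y = 0"
    by (intro Y_complete[of "\<lambda>y. F y - f y"] continuous_intros Fc f y)
  moreover have "summable (\<lambda>n. ?c n * Y n y)"
    by (rule summable_comparison_test'[OF s]) (use le in auto)
  ultimately show ?thesis by (simp add: F_def sums_iff)
qed

section \<open>Decay of the Fourier coefficients of the data\<close>

lemma holder_continuous:
  assumes "0 < \<delta>" "\<forall>x\<in>{l..r}. \<forall>y\<in>{l..r}. \<bar>D x - D y\<bar> \<le> L * \<bar>x - y\<bar> powr \<delta>"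
  shows "continuous_on {l..r} (D :: real \<Rightarrow> real)"
  unfolding continuous_on_def
proof
  fix x assume x: "x \<in> {l..r}"
  have "((\<lambda>y. L * \<bar>y - x\<bar> powr \<delta>) \<longlongrightarrow> L * \<bar>x - x\<bar> powr \<delta>) (at x within {l..r})"
    using assms(1) by (intro tendsto_intros tendsto_powr2) auto
  then have "((\<lambda>y. L * \<bar>y - x\<bar> powr \<delta>) \<longlongrightarrow> 0) (at x within {l..r})" using assms(1) by simp
  then have "((\<lambda>y. D y - D x) \<longlongrightarrow> 0) (at x within {l..r})"
    by (rule Lim_null_comparison[rotated]) (use assms(2) x in \<open>auto simp: eventually_at_filter\<close>)
  then show "(D \<longlongrightarrow> D x) (at x within {l..r})" by (simp add: LIM_zero_cancel)
qed

text \<open>Two integrations by parts. The first boundary term is killed by f' = 0 at the ends, the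
  second by Z n = 0 there.\<close>

lemma ip_Y_second_derivative:
  assumes "cpi D2" and n: "0 < n"
    and 1: "\<And>y. y \<in> {- pi..pi} \<Longrightarrow> (f has_real_derivative D1 y) (at y within {- pi..pi})"
    and 2: "\<And>y. y \<in> {- pi..pi} \<Longrightarrow> (D1 has_real_derivative D2 y) (at y within {- pi..pi})"
    and b: "D1 pi = 0" "D1 (- pi) = 0"
  shows "ip f (Y n) = - (4 / (real n)\<^sup>2) * ip D2 (Y n)"
proof -
  have c: "cpi f" "cpi D1"
    by (rule DERIV_continuous_on, rule 1 2, assumption)+
  have "integral {- pi..pi} (\<lambda>y. D2 y * Y n y) = D1 pi * Y n pi - D1 (- pi) * Y n (- pi)
      - integral {- pi..pi} (\<lambda>y. D1 y * (real n / 2 * Z n y))"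
    by (rule integral_parts[OF _ assms(1) _ 2 Y_has_derivative]) (intro continuous_intros | simp)+
  then have A: "ip D2 (Y n) = - (real n / 2 * ip D1 (Z n))"
    using b unfolding ip_cmult by simp
  have "integral {- pi..pi} (\<lambda>y. D1 y * Z n y) = f pi * Z n pi - f (- pi) * Z n (- pi)
      - integral {- pi..pi} (\<lambda>y. f y * - (real n / 2 * Y n y))"
    by (rule integral_parts[OF _ c(2) _ 1 Z_has_derivative]) (intro continuous_intros | simp)+
  then have "ip D1 (Z n) = real n / 2 * ip f (Y n)"
    using ip_cmult[of f "- (real n / 2)" "Y n"] by (simp add: Z_pi)
  with A have "ip D2 (Y n) = - (real n / 2 * (real n / 2 * ip f (Y n)))" by (simp only:)
  then show ?thesis using n by (simp add: field_simps power2_eq_square)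
qed

text \<open>A third integration by parts needs no boundary condition on the data, since Z n itself
  vanishes at the ends.\<close>

lemma ip_Y_first_derivative:
  assumes "cpi D3" and n: "0 < n"
    and 1: "\<And>y. y \<in> {- pi..pi} \<Longrightarrow> (D2 has_real_derivative D3 y) (at y within {- pi..pi})"
  shows "ip D2 (Y n) = 2 / real n * ip D3 (Z n)"
proof -
  have "integral {- pi..pi} (\<lambda>y. D3 y * Z n y) = D2 pi * Z n pi - D2 (- pi) * Z n (- pi)
      - integral {- pi..pi} (\<lambda>y. D2 y * - (real n / 2 * Y n y))"
    by (rule integral_parts[OF _ assms(1) _ 1 Z_has_derivative]) (intro continuous_intros | simp)+
  then show ?thesis using n ip_cmult[of D2 "- (real n / 2)" "Y n"] by (simp add: Z_pi field_simps)
qed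

text \<open>Turns the square sums of Bessel's inequality into absolute summability by 2|b|/n <= b^2
  + 1/n^2. The term n = 0 does no harm because division by 0 gives 0.\<close>

lemma summable_div_nat:
  fixes b :: "nat \<Rightarrow> real"
  assumes "\<And>N. (\<Sum>n\<in>{1..N}. (b n)\<^sup>2) \<le> K"
  shows "summable (\<lambda>n. \<bar>b n\<bar> / real n)"
proof -
  have "summable (\<lambda>n. (b (Suc n))\<^sup>2)"
  proof (rule summableI_nonneg_bounded[of _ K])
    fix N show "(\<Sum>n<N. (b (Suc n))\<^sup>2) \<le> K"
      using assms[of N] by (simp add: sum.atLeast1_atMost_eq)
  qed simp
  then have "summable (\<lambda>n. (b n)\<^sup>2)" by (subst (asm) summable_Suc_iff)
  then have "summable (\<lambda>n. (b n)\<^sup>2 + 1 / (real n)\<^sup>2)"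
    using inverse_power_summable[of 2, where 'a = real] by (intro summable_add) (simp_all add: inverse_eq_divide)
  then show ?thesis
  proof (rule summable_comparison_test'[of _ 0])
    fix n
    have "0 \<le> (\<bar>b n\<bar> - 1 / real n)\<^sup>2" by simp
    then have "2 * (\<bar>b n\<bar> / real n) \<le> (b n)\<^sup>2 + 1 / (real n)\<^sup>2"
      by (simp add: power2_diff power_divide)
    moreover have "0 \<le> \<bar>b n\<bar> / real n" by simp
    ultimately show "norm (\<bar>b n\<bar> / real n) \<le> (b n)\<^sup>2 + 1 / (real n)\<^sup>2" unfolding real_norm_def by linarith
  qed
qed

text \<open>Transfers the one-sided boundary conditions to the derivative \<open>D 1\<close>
  supplied by the Hoelder space.\<close>

lemma deriv_unique_pi:
  assumes "(f has_real_derivative a) (at x within {- pi..pi})" "(f has_real_derivative b) (at x within {- pi..pi})" "x \<in> {- pi..pi}"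
  shows "a = b"
proof -
  have "at x within {- pi..pi} \<noteq> bot"
    using assms(3) pi_gt_zero by (simp add: trivial_limit_within islimpt_Icc)
  then show ?thesis
    using assms(1,2) by (auto simp: has_real_derivative_iff_has_vector_derivative
      intro: vector_derivative_unique_within)
qed

text \<open>Two integrations by parts leave n |psi_n| = (4/pi) |b_n| / n, where the b_n are
  coefficients of psi'' and so square summable.\<close>

lemma holder2_coeffs:
  assumes \<delta>: "0 < \<delta>" and h: "holder_space 2 \<delta> (- pi) pi \<psi>"
    and b: "(\<psi> has_real_derivative 0) (at (- pi) within {- pi..pi})" "(\<psi> has_real_derivative 0) (at pi within {- pi..pi})"
  shows "cpi \<psi>" "summable (\<lambda>n. real n * \<bar>fourier_coeff \<psi> n\<bar>)"
proof -
  obtain D L where D: "\<forall>x\<in>{- pi..pi}. D 0 x = \<psi> x"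
    "\<forall>i<2. \<forall>x\<in>{- pi..pi}. (D i has_real_derivative D (Suc i) x) (at x within {- pi..pi})"
    "\<forall>x\<in>{- pi..pi}. \<forall>y\<in>{- pi..pi}. \<bar>D 2 x - D 2 y\<bar> \<le> L * \<bar>x - y\<bar> powr \<delta>"
    using h unfolding holder_space_def by blast
  have d1: "(\<psi> has_real_derivative D 1 x) (at x within {- pi..pi})" if "x \<in> {- pi..pi}" for x
    by (rule has_field_derivative_transform_within[of "D 0" _ _ _ 1]) (use D(1,2) that in auto)
  have d2: "(D 1 has_real_derivative D 2 x) (at x within {- pi..pi})" if "x \<in> {- pi..pi}" for x
    using D(2) that by (auto simp: numeral_2_eq_2)
  have c2: "cpi (D 2)" by (rule holder_continuous[OF \<delta> D(3)])
  show c: "cpi \<psi>" by (rule DERIV_continuous_on[OF d1])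
  have b0: "D 1 pi = 0" "D 1 (- pi) = 0"
    using deriv_unique_pi[OF d1 b(2)] deriv_unique_pi[OF d1 b(1)] by auto
  have "summable (\<lambda>n. \<bar>ip (D 2) (Y n)\<bar> / real n)"
    by (rule summable_div_nat[of _ "pi * ip (D 2) (D 2)"]) (auto intro!: bessel c2)
  then have "summable (\<lambda>n. 4 / pi * (\<bar>ip (D 2) (Y n)\<bar> / real n))" by (rule summable_mult)
  moreover have "real n * \<bar>fourier_coeff \<psi> n\<bar> = 4 / pi * (\<bar>ip (D 2) (Y n)\<bar> / real n)" for n
  proof (cases "n = 0")
    case False
    then show ?thesis
      using ip_Y_second_derivative[OF c2 _ d1 d2 b0, of n] ip_YZ_self(1)[of n] pi_gt_zero
      by (simp add: fourier_coeff_eq[OF c] abs_mult power2_eq_square)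
  qed simp
  ultimately show "summable (\<lambda>n. real n * \<bar>fourier_coeff \<psi> n\<bar>)" by simp
qed

text \<open>As for psi with one more derivative: n^2 |phi_n| = (8/pi) |b_n| / n, where the b_n pair
  phi''' with the Dirichlet system.\<close>

lemma holder3_coeffs:
  assumes \<delta>: "0 < \<delta>" and h: "holder_space 3 \<delta> (- pi) pi \<phi>"
    and b: "(\<phi> has_real_derivative 0) (at (- pi) within {- pi..pi})" "(\<phi> has_real_derivative 0) (at pi within {- pi..pi})"
  shows "cpi \<phi>" "summable (\<lambda>n. (real n)\<^sup>2 * \<bar>fourier_coeff \<phi> n\<bar>)"
proof -
  obtain D L where D: "\<forall>x\<in>{- pi..pi}. D 0 x = \<phi> x"
    "\<forall>i<3. \<forall>x\<in>{- pi..pi}. (D i has_real_derivative D (Suc i) x) (at x within {- pi..pi})"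
    "\<forall>x\<in>{- pi..pi}. \<forall>y\<in>{- pi..pi}. \<bar>D 3 x - D 3 y\<bar> \<le> L * \<bar>x - y\<bar> powr \<delta>"
    using h unfolding holder_space_def by blast
  have d1: "(\<phi> has_real_derivative D 1 x) (at x within {- pi..pi})" if "x \<in> {- pi..pi}" for x
    by (rule has_field_derivative_transform_within[of "D 0" _ _ _ 1]) (use D(1,2) that in auto)
  have d2: "(D 1 has_real_derivative D 2 x) (at x within {- pi..pi})" if "x \<in> {- pi..pi}" for x
    using D(2) that by (auto simp: numeral_2_eq_2)
  have d3: "(D 2 has_real_derivative D 3 x) (at x within {- pi..pi})" if "x \<in> {- pi..pi}" for x
    using D(2) that by (auto simp: eval_nat_numeral)
  have c3: "cpi (D 3)" by (rule holder_continuous[OF \<delta> D(3)])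
  have c2: "cpi (D 2)" by (rule DERIV_continuous_on[OF d3])
  show c: "cpi \<phi>" by (rule DERIV_continuous_on[OF d1])
  have b0: "D 1 pi = 0" "D 1 (- pi) = 0"
    using deriv_unique_pi[OF d1 b(2)] deriv_unique_pi[OF d1 b(1)] by auto
  have "summable (\<lambda>n. \<bar>ip (D 3) (Z n)\<bar> / real n)"
    by (rule summable_div_nat[of _ "pi * ip (D 3) (D 3)"]) (auto intro!: bessel c3)
  then have "summable (\<lambda>n. 8 / pi * (\<bar>ip (D 3) (Z n)\<bar> / real n))" by (rule summable_mult)
  moreover have "(real n)\<^sup>2 * \<bar>fourier_coeff \<phi> n\<bar> = 8 / pi * (\<bar>ip (D 3) (Z n)\<bar> / real n)" for n
  proof (cases "n = 0")
    case False
    then show ?thesis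
      using ip_Y_second_derivative[OF c2 _ d1 d2 b0, of n] ip_Y_first_derivative[OF c3 _ d3, of n]
        ip_YZ_self(1)[of n] pi_gt_zero
      by (simp add: fourier_coeff_eq[OF c] abs_mult power2_eq_square)
  qed simp
  ultimately show "summable (\<lambda>n. (real n)\<^sup>2 * \<bar>fourier_coeff \<phi> n\<bar>)" by simp
qed

subsection \<open>The series solution\<close>

lemma caputo_cmult:
  assumes "\<And>s. s \<in> {0<..x} \<Longrightarrow> f field_differentiable (at s)" "0 < x"
  shows "caputo_deriv a (\<lambda>t. f t * k) x = caputo_deriv a f x * k"
proof (cases "a = 1")
  case True
  have "deriv (\<lambda>t. f t * k) x = deriv f x * k"
    using assms by (intro deriv_cmult_right) auto
  then show ?thesis using True by (simp add: caputo_deriv_def)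
next
  case False
  have "rlint (1 - a) (deriv (\<lambda>t. f t * k)) x = rlint (1 - a) (\<lambda>s. deriv f s * k) x"
    by (rule rlint_cong) (use assms(1) in \<open>auto intro!: deriv_cmult_right\<close>)
  also have "\<dots> = rlint (1 - a) (deriv f) x * k"
    by (simp add: rlint_def mult.assoc[symmetric])
  finally show ?thesis using False by (simp add: caputo_deriv_eq_rlint)
qed

text \<open>Lets the coefficient functions be replaced by formulas that hold only on the open
  interval.\<close>

lemma caputo_cong:
  assumes "\<And>t. t \<in> {0<..<1} \<Longrightarrow> f t = g t" "x \<in> {0<..<1}"
  shows "caputo_deriv a f x = caputo_deriv a g x"
    and "caputo_differentiable a f x \<longleftrightarrow> caputo_differentiable a g x"
proof -
  have ev: "eventually (\<lambda>t. f t = g t) (nhds s)" if "s \<in> {0<..<1}" for s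
    using eventually_nhds_in_open[of "{0<..<1}" s] that assms(1) by (auto elim: eventually_mono)
  have d: "deriv f s = deriv g s" "f field_differentiable (at s) \<longleftrightarrow> g field_differentiable (at s)"
    if "s \<in> {0<..<1}" for s
    using deriv_cong_ev[OF ev[OF that] refl] DERIV_cong_ev[OF refl ev[OF that] refl]
    by (auto simp: field_differentiable_def)
  have sub: "s \<in> {0<..<1}" if "s \<in> {0<..<x}" for s using that assms(2) by auto
  show "caputo_deriv a f x = caputo_deriv a g x"
  proof (cases "a = 1")
    case False
    then show ?thesis using rlint_cong(1)[of x "deriv f" "deriv g"] d sub by (simp add: caputo_deriv_eq_rlint)
  qed (use d(1)[OF assms(2)] in \<open>simp add: caputo_deriv_def\<close>)
  show "caputo_differentiable a f x \<longleftrightarrow> caputo_differentiable a g x"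
  proof (cases "a = 1")
    case False
    then show ?thesis using rlint_cong(2)[of x "deriv f" "deriv g" "1 - a"] d sub
      by (simp add: caputo_differentiable_iff_rl_ok)
  qed (use d(2)[OF assms(2)] in \<open>simp add: caputo_differentiable_def\<close>)
qed

lemma continuous_on_suminf:
  fixes f :: "nat \<Rightarrow> 'a::topological_space \<Rightarrow> real"
  assumes "\<And>n. continuous_on S (f n)" "summable B" "\<And>n p. p \<in> S \<Longrightarrow> \<bar>f n p\<bar> \<le> B n"
  shows "continuous_on S (\<lambda>p. \<Sum>n. f n p)"
proof (rule uniform_limit_theorem)
  show "uniform_limit S (\<lambda>N p. \<Sum>n<N. f n p) (\<lambda>p. \<Sum>n. f n p) sequentially"
    by (rule Weierstrass_m_test[OF _ assms(2)]) (use assms(3) in auto)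
  show "\<forall>\<^sub>F N in sequentially. continuous_on S (\<lambda>p. \<Sum>n<N. f n p)"
    by (intro always_eventually allI continuous_on_sum assms(1))
qed simp

lemma suminf_has_derivative_within:
  fixes f f' :: "nat \<Rightarrow> real \<Rightarrow> real"
  assumes "\<And>n y. y \<in> {l..r} \<Longrightarrow> (f n has_real_derivative f' n y) (at y within {l..r})"
    and "summable B" "\<And>n y. y \<in> {l..r} \<Longrightarrow> \<bar>f' n y\<bar> \<le> B n"
    and "\<And>y. y \<in> {l..r} \<Longrightarrow> summable (\<lambda>n. f n y)" and y: "y \<in> {l..r}"
  shows "((\<lambda>y. \<Sum>n. f n y) has_real_derivative (\<Sum>n. f' n y)) (at y within {l..r})"
proof -
  have "uniform_limit {l..r} (\<lambda>N y. \<Sum>n<N. f' n y) (\<lambda>y. \<Sum>n. f' n y) sequentially"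
    by (rule Weierstrass_m_test[OF _ assms(2)]) (use assms(3) in auto)
  then have "\<exists>g. \<forall>x\<in>{l..r}. (\<lambda>n. f n x) sums g x \<and> (g has_real_derivative (\<Sum>n. f' n x)) (at x within {l..r})"
    by (intro has_field_derivative_series[OF _ assms(1) _ y assms(4)[OF y]]) auto
  then obtain g where g: "\<And>x. x \<in> {l..r} \<Longrightarrow> (\<lambda>n. f n x) sums g x"
     "\<And>x. x \<in> {l..r} \<Longrightarrow> (g has_real_derivative (\<Sum>n. f' n x)) (at x within {l..r})" by blast
  show ?thesis
    by (rule has_field_derivative_transform_within[OF g(2)[OF y] zero_less_one y])
       (use g(1) in \<open>simp add: sums_iff\<close>)
qed

lemma dy_eqI:
  assumes "(u x has_real_derivative d) (at y within {- pi..pi})" "y \<in> {- pi..pi}"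
  shows "dy u x y = d" "dy_exists u x y"
proof -
  have "vector_derivative (u x) (at y within cbox (- pi) pi) = d"
    by (rule vector_derivative_within_cbox)
       (use assms pi_gt_zero in \<open>auto simp: has_real_derivative_iff_has_vector_derivative\<close>)
  then show "dy u x y = d" by (simp add: dy_def)
  show "dy_exists u x y"
    using assms(1) unfolding dy_exists_def by (auto simp: has_field_derivative_def differentiable_def)
qed

text \<open>Absolute convergence allows the single series used in the estimates to be regrouped into
  the odd, the positive even and the zero mode.\<close>

lemma suminf_parity_split:
  fixes f :: "nat \<Rightarrow> real"
  assumes "summable (\<lambda>n. \<bar>f n\<bar>)"
  shows "summable (\<lambda>k. f (2 * k + 1))" "summable (\<lambda>k. f (2 * Suc k))"
    and "(\<Sum>n. f n) = f 0 + (\<Sum>k. f (2 * k + 1)) + (\<Sum>k. f (2 * Suc k))"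
proof -
  have sub: "summable (\<lambda>k. f (g k))" if "strict_mono g" for g :: "nat \<Rightarrow> nat"
  proof (rule summable_rabs_cancel)
    show "summable (\<lambda>k. \<bar>f (g k)\<bar>)"
      using summable_reindex[OF assms, of g] strict_mono_imp_inj_on[OF that] by (simp add: o_def)
  qed
  have mono: "strict_mono (\<lambda>k::nat. 2 * k + 1)" "strict_mono (\<lambda>k::nat. 2 * k)" by (auto simp: strict_mono_def)
  show o: "summable (\<lambda>k. f (2 * k + 1))" by (rule sub[OF mono(1)])
  have ev: "summable (\<lambda>k. f (2 * k))" by (rule sub[OF mono(2)])
  then show ev': "summable (\<lambda>k. f (2 * Suc k))" by (subst summable_Suc_iff[of "\<lambda>k. f (2 * k)"])
  have "(\<lambda>n. if odd n then f n else 0) sums (\<Sum>k. f (2 * k + 1))"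
    by (subst sums_mono_reindex[OF mono(1), symmetric]) (use o in \<open>auto simp: summable_sums elim!: oddE\<close>)
  moreover have "(\<lambda>n. if even n then f n else 0) sums (\<Sum>k. f (2 * k))"
    by (subst sums_mono_reindex[OF mono(2), symmetric]) (use ev in \<open>auto simp: summable_sums elim!: evenE\<close>)
  ultimately have "(\<lambda>n. (if odd n then f n else 0) + (if even n then f n else 0)) sums
      ((\<Sum>k. f (2 * k + 1)) + (\<Sum>k. f (2 * k)))" by (rule sums_add)
  moreover have "(if odd n then f n else 0) + (if even n then f n else 0) = f n" for n by simp
  ultimately have "f sums ((\<Sum>k. f (2 * k + 1)) + (\<Sum>k. f (2 * k)))" by simp
  moreover have "(\<Sum>k. f (2 * k)) = f 0 + (\<Sum>k. f (2 * Suc k))"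
    using suminf_split_head[OF ev] by simp
  ultimately show "(\<Sum>n. f n) = f 0 + (\<Sum>k. f (2 * k + 1)) + (\<Sum>k. f (2 * Suc k))"
    by (simp add: sums_iff)
qed

section \<open>Eigenvalues and estimates of the coefficient functions\<close>

lemma eigenval_eq: "eigenval e n = (if even n then 1 - e else 1 + e) * (real n / 2)\<^sup>2"
  by (auto simp: eigenval_def elim!: evenE oddE)

lemma mu_sq:
  assumes "\<bar>e\<bar> < 1" shows "(mu e c n)\<^sup>2 = eigenval e n + c\<^sup>2"
  using assms by (simp add: mu_def eigenval_eq)

lemma mu_nonneg: "\<bar>e\<bar> < 1 \<Longrightarrow> 0 \<le> mu e c n"
  by (simp add: mu_def eigenval_eq)

lemma mu_ge:
  assumes "\<bar>e\<bar> < 1" shows "sqrt (1 - \<bar>e\<bar>) / 2 * real n \<le> mu e c n"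
proof -
  have "(1 - \<bar>e\<bar>) * (real n / 2)\<^sup>2 \<le> eigenval e n + c\<^sup>2"
    unfolding eigenval_eq by (intro add_increasing2 mult_right_mono) auto
  then have "sqrt ((1 - \<bar>e\<bar>) * (real n / 2)\<^sup>2) \<le> mu e c n" unfolding mu_def by simp
  then show ?thesis by (simp add: real_sqrt_mult)
qed

lemma mu_sq_le:
  assumes "\<bar>e\<bar> < 1" shows "(mu e c n)\<^sup>2 \<le> (1 + c\<^sup>2) * ((real n)\<^sup>2 + 1)"
proof -
  have "(if even n then 1 - e else 1 + e) * (real n / 2)\<^sup>2 \<le> 2 * (real n / 2)\<^sup>2"
    using assms by (intro mult_right_mono) auto
  also have "\<dots> \<le> (real n)\<^sup>2" by (simp add: power_divide)
  finally have "(mu e c n)\<^sup>2 \<le> (real n)\<^sup>2 + c\<^sup>2" by (simp add: mu_sq[OF assms] eigenval_eq)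
  also have "\<dots> \<le> (1 + c\<^sup>2) * ((real n)\<^sup>2 + 1)" by (simp add: algebra_simps)
  finally show ?thesis .
qed

lemma mu_0: "mu e c 0 = \<bar>c\<bar>"
  by (simp add: mu_def eigenval_def)

text \<open>The construction sees the data only through these two weighted sums; that
  \<open>fp\<close> and \<open>fq\<close> are Fourier coefficients is used again only for the
  boundary values.\<close>

locale series_data =
  fixes a e c :: real and fp fq :: "nat \<Rightarrow> real"
  assumes a: "0 < a" "a \<le> 1" and e: "\<bar>e\<bar> < 1"
    and sp: "summable (\<lambda>n. (real n)\<^sup>2 * \<bar>fp n\<bar>)" and sq: "summable (\<lambda>n. real n * \<bar>fq n\<bar>)"
begin

abbreviation m :: "nat \<Rightarrow> real" where "m \<equiv> mu e c"

definition T :: "nat \<Rightarrow> real \<Rightarrow> real" where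
  "T n x = (if n = 0 then zero_mode a c (fp 0) (fq 0) x
     else fp n * C_fun a (m n) x + fq n * S_fun a (m n) x)"

text \<open>\<open>PP n\<close> and \<open>QQ n\<close> are the weights of the decaying and growing
  solution that take the values \<open>fp n\<close> at 0 and \<open>fq n\<close> at 1.\<close>

definition PP :: "nat \<Rightarrow> real" where
  "PP n = (fp n * mittag_leffler a 1 (m n) - fq n) / (mittag_leffler a 1 (m n) - mittag_leffler a 1 (- m n))"

definition QQ :: "nat \<Rightarrow> real" where
  "QQ n = mittag_leffler a 1 (m n) * (fq n - mittag_leffler a 1 (- m n) * fp n)
     / (mittag_leffler a 1 (m n) - mittag_leffler a 1 (- m n))"

text \<open>The common summable majorant: every series below is dominated by a constant multiple of
  it.\<close>

definition A :: "nat \<Rightarrow> real" where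
  "A n = ((real n)\<^sup>2 + 1) * \<bar>fp n\<bar> + (real n + 1) * \<bar>fq n\<bar>"

text \<open>A positive lower bound for all nonzero mu. The index 0 contributes |c|, which counts
  only when it is not 0.\<close>

definition m0 :: real where
  "m0 = (if c = 0 then sqrt (1 - \<bar>e\<bar>) / 2 else min (sqrt (1 - \<bar>e\<bar>) / 2) \<bar>c\<bar>)"

lemma m0_pos: "0 < m0" using e by (auto simp: m0_def)

lemma m_eq_0_iff: "m n = 0 \<longleftrightarrow> n = 0 \<and> c = 0"
  using mu_pos_square(1)[OF e, of n c] mu_0[of e c] by (cases "n = 0") auto

lemma m_ge: "m n \<noteq> 0 \<Longrightarrow> m0 \<le> m n" "m0 * real n \<le> m n"
proof -
  let ?k = "sqrt (1 - \<bar>e\<bar>) / 2"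
  have k: "0 < ?k" "m0 \<le> ?k" using e by (auto simp: m0_def)
  have 1: "?k * real n \<le> m n" by (rule mu_ge[OF e])
  have "m0 * real n \<le> ?k * real n" using k by (intro mult_right_mono) auto
  with 1 show "m0 * real n \<le> m n" by linarith
  assume "m n \<noteq> 0"
  show "m0 \<le> m n"
  proof (cases "n = 0")
    case True
    then show ?thesis using \<open>m n \<noteq> 0\<close> mu_0[of e c] by (auto simp: m0_def)
  next
    case False
    then have "?k * 1 \<le> ?k * real n" using k by (intro mult_left_mono) auto
    then show ?thesis using 1 k by linarith
  qed
qed

lemma T_eq_mode:
  assumes "m n \<noteq> 0" "0 \<le> x" shows "T n x = mode a (m n) (PP n) (QQ n) x"
proof -
  have "0 < m n" using assms(1) mu_nonneg[OF e, of c n] by simp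
  from C_fun_S_fun_mode[OF a(1) this assms(2)]
  have "fp n * C_fun a (m n) x + fq n * S_fun a (m n) x = mode a (m n) (PP n) (QQ n) x"
    by (simp add: PP_def QQ_def)
  then show ?thesis using assms(1) m_eq_0_iff[of n] mu_0[of e c] by (auto simp: T_def zero_mode_def)
qed

lemma T_eq_linear:
  assumes "m n = 0" shows "T n x = fp 0 + (fq 0 - fp 0) * x powr a" "n = 0"
  using assms m_eq_0_iff[of n] unfolding T_def zero_mode_def by (auto simp: algebra_simps)

lemma A_nonneg: "0 \<le> A n" by (simp add: A_def)

lemma summable_fp: "summable (\<lambda>n. \<bar>fp n\<bar>)" and summable_fq: "summable (\<lambda>n. \<bar>fq n\<bar>)"
proof -
  show "summable (\<lambda>n. \<bar>fp n\<bar>)"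
  proof (rule summable_comparison_test'[OF sp, of 1])
    fix n :: nat assume "1 \<le> n"
    then have "1 * \<bar>fp n\<bar> \<le> (real n)\<^sup>2 * \<bar>fp n\<bar>" by (intro mult_right_mono) auto
    then show "norm \<bar>fp n\<bar> \<le> (real n)\<^sup>2 * \<bar>fp n\<bar>" by simp
  qed
  show "summable (\<lambda>n. \<bar>fq n\<bar>)"
  proof (rule summable_comparison_test'[OF sq, of 1])
    fix n :: nat assume "1 \<le> n"
    then have "1 * \<bar>fq n\<bar> \<le> real n * \<bar>fq n\<bar>" by (intro mult_right_mono) auto
    then show "norm \<bar>fq n\<bar> \<le> real n * \<bar>fq n\<bar>" by simp
  qed
qed

lemma summable_A: "summable A"
proof -
  have "summable (\<lambda>n. ((real n)\<^sup>2 * \<bar>fp n\<bar> + \<bar>fp n\<bar>) + (real n * \<bar>fq n\<bar> + \<bar>fq n\<bar>))"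
    by (intro summable_add sp sq summable_fp summable_fq)
  moreover have "((real n)\<^sup>2 * \<bar>fp n\<bar> + \<bar>fp n\<bar>) + (real n * \<bar>fq n\<bar> + \<bar>fq n\<bar>) = A n" for n
    by (simp add: A_def algebra_simps)
  ultimately show ?thesis by simp
qed

text \<open>The denominator E(mu) - E(-mu) is at least a fixed fraction of E(mu). Hence |PP| is of
  size |fp| + |fq|/E(mu) and |QQ| of size |fp| + |fq|, and mu^2/E(mu) stays bounded.\<close>

lemma PQ_bounds:
  shows "\<exists>K>0. \<forall>n. m n \<noteq> 0 \<longrightarrow> (m n)\<^sup>2 * \<bar>PP n\<bar> + \<bar>QQ n\<bar> \<le> K * A n
     \<and> (1 + real n) * (\<bar>PP n\<bar> + \<bar>QQ n\<bar>) \<le> K * A n"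
proof -
  \<comment> \<open>The linear term of the series shows E(mu) >= 1 + eta for every nonzero mu.
    \<open>k\<close> is then chosen with k E <= E - 1, and E(-mu) <= 1.\<close>
  define \<eta> where "\<eta> = m0 / Gamma (a + 1)"
  have \<eta>: "0 < \<eta>" using m0_pos a by (simp add: \<eta>_def)
  define k where "k = \<eta> / (1 + \<eta>)"
  have k: "0 < k" using \<eta> by (simp add: k_def)
  \<comment> \<open>From the quadratic term of the series: mu^2 <= G E(mu).\<close>
  define G where "G = Gamma (2 * a + 1)"
  have G: "0 < G" using a by (simp add: G_def)
  \<comment> \<open>1 + c^2, G and 1 pay for the first estimate, 4 for the second.\<close>
  define K where "K = (1 + c\<^sup>2 + G + 1 + 4) / k"
  have K: "0 < K" using k G by (auto simp: K_def intro!: divide_pos_pos add_pos_pos add_nonneg_pos)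
  have "(m n)\<^sup>2 * \<bar>PP n\<bar> + \<bar>QQ n\<bar> \<le> K * A n \<and> (1 + real n) * (\<bar>PP n\<bar> + \<bar>QQ n\<bar>) \<le> K * A n"
    if n: "m n \<noteq> 0" for n
  proof -
    let ?E = "mittag_leffler a 1 (m n)" and ?F = "mittag_leffler a 1 (- m n)"
    have mpos: "0 < m n" using n mu_nonneg[OF e, of c n] by simp
    have F: "0 \<le> ?F" "?F \<le> 1" using ml_neg_bounds[OF a, of "m n"] mpos by auto
    have "(\<Sum>k\<in>{0, 1}. (m n) ^ k / Gamma (a * real k + 1)) \<le> ?E"
      unfolding mittag_leffler_def using a mpos
      by (intro sum_le_suminf summable_ml divide_nonneg_nonneg less_imp_le[OF Gamma_arg_pos]) auto
    then have "1 + m n / Gamma (a + 1) \<le> ?E" by simp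
    moreover have "\<eta> \<le> m n / Gamma (a + 1)"
      unfolding \<eta>_def using m_ge(1)[OF n] a by (intro divide_right_mono) (auto intro: less_imp_le)
    ultimately have E: "1 + \<eta> \<le> ?E" by simp
    have E0: "0 < ?E" "1 \<le> ?E" using E \<eta> by auto
    have "k * ?E \<le> ?E - 1"
      using E \<eta> by (simp add: k_def field_simps)
    then have D: "k * ?E \<le> ?E - ?F" using F by linarith
    have D0: "0 < ?E - ?F" using D k E0 mult_pos_pos[of k ?E] by linarith
    have kE: "0 < k * ?E" using k E0 by simp
    have "\<bar>PP n\<bar> \<le> (\<bar>fp n\<bar> * ?E + \<bar>fq n\<bar>) / (k * ?E)"
    proof -
      have "\<bar>fp n * ?E - fq n\<bar> \<le> \<bar>fp n\<bar> * ?E + \<bar>fq n\<bar>"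
        using E0 by (intro order_trans[OF abs_triangle_ineq4]) (simp add: abs_mult)
      then show ?thesis unfolding PP_def abs_divide using D0 D kE by (intro frac_le) auto
    qed
    also have "\<dots> = (\<bar>fp n\<bar> + \<bar>fq n\<bar> / ?E) / k" using E0 k by (simp add: field_simps)
    finally have P: "\<bar>PP n\<bar> \<le> (\<bar>fp n\<bar> + \<bar>fq n\<bar> / ?E) / k" .
    have "\<bar>QQ n\<bar> \<le> (?E * (\<bar>fq n\<bar> + \<bar>fp n\<bar>)) / (k * ?E)"
    proof -
      have "\<bar>fq n - ?F * fp n\<bar> \<le> \<bar>fq n\<bar> + ?F * \<bar>fp n\<bar>"
        using F by (intro order_trans[OF abs_triangle_ineq4]) (simp add: abs_mult)
      also have "\<dots> \<le> \<bar>fq n\<bar> + 1 * \<bar>fp n\<bar>" using F by (intro add_left_mono mult_right_mono) auto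
      finally have "?E * \<bar>fq n - ?F * fp n\<bar> \<le> ?E * (\<bar>fq n\<bar> + \<bar>fp n\<bar>)" using E0 by simp
      then have "\<bar>?E * (fq n - ?F * fp n)\<bar> \<le> ?E * (\<bar>fq n\<bar> + \<bar>fp n\<bar>)" using E0 by (simp add: abs_mult)
      then show ?thesis unfolding QQ_def abs_divide using D0 D kE E0 by (intro frac_le) auto
    qed
    also have "\<dots> = (\<bar>fq n\<bar> + \<bar>fp n\<bar>) / k" using E0 k by simp
    finally have Q: "\<bar>QQ n\<bar> \<le> (\<bar>fq n\<bar> + \<bar>fp n\<bar>) / k" .
    have fA: "\<bar>fp n\<bar> \<le> A n" "\<bar>fq n\<bar> \<le> A n" "\<bar>fp n\<bar> + \<bar>fq n\<bar> \<le> A n" "((real n)\<^sup>2 + 1) * \<bar>fp n\<bar> \<le> A n"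
    proof -
      have "1 * \<bar>fp n\<bar> \<le> ((real n)\<^sup>2 + 1) * \<bar>fp n\<bar>" "1 * \<bar>fq n\<bar> \<le> (real n + 1) * \<bar>fq n\<bar>"
        by (intro mult_right_mono; simp)+
      then show "\<bar>fp n\<bar> \<le> A n" "\<bar>fq n\<bar> \<le> A n" "\<bar>fp n\<bar> + \<bar>fq n\<bar> \<le> A n" "((real n)\<^sup>2 + 1) * \<bar>fp n\<bar> \<le> A n"
        unfolding A_def by auto
    qed
    have mE: "(m n)\<^sup>2 / ?E \<le> G"
    proof -
      have "(m n)\<^sup>2 / G \<le> ?E" using ml_ge_term[of a 1 "m n" 2] a mpos by (simp add: G_def mult.commute)
      then show ?thesis using G E0 by (simp add: field_simps)
    qed
    have "(m n)\<^sup>2 * \<bar>PP n\<bar> \<le> (m n)\<^sup>2 * ((\<bar>fp n\<bar> + \<bar>fq n\<bar> / ?E) / k)"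
      by (intro mult_left_mono P) auto
    also have "\<dots> = ((m n)\<^sup>2 * \<bar>fp n\<bar> + (m n)\<^sup>2 / ?E * \<bar>fq n\<bar>) / k"
      by (simp add: field_simps)
    also have "\<dots> \<le> ((1 + c\<^sup>2) * A n + G * A n) / k"
    proof (intro divide_right_mono add_mono)
      have "(m n)\<^sup>2 * \<bar>fp n\<bar> \<le> (1 + c\<^sup>2) * ((real n)\<^sup>2 + 1) * \<bar>fp n\<bar>"
        by (intro mult_right_mono mu_sq_le e) auto
      also have "\<dots> \<le> (1 + c\<^sup>2) * A n" unfolding mult.assoc by (intro mult_left_mono fA) auto
      finally show "(m n)\<^sup>2 * \<bar>fp n\<bar> \<le> (1 + c\<^sup>2) * A n" .
      show "(m n)\<^sup>2 / ?E * \<bar>fq n\<bar> \<le> G * A n" using G by (intro mult_mono mE fA) auto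
    qed (use k in auto)
    finally have 1: "(m n)\<^sup>2 * \<bar>PP n\<bar> \<le> ((1 + c\<^sup>2) * A n + G * A n) / k" .
    have 2: "\<bar>QQ n\<bar> \<le> A n / k"
      using Q divide_right_mono[of "\<bar>fq n\<bar> + \<bar>fp n\<bar>" "A n" k] fA(3) k by linarith
    have "(m n)\<^sup>2 * \<bar>PP n\<bar> + \<bar>QQ n\<bar> \<le> ((1 + c\<^sup>2) * A n + G * A n + A n) / k"
      using 1 2 by (simp add: add_divide_distrib)
    also have "\<dots> \<le> K * A n"
      unfolding K_def using k A_nonneg[of n] by (simp add: field_simps)
    finally have X: "(m n)\<^sup>2 * \<bar>PP n\<bar> + \<bar>QQ n\<bar> \<le> K * A n" .
    have "\<bar>fq n\<bar> / ?E \<le> \<bar>fq n\<bar> / 1" using E0 by (intro divide_left_mono) auto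
    then have "(\<bar>fp n\<bar> + \<bar>fq n\<bar> / ?E) / k \<le> (\<bar>fp n\<bar> + \<bar>fq n\<bar>) / k"
      using k by (intro divide_right_mono) auto
    moreover have "\<bar>QQ n\<bar> \<le> (\<bar>fp n\<bar> + \<bar>fq n\<bar>) / k" using Q by (simp add: add.commute)
    ultimately have "\<bar>PP n\<bar> + \<bar>QQ n\<bar> \<le> 2 * ((\<bar>fp n\<bar> + \<bar>fq n\<bar>) / k)" using P by linarith
    then have "(1 + real n) * (\<bar>PP n\<bar> + \<bar>QQ n\<bar>) \<le> (1 + real n) * (2 * ((\<bar>fp n\<bar> + \<bar>fq n\<bar>) / k))"
      by (intro mult_left_mono) auto
    also have "\<dots> = 2 * ((1 + real n) * \<bar>fp n\<bar> + (1 + real n) * \<bar>fq n\<bar>) / k"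
      using k by (simp add: field_simps)
    also have "\<dots> \<le> 2 * (2 * A n) / k"
    proof (intro divide_right_mono mult_left_mono)
      have "0 \<le> (real n - 1 / 2)\<^sup>2" by simp
      then have "1 + real n \<le> 2 * ((real n)\<^sup>2 + 1)" by (simp add: power2_diff power_divide)
      then have "(1 + real n) * \<bar>fp n\<bar> \<le> 2 * ((real n)\<^sup>2 + 1) * \<bar>fp n\<bar>" by (intro mult_right_mono) auto
      moreover have "0 \<le> (1 + real n) * \<bar>fq n\<bar>" by simp
      ultimately show "(1 + real n) * \<bar>fp n\<bar> + (1 + real n) * \<bar>fq n\<bar> \<le> 2 * A n"
      proof -
        assume X: "(1 + real n) * \<bar>fp n\<bar> \<le> 2 * ((real n)\<^sup>2 + 1) * \<bar>fp n\<bar>"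
          and Y: "0 \<le> (1 + real n) * \<bar>fq n\<bar>"
        have "2 * A n = 2 * ((real n)\<^sup>2 + 1) * \<bar>fp n\<bar> + 2 * ((1 + real n) * \<bar>fq n\<bar>)"
          by (simp add: A_def algebra_simps)
        then show ?thesis using X Y by linarith
      qed
    qed (use k in auto)
    also have "\<dots> \<le> K * A n"
      unfolding K_def using k A_nonneg[of n] G by (simp add: field_simps)
    finally show ?thesis using X by blast
  qed
  with K show ?thesis by blast
qed

definition T' :: "nat \<Rightarrow> real \<Rightarrow> real" where
  "T' n x = (if m n = 0 then (fq 0 - fp 0) * a * x powr (a - 1) else mode_d a (m n) (PP n) (QQ n) x)"

text \<open>The Caputo derivative of \<open>T n\<close>, by \<open>mode_caputo\<close>; for mu = 0
  it is a constant.\<close>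

definition G :: "nat \<Rightarrow> real \<Rightarrow> real" where
  "G n x = (if m n = 0 then (fq 0 - fp 0) * Gamma (a + 1) else mode a (m n) (- m n * PP n) (m n * QQ n) x)"

definition G' :: "nat \<Rightarrow> real \<Rightarrow> real" where
  "G' n x = (if m n = 0 then 0 else mode_d a (m n) (- m n * PP n) (m n * QQ n) x)"

lemma T_has_derivative: "0 < x \<Longrightarrow> (T n has_real_derivative T' n x) (at x)"
proof (cases "m n = 0")
  case True
  assume "0 < x"
  moreover have "T n = (\<lambda>x. fp 0 + (fq 0 - fp 0) * x powr a)"
    using T_eq_linear(1)[OF True] by auto
  ultimately show ?thesis
    using caputo_linear_power(1)[OF a, of x "fp 0" "fq 0 - fp 0"] True by (simp add: T'_def)
next
  case False
  assume x: "0 < x"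
  have "(mode a (m n) (PP n) (QQ n) has_real_derivative T' n x) (at x)"
    using mode_has_derivative[OF a(1) x] False by (simp add: T'_def)
  then show ?thesis
    by (rule has_field_derivative_transform_within_open[of _ _ _ "{0<..}"])
       (use x T_eq_mode[OF False] in auto)
qed

lemma G_has_derivative: "0 < x \<Longrightarrow> (G n has_real_derivative G' n x) (at x)"
  using mode_has_derivative[OF a(1), of x] by (cases "m n = 0") (simp_all add: G_def[abs_def] G'_def)

lemma continuous_on_TG:
  "continuous_on {0..} (T n)" "continuous_on {0<..} (T' n)" "continuous_on {0..} (G n)" "continuous_on {0<..} (G' n)"
proof -
  show "continuous_on {0..} (T n)"
  proof (cases "m n = 0")
    case True
    have "continuous_on {0..} (\<lambda>x. fp 0 + (fq 0 - fp 0) * x powr a)"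
      using a by (intro continuous_intros continuous_on_powr') auto
    then show ?thesis using T_eq_linear(1)[OF True] by (simp add: fun_eq_iff cong: continuous_on_cong)
  next
    case False
    show ?thesis
      by (rule continuous_on_eq[OF continuous_on_mode[OF a(1)]])
         (use T_eq_mode[OF False] in auto)
  qed
  show "continuous_on {0<..} (T' n)"
    unfolding T'_def[abs_def] by (cases "m n = 0") (auto intro!: continuous_intros continuous_on_mode_d a)
  show "continuous_on {0..} (G n)"
    unfolding G_def[abs_def] by (cases "m n = 0") (auto intro!: continuous_on_mode a)
  show "continuous_on {0<..} (G' n)"
    unfolding G'_def[abs_def] by (cases "m n = 0") (auto intro!: continuous_on_mode_d a)
qed

lemma T_caputo:
  assumes x: "x \<in> {0<..<1}" shows "caputo_deriv a (T n) x = G n x"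
proof (cases "m n = 0")
  case True
  have "T n = (\<lambda>x. fp 0 + (fq 0 - fp 0) * x powr a)"
    using T_eq_linear(1)[OF True] by auto
  then show ?thesis using caputo_linear_power(2)[OF a, of x] True x by (simp add: G_def)
next
  case False
  have "caputo_deriv a (T n) x = caputo_deriv a (mode a (m n) (PP n) (QQ n)) x"
    by (rule caputo_cong(1)[OF _ x]) (use T_eq_mode[OF False] in auto)
  then show ?thesis using mode_caputo[OF a, of x "m n" "PP n" "QQ n"] False x by (simp add: G_def)
qed

lemma G_caputo:
  assumes x: "x \<in> {0<..<1}" shows "caputo_deriv a (G n) x = (m n)\<^sup>2 * T n x"
proof (cases "m n = 0")
  case True
  then show ?thesis by (simp add: G_def[abs_def] caputo_const)
next
  case False
  have "mode a (m n) (- m n * (- m n * PP n)) (m n * (m n * QQ n)) x = (m n)\<^sup>2 * mode a (m n) (PP n) (QQ n) x"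
    by (simp add: mode_def power2_eq_square algebra_simps)
  then show ?thesis
    using mode_caputo[OF a, of x "m n" "- m n * PP n" "m n * QQ n"] False x T_eq_mode[OF False, of x]
    by (simp add: G_def[abs_def])
qed

text \<open>At x = 1 the growing part has its full size and nothing is gained in mu, so a single
  factor n is affordable. That is what the series of u_y needs up to the boundary.\<close>

lemma T_global_bound: "\<exists>C>0. \<forall>n. \<forall>x\<in>{0..1}. (1 + real n) * \<bar>T n x\<bar> \<le> C * A n"
proof -
  obtain K where K: "K > 0" "\<And>n. m n \<noteq> 0 \<Longrightarrow> (1 + real n) * (\<bar>PP n\<bar> + \<bar>QQ n\<bar>) \<le> K * A n"
    using PQ_bounds by blast
  have "(1 + real n) * \<bar>T n x\<bar> \<le> (K + 2) * A n" if x: "x \<in> {0..1}" for n x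
  proof (cases "m n = 0")
    case True
    have p: "0 \<le> x powr a" "x powr a \<le> 1" using x a powr_le1[of a x] by auto
    have "\<bar>(fq 0 - fp 0) * x powr a\<bar> \<le> \<bar>fq 0 - fp 0\<bar> * 1"
      unfolding abs_mult using p by (intro mult_left_mono) auto
    then have Tle: "\<bar>T n x\<bar> \<le> \<bar>fp 0\<bar> + \<bar>fq 0 - fp 0\<bar> * 1"
      unfolding T_eq_linear(1)[OF True] by (rule order_trans[OF abs_triangle_ineq add_left_mono])
    note Tle
    also have "\<bar>fp 0\<bar> + \<bar>fq 0 - fp 0\<bar> * 1 \<le> \<bar>fp 0\<bar> + (\<bar>fq 0\<bar> + \<bar>fp 0\<bar>) * 1"
      by (intro add_left_mono mult_right_mono abs_triangle_ineq4) auto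
    also have "\<dots> \<le> 2 * (\<bar>fp 0\<bar> + \<bar>fq 0\<bar>)" by simp
    also have "\<dots> \<le> (K + 2) * A n"
      unfolding T_eq_linear(2)[OF True] A_def using K by (intro mult_mono) auto
    finally show ?thesis using T_eq_linear(2)[OF True] by simp
  next
    case False
    have mpos: "0 < m n" using False mu_nonneg[OF e, of c n] by simp
    have "(1 + real n) * \<bar>T n x\<bar> \<le> (1 + real n) * (\<bar>PP n\<bar> + \<bar>QQ n\<bar>)"
      using mode_bound[OF a mpos x, of "PP n" "QQ n"] T_eq_mode[OF False, of x] x
      by (intro mult_left_mono) auto
    also have "\<dots> \<le> K * A n" by (rule K(2)[OF False])
    also have "\<dots> \<le> (K + 2) * A n" by (intro mult_right_mono A_nonneg) auto
    finally show ?thesis .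
  qed
  moreover have "0 < K + 2" using K by simp
  ultimately show ?thesis by blast
qed

text \<open>For x <= x0 < 1 a mode is O(B/mu^2) with B = mu^2 |PP| + |QQ|, and each application of
  D^a or d/dx costs one factor mu. At most two are spent, and B is bounded by a multiple of
  A.\<close>

lemma interior_bounds:
  assumes x0: "0 < x0" "x0 < 1"
  shows "\<exists>C>0. \<forall>n. \<forall>x\<in>{0<..x0}.
      \<bar>T' n x\<bar> \<le> C * A n * x powr (a - 1) \<and> \<bar>G n x\<bar> \<le> C * A n \<and>
      \<bar>G' n x\<bar> \<le> C * A n * x powr (a - 1) \<and> (1 + (real n)\<^sup>2) * \<bar>T n x\<bar> \<le> C * A n"
proof -
  obtain K where K: "K > 0" "\<And>n. m n \<noteq> 0 \<Longrightarrow> (m n)\<^sup>2 * \<bar>PP n\<bar> + \<bar>QQ n\<bar> \<le> K * A n"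
    using PQ_bounds by blast
  obtain C where C: "C > 0" "\<And>\<mu> p q x. \<mu> > 0 \<Longrightarrow> x \<in> {0<..x0} \<Longrightarrow> \<bar>mode a \<mu> p q x\<bar> \<le> C * (\<bar>p\<bar> + \<bar>q\<bar> / \<mu>\<^sup>2)"
    "\<And>\<mu> p q x. \<mu> > 0 \<Longrightarrow> x \<in> {0<..x0} \<Longrightarrow>
      \<bar>mode_d a \<mu> p q x\<bar> \<le> C * (\<mu> * (\<bar>p\<bar> + \<bar>q\<bar> / \<mu>\<^sup>2)) * x powr (a - 1)"
    using mode_interior_bounds[OF a x0] by blast
  define g where "g = Gamma (a + 1)"
  have g: "0 < g" using a by (simp add: g_def)
  define h where "h = 1 / m0\<^sup>2"
  have h: "0 < h" using m0_pos by (simp add: h_def)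
  \<comment> \<open>1/m0 serves \<open>T'\<close> and \<open>G\<close>, the 1 serves
    \<open>G'\<close>, and 2h converts mu^2 into 1 + n^2 for \<open>T\<close>; the last two summands
    cover the case mu = 0.\<close>
  define C' where "C' = C * K * (1 / m0 + 1 + 2 * h) + 2 + g"
  have CK: "0 < C * K" "0 < 1 / m0" using C(1) K(1) m0_pos by auto
  have sum3: "C * K / m0 \<le> C'" "C * K \<le> C'" "C * K * (2 * h) \<le> C'"
  proof -
    have "0 < C * K * (1 / m0)" "0 < C * K * (2 * h)" using CK h by (auto intro!: mult_pos_pos)
    moreover have "C' = C * K * (1 / m0) + C * K + C * K * (2 * h) + 2 + g"
      by (simp add: C'_def algebra_simps)
    moreover have "C * K / m0 = C * K * (1 / m0)" by simp
    ultimately show "C * K / m0 \<le> C'" "C * K \<le> C'" "C * K * (2 * h) \<le> C'" using CK g by linarith+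
  qed
  have C'pos: "0 < C'" "2 \<le> C'" "g \<le> C'" 
  proof -
    have "0 \<le> C * K * (1 / m0 + 1 + 2 * h)" using CK h by (intro mult_nonneg_nonneg[OF less_imp_le[OF CK(1)]]) auto
    then show "0 < C'" "2 \<le> C'" "g \<le> C'" using g unfolding C'_def by linarith+
  qed
  have "\<bar>T' n x\<bar> \<le> C' * A n * x powr (a - 1) \<and> \<bar>G n x\<bar> \<le> C' * A n \<and>
      \<bar>G' n x\<bar> \<le> C' * A n * x powr (a - 1) \<and> (1 + (real n)\<^sup>2) * \<bar>T n x\<bar> \<le> C' * A n"
    if x: "x \<in> {0<..x0}" for n x
  proof (cases "m n = 0")
    case True
    have n0: "n = 0" by (rule T_eq_linear(2)[OF True])
    have p: "0 \<le> x powr a" "x powr a \<le> 1" using x x0 a powr_le1[of a x] by auto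
    have A0: "A n = \<bar>fp 0\<bar> + \<bar>fq 0\<bar>" by (simp add: A_def n0)
    have d: "\<bar>fq 0 - fp 0\<bar> \<le> A n" unfolding A0 by (simp add: abs_if)
    have "\<bar>(fq 0 - fp 0) * a\<bar> \<le> A n * 1"
      unfolding abs_mult using a d by (intro mult_mono) auto
    also have "\<dots> \<le> C' * A n" using C'pos A_nonneg[of n] mult_right_mono[of 1 C' "A n"] by simp
    finally have "\<bar>(fq 0 - fp 0) * a\<bar> * x powr (a - 1) \<le> C' * A n * x powr (a - 1)"
      by (intro mult_right_mono) auto
    then have 1: "\<bar>T' n x\<bar> \<le> C' * A n * x powr (a - 1)" using True by (simp add: T'_def abs_mult)
    have "\<bar>fq 0 - fp 0\<bar> * g \<le> A n * C'" using d g C'pos by (intro mult_mono A_nonneg) auto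
    then have 2: "\<bar>G n x\<bar> \<le> C' * A n" using True g by (simp add: G_def abs_mult g_def[symmetric] mult.commute)
    have "\<bar>(fq 0 - fp 0) * x powr a\<bar> \<le> \<bar>fq 0 - fp 0\<bar> * 1"
      unfolding abs_mult using p by (intro mult_left_mono) auto
    then have Tle: "\<bar>T n x\<bar> \<le> \<bar>fp 0\<bar> + \<bar>fq 0 - fp 0\<bar> * 1"
      unfolding T_eq_linear(1)[OF True] by (rule order_trans[OF abs_triangle_ineq add_left_mono])
    note Tle
    also have "\<bar>fp 0\<bar> + \<bar>fq 0 - fp 0\<bar> * 1 \<le> A n + A n * 1"
      by (intro add_mono mult_right_mono d) (auto simp: A0)
    also have "\<dots> = 2 * A n" by simp
    also have "\<dots> \<le> C' * A n" using C'pos by (intro mult_right_mono A_nonneg)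
    finally have 3: "(1 + (real n)\<^sup>2) * \<bar>T n x\<bar> \<le> C' * A n" using n0 by simp
    have 4: "\<bar>G' n x\<bar> \<le> C' * A n * x powr (a - 1)"
      using True C'pos A_nonneg[of n] by (simp add: G'_def)
    from 1 2 3 4 show ?thesis by blast
  next
    case False
    have mpos: "0 < m n" using False mu_nonneg[OF e, of c n] by simp
    have x0': "0 \<le> x" using x by simp
    define B where "B = (m n)\<^sup>2 * \<bar>PP n\<bar> + \<bar>QQ n\<bar>"
    have B: "B \<le> K * A n" "0 \<le> B" unfolding B_def using K(2)[OF False] by auto
    have CB: "C * B \<le> C * K * A n" using B C(1) by (simp add: mult.assoc)
    have r1: "\<bar>PP n\<bar> + \<bar>QQ n\<bar> / (m n)\<^sup>2 = B / (m n)\<^sup>2"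
      using mpos by (simp add: B_def add_divide_distrib)
    have r2: "m n * (\<bar>PP n\<bar> + \<bar>QQ n\<bar> / (m n)\<^sup>2) = B / m n"
      unfolding r1 using mpos by (simp add: power2_eq_square)
    have r3: "\<bar>- m n * PP n\<bar> + \<bar>m n * QQ n\<bar> / (m n)\<^sup>2 = B / m n"
      using mpos by (simp add: B_def abs_mult power2_eq_square field_simps)
    have minv: "1 / m n \<le> 1 / m0" using m_ge(1)[OF False] m0_pos mpos by (simp add: frac_le)
    have Bm: "C * (B / m n) \<le> C' * A n"
    proof -
      have "C * (B / m n) = C * B * (1 / m n)" by simp
      also have "\<dots> \<le> C * K * A n * (1 / m0)"
        by (rule mult_mono[OF CB minv]) (use mpos CK A_nonneg[of n] in auto)
      also have "\<dots> = C * K / m0 * A n" by simp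
      also have "\<dots> \<le> C' * A n" by (intro mult_right_mono sum3 A_nonneg)
      finally show ?thesis .
    qed
    have 1: "\<bar>T' n x\<bar> \<le> C' * A n * x powr (a - 1)"
    proof -
      have "\<bar>T' n x\<bar> \<le> C * (B / m n) * x powr (a - 1)"
        using C(3)[OF mpos x, of "PP n" "QQ n"] False unfolding r2 by (simp add: T'_def)
      also have "\<dots> \<le> C' * A n * x powr (a - 1)" by (intro mult_right_mono Bm) auto
      finally show ?thesis .
    qed
    have 2: "\<bar>G n x\<bar> \<le> C' * A n"
      using C(2)[OF mpos x, of "- m n * PP n" "m n * QQ n"] False Bm unfolding r3 by (simp add: G_def)
    have 3: "\<bar>G' n x\<bar> \<le> C' * A n * x powr (a - 1)"
    proof -
      have "\<bar>G' n x\<bar> \<le> C * (m n * (B / m n)) * x powr (a - 1)"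
        using C(3)[OF mpos x, of "- m n * PP n" "m n * QQ n"] False unfolding r3 by (simp add: G'_def)
      also have "C * (m n * (B / m n)) = C * B" using mpos by simp
      also have "C * B * x powr (a - 1) \<le> C' * A n * x powr (a - 1)"
        using CB mult_right_mono[OF sum3(2) A_nonneg[of n]] by (intro mult_right_mono) auto
      finally show ?thesis .
    qed
    have 4: "(1 + (real n)\<^sup>2) * \<bar>T n x\<bar> \<le> C' * A n"
    proof -
      have "m0\<^sup>2 \<le> (m n)\<^sup>2" using m_ge(1)[OF False] m0_pos by (intro power_mono) auto
      moreover have "(m0 * real n)\<^sup>2 \<le> (m n)\<^sup>2" using m_ge(2)[of n] m0_pos by (intro power_mono) auto
      ultimately have "m0\<^sup>2 * (1 + (real n)\<^sup>2) \<le> 2 * (m n)\<^sup>2" by (simp add: power_mult_distrib algebra_simps)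
      then have nm: "1 + (real n)\<^sup>2 \<le> 2 * h * (m n)\<^sup>2" using m0_pos by (simp add: h_def field_simps)
      have "\<bar>T n x\<bar> \<le> C * (B / (m n)\<^sup>2)"
        using C(2)[OF mpos x, of "PP n" "QQ n"] T_eq_mode[OF False x0'] unfolding r1 by simp
      then have "(1 + (real n)\<^sup>2) * \<bar>T n x\<bar> \<le> (2 * h * (m n)\<^sup>2) * (C * (B / (m n)\<^sup>2))"
        using nm h by (intro mult_mono) auto
      also have "\<dots> = C * B * (2 * h)" using mpos by simp
      also have "\<dots> \<le> C * K * A n * (2 * h)" using CB h by (intro mult_right_mono) auto
      also have "\<dots> = C * K * (2 * h) * A n" by simp
      also have "\<dots> \<le> C' * A n" by (intro mult_right_mono sum3 A_nonneg)
      finally show ?thesis .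
    qed
    from 1 2 3 4 show ?thesis by blast
  qed
  with C'pos(1) show ?thesis by blast
qed

lemma T_endpoints: "T n 0 = fp n" "T n 1 = fq n"
proof -
  have "T n 0 = fp n \<and> T n 1 = fq n"
  proof (cases "m n = 0")
    case True
    then show ?thesis using T_eq_linear[OF True] a by simp
  next
    case False
    let ?E = "mittag_leffler a 1 (m n)" and ?F = "mittag_leffler a 1 (- m n)"
    have mpos: "0 < m n" using False mu_nonneg[OF e, of c n] by simp
    have E: "0 < ?E" by (rule ml_pos) (use a mpos in auto)
    have "0 < mittag_leffler (2 * a) (a + 1) ((m n)\<^sup>2)" by (rule ml_pos) (use a in auto)
    then have D: "?E - ?F \<noteq> 0" using ml_odd_part[OF a(1), of "m n"] mpos by simp
    have "T n 0 = PP n + QQ n / ?E" using T_eq_mode[OF False, of 0] a by (simp add: mode_def)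
    also have "\<dots> = (fp n * ?E - fq n) / (?E - ?F) + (fq n - ?F * fp n) / (?E - ?F)"
      using E by (simp add: PP_def QQ_def)
    also have "\<dots> = (fp n * (?E - ?F)) / (?E - ?F)"
      unfolding add_divide_distrib[symmetric] by (simp add: algebra_simps)
    also have "\<dots> = fp n" using D by simp
    finally have 1: "T n 0 = fp n" .
    have "T n 1 = PP n * ?F + QQ n" using T_eq_mode[OF False, of 1] a E by (simp add: mode_def)
    also have "\<dots> = (fq n * (?E - ?F)) / (?E - ?F)"
      unfolding PP_def QQ_def times_divide_eq_left times_divide_eq_right add_divide_distrib[symmetric]
      by (simp add: algebra_simps)
    also have "\<dots> = fq n" using D by simp
    finally show ?thesis using 1 by simp
  qed
  then show "T n 0 = fp n" "T n 1 = fq n" by auto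
qed

section \<open>The series for the solution and its derivatives\<close>

definition u :: "real \<Rightarrow> real \<Rightarrow> real" where
  "u x y = (\<Sum>n. T n x * Y n y)"

definition uy :: "real \<Rightarrow> real \<Rightarrow> real" where
  "uy x y = (\<Sum>n. T n x * (real n / 2 * Z n y))"

definition uyy :: "real \<Rightarrow> real \<Rightarrow> real" where
  "uyy x y = (\<Sum>n. T n x * (- ((real n / 2)\<^sup>2 * Y n y)))"

text \<open>\<open>ux\<close> and \<open>uxx\<close> are the series of D_x^a u and D_x^a D_x^a u,
  not of ordinary derivatives.\<close>

definition ux :: "real \<Rightarrow> real \<Rightarrow> real" where
  "ux x y = (\<Sum>n. G n x * Y n y)"

definition uxx :: "real \<Rightarrow> real \<Rightarrow> real" where
  "uxx x y = (\<Sum>n. (m n)\<^sup>2 * T n x * Y n y)"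

lemma abs_mult_Y_le: "\<bar>t * Y n y\<bar> \<le> \<bar>t\<bar>" and abs_mult_Z_le: "\<bar>t * Z n y\<bar> \<le> \<bar>t\<bar>"
  using abs_Y_le_1[of n y] abs_Z_le_1[of n y] by (simp_all add: abs_mult mult_left_le)

lemma closure_bound:
  obtains B where "summable B" "\<And>n x y. x \<in> {0..1} \<Longrightarrow> \<bar>T n x * Y n y\<bar> \<le> B n"
    "\<And>n x y. x \<in> {0..1} \<Longrightarrow> \<bar>T n x * (real n / 2 * Z n y)\<bar> \<le> B n"
proof -
  obtain C where C: "C > 0" "\<And>n x. x \<in> {0..1} \<Longrightarrow> (1 + real n) * \<bar>T n x\<bar> \<le> C * A n"
    using T_global_bound by blast
  show ?thesis
  proof (rule that)
    show "summable (\<lambda>n. C * A n)" by (intro summable_mult summable_A)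
    fix n x y assume x: "x \<in> {0..1::real}"
    have "\<bar>T n x\<bar> \<le> (1 + real n) * \<bar>T n x\<bar>" by (simp add: algebra_simps)
    then show "\<bar>T n x * Y n y\<bar> \<le> C * A n" using C(2)[OF x, of n] abs_mult_Y_le[of "T n x" n y] by linarith
    have "\<bar>T n x * (real n / 2 * Z n y)\<bar> = \<bar>T n x * (real n / 2) * Z n y\<bar>" by (simp add: mult.assoc)
    also have "\<dots> \<le> \<bar>T n x * (real n / 2)\<bar>" by (rule abs_mult_Z_le)
    also have "\<dots> \<le> (1 + real n) * \<bar>T n x\<bar>" by (simp add: abs_mult algebra_simps)
    finally show "\<bar>T n x * (real n / 2 * Z n y)\<bar> \<le> C * A n" using C(2)[OF x, of n] by linarith
  qed
qed

lemma interior_bound: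
  assumes "0 < x0" "x0 < 1"
  obtains B where "summable B" "\<And>n x y. x \<in> {0<..x0} \<Longrightarrow> \<bar>T' n x * Y n y\<bar> \<le> B n * x powr (a - 1)"
    "\<And>n x y. x \<in> {0<..x0} \<Longrightarrow> \<bar>G n x * Y n y\<bar> \<le> B n"
    "\<And>n x y. x \<in> {0<..x0} \<Longrightarrow> \<bar>G' n x * Y n y\<bar> \<le> B n * x powr (a - 1)"
    "\<And>n x y. x \<in> {0<..x0} \<Longrightarrow> \<bar>T n x * (- ((real n / 2)\<^sup>2 * Y n y))\<bar> \<le> B n"
    "\<And>n x y. x \<in> {0<..x0} \<Longrightarrow> \<bar>(m n)\<^sup>2 * T n x * Y n y\<bar> \<le> B n"
proof -
  obtain C where C: "C > 0"
    "\<And>n x. x \<in> {0<..x0} \<Longrightarrow> \<bar>T' n x\<bar> \<le> C * A n * x powr (a - 1)"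
    "\<And>n x. x \<in> {0<..x0} \<Longrightarrow> \<bar>G n x\<bar> \<le> C * A n"
    "\<And>n x. x \<in> {0<..x0} \<Longrightarrow> \<bar>G' n x\<bar> \<le> C * A n * x powr (a - 1)"
    "\<And>n x. x \<in> {0<..x0} \<Longrightarrow> (1 + (real n)\<^sup>2) * \<bar>T n x\<bar> \<le> C * A n"
    using interior_bounds[OF assms] by blast
  have le: "C * A n \<le> (1 + c\<^sup>2) * (C * A n)" for n
    using C(1) A_nonneg[of n] mult_right_mono[of 1 "1 + c\<^sup>2" "C * A n"] by simp
  show ?thesis
  proof (rule that)
    show "summable (\<lambda>n. (1 + c\<^sup>2) * (C * A n))" by (intro summable_mult summable_A)
    fix n x y assume x: "x \<in> {0<..x0}"
    have lep: "C * A n * x powr (a - 1) \<le> (1 + c\<^sup>2) * (C * A n) * x powr (a - 1)"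
      by (intro mult_right_mono le) auto
    show "\<bar>T' n x * Y n y\<bar> \<le> (1 + c\<^sup>2) * (C * A n) * x powr (a - 1)"
      using C(2)[OF x, of n] lep abs_mult_Y_le[of "T' n x" n y] by linarith
    show "\<bar>G n x * Y n y\<bar> \<le> (1 + c\<^sup>2) * (C * A n)"
      using C(3)[OF x, of n] le[of n] abs_mult_Y_le[of "G n x" n y] by linarith
    show "\<bar>G' n x * Y n y\<bar> \<le> (1 + c\<^sup>2) * (C * A n) * x powr (a - 1)"
      using C(4)[OF x, of n] lep abs_mult_Y_le[of "G' n x" n y] by linarith
    have "\<bar>T n x * (- ((real n / 2)\<^sup>2 * Y n y))\<bar> = \<bar>(T n x * (real n / 2)\<^sup>2) * Y n y\<bar>"
      by (simp add: abs_mult)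
    also have "\<dots> \<le> \<bar>T n x * (real n / 2)\<^sup>2\<bar>" by (rule abs_mult_Y_le)
    also have "\<dots> \<le> (1 + (real n)\<^sup>2) * \<bar>T n x\<bar>"
      unfolding abs_mult mult.commute[of "\<bar>T n x\<bar>"] by (intro mult_right_mono) (auto simp: power_divide)
    finally show "\<bar>T n x * (- ((real n / 2)\<^sup>2 * Y n y))\<bar> \<le> (1 + c\<^sup>2) * (C * A n)"
      using C(5)[OF x, of n] le[of n] by linarith
    have "\<bar>(m n)\<^sup>2 * T n x * Y n y\<bar> \<le> \<bar>(m n)\<^sup>2 * T n x\<bar>" by (rule abs_mult_Y_le)
    also have "\<dots> \<le> (1 + c\<^sup>2) * ((real n)\<^sup>2 + 1) * \<bar>T n x\<bar>"
      unfolding abs_mult using mu_sq_le[OF e, of c n] by (intro mult_right_mono) auto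
    also have "\<dots> = (1 + c\<^sup>2) * ((1 + (real n)\<^sup>2) * \<bar>T n x\<bar>)" by (simp add: algebra_simps)
    also have "\<dots> \<le> (1 + c\<^sup>2) * (C * A n)" by (intro mult_left_mono C(5)[OF x]) auto
    finally show "\<bar>(m n)\<^sup>2 * T n x * Y n y\<bar> \<le> (1 + c\<^sup>2) * (C * A n)" .
  qed
qed

end

context series_data
begin

lemma summable_closure:
  assumes "x \<in> {0..1}"
  shows "summable (\<lambda>n. \<bar>T n x * Y n y\<bar>)" "summable (\<lambda>n. T n x * Y n y)"
    "summable (\<lambda>n. T n x * (real n / 2 * Z n y))"
proof -
  obtain B where B: "summable B" "\<And>n x y. x \<in> {0..1} \<Longrightarrow> \<bar>T n x * Y n y\<bar> \<le> B n"
    "\<And>n x y. x \<in> {0..1} \<Longrightarrow> \<bar>T n x * (real n / 2 * Z n y)\<bar> \<le> B n"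
    using closure_bound by metis
  show "summable (\<lambda>n. \<bar>T n x * Y n y\<bar>)"
    by (rule summable_comparison_test'[OF B(1)]) (use B(2)[OF assms] in auto)
  show "summable (\<lambda>n. T n x * Y n y)"
    by (rule summable_comparison_test'[OF B(1)]) (use B(2)[OF assms] in auto)
  show "summable (\<lambda>n. T n x * (real n / 2 * Z n y))"
    by (rule summable_comparison_test'[OF B(1)]) (use B(3)[OF assms] in auto)
qed

lemma summable_interior:
  assumes "x \<in> {0<..<1}"
  shows "summable (\<lambda>n. G n x * Y n y)" "summable (\<lambda>n. T n x * (- ((real n / 2)\<^sup>2 * Y n y)))"
    "summable (\<lambda>n. (m n)\<^sup>2 * T n x * Y n y)"
proof -
  obtain B where B: "summable B"
    "\<And>n x' y. x' \<in> {0<..x} \<Longrightarrow> \<bar>G n x' * Y n y\<bar> \<le> B n"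
    "\<And>n x' y. x' \<in> {0<..x} \<Longrightarrow> \<bar>T n x' * (- ((real n / 2)\<^sup>2 * Y n y))\<bar> \<le> B n"
    "\<And>n x' y. x' \<in> {0<..x} \<Longrightarrow> \<bar>(m n)\<^sup>2 * T n x' * Y n y\<bar> \<le> B n"
    using interior_bound[of x] assms by (metis greaterThanLessThan_iff)
  have x: "x \<in> {0<..x}" using assms by simp
  show "summable (\<lambda>n. G n x * Y n y)"
    by (rule summable_comparison_test'[OF B(1)]) (use B(2)[OF x] in auto)
  show "summable (\<lambda>n. T n x * (- ((real n / 2)\<^sup>2 * Y n y)))"
    by (rule summable_comparison_test'[OF B(1)]) (use B(3)[OF x, of _ y] in \<open>simp only: real_norm_def\<close>)
  show "summable (\<lambda>n. (m n)\<^sup>2 * T n x * Y n y)"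
    by (rule summable_comparison_test'[OF B(1)]) (use B(4)[OF x, of _ y] in \<open>simp only: real_norm_def\<close>)
qed

lemma T_field_differentiable: "0 < x \<Longrightarrow> T n field_differentiable (at x)"
  and G_field_differentiable: "0 < x \<Longrightarrow> G n field_differentiable (at x)"
  by (metis T_has_derivative field_differentiable_def) (metis G_has_derivative field_differentiable_def)

lemma u_caputo:
  assumes x: "x \<in> {0<..<1}"
  shows "caputo_differentiable a (\<lambda>t. u t y) x" "caputo_dx a u x y = ux x y"
proof -
  have der: "((\<lambda>t. T n t * Y n y) has_real_derivative T' n s * Y n y) (at s)" if "s \<in> {0<..<1}" for n s
    by (rule DERIV_cmult_right[OF T_has_derivative]) (use that in simp)
  have cont: "continuous_on {0<..<1} (\<lambda>s. T' n s * Y n y)" for n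
    by (intro continuous_intros continuous_on_subset[OF continuous_on_TG(2)]) auto
  have sm: "summable (\<lambda>n. T n s * Y n y)" if "s \<in> {0<..<1}" for s
    by (rule summable_closure) (use that in auto)
  have bd: "\<exists>B. summable B \<and> (\<forall>n. \<forall>s\<in>{0<..x0}. \<bar>T' n s * Y n y\<bar> \<le> B n * s powr (a - 1))"
    if "x0 \<in> {0<..<1}" for x0
    using interior_bound[of x0] that by (metis greaterThanLessThan_iff)
  have cap: "caputo_deriv a (\<lambda>t. T n t * Y n y) x = G n x * Y n y" if "x \<in> {0<..<1}" for n x
    using caputo_cmult[of x "T n" a "Y n y"] T_field_differentiable T_caputo[OF that] that by auto
  note * = caputo_series[OF a der cont sm bd cap x]
  show "caputo_differentiable a (\<lambda>t. u t y) x" unfolding u_def by (rule *(2))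
  show "caputo_dx a u x y = ux x y" unfolding caputo_dx_def u_def ux_def by (rule *(3))
qed

lemma ux_caputo:
  assumes x: "x \<in> {0<..<1}"
  shows "caputo_differentiable a (\<lambda>t. ux t y) x" "caputo_deriv a (\<lambda>t. ux t y) x = uxx x y"
proof -
  have der: "((\<lambda>t. G n t * Y n y) has_real_derivative G' n s * Y n y) (at s)" if "s \<in> {0<..<1}" for n s
    by (rule DERIV_cmult_right[OF G_has_derivative]) (use that in simp)
  have cont: "continuous_on {0<..<1} (\<lambda>s. G' n s * Y n y)" for n
    by (intro continuous_intros continuous_on_subset[OF continuous_on_TG(4)]) auto
  have sm: "summable (\<lambda>n. G n s * Y n y)" if "s \<in> {0<..<1}" for s
    by (rule summable_interior[OF that])
  have bd: "\<exists>B. summable B \<and> (\<forall>n. \<forall>s\<in>{0<..x0}. \<bar>G' n s * Y n y\<bar> \<le> B n * s powr (a - 1))"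
    if "x0 \<in> {0<..<1}" for x0
    using interior_bound[of x0] that by (metis greaterThanLessThan_iff)
  have cap: "caputo_deriv a (\<lambda>t. G n t * Y n y) x = (m n)\<^sup>2 * T n x * Y n y" if "x \<in> {0<..<1}" for n x
    using caputo_cmult[of x "G n" a "Y n y"] G_field_differentiable G_caputo[OF that] that by auto
  note * = caputo_series[OF a der cont sm bd cap x]
  show "caputo_differentiable a (\<lambda>t. ux t y) x" unfolding ux_def by (rule *(2))
  show "caputo_deriv a (\<lambda>t. ux t y) x = uxx x y" unfolding ux_def uxx_def by (rule *(3))
qed

lemma u_caputo2:
  assumes x: "x \<in> {0<..<1}"
  shows "caputo_differentiable a (\<lambda>t. caputo_dx a u t y) x" "caputo_dx a (caputo_dx a u) x y = uxx x y"
proof -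
  note cong = caputo_cong[of "\<lambda>t. caputo_dx a u t y" "\<lambda>t. ux t y", OF u_caputo(2) x]
  show "caputo_differentiable a (\<lambda>t. caputo_dx a u t y) x" using ux_caputo(1)[OF x] by (simp only: cong)
  show "caputo_dx a (caputo_dx a u) x y = uxx x y"
    unfolding caputo_dx_def[of a "caputo_dx a u"] using ux_caputo(2)[OF x] by (simp only: cong)
qed

lemma u_dy:
  assumes x: "x \<in> {0..1}" and y: "y \<in> {- pi..pi}"
  shows "dy u x y = uy x y" "dy_exists u x y"
proof -
  obtain B where B: "summable B" "\<And>n x y. x \<in> {0..1} \<Longrightarrow> \<bar>T n x * (real n / 2 * Z n y)\<bar> \<le> B n"
    using closure_bound by metis
  have d: "((\<lambda>y. T n x * Y n y) has_real_derivative T n x * (real n / 2 * Z n y)) (at y within S)" for n y S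
    by (rule DERIV_cmult[OF Y_has_derivative])
  have "((\<lambda>y. \<Sum>n. T n x * Y n y) has_real_derivative (\<Sum>n. T n x * (real n / 2 * Z n y))) (at y within {- pi..pi})"
    by (rule suminf_has_derivative_within[OF d B(1) B(2)[OF x] summable_closure(2)[OF x] y])
  then have "(u x has_real_derivative uy x y) (at y within {- pi..pi})"
    by (simp add: u_def[abs_def] uy_def)
  from dy_eqI[of u, OF this y] show "dy u x y = uy x y" "dy_exists u x y" by auto
qed

lemma u_dyy:
  assumes x: "x \<in> {0<..<1}" and y: "y \<in> {- pi..pi}"
  shows "dy (dy u) x y = uyy x y" "dy_exists (dy u) x y"
proof -
  obtain B where B: "summable B"
    "\<And>n x' y. x' \<in> {0<..x} \<Longrightarrow> \<bar>T n x' * (- ((real n / 2)\<^sup>2 * Y n y))\<bar> \<le> B n"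
    using interior_bound[of x] x by (metis greaterThanLessThan_iff)
  have x': "x \<in> {0..1}" "x \<in> {0<..x}" using x by auto
  have d: "((\<lambda>y. T n x * (real n / 2 * Z n y)) has_real_derivative T n x * (- ((real n / 2)\<^sup>2 * Y n y))) (at y within S)" for n y S
    by (rule DERIV_cong[OF DERIV_cmult[OF DERIV_cmult[OF Z_has_derivative]]]) (simp add: power2_eq_square)
  have "((\<lambda>y. \<Sum>n. T n x * (real n / 2 * Z n y)) has_real_derivative
      (\<Sum>n. T n x * (- ((real n / 2)\<^sup>2 * Y n y)))) (at y within {- pi..pi})"
    by (rule suminf_has_derivative_within[OF d B(1) B(2)[OF x'(2)] summable_closure(3)[OF x'(1)] y])
  then have "(uy x has_real_derivative uyy x y) (at y within {- pi..pi})"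
    by (simp add: uy_def[abs_def] uyy_def)
  then have "(dy u x has_real_derivative uyy x y) (at y within {- pi..pi})"
    by (rule has_field_derivative_transform_within[OF _ zero_less_one y])
       (use u_dy(1)[OF x'(1)] in simp)
  from dy_eqI[of "dy u", OF this y] show "dy (dy u) x y = uyy x y" "dy_exists (dy u) x y" by auto
qed

text \<open>The majorants deteriorate as x approaches 1, so continuity is proved on strips x < x0
  and glued.\<close>

lemma Omega_UN: "Omega = (\<Union>x0\<in>{0<..<1}. {0<..<x0} \<times> {- pi<..<pi})"
proof (intro equalityI subsetI)
  fix p assume "p \<in> Omega"
  then obtain x y where p: "p = (x, y)" "0 < x" "x < 1" "y \<in> {- pi<..<pi}" by (auto simp: Omega_def)
  then have "(x + 1) / 2 \<in> {0<..<1}" "p \<in> {0<..<(x + 1) / 2} \<times> {- pi<..<pi}" by simp_all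
  then show "p \<in> (\<Union>x0\<in>{0<..<1}. {0<..<x0} \<times> {- pi<..<pi})" by blast
qed (auto simp: Omega_def)

lemma continuous_on_Omega_series:
  assumes "\<And>n. continuous_on Omega (f n)"
    and "\<And>x0. x0 \<in> {0<..<1} \<Longrightarrow> \<exists>B. summable B \<and> (\<forall>n x y. x \<in> {0<..x0} \<longrightarrow> \<bar>f n (x, y)\<bar> \<le> B n)"
  shows "continuous_on Omega (\<lambda>p. \<Sum>n. f n p :: real)"
proof -
  have "continuous_on (\<Union>x0\<in>{0<..<1}. {0<..<x0} \<times> {- pi<..<pi}) (\<lambda>p. \<Sum>n. f n p)"
  proof (rule continuous_on_open_UN)
    fix x0 :: real assume x0: "x0 \<in> {0<..<1}"
    show "open ({0<..<x0} \<times> {- pi<..<pi})" by (intro open_Times open_greaterThanLessThan)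
    obtain B where B: "summable B" "\<And>n x y. x \<in> {0<..x0} \<Longrightarrow> \<bar>f n (x, y)\<bar> \<le> B n"
      using assms(2)[OF x0] by blast
    show "continuous_on ({0<..<x0} \<times> {- pi<..<pi}) (\<lambda>p. \<Sum>n. f n p)"
      by (rule continuous_on_suminf[OF continuous_on_subset[OF assms(1)] B(1)])
         (use x0 B(2) in \<open>auto simp: Omega_def\<close>)
  qed
  then show ?thesis by (simp only: Omega_UN[symmetric])
qed

lemma continuous_on_fst_snd:
  assumes "continuous_on S f" "fst ` D \<subseteq> S" "continuous_on UNIV g"
  shows "continuous_on D (\<lambda>p. f (fst p) * g (snd p) :: real)"
  by (intro continuous_intros continuous_on_compose2[OF assms(1)] continuous_on_compose2[OF assms(3)])
     (use assms(2) in auto)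

lemma continuous_u:
  "continuous_on (closure Omega) (\<lambda>(x, y). u x y)"
  "continuous_on (closure Omega) (\<lambda>(x, y). uy x y)"
proof -
  obtain B where B: "summable B" "\<And>n x y. x \<in> {0..1} \<Longrightarrow> \<bar>T n x * Y n y\<bar> \<le> B n"
    "\<And>n x y. x \<in> {0..1} \<Longrightarrow> \<bar>T n x * (real n / 2 * Z n y)\<bar> \<le> B n"
    using closure_bound by metis
  have fst: "fst ` closure Omega \<subseteq> {0..}" by (auto simp: closure_Omega)
  have "continuous_on (closure Omega) (\<lambda>p. \<Sum>n. T n (fst p) * Y n (snd p))"
    by (rule continuous_on_suminf[OF continuous_on_fst_snd[OF continuous_on_TG(1) fst continuous_on_Y[OF continuous_on_id]] B(1)])
       (use B(2) in \<open>simp add: closure_Omega mem_Times_iff\<close>)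
  then show "continuous_on (closure Omega) (\<lambda>(x, y). u x y)"
    by (simp add: u_def case_prod_unfold)
  have "continuous_on (closure Omega) (\<lambda>p. \<Sum>n. T n (fst p) * (real n / 2 * Z n (snd p)))"
    by (rule continuous_on_suminf[OF continuous_on_fst_snd[OF continuous_on_TG(1) fst
            continuous_on_mult[OF continuous_on_const continuous_on_Z[OF continuous_on_id]]] B(1)])
       (use B(3) in \<open>simp add: closure_Omega mem_Times_iff\<close>)
  then show "continuous_on (closure Omega) (\<lambda>(x, y). uy x y)"
    by (simp add: uy_def case_prod_unfold)
qed

lemma continuous_u_interior:
  "continuous_on Omega (\<lambda>(x, y). ux x y)" "continuous_on Omega (\<lambda>(x, y). uxx x y)"
  "continuous_on Omega (\<lambda>(x, y). uyy x y)"
proof -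
  have fst: "fst ` Omega \<subseteq> {0..}" by (auto simp: Omega_def)
  have ib: "\<exists>B. summable B \<and> (\<forall>n x y. x \<in> {0<..x0} \<longrightarrow> \<bar>G n x * Y n y\<bar> \<le> B n)
    \<and> (\<forall>n x y. x \<in> {0<..x0} \<longrightarrow> \<bar>T n x * (- ((real n / 2)\<^sup>2 * Y n y))\<bar> \<le> B n)
    \<and> (\<forall>n x y. x \<in> {0<..x0} \<longrightarrow> \<bar>(m n)\<^sup>2 * T n x * Y n y\<bar> \<le> B n)" if "x0 \<in> {0<..<1}" for x0
  proof -
    from that have "0 < x0" "x0 < 1" by auto
    from interior_bound[OF this] show ?thesis by metis
  qed
  have "continuous_on Omega (\<lambda>p. \<Sum>n. G n (fst p) * Y n (snd p))"
  proof (rule continuous_on_Omega_series)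
    show "continuous_on Omega (\<lambda>p. G n (fst p) * Y n (snd p))" for n
      by (rule continuous_on_fst_snd[OF continuous_on_TG(3) fst]) (intro continuous_intros)
    show "\<exists>B. summable B \<and> (\<forall>n x y. x \<in> {0<..x0} \<longrightarrow> \<bar>G n (fst (x, y)) * Y n (snd (x, y))\<bar> \<le> B n)"
      if "x0 \<in> {0<..<1}" for x0 using ib[OF that] unfolding fst_conv snd_conv by blast
  qed
  then show "continuous_on Omega (\<lambda>(x, y). ux x y)" by (simp add: ux_def case_prod_unfold)
  have "continuous_on Omega (\<lambda>p. \<Sum>n. (m n)\<^sup>2 * T n (fst p) * Y n (snd p))"
  proof (rule continuous_on_Omega_series)
    show "continuous_on Omega (\<lambda>p. (m n)\<^sup>2 * T n (fst p) * Y n (snd p))" for n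
      by (rule continuous_on_fst_snd[OF _ fst, of "\<lambda>x. (m n)\<^sup>2 * T n x"])
         (intro continuous_intros continuous_on_TG)+
    show "\<exists>B. summable B \<and> (\<forall>n x y. x \<in> {0<..x0} \<longrightarrow> \<bar>(m n)\<^sup>2 * T n (fst (x, y)) * Y n (snd (x, y))\<bar> \<le> B n)"
      if "x0 \<in> {0<..<1}" for x0 using ib[OF that] unfolding fst_conv snd_conv by blast
  qed
  then show "continuous_on Omega (\<lambda>(x, y). uxx x y)" by (simp add: uxx_def case_prod_unfold)
  have "continuous_on Omega (\<lambda>p. \<Sum>n. T n (fst p) * (- ((real n / 2)\<^sup>2 * Y n (snd p))))"
  proof (rule continuous_on_Omega_series)
    show "continuous_on Omega (\<lambda>p. T n (fst p) * (- ((real n / 2)\<^sup>2 * Y n (snd p))))" for n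
      by (rule continuous_on_fst_snd[OF continuous_on_TG(1) fst]) (intro continuous_intros)
    show "\<exists>B. summable B \<and> (\<forall>n x y. x \<in> {0<..x0} \<longrightarrow> \<bar>T n (fst (x, y)) * (- ((real n / 2)\<^sup>2 * Y n (snd (x, y))))\<bar> \<le> B n)"
      if "x0 \<in> {0<..<1}" for x0 using ib[OF that] unfolding fst_conv snd_conv by blast
  qed
  then show "continuous_on Omega (\<lambda>(x, y). uyy x y)" by (simp add: uyy_def case_prod_unfold)
qed

text \<open>The terms cancel one by one: reflection multiplies Y n by its parity sign, which is
  exactly the sign distinguishing 1 - e from 1 + e in the eigenvalue.\<close>

lemma u_equation:
  assumes x: "x \<in> {0<..<1}"
  shows "uxx x y + uyy x y - e * uyy x (- y) - c\<^sup>2 * u x y = 0"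
proof -
  have x': "x \<in> {0..1}" using x by simp
  have "(\<lambda>n. (m n)\<^sup>2 * T n x * Y n y + T n x * (- ((real n / 2)\<^sup>2 * Y n y))
      - e * (T n x * (- ((real n / 2)\<^sup>2 * Y n (- y)))) - c\<^sup>2 * (T n x * Y n y)) sums
      (uxx x y + uyy x y - e * uyy x (- y) - c\<^sup>2 * u x y)"
    unfolding uxx_def uyy_def u_def
    by (intro sums_add sums_diff sums_mult summable_sums summable_interior[OF x] summable_closure(2)[OF x'])
  moreover have "(m n)\<^sup>2 * T n x * Y n y + T n x * (- ((real n / 2)\<^sup>2 * Y n y))
      - e * (T n x * (- ((real n / 2)\<^sup>2 * Y n (- y)))) - c\<^sup>2 * (T n x * Y n y) = 0" for n
    unfolding mu_sq[OF e] eigenval_eq Y_neg by (cases "even n") (simp_all add: algebra_simps)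
  ultimately show ?thesis using sums_unique2[OF _ sums_zero] by (simp only:)
qed

theorem u_regular: "regular_solution a e c u"
proof -
  have 1: "continuous_on Omega (\<lambda>(x, y). caputo_dx a u x y)"
    by (rule continuous_on_eq[OF continuous_u_interior(1)]) (auto simp: Omega_def u_caputo)
  have 2: "continuous_on Omega (\<lambda>(x, y). caputo_dx a (caputo_dx a u) x y)"
    by (rule continuous_on_eq[OF continuous_u_interior(2)]) (auto simp: Omega_def u_caputo2)
  have 3: "continuous_on Omega (\<lambda>(x, y). dy (dy u) x y)"
    by (rule continuous_on_eq[OF continuous_u_interior(3)]) (auto simp: Omega_def u_dyy)
  show ?thesis
    unfolding regular_solution_def
    using continuous_u(1) 1 2 3
  proof (intro conjI)
    show "\<forall>(x, y)\<in>Omega. caputo_dx a (caputo_dx a u) x y + dy (dy u) x y - e * dy (dy u) x (- y) - c\<^sup>2 * u x y = 0"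
      using u_equation by (simp add: Omega_def u_caputo2 u_dyy del: diff_eq_eq eq_iff_diff_eq_0)
  qed (auto simp: Omega_def u_caputo u_caputo2 u_dy u_dyy)
qed

theorem u_dy_continuous: "dy_continuous_closure u"
  unfolding dy_continuous_closure_def
  using continuous_on_eq[OF continuous_u(2), of "\<lambda>(x, y). dy u x y"] by (auto simp: closure_Omega u_dy)

theorem u_boundary:
  assumes "cpi \<phi>" "cpi \<psi>" "fp = fourier_coeff \<phi>" "fq = fourier_coeff \<psi>"
  shows "boundary_conditions \<phi> \<psi> u"
proof -
  have "u 0 y = \<phi> y" "u 1 y = \<psi> y" if "y \<in> {- pi..pi}" for y
  proof -
    have "(\<lambda>n. fp n * Y n y) sums \<phi> y" "(\<lambda>n. fq n * Y n y) sums \<psi> y"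
      using fourier_series_sums[OF assms(1) _ that] fourier_series_sums[OF assms(2) _ that]
        summable_fp summable_fq unfolding assms(3,4) by auto
    then show "u 0 y = \<phi> y" "u 1 y = \<psi> y" unfolding u_def T_endpoints by (simp_all add: sums_iff)
  qed
  moreover have "dy u x (- pi) = 0" "dy u x pi = 0" if "x \<in> {0..1}" for x
    using that pi_gt_zero by (auto simp: u_dy uy_def Z_pi)
  ultimately show ?thesis by (auto simp: boundary_conditions_def)
qed

theorem u_series:
  assumes x: "x \<in> {0..1}"
  shows "summable (\<lambda>k. (fp (2 * k + 1) * C_fun a (m (2 * k + 1)) x + fq (2 * k + 1) * S_fun a (m (2 * k + 1)) x) * Y (2 * k + 1) y)"
    "summable (\<lambda>k. (fp (2 * Suc k) * C_fun a (m (2 * Suc k)) x + fq (2 * Suc k) * S_fun a (m (2 * Suc k)) x) * Y (2 * Suc k) y)"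
    "u x y = zero_mode a c (fp 0) (fq 0) x
       + (\<Sum>k. (fp (2 * k + 1) * C_fun a (m (2 * k + 1)) x + fq (2 * k + 1) * S_fun a (m (2 * k + 1)) x) * Y (2 * k + 1) y)
       + (\<Sum>k. (fp (2 * Suc k) * C_fun a (m (2 * Suc k)) x + fq (2 * Suc k) * S_fun a (m (2 * Suc k)) x) * Y (2 * Suc k) y)"
proof -
  have pos: "T n x = fp n * C_fun a (m n) x + fq n * S_fun a (m n) x" if "n \<noteq> 0" for n
    using that by (simp add: T_def)
  have z: "T 0 x * Y 0 y = zero_mode a c (fp 0) (fq 0) x" by (simp add: T_def Y_def)
  have ne: "2 * k + 1 \<noteq> 0" "2 * Suc k \<noteq> 0" for k :: nat by simp_all
  note * = suminf_parity_split[OF summable_closure(1)[OF x, of y], unfolded pos[OF ne(1)] pos[OF ne(2)] z]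
  show "summable (\<lambda>k. (fp (2 * k + 1) * C_fun a (m (2 * k + 1)) x + fq (2 * k + 1) * S_fun a (m (2 * k + 1)) x) * Y (2 * k + 1) y)"
    "summable (\<lambda>k. (fp (2 * Suc k) * C_fun a (m (2 * Suc k)) x + fq (2 * Suc k) * S_fun a (m (2 * Suc k)) x) * Y (2 * Suc k) y)"
    "u x y = zero_mode a c (fp 0) (fq 0) x
       + (\<Sum>k. (fp (2 * k + 1) * C_fun a (m (2 * k + 1)) x + fq (2 * k + 1) * S_fun a (m (2 * k + 1)) x) * Y (2 * k + 1) y)
       + (\<Sum>k. (fp (2 * Suc k) * C_fun a (m (2 * Suc k)) x + fq (2 * Suc k) * S_fun a (m (2 * Suc k)) x) * Y (2 * Suc k) y)"
    using * by (simp_all only: u_def)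
qed

end

subsection \<open>Integrating the equation twice\<close>

lemma set_integrable_bounded_mult:
  fixes k f :: "real \<Rightarrow> real"
  assumes k: "set_integrable lborel S k" and f: "set_borel_measurable lborel S f"
    and b: "\<And>s. s \<in> S \<Longrightarrow> \<bar>f s\<bar> \<le> M"
  shows "set_integrable lborel S (\<lambda>s. k s * f s)"
proof (rule set_integrable_bound[OF set_integrable_mult_right[of M, OF k]])
  have "(\<lambda>s. (indicator S s *\<^sub>R k s) * (indicator S s *\<^sub>R f s)) \<in> borel_measurable lborel"
    using k f unfolding set_integrable_def set_borel_measurable_def by (intro borel_measurable_times) auto
  moreover have "(indicator S s *\<^sub>R k s) * (indicator S s *\<^sub>R f s) = indicator S s *\<^sub>R (k s * f s)" for s
    by (simp add: indicator_def)
  ultimately show "set_borel_measurable lborel S (\<lambda>s. k s * f s)"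
    unfolding set_borel_measurable_def by (simp only:)
  show "AE s in lborel. s \<in> S \<longrightarrow> norm (k s * f s) \<le> norm (M * k s)"
  proof (intro AE_I2 impI)
    fix s assume "s \<in> S"
    then have "\<bar>k s\<bar> * \<bar>f s\<bar> \<le> \<bar>k s\<bar> * \<bar>M\<bar>" using b[of s] by (intro mult_left_mono) auto
    then show "norm (k s * f s) \<le> norm (M * k s)" by (simp add: abs_mult mult.commute)
  qed
qed

lemma continuous_set_borel_measurable:
  assumes "continuous_on S (f :: real \<Rightarrow> real)" "S \<in> sets borel"
  shows "set_borel_measurable lborel S f"
  using borel_measurable_continuous_on_indicator[OF assms(2,1)] by (simp add: set_borel_measurable_def)

text \<open>Common frame for fractional kernels singular at an end point, for the rescaled kernel on
  (0, 1), and for the weight |x - s|. The integration set \<open>S\<close> may omit the singular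
  points, while continuity of \<open>v\<close> on the compact \<open>K\<close> provides uniform
  bounds.\<close>

locale kernel_product =
  fixes k :: "real \<Rightarrow> real" and v :: "real \<Rightarrow> real \<Rightarrow> real" and S K :: "real set" and l r :: real
  assumes k: "set_integrable lborel S k" and S: "S \<in> sets borel" "S \<subseteq> K" and K: "compact K"
    and v: "continuous_on (K \<times> {l..r}) (\<lambda>(s, y). v s y)"
begin

lemma v_bounded: obtains M where "M \<ge> 0" "\<And>s y. s \<in> K \<Longrightarrow> y \<in> {l..r} \<Longrightarrow> \<bar>v s y\<bar> \<le> M"
proof -
  have "bounded ((\<lambda>(s, y). v s y) ` (K \<times> {l..r}))"
    by (intro compact_imp_bounded compact_continuous_image v compact_Times K) simp
  then obtain M where M: "\<And>z. z \<in> (\<lambda>(s, y). v s y) ` (K \<times> {l..r}) \<Longrightarrow> norm z \<le> M"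
    unfolding bounded_iff by blast
  have "\<bar>v s y\<bar> \<le> \<bar>M\<bar>" if "s \<in> K" "y \<in> {l..r}" for s y
    using M[of "v s y"] that by force
  then show ?thesis using that[of "\<bar>M\<bar>"] by simp
qed

lemma v_slice: "y \<in> {l..r} \<Longrightarrow> continuous_on K (\<lambda>s. v s y)" "s \<in> K \<Longrightarrow> continuous_on {l..r} (v s)"
proof -
  assume "y \<in> {l..r}"
  then have "(\<lambda>s. (s, y)) ` K \<subseteq> K \<times> {l..r}" by auto
  from continuous_on_compose2[OF v _ this] show "continuous_on K (\<lambda>s. v s y)"
    by (simp add: continuous_on_Pair continuous_on_id continuous_on_const)
next
  assume "s \<in> K"
  then have "(\<lambda>y. (s, y)) ` {l..r} \<subseteq> K \<times> {l..r}" by auto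
  from continuous_on_compose2[OF v _ this] show "continuous_on {l..r} (v s)"
    by (simp add: continuous_on_Pair continuous_on_id continuous_on_const)
qed

lemma integrable_slice:
  assumes y: "y \<in> {l..r}" shows "set_integrable lborel S (\<lambda>s. k s * v s y)"
proof -
  obtain M where M: "\<And>s y. s \<in> K \<Longrightarrow> y \<in> {l..r} \<Longrightarrow> \<bar>v s y\<bar> \<le> M" using v_bounded by metis
  show ?thesis
    by (rule set_integrable_bounded_mult[OF k continuous_set_borel_measurable, of _ M])
       (use S M y in \<open>auto intro: continuous_on_subset[OF v_slice(1)[OF y]]\<close>)
qed

text \<open>Uniform continuity of \<open>v\<close> on the compact product is multiplied by the
  integral of |k|, which is finite even if \<open>k\<close> is unbounded.\<close>

lemma continuous: "continuous_on {l..r} (\<lambda>y. LBINT s:S. k s * v s y)"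
  unfolding continuous_on_iff
proof (intro ballI allI impI)
  fix y and \<epsilon> :: real assume y: "y \<in> {l..r}" and \<epsilon>: "0 < \<epsilon>"
  define C where "C = (LBINT s:S. \<bar>k s\<bar>)"
  have C: "0 \<le> C" unfolding C_def set_lebesgue_integral_def by (intro Bochner_Integration.integral_nonneg) auto
  define \<eta> where "\<eta> = \<epsilon> / (C + 1)"
  have \<eta>: "0 < \<eta>" using \<epsilon> C by (simp add: \<eta>_def)
  have "uniformly_continuous_on (K \<times> {l..r}) (\<lambda>(s, y). v s y)"
    by (intro compact_uniformly_continuous v compact_Times K) simp
  then obtain d where d: "d > 0" "\<And>p q. p \<in> K \<times> {l..r} \<Longrightarrow> q \<in> K \<times> {l..r} \<Longrightarrow> dist q p < d \<Longrightarrow>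
      dist (case q of (s, y) \<Rightarrow> v s y) (case p of (s, y) \<Rightarrow> v s y) < \<eta>"
    unfolding uniformly_continuous_on_def using \<eta> by metis
  show "\<exists>d>0. \<forall>y'\<in>{l..r}. dist y' y < d \<longrightarrow> dist (LBINT s:S. k s * v s y') (LBINT s:S. k s * v s y) < \<epsilon>"
  proof (intro exI[of _ d] conjI d(1) ballI impI)
    fix y' assume y': "y' \<in> {l..r}" "dist y' y < d"
    have dv: "\<bar>v s y' - v s y\<bar> \<le> \<eta>" if "s \<in> S" for s
      using d(2)[of "(s, y)" "(s, y')"] that S(2) y y' by (auto simp: dist_Pair_Pair dist_real_def less_imp_le)
    have "\<bar>(LBINT s:S. k s * v s y') - (LBINT s:S. k s * v s y)\<bar> = \<bar>LBINT s:S. k s * v s y' - k s * v s y\<bar>"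
      by (simp add: set_integral_diff(2)[OF integrable_slice[OF y'(1)] integrable_slice[OF y]])
    also have "\<dots> \<le> (LBINT s:S. \<bar>k s * v s y' - k s * v s y\<bar>)"
      using set_integral_norm_bound[OF set_integral_diff(1)[OF integrable_slice[OF y'(1)] integrable_slice[OF y]]] by simp
    also have "\<dots> \<le> (LBINT s:S. \<bar>k s\<bar> * \<eta>)"
    proof (rule set_integral_mono)
      show "set_integrable lborel S (\<lambda>s. \<bar>k s * v s y' - k s * v s y\<bar>)"
        by (intro set_integrable_abs set_integral_diff(1) integrable_slice y y'(1))
      show "set_integrable lborel S (\<lambda>s. \<bar>k s\<bar> * \<eta>)"
        by (intro set_integrable_mult_left set_integrable_abs k)
      show "\<bar>k s * v s y' - k s * v s y\<bar> \<le> \<bar>k s\<bar> * \<eta>" if "s \<in> S" for s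
        using mult_left_mono[OF dv[OF that], of "\<bar>k s\<bar>"] by (simp add: right_diff_distrib[symmetric] abs_mult)
    qed
    also have "\<dots> = C * \<eta>" by (simp add: C_def)
    also have "\<dots> < \<epsilon>" using C \<epsilon> by (simp add: \<eta>_def field_simps)
    finally show "dist (LBINT s:S. k s * v s y') (LBINT s:S. k s * v s y) < \<epsilon>" by (simp add: dist_real_def)
  qed
qed

lemma fubini:
  assumes lr: "l \<le> r" and g: "continuous_on {l..r} g"
  shows "set_integrable lborel S (\<lambda>s. k s * integral {l..r} (\<lambda>y. v s y * g y))"
    and "integral {l..r} (\<lambda>y. (LBINT s:S. k s * v s y) * g y) = (LBINT s:S. k s * integral {l..r} (\<lambda>y. v s y * g y))"
proof -
  obtain M where M: "\<And>s y. s \<in> K \<Longrightarrow> y \<in> {l..r} \<Longrightarrow> \<bar>v s y\<bar> \<le> M" "M \<ge> 0" using v_bounded by metis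
  have "bounded (g ` {l..r})" by (intro compact_imp_bounded compact_continuous_image g) simp
  then obtain N where N: "\<And>y. y \<in> {l..r} \<Longrightarrow> \<bar>g y\<bar> \<le> N" unfolding bounded_iff by (metis imageI real_norm_def)
  define k0 where "k0 s = indicator S s * k s" for s
  have k0: "integrable lborel k0" using k by (simp add: set_integrable_def k0_def[abs_def])
  then have k0m[measurable]: "k0 \<in> borel_measurable borel" by simp
  define V where "V = (\<lambda>p. indicator (S \<times> {l..r}) p * (v (fst p) (snd p) * g (snd p)))"
  have Vm: "V \<in> borel_measurable (lborel \<Otimes>\<^sub>M lborel)"
  proof -
    have "continuous_on (S \<times> {l..r}) (\<lambda>p. v (fst p) (snd p) * g (snd p))"
    proof (rule continuous_on_mult)
      show "continuous_on (S \<times> {l..r}) (\<lambda>p. v (fst p) (snd p))"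
        using continuous_on_subset[OF v, of "S \<times> {l..r}"] S(2) by (auto simp: case_prod_unfold)
      show "continuous_on (S \<times> {l..r}) (\<lambda>p. g (snd p))"
        by (rule continuous_on_compose2[OF g]) (auto intro!: continuous_intros)
    qed
    moreover have "S \<times> {l..r} \<in> sets borel" using S(1) by (intro borel_Times) auto
    ultimately have "V \<in> borel_measurable borel"
      using borel_measurable_continuous_on_indicator[of "S \<times> {l..r}" "\<lambda>p. v (fst p) (snd p) * g (snd p)"]
      by (simp add: V_def)
    then show ?thesis by (simp add: lborel_prod)
  qed
  define H where "H s y = k0 s * V (s, y)" for s y
  have H_eq: "H s y = indicator S s * k s * (indicator {l..r} y * (v s y * g y))" for s y
    by (simp add: H_def k0_def V_def indicator_def)
  have Hm: "(\<lambda>(s, y). H s y) \<in> borel_measurable (lborel \<Otimes>\<^sub>M lborel)"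
  proof -
    have "(\<lambda>p. k0 (fst p) * V p) \<in> borel_measurable (lborel \<Otimes>\<^sub>M lborel)"
      using Vm by measurable
    then show ?thesis by (simp add: H_def case_prod_unfold)
  qed
  have dom: "integrable (lborel \<Otimes>\<^sub>M lborel) (\<lambda>(s, y). k0 s * (indicator {l..r} y * (M * N)))"
  proof (rule lborel_pair.Fubini_integrable)
    show "(\<lambda>(s, y). k0 s * (indicator {l..r} y * (M * N))) \<in> borel_measurable (lborel \<Otimes>\<^sub>M lborel)"
      by measurable
    have "(LINT y|lborel. norm (k0 s * (indicator {l..r} y * (M * N)))) = \<bar>k0 s\<bar> * ((r - l) * \<bar>M * N\<bar>)" for s
      using lr by (simp add: abs_mult)
    then show "integrable lborel (\<lambda>s. LINT y|lborel. norm (case (s, y) of (s, y) \<Rightarrow> k0 s * (indicator {l..r} y * (M * N))))"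
      using k0 by simp
    have "integrable lborel (indicator {l..r} :: real \<Rightarrow> real)"
      by (rule integrable_real_indicator) (auto simp: emeasure_lborel_Icc_eq)
    then show "AE s in lborel. integrable lborel (\<lambda>y. case (s, y) of (s, y) \<Rightarrow> k0 s * (indicator {l..r} y * (M * N)))"
      by simp
  qed
  have HI: "integrable (lborel \<Otimes>\<^sub>M lborel) (\<lambda>(s, y). H s y)"
  proof (rule Bochner_Integration.integrable_bound[OF dom Hm], intro AE_I2, clarify)
    fix s y
    have "\<bar>v s y * g y\<bar> \<le> \<bar>M * N\<bar>" if "s \<in> S" "y \<in> {l..r}"
      unfolding abs_mult using M(1)[of s y] N[of y] that S(2) by (intro mult_mono) auto
    then show "norm (H s y) \<le> norm (k0 s * (indicator {l..r} y * (M * N)))"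
      by (auto simp: H_eq k0_def indicator_def abs_mult intro!: mult_left_mono)
  qed
  have gm: "set_integrable lborel {l..r} (\<lambda>y. v s y * g y)" if "s \<in> K" for s
    by (intro borel_integrable_atLeastAtMost' continuous_intros v_slice that g)
  have in1: "(LINT y|lborel. H s y) = indicator S s *\<^sub>R (k s * integral {l..r} (\<lambda>y. v s y * g y))" for s
  proof (cases "s \<in> S")
    case True
    then have "integral {l..r} (\<lambda>y. v s y * g y) = (LBINT y:{l..r}. v s y * g y)"
      using set_borel_integral_eq_integral(2)[OF gm] S(2) by auto
    then show ?thesis using True by (simp add: H_eq set_lebesgue_integral_def)
  qed (simp add: H_eq)
  have in2: "(LINT s|lborel. H s y) = indicator {l..r} y *\<^sub>R ((LBINT s:S. k s * v s y) * g y)" for y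
  proof -
    have "H s y = (indicator S s *\<^sub>R (k s * v s y)) * (indicator {l..r} y * g y)" for s
      by (simp add: H_eq mult_ac)
    then show ?thesis by (simp add: set_lebesgue_integral_def)
  qed
  show "set_integrable lborel S (\<lambda>s. k s * integral {l..r} (\<lambda>y. v s y * g y))"
    using lborel_pair.integrable_fst[OF HI] unfolding in1 set_integrable_def by simp
  have "(LINT y|lborel. LINT s|lborel. H s y) = (LINT s|lborel. LINT y|lborel. H s y)"
    by (rule lborel_pair.Fubini_integral[OF HI])
  then have "(LBINT y:{l..r}. (LBINT s:S. k s * v s y) * g y) = (LBINT s:S. k s * integral {l..r} (\<lambda>y. v s y * g y))"
    unfolding in1 in2 by (simp add: set_lebesgue_integral_def)
  moreover have yi: "set_integrable lborel {l..r} (\<lambda>y. (LBINT s:S. k s * v s y) * g y)"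
    by (intro borel_integrable_atLeastAtMost' continuous_on_mult continuous g)
  ultimately show "integral {l..r} (\<lambda>y. (LBINT s:S. k s * v s y) * g y) = (LBINT s:S. k s * integral {l..r} (\<lambda>y. v s y * g y))"
    unfolding set_borel_integral_eq_integral(2)[OF yi] by (simp only:)
qed

end

lemma rlint_scale:
  assumes "0 < x"
  shows "rlint a f x = x powr a / Gamma a * (LBINT t:{0<..<1}. (1 - t) powr (a - 1) * f (x * t))"
proof -
  let ?g = "\<lambda>s. indicator {0<..<x} s *\<^sub>R ((x - s) powr (a - 1) * f s)"
  have eq: "?g (0 + x * t) = x powr (a - 1) * (indicator {0<..<1} t *\<^sub>R ((1 - t) powr (a - 1) * f (x * t)))" for t
  proof -
    have "x * t \<in> {0<..<x} \<longleftrightarrow> t \<in> {0<..<1}"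
      using assms by (auto simp: zero_less_mult_iff)
    moreover have "x - x * t = x * (1 - t)" by (simp add: algebra_simps)
    ultimately show ?thesis
      using assms by (cases "t \<in> {0<..<1}") (auto simp: powr_mult)
  qed
  have "(LINT s|lborel. ?g s) = x * (LINT t|lborel. ?g (0 + x * t))"
    using lborel_integral_real_affine[of x ?g 0] assms by simp
  also have "\<dots> = x * x powr (a - 1) * (LBINT t:{0<..<1}. (1 - t) powr (a - 1) * f (x * t))"
    unfolding eq by (simp add: set_lebesgue_integral_def)
  also have "x * x powr (a - 1) = x powr a" using assms powr_mult_base[of x "a - 1"] by simp
  finally show ?thesis by (simp add: rlint_def set_lebesgue_integral_def)
qed

text \<open>After the scaling s = x t the kernel is free of x, and x takes the place of the
  parameter y in \<open>kernel_product\<close>. At x = 0 the factor x^a gives the value 0.\<close>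

lemma rlint_continuous:
  assumes a: "0 < a" and f: "continuous_on {0..1} f"
  shows "continuous_on {0..1} (rlint a f)"
proof -
  interpret kernel_product "\<lambda>t. (1 - t) powr (a - 1)" "\<lambda>t x. f (x * t)" "{0<..<1}" "{0..1}" 0 1
  proof
    show "set_integrable lborel {0<..<1} (\<lambda>t. (1 - t) powr (a - 1))" by (rule rl_ok_one) (use a in auto)
    show "continuous_on ({0..1} \<times> {0..1}) (\<lambda>(t, x). f (x * t))"
      unfolding case_prod_unfold
      by (rule continuous_on_compose2[OF f]) (auto intro!: continuous_intros mult_le_one)
  qed auto
  have "continuous_on {0..1} (\<lambda>x. x powr a / Gamma a * (LBINT t:{0<..<1}. (1 - t) powr (a - 1) * f (x * t)))"
    unfolding divide_inverse
    by (intro continuous_on_mult continuous continuous_on_const continuous_on_powr' continuous_on_id) (use a in auto)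
  then show ?thesis
  proof (rule continuous_on_eq)
    fix x :: real assume "x \<in> {0..1}"
    then show "x powr a / Gamma a * (LBINT t:{0<..<1}. (1 - t) powr (a - 1) * f (x * t)) = rlint a f x"
      using rlint_scale[of x a f] by (cases "x = 0") (auto simp: rlint_def set_lebesgue_integral_def)
  qed
qed

text \<open>Raising the order multiplies the integrand by the bounded factor (x - s)^(b -
  a).\<close>

lemma rl_ok_mono:
  assumes ok: "rl_ok a f x" and "a \<le> b"
  shows "rl_ok b f x"
proof -
  have "set_integrable lborel {0<..<x} (\<lambda>s. ((x - s) powr (a - 1) * f s) * (x - s) powr (b - a))"
  proof (rule set_integrable_bounded_mult[OF ok])
    show "set_borel_measurable lborel {0<..<x} (\<lambda>s. (x - s) powr (b - a))"
      by (rule continuous_set_borel_measurable) (auto intro!: continuous_intros)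
    show "\<bar>(x - s) powr (b - a)\<bar> \<le> x powr (b - a)" if "s \<in> {0<..<x}" for s
      using that assms(2) by (auto intro!: powr_mono2)
  qed
  then show ?thesis
    by (rule iffD1[OF set_integrable_cong, rotated -1]) (auto simp: powr_add[symmetric])
qed

lemma rl_ok_1_iff: "rl_ok 1 f x \<longleftrightarrow> set_integrable lborel {0<..<x} f"
  by (rule set_integrable_cong) auto

lemma rlint_1: "rlint 1 f x = (LBINT s:{0<..<x}. f s)"
  unfolding rlint_def by (auto intro!: set_lebesgue_integral_cong)

lemma rlint_2: "rlint 2 f x = (LBINT s:{0<..<x}. (x - s) * f s)"
proof -
  have "Gamma (2 :: real) = 1" using Gamma_plus1_pos[of 1] by simp
  then show ?thesis unfolding rlint_def by (auto intro!: set_lebesgue_integral_cong)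
qed

lemma rlint_const:
  assumes "0 < a" "0 \<le> x" shows "rlint a (\<lambda>_. c) x = c * x powr a / Gamma (a + 1)"
proof (cases "x = 0")
  case False
  then have "rlint a (\<lambda>_. c) x = c * (x powr a / a) / Gamma a"
    using rl_ok_one(2)[of a x] assms by (simp add: rlint_def)
  then show ?thesis using Gamma_plus1_pos[OF assms(1)] by simp
qed (simp add: rlint_def set_lebesgue_integral_def)

lemma rlint_add:
  assumes "rl_ok a f x" "rl_ok a g x"
  shows "rl_ok a (\<lambda>t. f t + g t) x" "rlint a (\<lambda>t. f t + g t) x = rlint a f x + rlint a g x"
  using set_integral_add[OF assms] by (simp_all add: rlint_def distrib_left add_divide_distrib)

lemma rlint_cmult:
  assumes "rl_ok a f x"
  shows "rl_ok a (\<lambda>t. c * f t) x" "rlint a (\<lambda>t. c * f t) x = c * rlint a f x"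
  using set_integrable_mult_right[of c lborel "{0<..<x}", OF assms] by (simp_all add: rlint_def mult.left_commute)

lemma rl_ok_const: "0 < a \<Longrightarrow> 0 < x \<Longrightarrow> rl_ok a (\<lambda>_. c) x"
  using rl_ok_one(1) by simp

lemma set_integral_split:
  fixes f :: "real \<Rightarrow> real"
  assumes "p \<le> q" "q \<le> r" and i: "set_integrable lborel {p<..<r} f"
  shows "(LBINT s:{p<..<r}. f s) = (LBINT s:{p<..<q}. f s) + (LBINT s:{q..<r}. f s)"
    "(LBINT s:{q..<r}. f s) = (LBINT s:{q<..<r}. f s)"
proof -
  have i1: "set_integrable lborel {p<..<q} f" "set_integrable lborel {q<..<r} f"
    by (rule set_integrable_subset[OF i]; use assms in auto)+
  have ae: "AE s in lborel. (s \<in> {q..<r}) = (s \<in> {q<..<r})" "AE s in lborel. (s \<in> {q<..<r}) = (s \<in> {q..<r})"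
    "AE s in lborel. (s \<in> {p<..<q} \<union> {q<..<r}) = (s \<in> {p<..<r})"
    using AE_lborel_singleton[of q] by (eventually_elim, use assms in auto)+
  have m: "set_borel_measurable lborel {p<..<q} f" "set_borel_measurable lborel {q<..<r} f" "set_borel_measurable lborel {p<..<r} f"
    using i i1 by (auto simp: set_integrable_def set_borel_measurable_def)
  have m2: "set_borel_measurable lborel {q..<r} f"
  proof (cases "q < r")
    case True
    have "(\<lambda>s. indicator {q<..<r} s *\<^sub>R f s + indicator {q} s * f q) \<in> borel_measurable lborel"
      using m(2) unfolding set_borel_measurable_def by measurable
    moreover have "indicator {q<..<r} s *\<^sub>R f s + indicator {q} s * f q = indicator {q..<r} s *\<^sub>R f s" for s
      using True by (auto simp: indicator_def)
    ultimately show ?thesis by (simp add: set_borel_measurable_def)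
  qed (simp add: set_borel_measurable_def)
  show 2: "(LBINT s:{q..<r}. f s) = (LBINT s:{q<..<r}. f s)"
    by (rule set_integral_cong_set[OF m(2) m2 ae(2)])
  have mu: "set_borel_measurable lborel ({p<..<q} \<union> {q<..<r}) f"
    by (rule set_borel_measurable_subset[OF m(3)]) (use assms in auto)
  have "(LBINT s:{p<..<r}. f s) = (LBINT s:{p<..<q} \<union> {q<..<r}. f s)"
    by (rule set_integral_cong_set[OF mu m(3) ae(3)])
  also have "\<dots> = (LBINT s:{p<..<q}. f s) + (LBINT s:{q<..<r}. f s)"
    by (rule set_integral_Un[OF _ i1]) auto
  finally show "(LBINT s:{p<..<r}. f s) = (LBINT s:{p<..<q}. f s) + (LBINT s:{q..<r}. f s)" by (simp add: 2)
qed

lemma ftc_integrable: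
  fixes f f' :: "real \<Rightarrow> real"
  assumes "p \<le> q" "continuous_on {p..q} f" "\<And>s. s \<in> {p<..<q} \<Longrightarrow> (f has_real_derivative f' s) (at s)"
    and i: "set_integrable lborel {p<..<q} f'"
  shows "(LBINT s:{p<..<q}. f' s) = f q - f p"
proof -
  have "(f' has_integral (f q - f p)) {p..q}"
    by (rule fundamental_theorem_of_calculus_interior)
       (use assms in \<open>auto simp: has_real_derivative_iff_has_vector_derivative\<close>)
  then have "(f' has_integral (f q - f p)) {p<..<q}" by (simp add: has_integral_Icc_iff_Ioo)
  then show ?thesis using set_borel_integral_eq_integral(2)[OF i] by (simp add: integral_unique)
qed

text \<open>Apply I^(2-2a) to f = f(0) + I^1 f' and I^(2-a) to g = b + I^1 g'. The semigroup law
  regroups I^(2-2a) I^1 f' as I^(2-a) I^(1-a) f' = I^(2-a) g, and likewise I^(2-a) I^1 g' as I^2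
  h.\<close>

lemma caputo_twice_integrated:
  fixes a :: real and f :: "real \<Rightarrow> real"
  defines "g \<equiv> caputo_deriv a f"
  defines "h \<equiv> caputo_deriv a g"
  assumes a: "0 < a" "a < 1" and f: "continuous_on {0..1} f"
    and df: "\<And>x. x \<in> {0<..<1} \<Longrightarrow> caputo_differentiable a f x"
    and dg: "\<And>x. x \<in> {0<..<1} \<Longrightarrow> caputo_differentiable a g x"
  shows "\<exists>B. \<forall>x\<in>{0<..<1}. rl_ok 2 h x \<and>
    rlint (2 - 2 * a) f x = f 0 * x powr (2 - 2 * a) / Gamma (3 - 2 * a) + B * x powr (2 - a) + rlint 2 h x"
proof -
  have a1: "a \<noteq> 1" using a by simp
  have g: "g = rlint (1 - a) (deriv f)" and h: "h = rlint (1 - a) (deriv g)"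
    by (auto simp: g_def h_def caputo_deriv_eq_rlint[OF a1])
  have fd: "(f has_real_derivative deriv f s) (at s)" and gd: "(g has_real_derivative deriv g s) (at s)"
    if s: "s \<in> {0<..<1}" for s
  proof -
    \<comment> \<open>Caputo differentiability at x yields derivatives only on the open interval (0,
      x), hence the auxiliary point to the right of s.\<close>
    have x: "(s + 1) / 2 \<in> {0<..<1}" "s \<in> {0<..<(s + 1) / 2}" using s by auto
    show "(f has_real_derivative deriv f s) (at s)" "(g has_real_derivative deriv g s) (at s)"
      using df[OF x(1)] dg[OF x(1)] x(2) unfolding caputo_differentiable_iff_rl_ok[OF a1]
      by (auto simp: field_differentiable_derivI)
  qed
  have okf: "rl_ok (1 - a) (deriv f) x" and okg: "rl_ok (1 - a) (deriv g) x" if "x \<in> {0<..<1}" for x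
    using df[OF that] dg[OF that] unfolding caputo_differentiable_iff_rl_ok[OF a1] by auto
  have intf: "set_integrable lborel {0<..<x} (deriv f)" and intg: "set_integrable lborel {0<..<x} (deriv g)"
    if "x \<in> {0<..<1}" for x
    using rl_ok_mono[OF okf[OF that], of 1] rl_ok_mono[OF okg[OF that], of 1] a unfolding rl_ok_1_iff by auto
  have f_eq: "f t = f 0 + rlint 1 (deriv f) t" if t: "t \<in> {0<..<1}" for t
  proof -
    have "(LBINT s:{0<..<t}. deriv f s) = f t - f 0"
      by (rule ftc_integrable[OF _ _ fd intf]) (use t in \<open>auto intro: continuous_on_subset[OF f]\<close>)
    then show ?thesis by (simp add: rlint_1)
  qed
  \<comment> \<open>The limit of g at 0+. It is expressed through the point 1/2 because
    \<open>g\<close> at 0 itself is an integral over the empty set.\<close>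
  define b where "b = g (1 / 2) - rlint 1 (deriv g) (1 / 2)"
  have g_diff: "rlint 1 (deriv g) t - rlint 1 (deriv g) s = g t - g s" if st: "0 < s" "s \<le> t" "t < 1" for s t
  proof -
    have i: "set_integrable lborel {0<..<t} (deriv g)" using intg st by auto
    have "continuous_on {s..t} g"
      by (intro continuous_at_imp_continuous_on ballI DERIV_isCont[OF gd]) (use st in auto)
    then have "(LBINT z:{s<..<t}. deriv g z) = g t - g s"
      by (intro ftc_integrable gd set_integrable_subset[OF i]) (use st in auto)
    then show ?thesis unfolding rlint_1 using set_integral_split[of 0 s t, OF _ _ i] st by simp
  qed
  have g_eq: "g t = b + rlint 1 (deriv g) t" if t: "t \<in> {0<..<1}" for t
    using g_diff[of t "1 / 2"] g_diff[of "1 / 2" t] t by (cases "t \<le> 1 / 2") (auto simp: b_def)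
  have "rl_ok 2 h x \<and> rlint (2 - 2 * a) f x =
      f 0 * x powr (2 - 2 * a) / Gamma (3 - 2 * a) + b / Gamma (3 - a) * x powr (2 - a) + rlint 2 h x"
    if x: "x \<in> {0<..<1}" for x
  proof -
    have x0: "0 < x" using x by simp
    have ok1: "rl_ok (2 - 2 * a + 1) (deriv f) x" by (rule rl_ok_mono[OF okf[OF x]]) (use a in simp)
    have ok2: "rl_ok (2 - a + (1 - a)) (deriv f) x" by (rule rl_ok_mono[OF okf[OF x]]) (use a in simp)
    have ok3: "rl_ok (2 - a + 1) (deriv g) x" by (rule rl_ok_mono[OF okg[OF x]]) (use a in simp)
    have ok4: "rl_ok (2 + (1 - a)) (deriv g) x" by (rule rl_ok_mono[OF okg[OF x]]) (use a in simp)
    have s1: "rl_ok (2 - 2 * a) (rlint 1 (deriv f)) x" "rlint (2 - 2 * a) (rlint 1 (deriv f)) x = rlint (2 - 2 * a + 1) (deriv f) x"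
      by (rule rlint_semigroup[OF _ _ ok1]; use a in simp)+
    have s2: "rlint (2 - a) (rlint (1 - a) (deriv f)) x = rlint (2 - a + (1 - a)) (deriv f) x"
      by (rule rlint_semigroup[OF _ _ ok2]; use a in simp)+
    have s3: "rl_ok (2 - a) (rlint 1 (deriv g)) x" "rlint (2 - a) (rlint 1 (deriv g)) x = rlint (2 - a + 1) (deriv g) x"
      by (rule rlint_semigroup[OF _ _ ok3]; use a in simp)+
    have s4: "rl_ok 2 (rlint (1 - a) (deriv g)) x" "rlint 2 (rlint (1 - a) (deriv g)) x = rlint (2 + (1 - a)) (deriv g) x"
      by (rule rlint_semigroup[OF _ _ ok4]; use a in simp)+
    have e: "2 - 2 * a + 1 = 3 - 2 * a" "2 - a + (1 - a) = 3 - 2 * a" "2 - a + 1 = 3 - a" "2 + (1 - a) = 3 - a" by simp_all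
    have "rlint (2 - 2 * a) f x = rlint (2 - 2 * a) (\<lambda>t. f 0 + rlint 1 (deriv f) t) x"
      by (rule rlint_cong(1)) (use f_eq x in auto)
    also have "\<dots> = rlint (2 - 2 * a) (\<lambda>t. f 0) x + rlint (2 - 2 * a) (rlint 1 (deriv f)) x"
      by (rule rlint_add(2)[OF rl_ok_const s1(1)]) (use a x0 in auto)
    also have "\<dots> = f 0 * x powr (2 - 2 * a) / Gamma (3 - 2 * a) + rlint (2 - a) g x"
      unfolding s1(2) g s2 e using a x0 by (subst rlint_const) (auto simp: algebra_simps)
    also have "rlint (2 - a) g x = rlint (2 - a) (\<lambda>t. b + rlint 1 (deriv g) t) x"
      by (rule rlint_cong(1)) (use g_eq x in auto)
    also have "\<dots> = rlint (2 - a) (\<lambda>t. b) x + rlint (2 - a) (rlint 1 (deriv g)) x"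
      by (rule rlint_add(2)[OF rl_ok_const s3(1)]) (use a x0 in auto)
    also have "\<dots> = b / Gamma (3 - a) * x powr (2 - a) + rlint 2 h x"
      unfolding s3(2) h s4(2) e using a x0 by (subst rlint_const) (auto simp: algebra_simps)
    finally show ?thesis using s4(1) by (simp add: h)
  qed
  then show ?thesis by blast
qed

text \<open>
  A second antiderivative of \<open>h\<close> with base point \<open>1/2\<close>, which exists also when \<open>h\<close> is not integrable at \<open>0\<close>.
\<close>

definition Jint :: "(real \<Rightarrow> real) \<Rightarrow> real \<Rightarrow> real" where
  "Jint h x = (LBINT s:{min (1 / 2) x<..<max (1 / 2) x}. \<bar>x - s\<bar> * h s)"

text \<open>On (0, 1/2) the kernel x - s is affine in x and contributes p + q x; what remains lies
  between 1/2 and x. For x < 1/2 it enters with the opposite sign, which |x - s| absorbs.\<close>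

lemma rlint_2_eq_Jint:
  assumes "\<And>x. x \<in> {0<..<1} \<Longrightarrow> set_integrable lborel {0<..<x} h"
  shows "\<exists>p q. \<forall>x\<in>{0<..<1}. rlint 2 h x = p + q * x + Jint h x"
proof -
  have i: "set_integrable lborel {0<..<z} (\<lambda>s. (x - s) * h s)" if "z \<in> {0<..<1}" for x z
  proof -
    have "set_integrable lborel {0<..<z} (\<lambda>s. h s * (x - s))"
    proof (rule set_integrable_bounded_mult[OF assms[OF that]])
      show "set_borel_measurable lborel {0<..<z} (\<lambda>s. x - s)"
        by (rule continuous_set_borel_measurable) (auto intro!: continuous_intros)
      show "\<bar>x - s\<bar> \<le> \<bar>x\<bar> + z" if "s \<in> {0<..<z}" for s using that by auto
    qed
    then show ?thesis by (simp add: mult.commute)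
  qed
  define p where "p = (LBINT s:{0<..<1/2}. - (s * h s))"
  define q where "q = (LBINT s:{0<..<1/2}. h s)"
  have pq: "(LBINT s:{0<..<1/2}. (x - s) * h s) = p + q * x" for x
  proof -
    have "set_integrable lborel {0<..<1/2} (\<lambda>s. - (s * h s))" using i[of "1/2" 0] by simp
    moreover have "set_integrable lborel {0<..<1/2} (\<lambda>s. h s * x)" using assms[of "1/2"] by simp
    ultimately have "(LBINT s:{0<..<1/2}. - (s * h s) + h s * x) = p + q * x"
      by (subst set_integral_add(2)) (simp_all add: p_def q_def)
    then show ?thesis by (simp add: algebra_simps)
  qed
  have "rlint 2 h x = p + q * x + Jint h x" if x: "x \<in> {0<..<1}" for x
  proof (cases "x < 1 / 2")
    case True
    have "(LBINT s:{0<..<1/2}. (x - s) * h s) = (LBINT s:{0<..<x}. (x - s) * h s) + (LBINT s:{x<..<1/2}. (x - s) * h s)"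
      using set_integral_split[of 0 x "1/2", OF _ _ i] True x by simp
    moreover have "Jint h x = (LBINT s:{x<..<1/2}. - ((x - s) * h s))"
      unfolding Jint_def using True
      by (auto intro!: set_lebesgue_integral_cong simp: min_def max_def minus_mult_left)
    moreover have "(LBINT s:{x<..<1/2}. - ((x - s) * h s)) = - (LBINT s:{x<..<1/2}. (x - s) * h s)"
      by (rule set_integral_uminus, rule set_integrable_subset[OF i[of "1/2"]]) (use x in auto)
    ultimately show ?thesis unfolding rlint_2 using pq[of x] by simp
  next
    case False
    have "(LBINT s:{0<..<x}. (x - s) * h s) = (LBINT s:{0<..<1/2}. (x - s) * h s) + (LBINT s:{1/2<..<x}. (x - s) * h s)"
      using set_integral_split[of 0 "1/2" x, OF _ _ i] False x by simp
    moreover have "Jint h x = (LBINT s:{1/2<..<x}. (x - s) * h s)"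
      unfolding Jint_def using False by (auto intro!: set_lebesgue_integral_cong simp: min_def max_def)
    ultimately show ?thesis unfolding rlint_2 using pq[of x] by simp
  qed
  then show ?thesis by blast
qed

subsection \<open>Volterra equations\<close>

lemma continuous_on_Icc_eqI:
  fixes f g :: "real \<Rightarrow> real"
  assumes f: "continuous_on {0..1} f" and g: "continuous_on {0..1} g"
    and eq: "\<And>x. x \<in> {0<..<1} \<Longrightarrow> f x = g x" and x: "x \<in> {0..1}"
  shows "f x = g x"
proof -
  have "closure {0<..<1::real} = {0..1}" by simp
  then have "f x - g x = 0"
    using continuous_constant_on_closure[of "{0<..<1::real}" "\<lambda>x. f x - g x" 0 x] f g eq x
    by (simp add: continuous_on_diff)
  then show ?thesis by simp
qed

lemma rlint_1_eq_integral:
  assumes f: "continuous_on {0..1} f" and x: "x \<in> {0..1}"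
  shows "rlint 1 f x = integral {0..x} f"
proof -
  have i: "set_integrable lborel {0..x} f"
    by (intro borel_integrable_atLeastAtMost' continuous_on_subset[OF f]) (use x in auto)
  have "rlint 1 f x = integral {0<..<x} f"
    unfolding rlint_1
    by (intro set_borel_integral_eq_integral(2) set_integrable_subset[OF i]) auto
  then show ?thesis by (simp add: integral_open_interval_real)
qed

lemma rlint_1_injective:
  assumes f: "continuous_on {0..1} f" and z: "\<And>x. x \<in> {0<..<1} \<Longrightarrow> rlint 1 f x = 0" and x: "x \<in> {0..1}"
  shows "f x = 0"
proof (rule continuous_on_Icc_eqI[OF f _ _ x])
  fix x :: real assume x: "x \<in> {0<..<1}"
  have "((\<lambda>x. integral {0..x} f) has_real_derivative f x) (at x within {0..1})"
    by (rule integral_has_real_derivative[OF f]) (use x in auto)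
  then have 1: "((\<lambda>x. integral {0..x} f) has_real_derivative f x) (at x)"
    using x at_within_interior[of x "{0..1}"] by simp
  have 2: "((\<lambda>x. integral {0..x} f) has_real_derivative 0) (at x)"
    by (rule has_field_derivative_transform_within_open[of "\<lambda>_. 0" _ _ "{0<..<1}"])
       (use x z rlint_1_eq_integral[OF f] in auto)
  show "f x = 0" by (rule DERIV_unique[OF 1 2])
qed auto

lemma rl_ok_continuous:
  assumes "0 < a" "continuous_on {0..1} f" "x \<in> {0..1}"
  shows "rl_ok a f x"
proof -
  have "bounded (f ` {0..1})" by (intro compact_imp_bounded compact_continuous_image assms) simp
  then obtain M where "\<And>s. s \<in> {0..1} \<Longrightarrow> \<bar>f s\<bar> \<le> M" unfolding bounded_iff by (metis imageI real_norm_def)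
  then show ?thesis
    using assms by (intro rl_ok_bounded(1)[of _ _ _ M] continuous_set_borel_measurable continuous_on_subset[OF assms(2)]) auto
qed

lemma rlint_semigroup_continuous:
  assumes "0 < a" "0 < b" "continuous_on {0..1} f" "x \<in> {0..1}"
  shows "rlint a (rlint b f) x = rlint (a + b) f x"
  by (rule rlint_semigroup) (use assms in \<open>auto intro!: rl_ok_continuous\<close>)

text \<open>The semigroup law lifts the order to 2, and an integral of order 2 is undone by
  differentiating twice.\<close>

lemma rlint_injective:
  assumes a: "0 < a" "a \<le> 2" and f: "continuous_on {0..1} f"
    and z: "\<And>x. x \<in> {0<..<1} \<Longrightarrow> rlint a f x = 0" and x: "x \<in> {0..1}"
  shows "f x = 0"
proof -
  have 2: "rlint 2 f x = 0" if x: "x \<in> {0<..<1}" for x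
  proof (cases "a = 2")
    case False
    then have "rlint (2 - a) (rlint a f) x = rlint 2 f x"
      using rlint_semigroup_continuous[of "2 - a" a f x] a f x by simp
    moreover have "rlint (2 - a) (rlint a f) x = rlint (2 - a) (\<lambda>_. 0) x"
      by (rule rlint_cong) (use z x in auto)
    ultimately show ?thesis by (simp add: rlint_def)
  qed (use z x in auto)
  have c: "continuous_on {0..1} (rlint 1 f)" by (rule rlint_continuous[OF _ f]) simp
  have "rlint 1 (rlint 1 f) x = 0" if x: "x \<in> {0<..<1}" for x
    using rlint_semigroup_continuous[of 1 1 f x] f x 2[OF x] by simp
  then have "rlint 1 f x = 0" if "x \<in> {0<..<1}" for x
    using rlint_1_injective[OF c, of x] that by auto
  then show ?thesis using rlint_1_injective[OF f _ x] by blast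
qed

text \<open>Iterating the equation gives f = B S_N + M^N I^(2aN) f. The remainder tends to 0, while
  S_N(1) >= 1 because M >= 0 makes all terms nonnegative; so f(1) = 0 forces B = 0, and then f is a
  limit of remainders.\<close>

lemma volterra_zero:
  assumes a: "0 < a" and f: "continuous_on {0..1} f" and M: "0 \<le> M"
    and eq: "\<And>x. x \<in> {0..1} \<Longrightarrow> f x = B * x powr a + M * rlint (2 * a) f x"
    and f1: "f 1 = 0" and x: "x \<in> {0..1}"
  shows "f x = 0"
proof -
  define k where "k j = Gamma (a + 1) / Gamma (2 * a * real j + a + 1)" for j
  define S where "S N x = (\<Sum>j<N. M ^ j * k j * x powr (2 * a * real j + a))" for N and x :: real
  have k: "0 < k j" for j using a Gamma_arg_pos[of "2 * a" "a + 1" j] by (simp add: k_def add.assoc)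
  have "0 < Gamma (a + 1)" using a by simp
  then have k0: "k 0 = 1" by (simp add: k_def)
  have pw: "rlint d (\<lambda>t. t powr a) x = Gamma (a + 1) / Gamma (d + a + 1) * x powr (d + a)"
    "rl_ok d (\<lambda>t. t powr a) x" if "0 < d" "x \<in> {0..1}" for d x
  proof -
    have "continuous_on {0..1} (\<lambda>t::real. t powr a)" by (intro continuous_on_powr' continuous_intros) (use a in auto)
    then show "rl_ok d (\<lambda>t. t powr a) x" using that by (intro rl_ok_continuous)
    show "rlint d (\<lambda>t. t powr a) x = Gamma (a + 1) / Gamma (d + a + 1) * x powr (d + a)"
      using rlint_power(2)[of d "a + 1" x] that a
      by (cases "x = 0") (auto simp: add.assoc rlint_def set_lebesgue_integral_def)
  qed
  have iter: "f x = B * S N x + M ^ N * rlint (2 * a * real N) f x" if "N \<ge> 1" "x \<in> {0..1}" for N x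
    using that(1)
  proof (induction N rule: dec_induct)
    case base
    show ?case using eq[OF that(2)] k0 by (simp add: S_def)
  next
    case (step N)
    let ?d = "2 * a * real N"
    have d: "0 < ?d" using a step by simp
    have "rlint ?d f x = rlint ?d (\<lambda>t. B * t powr a + M * rlint (2 * a) f t) x"
      by (rule rlint_cong) (use eq that in auto)
    also have "\<dots> = B * rlint ?d (\<lambda>t. t powr a) x + M * rlint ?d (rlint (2 * a) f) x"
    proof -
      have 1: "rl_ok ?d (\<lambda>t. t powr a) x" by (rule pw[OF d that(2)])
      have 2: "rl_ok ?d (rlint (2 * a) f) x"
        by (intro rl_ok_continuous rlint_continuous d f that) (use a in simp)
      show ?thesis
        unfolding rlint_add(2)[OF rlint_cmult(1)[OF 1] rlint_cmult(1)[OF 2]] rlint_cmult(2)[OF 1] rlint_cmult(2)[OF 2] ..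
    qed
    also have "rlint ?d (rlint (2 * a) f) x = rlint (2 * a * real (Suc N)) f x"
      using rlint_semigroup_continuous[OF d _ f that(2), of "2 * a"] a by (simp add: algebra_simps)
    also have "rlint ?d (\<lambda>t. t powr a) x = k N * x powr (?d + a)"
      unfolding pw(1)[OF d that(2)] by (simp add: k_def)
    finally show ?case using step.IH by (simp add: S_def algebra_simps)
  qed
  have "bounded (f ` {0..1})" by (intro compact_imp_bounded compact_continuous_image f) simp
  then obtain K where K: "\<And>s. s \<in> {0..1} \<Longrightarrow> \<bar>f s\<bar> \<le> K" unfolding bounded_iff by (metis imageI real_norm_def)
  have K0: "0 \<le> K" using K[of 0] by auto
  have lim: "(\<lambda>N. M ^ N * rlint (2 * a * real N) f x) \<longlonglongrightarrow> 0" if x: "x \<in> {0..1}" for x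
  proof (rule Lim_null_comparison)
    \<comment> \<open>These are the terms of the convergent series E_{2a,1}(M).\<close>
    have "(\<lambda>N. M ^ N / Gamma (2 * a * real N + 1)) \<longlonglongrightarrow> 0"
      by (rule summable_LIMSEQ_zero[OF summable_ml]) (use a in auto)
    then show "(\<lambda>N. K * (M ^ N / Gamma (2 * a * real N + 1))) \<longlonglongrightarrow> 0" by (rule tendsto_mult_right_zero)
    show "\<forall>\<^sub>F N in sequentially. norm (M ^ N * rlint (2 * a * real N) f x) \<le> K * (M ^ N / Gamma (2 * a * real N + 1))"
    proof (rule eventually_sequentiallyI[of 1])
      fix N :: nat assume N: "1 \<le> N"
      let ?d = "2 * a * real N"
      have d: "0 < ?d" using a N by simp
      have "\<bar>rlint ?d f x\<bar> \<le> K * x powr ?d / Gamma (?d + 1)"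
        by (rule rl_ok_bounded(2)[OF d])
           (use x K in \<open>auto intro!: continuous_set_borel_measurable continuous_on_subset[OF f]\<close>)
      also have "\<dots> \<le> K * 1 / Gamma (?d + 1)"
        using x d K0 powr_le1[of ?d x] by (intro divide_right_mono mult_left_mono) (auto intro!: less_imp_le[OF Gamma_real_pos])
      finally have "M ^ N * \<bar>rlint ?d f x\<bar> \<le> M ^ N * (K * 1 / Gamma (?d + 1))"
        using M by (intro mult_left_mono) auto
      then show "norm (M ^ N * rlint ?d f x) \<le> K * (M ^ N / Gamma (?d + 1))"
        using M by (simp add: abs_mult mult_ac)
    qed
  qed
  have "\<bar>B\<bar> \<le> \<bar>M ^ N * rlint (2 * a * real N) f 1\<bar>" if "N \<ge> 1" for N
  proof -
    have "M ^ 0 * k 0 * 1 powr (2 * a * real 0 + a) \<le> S N 1"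
      unfolding S_def by (rule member_le_sum) (use that M k in \<open>auto simp: less_imp_le\<close>)
    then have "1 \<le> S N 1" by (simp add: k0)
    moreover have "B * S N 1 = - (M ^ N * rlint (2 * a * real N) f 1)" using iter[OF that, of 1] f1 by simp
    then have "\<bar>B\<bar> * \<bar>S N 1\<bar> = \<bar>M ^ N * rlint (2 * a * real N) f 1\<bar>" by (metis abs_minus_cancel abs_mult)
    ultimately show ?thesis using mult_left_mono[of 1 "\<bar>S N 1\<bar>" "\<bar>B\<bar>"] by simp
  qed
  moreover have "(\<lambda>N. \<bar>M ^ N * rlint (2 * a * real N) f 1\<bar>) \<longlonglongrightarrow> 0"
    using tendsto_rabs_zero[OF lim[of 1]] by simp
  ultimately have "\<bar>B\<bar> \<le> 0"
    by (intro tendsto_lowerbound[where F = sequentially]) (auto simp: eventually_sequentially)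
  then have "B = 0" by simp
  then have "f x = M ^ N * rlint (2 * a * real N) f x" if "N \<ge> 1" for N using iter[OF that x] by simp
  then have "(\<lambda>N. M ^ N * rlint (2 * a * real N) f x) \<longlonglongrightarrow> f x"
    by (intro tendsto_eventually eventually_sequentiallyI[of 1]) auto
  then show ?thesis using lim[OF x] LIMSEQ_unique by blast
qed

(* Unisolvence of 1, x, x^(2 - a) at three points: the second difference of a strictly convex power is nonzero. *)
lemma interpolation:
  fixes a :: real
  assumes a: "0 < a" "a \<le> 1"
  shows "\<exists>\<alpha> \<beta> \<gamma>. (a = 1 \<longrightarrow> (\<forall>i. \<gamma> i = 0)) \<and>
    (\<forall>F p q B. (a = 1 \<longrightarrow> B = 0) \<longrightarrow> (\<forall>x\<in>{0<..<1}. F x = p + q * x + B * x powr (2 - a)) \<longrightarrow>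
      (\<forall>x\<in>{0<..<1}. F x = (\<Sum>i<3. (\<alpha> i + \<beta> i * x + \<gamma> i * x powr (2 - a)) * F (real (Suc i) / 4))))"
proof -
  define \<phi> where "\<phi> x = x powr (2 - a)" for x :: real
  define \<Delta> where "\<Delta> = \<phi> (1/4) - 2 * \<phi> (1/2) + \<phi> (3/4)"
  have \<Delta>: "\<Delta> \<noteq> 0" if "a < 1"
  proof -
    have "2 * \<phi> (1/2) < \<phi> (1/4) + \<phi> (3/4)"
    proof -
      have d: "(\<phi> has_real_derivative (2 - a) * x powr (1 - a)) (at x)" if "x > 0" for x
        unfolding \<phi>_def[abs_def] using that by (auto intro!: derivative_eq_intros)
      obtain \<xi> where \<xi>: "1/4 < \<xi>" "\<xi> < 1/2" "\<phi> (1/2) - \<phi> (1/4) = (1/2 - 1/4) * ((2 - a) * \<xi> powr (1 - a))"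
        using MVT2[of "1/4" "1/2" \<phi> "\<lambda>x. (2 - a) * x powr (1 - a)"] d by auto
      obtain \<eta> where \<eta>: "1/2 < \<eta>" "\<eta> < 3/4" "\<phi> (3/4) - \<phi> (1/2) = (3/4 - 1/2) * ((2 - a) * \<eta> powr (1 - a))"
        using MVT2[of "1/2" "3/4" \<phi> "\<lambda>x. (2 - a) * x powr (1 - a)"] d by auto
      have "\<xi> powr (1 - a) < \<eta> powr (1 - a)" using \<xi> \<eta> that by (intro powr_less_mono2) auto
      then have "(2 - a) * \<xi> powr (1 - a) < (2 - a) * \<eta> powr (1 - a)" using a by simp
      then show ?thesis using \<xi>(3) \<eta>(3) by simp
    qed
    then show ?thesis by (simp add: \<Delta>_def)
  qed
  \<comment> \<open>\<open>gamma\<close> extracts B by the second difference, which kills 1 and x;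
    \<open>beta\<close> then reads q off the difference quotient between 1/4 and 3/4, and
    \<open>alpha\<close> reads p off the value at 1/4. For a = 1 the power is x itself, so its
    coefficient is normalised to 0.\<close>
  define \<gamma> where "\<gamma> i = (if a = 1 then 0 else (if i = 1 then - 2 else 1) / \<Delta>)" for i :: nat
  define \<beta> where "\<beta> i = 2 * ((if i = 2 then 1 else 0) - (if i = 0 then 1 else 0) - \<gamma> i * (\<phi> (3/4) - \<phi> (1/4)))" for i :: nat
  define \<alpha> where "\<alpha> i = (if i = 0 then 1 else 0) - \<beta> i / 4 - \<gamma> i * \<phi> (1/4)" for i :: nat
  have main: "F x = (\<Sum>i<3. (\<alpha> i + \<beta> i * x + \<gamma> i * \<phi> x) * F (real (Suc i) / 4))"
    if F: "\<And>x. x \<in> {0<..<1} \<Longrightarrow> F x = p + q * x + B * \<phi> x" and B: "a = 1 \<longrightarrow> B = 0" and x: "x \<in> {0<..<1}"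
    for F p q B x
  proof -
    have F': "F (1/4) = p + q / 4 + B * \<phi> (1/4)" "F (1/2) = p + q / 2 + B * \<phi> (1/2)" "F (3/4) = p + q * (3/4) + B * \<phi> (3/4)"
      using F[of "1/4"] F[of "1/2"] F[of "3/4"] by auto
    have g: "\<gamma> 0 * F (1/4) + \<gamma> 1 * F (1/2) + \<gamma> 2 * F (3/4) = B"
    proof (cases "a = 1")
      case False
      then have "a < 1" using a by simp
      note \<Delta> = \<Delta>[OF this]
      have "F (1/4) - 2 * F (1/2) + F (3/4) = B * \<Delta>" unfolding F' \<Delta>_def by (simp add: algebra_simps)
      then show ?thesis using False \<Delta> by (simp add: \<gamma>_def field_simps)
    qed (use B in \<open>simp add: \<gamma>_def\<close>)
    have b: "\<beta> 0 * F (1/4) + \<beta> 1 * F (1/2) + \<beta> 2 * F (3/4) = q"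
    proof -
      have "\<beta> 0 * F (1/4) + \<beta> 1 * F (1/2) + \<beta> 2 * F (3/4) = 2 * (F (3/4) - F (1/4)
          - (\<gamma> 0 * F (1/4) + \<gamma> 1 * F (1/2) + \<gamma> 2 * F (3/4)) * (\<phi> (3/4) - \<phi> (1/4)))"
        by (simp add: \<beta>_def algebra_simps)
      also have "\<dots> = q" unfolding g unfolding F' by (simp add: algebra_simps)
      finally show ?thesis .
    qed
    have al: "\<alpha> 0 * F (1/4) + \<alpha> 1 * F (1/2) + \<alpha> 2 * F (3/4) = p"
    proof -
      have "\<alpha> 0 * F (1/4) + \<alpha> 1 * F (1/2) + \<alpha> 2 * F (3/4) = F (1/4)
          - (\<beta> 0 * F (1/4) + \<beta> 1 * F (1/2) + \<beta> 2 * F (3/4)) / 4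
          - (\<gamma> 0 * F (1/4) + \<gamma> 1 * F (1/2) + \<gamma> 2 * F (3/4)) * \<phi> (1/4)"
        by (simp add: \<alpha>_def algebra_simps add_divide_distrib)
      also have "\<dots> = p" unfolding g b unfolding F' by simp
      finally show ?thesis .
    qed
    have "(\<Sum>i<3. (\<alpha> i + \<beta> i * x + \<gamma> i * \<phi> x) * F (real (Suc i) / 4))
        = (\<alpha> 0 * F (1/4) + \<alpha> 1 * F (1/2) + \<alpha> 2 * F (3/4))
          + (\<beta> 0 * F (1/4) + \<beta> 1 * F (1/2) + \<beta> 2 * F (3/4)) * x
          + (\<gamma> 0 * F (1/4) + \<gamma> 1 * F (1/2) + \<gamma> 2 * F (3/4)) * \<phi> x"
      by (simp add: eval_nat_numeral algebra_simps)
    then show ?thesis unfolding al b g F[OF x] by simp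
  qed
  have g0: "\<forall>i. \<gamma> i = 0" if "a = 1" using that by (simp add: \<gamma>_def)
  show ?thesis
  proof (rule exI[of _ \<alpha>], rule exI[of _ \<beta>], rule exI[of _ \<gamma>], intro conjI allI impI ballI)
    fix F p q B x
    assume "a = 1 \<longrightarrow> B = 0" "\<forall>x\<in>{0<..<1}. F x = p + q * x + B * x powr (2 - a)" "x \<in> {0<..<1::real}"
    then show "F x = (\<Sum>i<3. (\<alpha> i + \<beta> i * x + \<gamma> i * x powr (2 - a)) * F (real (Suc i) / 4))"
      using main[of F p q B x] unfolding \<phi>_def by blast
  qed (use g0 in blast)
qed

subsection \<open>Coefficients of a solution with zero data\<close>

text \<open>On (0, x) with x < x' the weight x' - s is bounded below, so it can be divided
  out.\<close>

lemma rl_ok_2_imp_integrable: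
  assumes "rl_ok 2 f x'" "x < x'"
  shows "set_integrable lborel {0<..<x} f"
proof -
  have i: "set_integrable lborel {0<..<x} (\<lambda>s. (x' - s) powr (2 - 1) * f s)"
    by (rule set_integrable_subset[OF assms(1)]) (use assms(2) in auto)
  have "set_integrable lborel {0<..<x} (\<lambda>s. ((x' - s) powr (2 - 1) * f s) * (1 / (x' - s)))"
  proof (rule set_integrable_bounded_mult[OF i])
    show "set_borel_measurable lborel {0<..<x} (\<lambda>s. 1 / (x' - s))"
      by (rule continuous_set_borel_measurable) (use assms(2) in \<open>auto intro!: continuous_intros\<close>)
    show "\<bar>1 / (x' - s)\<bar> \<le> 1 / (x' - x)" if "s \<in> {0<..<x}" for s
      using that assms(2) by (auto intro!: frac_le)
  qed
  then show ?thesis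
    by (rule iffD1[OF set_integrable_cong, rotated -1]) (use assms(2) in auto)
qed

text \<open>The difference of two solutions, with the equation already integrated for each fixed y;
  the constants depend on y without known regularity. In \<open>eq_lt\<close> the zero value at x =
  0 has removed the term in x^(2-2a). \<open>eq_1\<close> is Taylor's formula at 1/2.\<close>

locale null_solution =
  fixes a e c :: real and v vy vyy :: "real \<Rightarrow> real \<Rightarrow> real"
  assumes a: "0 < a" "a \<le> 1" and e: "\<bar>e\<bar> < 1"
    and v: "continuous_on ({0..1} \<times> {- pi..pi}) (\<lambda>(x, y). v x y)"
    and vy: "continuous_on ({0..1} \<times> {- pi..pi}) (\<lambda>(x, y). vy x y)"
    and vyy: "continuous_on ({0<..<1} \<times> {- pi<..<pi}) (\<lambda>(x, y). vyy x y)"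
    and dv: "\<And>x y. x \<in> {0..1} \<Longrightarrow> y \<in> {- pi..pi} \<Longrightarrow> (v x has_real_derivative vy x y) (at y within {- pi..pi})"
    and dvy: "\<And>x y. x \<in> {0<..<1} \<Longrightarrow> y \<in> {- pi<..<pi} \<Longrightarrow> (vy x has_real_derivative vyy x y) (at y)"
    and zero: "\<And>y. y \<in> {- pi..pi} \<Longrightarrow> v 0 y = 0" "\<And>y. y \<in> {- pi..pi} \<Longrightarrow> v 1 y = 0"
    and bnd: "\<And>x. x \<in> {0..1} \<Longrightarrow> vy x pi = 0" "\<And>x. x \<in> {0..1} \<Longrightarrow> vy x (- pi) = 0"
    and eq_lt: "\<And>y. a < 1 \<Longrightarrow> y \<in> {- pi<..<pi} \<Longrightarrow> \<exists>B. \<forall>x\<in>{0<..<1}.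
        rl_ok 2 (\<lambda>t. c\<^sup>2 * v t y - vyy t y + e * vyy t (- y)) x \<and>
        rlint (2 - 2 * a) (\<lambda>t. v t y) x
          = B * x powr (2 - a) + rlint 2 (\<lambda>t. c\<^sup>2 * v t y - vyy t y + e * vyy t (- y)) x"
    and eq_1: "\<And>y. a = 1 \<Longrightarrow> y \<in> {- pi<..<pi} \<Longrightarrow> \<exists>p q. \<forall>x\<in>{0<..<1}.
        v x y = p + q * x + Jint (\<lambda>t. c\<^sup>2 * v t y - vyy t y + e * vyy t (- y)) x"
begin

abbreviation m :: "nat \<Rightarrow> real" where "m \<equiv> mu e c"

definition H :: "real \<Rightarrow> real \<Rightarrow> real" where
  "H x y = c\<^sup>2 * v x y - vyy x y + e * vyy x (- y)"

definition vn :: "nat \<Rightarrow> real \<Rightarrow> real" where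
  "vn n x = ip (v x) (Y n)"

definition E :: "real \<Rightarrow> nat \<Rightarrow> real \<Rightarrow> real" where
  "E b n x = integral {- b..b} (\<lambda>y. H x y * Y n y)"

text \<open>At a = 1 the order 2 - 2a is 0, where the integral is singular and Gamma has a pole; the
  identity takes its place.\<close>

definition W :: "real \<Rightarrow> real \<Rightarrow> real" where
  "W x y = (if a = 1 then v x y else rlint (2 - 2 * a) (\<lambda>t. v t y) x)"

definition Wn :: "nat \<Rightarrow> real \<Rightarrow> real" where
  "Wn n x = (if a = 1 then vn n x else rlint (2 - 2 * a) (vn n) x)"

lemma slices:
  assumes "x \<in> {0..1}" shows "cpi (v x)" "cpi (vy x)"
proof -
  have sub: "(\<lambda>y. (x, y)) ` {- pi..pi} \<subseteq> {0..1} \<times> {- pi..pi}" using assms by auto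
  have c: "continuous_on {- pi..pi} (\<lambda>y. (x, y))" by (intro continuous_on_Pair continuous_on_id continuous_on_const)
  show "cpi (v x)" "cpi (vy x)"
    using continuous_on_compose2[OF v c sub] continuous_on_compose2[OF vy c sub] by simp_all
qed

lemma vyy_slice:
  assumes x: "x \<in> {0<..<1}" and b: "b < pi" shows "continuous_on {- b..b} (vyy x)"
proof -
  have sub: "(\<lambda>y. (x, y)) ` {- b..b} \<subseteq> {0<..<1} \<times> {- pi<..<pi}" using x b by auto
  have c: "continuous_on {- b..b} (\<lambda>y. (x, y))" by (intro continuous_on_Pair continuous_on_id continuous_on_const)
  show ?thesis using continuous_on_compose2[OF vyy c sub] by simp
qed

lemma vn_continuous: "continuous_on {0..1} (vn n)"
proof -
  have "continuous_on ({0..1} \<times> cbox (- pi) pi) (\<lambda>(x, y). v x y * Y n y)"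
    using v unfolding case_prod_unfold by (intro continuous_intros) auto
  from integral_continuous_on_param[OF this] show ?thesis by (simp add: vn_def[abs_def])
qed

lemma vn_0: "vn n 0 = 0"
proof -
  have "ip (v 0) (Y n) = integral {- pi..pi} (\<lambda>y. 0)" by (rule integral_cong) (simp add: zero)
  then show ?thesis by (simp add: vn_def)
qed

lemma v_bounds: obtains M where "0 \<le> M" "\<And>x y. x \<in> {0..1} \<Longrightarrow> y \<in> {- pi..pi} \<Longrightarrow> \<bar>v x y\<bar> \<le> M \<and> \<bar>vy x y\<bar> \<le> M"
proof -
  have cp: "compact ({0..1::real} \<times> {- pi..pi})" by (intro compact_Times) auto
  have "bounded ((\<lambda>(x, y). v x y) ` ({0..1} \<times> {- pi..pi}))" "bounded ((\<lambda>(x, y). vy x y) ` ({0..1} \<times> {- pi..pi}))"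
    by (intro compact_imp_bounded compact_continuous_image v vy cp)+
  then obtain M1 M2 where "\<And>z. z \<in> (\<lambda>(x, y). v x y) ` ({0..1} \<times> {- pi..pi}) \<Longrightarrow> norm z \<le> M1"
    "\<And>z. z \<in> (\<lambda>(x, y). vy x y) ` ({0..1} \<times> {- pi..pi}) \<Longrightarrow> norm z \<le> M2"
    unfolding bounded_iff by metis
  then have "\<bar>v x y\<bar> \<le> max \<bar>M1\<bar> \<bar>M2\<bar> \<and> \<bar>vy x y\<bar> \<le> max \<bar>M1\<bar> \<bar>M2\<bar>" if "x \<in> {0..1}" "y \<in> {- pi..pi}" for x y
    using that by force
  then show ?thesis using that[of "max \<bar>M1\<bar> \<bar>M2\<bar>"] by simp
qed

text \<open>Both y derivatives are moved onto Y n over [-b, b], with all boundary terms kept. The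
  reflected term is brought back by y -> -y and contributes the parity sign.\<close>

lemma E_eq:
  assumes b: "0 < b" "b < pi" and x: "x \<in> {0<..<1}"
  shows "E b n x = c\<^sup>2 * integral {- b..b} (\<lambda>y. v x y * Y n y)
     - (1 - e * (if even n then 1 else - 1)) *
       (vy x b * Y n b - vy x (- b) * Y n (- b) - real n / 2 * (v x b * Z n b - v x (- b) * Z n (- b))
        - (real n / 2)\<^sup>2 * integral {- b..b} (\<lambda>y. v x y * Y n y))"
proof -
  have x': "x \<in> {0..1}" using x by auto
  have sub: "{- b..b} \<subseteq> {- pi..pi}" "{- b..b} \<subseteq> {- pi<..<pi}" using b by auto
  have cv: "continuous_on {- b..b} (v x)" and cvy: "continuous_on {- b..b} (vy x)"
    using slices[OF x'] sub(1) by (auto intro: continuous_on_subset)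
  have cvyy: "continuous_on {- b..b} (vyy x)" by (rule vyy_slice[OF x b(2)])
  have cvyy': "continuous_on {- b..b} (\<lambda>y. vyy x (- y))"
    by (rule continuous_on_compose2[OF cvyy]) (auto intro!: continuous_intros)
  let ?s = "if even n then 1 else - 1 :: real"
  let ?I = "integral {- b..b} (\<lambda>y. v x y * Y n y)"
  let ?J = "integral {- b..b} (\<lambda>y. vyy x y * Y n y)"
  have dv': "(v x has_real_derivative vy x y) (at y within {- b..b})" if "y \<in> {- b..b}" for y
    using dv[OF x'] that sub by (meson has_field_derivative_subset subsetD)
  have dvy': "(vy x has_real_derivative vyy x y) (at y within {- b..b})" if "y \<in> {- b..b}" for y
    using dvy[OF x] that sub by (meson has_field_derivative_at_within subsetD)
  have 1: "?J = vy x b * Y n b - vy x (- b) * Y n (- b) - integral {- b..b} (\<lambda>y. vy x y * (real n / 2 * Z n y))"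
    by (rule integral_parts[OF _ cvyy _ dvy' Y_has_derivative]) (use b in \<open>(intro continuous_intros | simp)+\<close>)
  have 2: "integral {- b..b} (\<lambda>y. vy x y * Z n y) = v x b * Z n b - v x (- b) * Z n (- b)
      - integral {- b..b} (\<lambda>y. v x y * (- (real n / 2 * Y n y)))"
    by (rule integral_parts[OF _ cvy _ dv' Z_has_derivative]) (use b in \<open>(intro continuous_intros | simp)+\<close>)
  have cm: "integral {- b..b} (\<lambda>y. f y * (k * g y)) = k * integral {- b..b} (\<lambda>y. f y * g y)" for f g :: "real \<Rightarrow> real" and k
    by (simp only: mult.left_commute[of _ k] integral_mult_right)
  have cm': "integral {- b..b} (\<lambda>y. v x y * (- (real n / 2 * Y n y))) = - (real n / 2) * ?I"
    using cm[of "v x" "- (real n / 2)" "Y n"] by simp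
  have J: "?J = vy x b * Y n b - vy x (- b) * Y n (- b) - real n / 2 * (v x b * Z n b - v x (- b) * Z n (- b))
        - (real n / 2)\<^sup>2 * ?I"
    unfolding 1 cm 2 cm' by (simp add: algebra_simps power2_eq_square)
  have "integral {- b..b} (\<lambda>y. vyy x (- y) * Y n y) = integral {- b..b} (\<lambda>y. vyy x y * Y n (- y))"
    using Henstock_Kurzweil_Integration.integral_reflect_real[of b "- b" "\<lambda>y. vyy x y * Y n (- y)"] by simp
  also have "\<dots> = ?s * ?J" unfolding Y_neg cm ..
  finally have R: "integral {- b..b} (\<lambda>y. vyy x (- y) * Y n y) = ?s * ?J" .
  have "E b n x = integral {- b..b} (\<lambda>y. (c\<^sup>2 * (v x y * Y n y) - vyy x y * Y n y) + e * (vyy x (- y) * Y n y))"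
    unfolding E_def H_def by (simp add: algebra_simps)
  also have "\<dots> = integral {- b..b} (\<lambda>y. c\<^sup>2 * (v x y * Y n y) - vyy x y * Y n y)
      + integral {- b..b} (\<lambda>y. e * (vyy x (- y) * Y n y))"
    by (intro integral_add integrable_continuous_interval continuous_intros cv cvyy cvyy')
  also have "integral {- b..b} (\<lambda>y. c\<^sup>2 * (v x y * Y n y) - vyy x y * Y n y)
      = integral {- b..b} (\<lambda>y. c\<^sup>2 * (v x y * Y n y)) - ?J"
    by (intro integral_diff integrable_continuous_interval continuous_intros cv cvyy)
  finally have "E b n x = c\<^sup>2 * ?I - ?J + e * (?s * ?J)" by (simp add: R)
  also have "\<dots> = c\<^sup>2 * ?I - (1 - e * ?s) * ?J" by (simp only: algebra_simps)
  finally show ?thesis by (simp only: J)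
qed

text \<open>
  \<open>vyy\<close> may be unbounded near \<open>y = \<plusminus>\<pi>\<close>, so the coefficients are first taken over \<open>[-bs j, bs j]\<close>.
\<close>

definition bs :: "nat \<Rightarrow> real" where "bs j = pi * (1 - 1 / real (j + 2))"

lemma bs: "0 < bs j" "bs j < pi" and bs_lim: "bs \<longlonglongrightarrow> pi"
proof -
  have "0 < 1 - 1 / real (j + 2)" "1 - 1 / real (j + 2) < 1" by (simp_all add: field_simps)
  then show "0 < bs j" "bs j < pi" using pi_gt_zero by (simp_all add: bs_def)
  have "(\<lambda>j. 1 / real (j + 2)) \<longlonglongrightarrow> 0" using LIMSEQ_ignore_initial_segment[OF lim_1_over_n, of 2] by simp
  then have "(\<lambda>j. pi * (1 - 1 / real (j + 2))) \<longlonglongrightarrow> pi * (1 - 0)" by (intro tendsto_intros)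
  then show "bs \<longlonglongrightarrow> pi" by (simp add: bs_def[abs_def])
qed

lemma bs_in: "bs j \<in> {- pi..pi}" "- bs j \<in> {- pi..pi}" using bs[of j] by auto

lemma bs_eval:
  assumes "cpi f" shows "(\<lambda>j. f (bs j)) \<longlonglongrightarrow> f pi" "(\<lambda>j. f (- bs j)) \<longlonglongrightarrow> f (- pi)"
proof -
  show "(\<lambda>j. f (bs j)) \<longlonglongrightarrow> f pi"
    by (rule continuous_on_tendsto_compose[OF assms bs_lim]) (use bs_in in auto)
  show "(\<lambda>j. f (- bs j)) \<longlonglongrightarrow> f (- pi)"
    by (rule continuous_on_tendsto_compose[OF assms tendsto_minus[OF bs_lim]]) (use bs_in in auto)
qed

lemma bs_integral:
  assumes f: "cpi f" shows "(\<lambda>j. integral {- bs j..bs j} f) \<longlonglongrightarrow> integral {- pi..pi} f"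
proof -
  let ?F = "\<lambda>t. integral {- pi..t} f"
  have F: "cpi ?F" by (rule indefinite_integral_continuous_1[OF int_cpi[OF f]])
  have "integral {- bs j..bs j} f = ?F (bs j) - ?F (- bs j)" for j
  proof -
    have "f integrable_on {- pi..bs j}"
      by (rule integrable_on_subinterval[OF int_cpi[OF f]]) (use bs[of j] in auto)
    from Henstock_Kurzweil_Integration.integral_combine[OF _ _ this, of "- bs j"]
    show ?thesis using bs[of j] by auto
  qed
  moreover have "(\<lambda>j. ?F (bs j) - ?F (- bs j)) \<longlonglongrightarrow> ?F pi - ?F (- pi)"
    by (intro tendsto_diff bs_eval F)
  ultimately show ?thesis by simp
qed

text \<open>As b tends to pi the boundary terms disappear, because \<open>vy\<close> and Z n vanish
  at the end points; the coefficients left over combine to mu^2.\<close>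

lemma E_lim:
  assumes x: "x \<in> {0<..<1}" shows "(\<lambda>j. E (bs j) n x) \<longlonglongrightarrow> (m n)\<^sup>2 * vn n x"
proof -
  have x': "x \<in> {0..1}" using x by auto
  note s = slices[OF x']
  let ?s = "if even n then 1 else - 1 :: real"
  have "(\<lambda>j. E (bs j) n x) \<longlonglongrightarrow> c\<^sup>2 * ip (v x) (Y n)
     - (1 - e * ?s) * (vy x pi * Y n pi - vy x (- pi) * Y n (- pi)
        - real n / 2 * (v x pi * Z n pi - v x (- pi) * Z n (- pi)) - (real n / 2)\<^sup>2 * ip (v x) (Y n))"
  proof -
    note L = tendsto_mult[OF bs_eval(1)[OF s(2)] bs_eval(1)[OF cpi_YZ(1)[of n]]]
      tendsto_mult[OF bs_eval(2)[OF s(2)] bs_eval(2)[OF cpi_YZ(1)[of n]]]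
      tendsto_mult[OF bs_eval(1)[OF s(1)] bs_eval(1)[OF cpi_YZ(2)[of n]]]
      tendsto_mult[OF bs_eval(2)[OF s(1)] bs_eval(2)[OF cpi_YZ(2)[of n]]]
      bs_integral[OF continuous_on_mult[OF s(1) cpi_YZ(1)[of n]]]
    show ?thesis
      unfolding E_eq[OF bs(1) bs(2) x]
      by (rule tendsto_diff[OF tendsto_mult[OF tendsto_const L(5)]
          tendsto_mult[OF tendsto_const tendsto_diff[OF tendsto_diff[OF tendsto_diff[OF L(1) L(2)]
            tendsto_mult[OF tendsto_const tendsto_diff[OF L(3) L(4)]]] tendsto_mult[OF tendsto_const L(5)]]]])
  qed
  also have "c\<^sup>2 * ip (v x) (Y n)
     - (1 - e * ?s) * (vy x pi * Y n pi - vy x (- pi) * Y n (- pi)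
        - real n / 2 * (v x pi * Z n pi - v x (- pi) * Z n (- pi)) - (real n / 2)\<^sup>2 * ip (v x) (Y n))
     = (m n)\<^sup>2 * vn n x"
    unfolding mu_sq[OF e] eigenval_eq vn_def using x' by (auto simp: bnd Z_pi algebra_simps)
  finally show ?thesis .
qed

text \<open>\<open>E_eq\<close> expresses everything through \<open>v\<close> and \<open>vy\<close>,
  which are bounded on the closed rectangle, so the possibly unbounded \<open>vyy\<close> leaves no
  trace. This is the majorant for dominated convergence in x.\<close>

lemma E_bound: "\<exists>K\<ge>0. \<forall>j. \<forall>x\<in>{0<..<1}. \<bar>E (bs j) n x\<bar> \<le> K"
proof -
  obtain M where M: "0 \<le> M" "\<And>x y. x \<in> {0..1} \<Longrightarrow> y \<in> {- pi..pi} \<Longrightarrow> \<bar>v x y\<bar> \<le> M \<and> \<bar>vy x y\<bar> \<le> M"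
    using v_bounds by metis
  define K where "K = c\<^sup>2 * (2 * pi * M) + 2 * (M + M + real n / 2 * (M + M) + (real n / 2)\<^sup>2 * (2 * pi * M))"
  have "\<bar>E (bs j) n x\<bar> \<le> K" if x: "x \<in> {0<..<1}" for j x
  proof -
    have x': "x \<in> {0..1}" using x by auto
    let ?b = "bs j" and ?s = "if even n then 1 else - 1 :: real"
    have vb: "\<bar>v x y\<bar> \<le> M" "\<bar>vy x y\<bar> \<le> M" if "y \<in> {- pi..pi}" for y using M(2)[OF x' that] by auto
    have prod: "\<bar>f * g\<bar> \<le> M" if "\<bar>f\<bar> \<le> M" "\<bar>g\<bar> \<le> 1" for f g :: real
      using mult_mono[OF that] M(1) by (simp add: abs_mult)
    let ?I = "integral {- ?b..?b} (\<lambda>y. v x y * Y n y)"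
    have I: "\<bar>?I\<bar> \<le> 2 * pi * M"
    proof -
      have "norm ?I \<le> M * (?b - (- ?b))"
      proof (rule integral_bound)
        show "continuous_on {- ?b..?b} (\<lambda>y. v x y * Y n y)"
          by (intro continuous_intros continuous_on_subset[OF slices(1)[OF x']]) (use bs[of j] in auto)
        show "norm (v x y * Y n y) \<le> M" if "y \<in> {- ?b..?b}" for y
          unfolding real_norm_def using that bs[of j] by (intro prod vb abs_Y_le_1) auto
      qed (use bs[of j] in auto)
      also have "\<dots> \<le> M * (2 * pi)" using bs[of j] M(1) by (intro mult_left_mono) auto
      finally show ?thesis by (simp add: mult_ac)
    qed
    have t: "\<bar>vy x ?b * Y n ?b\<bar> \<le> M" "\<bar>vy x (- ?b) * Y n (- ?b)\<bar> \<le> M" "\<bar>v x ?b * Z n ?b\<bar> \<le> M" "\<bar>v x (- ?b) * Z n (- ?b)\<bar> \<le> M"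
      by (intro prod vb bs_in abs_Y_le_1 abs_Z_le_1)+
    let ?Q = "vy x ?b * Y n ?b - vy x (- ?b) * Y n (- ?b) - real n / 2 * (v x ?b * Z n ?b - v x (- ?b) * Z n (- ?b))
        - (real n / 2)\<^sup>2 * ?I"
    have Q: "\<bar>?Q\<bar> \<le> M + M + real n / 2 * (M + M) + (real n / 2)\<^sup>2 * (2 * pi * M)"
    proof -
      have "\<bar>real n / 2 * (v x ?b * Z n ?b - v x (- ?b) * Z n (- ?b))\<bar> \<le> real n / 2 * (M + M)"
        unfolding abs_mult using t by (intro mult_mono) auto
      moreover have "\<bar>(real n / 2)\<^sup>2 * ?I\<bar> \<le> (real n / 2)\<^sup>2 * (2 * pi * M)"
        unfolding abs_mult using I by (intro mult_mono) auto
      ultimately show ?thesis using t(1,2) by linarith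
    qed
    have "\<bar>1 - e * ?s\<bar> \<le> 2" using e by (auto simp: abs_if split: if_splits)
    then have "\<bar>(1 - e * ?s) * ?Q\<bar> \<le> 2 * (M + M + real n / 2 * (M + M) + (real n / 2)\<^sup>2 * (2 * pi * M))"
      unfolding abs_mult[of "1 - e * ?s"] using Q by (intro mult_mono) auto
    moreover have "\<bar>c\<^sup>2 * ?I\<bar> \<le> c\<^sup>2 * (2 * pi * M)"
      unfolding abs_mult using I by (intro mult_mono) auto
    ultimately show ?thesis unfolding E_eq[OF bs x] K_def by linarith
  qed
  moreover have "0 \<le> K" unfolding K_def using M(1) by (intro add_nonneg_nonneg mult_nonneg_nonneg) auto
  ultimately show ?thesis by blast
qed

lemma W_modes:
  assumes x: "x \<in> {0<..<1}"
  shows "cpi (W x)" "ip (W x) (Y n) = Wn n x"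
proof -
  have "cpi (W x) \<and> ip (W x) (Y n) = Wn n x"
  proof (cases "a = 1")
    case True
    have "W x = v x" "Wn n x = vn n x" unfolding W_def Wn_def using True by auto
    then show ?thesis using slices[of x] x unfolding vn_def by auto
  next
    case False
    interpret kernel_product "\<lambda>s. (x - s) powr (2 - 2 * a - 1)" v "{0<..<x}" "{0..1}" "- pi" pi
    proof
      show "set_integrable lborel {0<..<x} (\<lambda>s. (x - s) powr (2 - 2 * a - 1))"
        by (rule rl_ok_one) (use a False x in auto)
    qed (use x v in auto)
    have W: "W x = (\<lambda>y. (LBINT s:{0<..<x}. (x - s) powr (2 - 2 * a - 1) * v s y) * (1 / Gamma (2 - 2 * a)))"
      using False by (simp add: W_def[abs_def] rlint_def)
    have "cpi (W x)" unfolding W by (intro continuous_on_mult continuous continuous_on_const)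
    moreover have "ip (W x) (Y n) = Wn n x"
    proof -
      have "ip (W x) (Y n) = integral {- pi..pi} (\<lambda>y. 1 / Gamma (2 - 2 * a) *
          ((LBINT s:{0<..<x}. (x - s) powr (2 - 2 * a - 1) * v s y) * Y n y))"
        unfolding W by (simp add: mult_ac)
      also have "\<dots> = 1 / Gamma (2 - 2 * a) * integral {- pi..pi} (\<lambda>y.
          (LBINT s:{0<..<x}. (x - s) powr (2 - 2 * a - 1) * v s y) * Y n y)"
        by (rule integral_mult_right)
      also have "\<dots> = 1 / Gamma (2 - 2 * a) * (LBINT s:{0<..<x}. (x - s) powr (2 - 2 * a - 1) * vn n s)"
        unfolding vn_def by (subst fubini(2)) (auto intro!: cpi_YZ)
      finally show ?thesis using False by (simp add: Wn_def rlint_def)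
    qed
    ultimately show ?thesis by blast
  qed
  then show "cpi (W x)" "ip (W x) (Y n) = Wn n x" by auto
qed

text \<open>The interval between 1/2 and x is compact in (0, 1), and [-bs j, bs j] is compact in
  (-pi, pi), so H is continuous on their product.\<close>

lemma H_kernel_product:
  assumes x: "x \<in> {0<..<1}"
  shows "kernel_product (\<lambda>s. \<bar>x - s\<bar>) H {min (1/2) x<..<max (1/2) x} {min (1/2) x..max (1/2) x} (- bs j) (bs j)"
proof
  let ?K = "{min (1/2) x..max (1/2) x}"
  have "set_integrable lborel ?K (\<lambda>s. \<bar>x - s\<bar>)"
    by (intro borel_integrable_atLeastAtMost' continuous_intros)
  then show "set_integrable lborel {min (1/2) x<..<max (1/2) x} (\<lambda>s. \<bar>x - s\<bar>)"
    by (rule set_integrable_subset) auto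
  have sub: "?K \<times> {- bs j..bs j} \<subseteq> {0..1} \<times> {- pi..pi}" "?K \<times> {- bs j..bs j} \<subseteq> {0<..<1} \<times> {- pi<..<pi}"
    using x bs[of j] by (auto simp: min_def max_def split: if_splits)
  have c1: "continuous_on (?K \<times> {- bs j..bs j}) (\<lambda>p. v (fst p) (snd p))"
    using continuous_on_subset[OF v sub(1)] by (simp add: case_prod_unfold)
  have c2: "continuous_on (?K \<times> {- bs j..bs j}) (\<lambda>p. vyy (fst p) (snd p))"
    using continuous_on_subset[OF vyy sub(2)] by (simp add: case_prod_unfold)
  have "continuous_on (?K \<times> {- bs j..bs j}) (\<lambda>p. (\<lambda>p. vyy (fst p) (snd p)) (fst p, - snd p))"
    by (rule continuous_on_compose2[OF c2]) (auto intro!: continuous_intros)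
  then have c3: "continuous_on (?K \<times> {- bs j..bs j}) (\<lambda>p. vyy (fst p) (- snd p))" by simp
  show "continuous_on (?K \<times> {- bs j..bs j}) (\<lambda>(s, y). H s y)"
    unfolding case_prod_unfold H_def by (intro continuous_intros c1 c2 c3)
qed auto

lemma Jint_modes:
  assumes x: "x \<in> {0<..<1}"
  shows "continuous_on {- bs j..bs j} (\<lambda>y. Jint (\<lambda>t. H t y) x)"
    and "integral {- bs j..bs j} (\<lambda>y. Jint (\<lambda>t. H t y) x * Y n y) = Jint (E (bs j) n) x"
    and "set_integrable lborel {min (1/2) x<..<max (1/2) x} (\<lambda>s. \<bar>x - s\<bar> * E (bs j) n s)"
proof -
  interpret kernel_product "\<lambda>s. \<bar>x - s\<bar>" H "{min (1/2) x<..<max (1/2) x}" "{min (1/2) x..max (1/2) x}" "- bs j" "bs j"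
    by (rule H_kernel_product[OF x])
  have b: "- bs j \<le> bs j" using bs[of j] by simp
  show "continuous_on {- bs j..bs j} (\<lambda>y. Jint (\<lambda>t. H t y) x)"
    unfolding Jint_def by (rule continuous)
  show "integral {- bs j..bs j} (\<lambda>y. Jint (\<lambda>t. H t y) x * Y n y) = Jint (E (bs j) n) x"
    unfolding Jint_def E_def by (rule fubini(2)[OF b]) (intro continuous_intros)
  show "set_integrable lborel {min (1/2) x<..<max (1/2) x} (\<lambda>s. \<bar>x - s\<bar> * E (bs j) n s)"
    unfolding E_def by (rule fubini(1)[OF b]) (intro continuous_intros)
qed

lemma Jint_lim:
  assumes x: "x \<in> {0<..<1}"
  shows "(\<lambda>j. Jint (E (bs j) n) x) \<longlonglongrightarrow> (m n)\<^sup>2 * Jint (vn n) x"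
proof -
  let ?S = "{min (1/2) x<..<max (1/2) x}"
  have S: "?S \<subseteq> {0<..<1}" using x by (auto simp: min_def max_def split: if_splits)
  obtain K where K: "0 \<le> K" "\<And>j s. s \<in> {0<..<1} \<Longrightarrow> \<bar>E (bs j) n s\<bar> \<le> K" using E_bound[of n] by blast
  have "(\<lambda>j. LINT s|lborel. indicator ?S s *\<^sub>R (\<bar>x - s\<bar> * E (bs j) n s)) \<longlonglongrightarrow>
      (LINT s|lborel. indicator ?S s *\<^sub>R (\<bar>x - s\<bar> * ((m n)\<^sup>2 * vn n s)))"
  proof (rule integral_dominated_convergence)
    have "continuous_on ?S (\<lambda>s. \<bar>x - s\<bar> * ((m n)\<^sup>2 * vn n s))"
      by (intro continuous_intros continuous_on_subset[OF vn_continuous]) (use S in auto)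
    then show "(\<lambda>s. indicator ?S s *\<^sub>R (\<bar>x - s\<bar> * ((m n)\<^sup>2 * vn n s))) \<in> borel_measurable lborel"
      using continuous_set_borel_measurable by (auto simp: set_borel_measurable_def)
    show "(\<lambda>s. indicator ?S s *\<^sub>R (\<bar>x - s\<bar> * E (bs j) n s)) \<in> borel_measurable lborel" for j
      using Jint_modes(3)[OF x, of j n] by (auto simp: set_integrable_def)
    have "set_integrable lborel {min (1/2) x..max (1/2) x} (\<lambda>s. \<bar>x - s\<bar> * K)"
      by (intro borel_integrable_atLeastAtMost' continuous_intros)
    then have "set_integrable lborel ?S (\<lambda>s. \<bar>x - s\<bar> * K)" by (rule set_integrable_subset) auto
    then show "integrable lborel (\<lambda>s. indicator ?S s *\<^sub>R (\<bar>x - s\<bar> * K))" by (simp add: set_integrable_def)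
    show "AE s in lborel. (\<lambda>j. indicator ?S s *\<^sub>R (\<bar>x - s\<bar> * E (bs j) n s)) \<longlonglongrightarrow>
        indicator ?S s *\<^sub>R (\<bar>x - s\<bar> * ((m n)\<^sup>2 * vn n s))"
    proof (intro AE_I2)
      fix s show "(\<lambda>j. indicator ?S s *\<^sub>R (\<bar>x - s\<bar> * E (bs j) n s)) \<longlonglongrightarrow>
        indicator ?S s *\<^sub>R (\<bar>x - s\<bar> * ((m n)\<^sup>2 * vn n s))"
      proof (cases "s \<in> ?S")
        case True
        then show ?thesis using E_lim[of s n] S by (intro tendsto_intros) auto
      qed simp
    qed
    show "AE s in lborel. norm (indicator ?S s *\<^sub>R (\<bar>x - s\<bar> * E (bs j) n s)) \<le> indicator ?S s *\<^sub>R (\<bar>x - s\<bar> * K)" for j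
    proof (intro AE_I2)
      fix s show "norm (indicator ?S s *\<^sub>R (\<bar>x - s\<bar> * E (bs j) n s)) \<le> indicator ?S s *\<^sub>R (\<bar>x - s\<bar> * K)"
      proof (cases "s \<in> ?S")
        case True
        then have "\<bar>E (bs j) n s\<bar> \<le> K" using K(2)[of s j] S by auto
        then show ?thesis using True by (simp add: abs_mult mult_left_mono)
      qed simp
    qed
  qed
  moreover have "(LINT s|lborel. indicator ?S s *\<^sub>R (\<bar>x - s\<bar> * ((m n)\<^sup>2 * vn n s))) = (m n)\<^sup>2 * Jint (vn n) x"
  proof -
    have "indicator ?S s *\<^sub>R (\<bar>x - s\<bar> * ((m n)\<^sup>2 * vn n s)) = (m n)\<^sup>2 * (indicator ?S s *\<^sub>R (\<bar>x - s\<bar> * vn n s))" for s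
      by simp
    then show ?thesis
      by (simp only: Jint_def set_lebesgue_integral_def integral_mult_right_zero)
  qed
  ultimately show ?thesis by (simp add: Jint_def set_lebesgue_integral_def)
qed

lemma H_integrable:
  assumes "a < 1" "y \<in> {- pi<..<pi}" "x \<in> {0<..<1}"
  shows "set_integrable lborel {0<..<x} (\<lambda>t. H t y)"
proof -
  have x: "(x + 1) / 2 \<in> {0<..<1}" "x < (x + 1) / 2" using assms(3) by auto
  have "rl_ok 2 (\<lambda>t. H t y) ((x + 1) / 2)"
    using eq_lt[OF assms(1,2)] x(1) unfolding H_def by blast
  then show ?thesis by (rule rl_ok_2_imp_integrable[OF _ x(2)])
qed

lemma W_minus_Jint:
  assumes y: "y \<in> {- pi<..<pi}"
  shows "\<exists>p q B. (a = 1 \<longrightarrow> B = 0) \<and> (\<forall>x\<in>{0<..<1}. W x y - Jint (\<lambda>t. H t y) x = p + q * x + B * x powr (2 - a))"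
proof (cases "a = 1")
  case True
  obtain p q where "\<And>x. x \<in> {0<..<1} \<Longrightarrow> v x y = p + q * x + Jint (\<lambda>t. H t y) x"
    using eq_1[OF True y] unfolding H_def by blast
  then show ?thesis unfolding W_def
    by (rule_tac exI[of _ p], rule_tac exI[of _ q], rule_tac exI[of _ 0]) (simp add: True)
next
  case False
  then have a1: "a < 1" using a by simp
  obtain B where B: "\<And>x. x \<in> {0<..<1} \<Longrightarrow> rlint (2 - 2 * a) (\<lambda>t. v t y) x = B * x powr (2 - a) + rlint 2 (\<lambda>t. H t y) x"
    using eq_lt[OF a1 y] unfolding H_def by blast
  obtain p q where "\<And>x. x \<in> {0<..<1} \<Longrightarrow> rlint 2 (\<lambda>t. H t y) x = p + q * x + Jint (\<lambda>t. H t y) x"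
    using rlint_2_eq_Jint[of "\<lambda>t. H t y"] H_integrable[OF a1 y] by blast
  then show ?thesis using False B unfolding W_def
    by (rule_tac exI[of _ p], rule_tac exI[of _ q], rule_tac exI[of _ B]) simp
qed

text \<open>
  The coefficients \<open>p\<close>, \<open>q\<close>, \<open>B\<close> of \<open>W_minus_Jint\<close> depend on \<open>y\<close> with no known regularity; \<open>interpolation\<close>
  replaces them by values at three points, which are continuous in \<open>y\<close>.
\<close>

lemma Wn_equation:
  "\<exists>p q B. (a = 1 \<longrightarrow> B = 0) \<and>
     (\<forall>x\<in>{0<..<1}. Wn n x = p + q * x + B * x powr (2 - a) + (m n)\<^sup>2 * Jint (vn n) x)"
proof -
  obtain \<alpha> \<beta> \<gamma> where g1: "a = 1 \<Longrightarrow> \<forall>i. \<gamma> i = 0"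
    and interp: "\<And>F p q B x. (a = 1 \<longrightarrow> B = 0) \<Longrightarrow> (\<forall>x\<in>{0<..<1}. F x = p + q * x + B * x powr (2 - a)) \<Longrightarrow> x \<in> {0<..<1} \<Longrightarrow>
      F x = (\<Sum>i<3. (\<alpha> i + \<beta> i * x + \<gamma> i * x powr (2 - a)) * F (real (Suc i) / 4))"
    using interpolation[OF a] by blast
  define w where "w i x = \<alpha> i + \<beta> i * x + \<gamma> i * x powr (2 - a)" for i x
  define X where "X i = real (Suc i) / 4" for i
  have X: "X i \<in> {0<..<1}" if "i < 3" for i using that by (auto simp: X_def)
  define F where "F y x = W x y - Jint (\<lambda>t. H t y) x" for y x
  \<comment> \<open>The weights \<open>w i x\<close> do not depend on y, so this identity survives
    pairing with Y n and the limit in j; there it yields constants independent of x.\<close>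
  have Fi: "F y x = (\<Sum>i<3. w i x * F y (X i))" if y: "y \<in> {- pi<..<pi}" and x: "x \<in> {0<..<1}" for y x
    using W_minus_Jint[OF y] interp[of _ "F y" _ _ x] x unfolding F_def w_def X_def by blast
  define D where "D j x = integral {- bs j..bs j} (\<lambda>y. W x y * Y n y) - Jint (E (bs j) n) x" for j x
  define L where "L x = Wn n x - (m n)\<^sup>2 * Jint (vn n) x" for x
  have D_lim: "(\<lambda>j. D j x) \<longlonglongrightarrow> L x" if x: "x \<in> {0<..<1}" for x
    unfolding D_def L_def W_modes(2)[OF x, symmetric]
    by (intro tendsto_diff Jint_lim x bs_integral continuous_on_mult W_modes(1) cpi_YZ)
  have cW: "continuous_on {- bs j..bs j} (W x)" if "x \<in> {0<..<1}" for j x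
    by (rule continuous_on_subset[OF W_modes(1)[OF that]]) (use bs[of j] in auto)
  have D_eq: "integral {- bs j..bs j} (\<lambda>y. F y x * Y n y) = D j x"
    and cF: "continuous_on {- bs j..bs j} (\<lambda>y. F y x)" if x: "x \<in> {0<..<1}" for j x
  proof -
    show "continuous_on {- bs j..bs j} (\<lambda>y. F y x)"
      unfolding F_def by (intro continuous_on_diff Jint_modes(1) x cW)
    have "integral {- bs j..bs j} (\<lambda>y. F y x * Y n y) =
        integral {- bs j..bs j} (\<lambda>y. W x y * Y n y - Jint (\<lambda>t. H t y) x * Y n y)"
      by (simp add: F_def left_diff_distrib)
    also have "\<dots> = D j x"
      unfolding D_def Jint_modes(2)[OF x, symmetric]
      by (intro integral_diff integrable_continuous_interval continuous_on_mult cW x Jint_modes(1) continuous_intros)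
    finally show "integral {- bs j..bs j} (\<lambda>y. F y x * Y n y) = D j x" .
  qed
  have D_interp: "D j x = (\<Sum>i<3. w i x * D j (X i))" if x: "x \<in> {0<..<1}" for j x
  proof -
    have "D j x = integral {- bs j..bs j} (\<lambda>y. \<Sum>i<3. w i x * (F y (X i) * Y n y))"
      unfolding D_eq[OF x, symmetric]
    proof (rule integral_cong)
      fix y assume "y \<in> {- bs j..bs j}"
      then have "y \<in> {- pi<..<pi}" using bs[of j] by auto
      from Fi[OF this x] show "F y x * Y n y = (\<Sum>i<3. w i x * (F y (X i) * Y n y))"
        by (simp add: sum_distrib_right mult.assoc)
    qed
    also have "\<dots> = (\<Sum>i<3. integral {- bs j..bs j} (\<lambda>y. w i x * (F y (X i) * Y n y)))"
      by (intro integral_sum integrable_continuous_interval continuous_on_mult continuous_on_const cF X continuous_intros) auto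
    also have "\<dots> = (\<Sum>i<3. w i x * D j (X i))"
    proof (rule sum.cong[OF refl])
      fix i :: nat assume "i \<in> {..<3}"
      then have "X i \<in> {0<..<1}" using X by auto
      from D_eq[OF this] show "integral {- bs j..bs j} (\<lambda>y. w i x * (F y (X i) * Y n y)) = w i x * D j (X i)"
        by (simp only: integral_mult_right)
    qed
    finally show ?thesis .
  qed
  have L_interp: "L x = (\<Sum>i<3. w i x * L (X i))" if x: "x \<in> {0<..<1}" for x
  proof (rule LIMSEQ_unique[OF D_lim[OF x]])
    show "(\<lambda>j. D j x) \<longlonglongrightarrow> (\<Sum>i<3. w i x * L (X i))"
      unfolding D_interp[OF x] by (intro tendsto_sum tendsto_mult tendsto_const D_lim X) auto
  qed
  let ?p = "\<Sum>i<3. \<alpha> i * L (X i)" and ?q = "\<Sum>i<3. \<beta> i * L (X i)" and ?B = "\<Sum>i<3. \<gamma> i * L (X i)"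
  have "Wn n x = ?p + ?q * x + ?B * x powr (2 - a) + (m n)\<^sup>2 * Jint (vn n) x" if x: "x \<in> {0<..<1}" for x
  proof -
    have "L x = ?p + ?q * x + ?B * x powr (2 - a)"
      unfolding L_interp[OF x] w_def by (simp add: sum_distrib_left sum_distrib_right sum.distrib algebra_simps)
    then show ?thesis by (simp add: L_def)
  qed
  moreover have "a = 1 \<longrightarrow> ?B = 0" using g1 by simp
  ultimately show ?thesis by blast
qed

text \<open>Unlike H, the coefficient v_n is continuous on [0, 1], so the base point can return from
  1/2 to 0. Evaluation at x = 0 then removes the constant term.\<close>

lemma Wn_equation_closed:
  "\<exists>q B. (a = 1 \<longrightarrow> B = 0) \<and>
     (\<forall>x\<in>{0..1}. Wn n x = q * x + B * x powr (2 - a) + (m n)\<^sup>2 * rlint 2 (vn n) x)"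
proof -
  obtain p q B where pq: "a = 1 \<longrightarrow> B = 0"
    "\<And>x. x \<in> {0<..<1} \<Longrightarrow> Wn n x = p + q * x + B * x powr (2 - a) + (m n)\<^sup>2 * Jint (vn n) x"
    using Wn_equation[of n] by blast
  have iv: "set_integrable lborel {0<..<x} (vn n)" if "x \<in> {0<..<1}" for x
  proof -
    have "set_integrable lborel {0..1} (vn n)" by (intro borel_integrable_atLeastAtMost' vn_continuous)
    then show ?thesis by (rule set_integrable_subset) (use that in auto)
  qed
  obtain p' q' where pq': "\<And>x. x \<in> {0<..<1} \<Longrightarrow> rlint 2 (vn n) x = p' + q' * x + Jint (vn n) x"
    using rlint_2_eq_Jint[of "vn n"] iv by blast
  define P where "P = p - (m n)\<^sup>2 * p'"
  define Q where "Q = q - (m n)\<^sup>2 * q'"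
  let ?R = "\<lambda>x. P + Q * x + B * x powr (2 - a) + (m n)\<^sup>2 * rlint 2 (vn n) x"
  have 1: "Wn n x = ?R x" if "x \<in> {0<..<1}" for x
    using pq(2)[OF that] pq'[OF that] by (simp add: P_def Q_def algebra_simps)
  have cW: "continuous_on {0..1} (Wn n)"
    unfolding Wn_def[abs_def] using a vn_continuous by (cases "a = 1") (auto intro!: rlint_continuous)
  have cR: "continuous_on {0..1} ?R"
    using a by (intro continuous_intros continuous_on_powr' rlint_continuous vn_continuous) auto
  have 2: "Wn n x = ?R x" if "x \<in> {0..1}" for x
    by (rule continuous_on_Icc_eqI[OF cW cR 1 that])
  have "Wn n 0 = 0" by (simp add: vn_0 Wn_def rlint_def set_lebesgue_integral_def)
  then have "P = 0" using 2[of 0] a by (simp add: rlint_def set_lebesgue_integral_def)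
  then show ?thesis using 2 pq(1) by (rule_tac exI[of _ Q], rule_tac exI[of _ B]) simp
qed

text \<open>For a < 1 all terms are of the form I^(2-2a) applied to something: x^(2-a) comes from
  x^a, and I^2 from I^(2a). Injectivity strips this operator and leaves a Volterra equation. For a =
  1 the term q x already has the form B' x^a.\<close>

lemma vn_zero:
  assumes "\<exists>q B. (a = 1 \<longrightarrow> B = 0) \<and> (a < 1 \<longrightarrow> q = 0) \<and>
     (\<forall>x\<in>{0..1}. Wn n x = q * x + B * x powr (2 - a) + (m n)\<^sup>2 * rlint 2 (vn n) x)"
    and x: "x \<in> {0..1}"
  shows "vn n x = 0"
proof -
  obtain q B where qB: "a = 1 \<longrightarrow> B = 0" "a < 1 \<longrightarrow> q = 0"
    "\<And>x. x \<in> {0..1} \<Longrightarrow> Wn n x = q * x + B * x powr (2 - a) + (m n)\<^sup>2 * rlint 2 (vn n) x"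
    using assms(1) by blast
  have "ip (v 1) (Y n) = integral {- pi..pi} (\<lambda>y. 0)" by (rule integral_cong) (simp add: zero)
  then have v1: "vn n 1 = 0" by (simp add: vn_def)
  have "\<exists>B'. \<forall>x\<in>{0..1}. vn n x = B' * x powr a + (m n)\<^sup>2 * rlint (2 * a) (vn n) x"
  proof (cases "a = 1")
    case True
    have "vn n x = q * x powr a + (m n)\<^sup>2 * rlint (2 * a) (vn n) x" if "x \<in> {0..1}" for x
      using qB(3)[OF that, unfolded Wn_def] qB(1) True that by simp
    then show ?thesis by blast
  next
    case False
    then have a1: "a < 1" using a by simp
    \<comment> \<open>Inverse of the factor Gamma(a+1)/Gamma(3-a) with which I^(2-2a) maps x^a to
      x^(2-a).\<close>
    define B' where "B' = B * Gamma (3 - a) / Gamma (a + 1)"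
    define f where "f x = vn n x - (B' * x powr a + (m n)\<^sup>2 * rlint (2 * a) (vn n) x)" for x
    let ?w = "2 - 2 * a"
    have w: "0 < ?w" "?w \<le> 2" using a a1 by auto
    have cp: "continuous_on {0..1} (\<lambda>x::real. x powr a)" by (intro continuous_on_powr' continuous_intros) (use a in auto)
    have cr: "continuous_on {0..1} (rlint (2 * a) (vn n))" by (rule rlint_continuous[OF _ vn_continuous]) (use a in simp)
    have g: "Gamma (a + 1) \<noteq> 0" "Gamma (3 - a) \<noteq> 0"
      using Gamma_real_pos[of "a + 1"] Gamma_real_pos[of "3 - a"] a by linarith+
    have cf: "continuous_on {0..1} f" unfolding f_def by (intro continuous_intros vn_continuous cp cr)
    have "rlint ?w f x = 0" if x: "x \<in> {0<..<1}" for x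
    proof -
      have x': "x \<in> {0..1}" using x by auto
      note ok = rl_ok_continuous[OF w(1) cp x'] rl_ok_continuous[OF w(1) cr x'] rl_ok_continuous[OF w(1) vn_continuous x', of n]
      have 1: "rlint ?w (\<lambda>t. t powr a) x = Gamma (a + 1) / Gamma (3 - a) * x powr (2 - a)"
        using rlint_power(2)[OF w(1), of "a + 1" x] a x by (simp add: algebra_simps)
      have 2: "rlint ?w (rlint (2 * a) (vn n)) x = rlint 2 (vn n) x"
        using rlint_semigroup_continuous[OF w(1) _ vn_continuous x', of "2 * a" n] a by simp
      have "rlint ?w f x = rlint ?w (\<lambda>t. vn n t + (- B' * t powr a + - (m n)\<^sup>2 * rlint (2 * a) (vn n) t)) x"
        unfolding f_def by (rule rlint_cong) simp
      also have "\<dots> = rlint ?w (vn n) x + (- B' * rlint ?w (\<lambda>t. t powr a) x + - (m n)\<^sup>2 * rlint ?w (rlint (2 * a) (vn n)) x)"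
        unfolding rlint_add(2)[OF ok(3) rlint_add(1)[OF rlint_cmult(1)[OF ok(1)] rlint_cmult(1)[OF ok(2)]]]
          rlint_add(2)[OF rlint_cmult(1)[OF ok(1)] rlint_cmult(1)[OF ok(2)]] rlint_cmult(2)[OF ok(1)] rlint_cmult(2)[OF ok(2)] ..
      also have "rlint ?w (vn n) x = B * x powr (2 - a) + (m n)\<^sup>2 * rlint 2 (vn n) x"
        using qB(3)[OF x'] qB(2) a1 False by (simp add: Wn_def)
      also have "B * x powr (2 - a) = B' * rlint ?w (\<lambda>t. t powr a) x"
        unfolding 1 B'_def using g by simp
      finally show ?thesis unfolding 2 by simp
    qed
    then have "f x = 0" if "x \<in> {0..1}" for x using rlint_injective[OF w cf _ that] by blast
    then show ?thesis by (intro exI[of _ B']) (simp add: f_def)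
  qed
  then obtain B' where "\<And>x. x \<in> {0..1} \<Longrightarrow> vn n x = B' * x powr a + (m n)\<^sup>2 * rlint (2 * a) (vn n) x" by blast
  from volterra_zero[OF a(1) vn_continuous _ this v1 x] show ?thesis by simp
qed

end

subsection \<open>Removing the linear term\<close>

lemma rlint_le_L1:
  assumes b: "1 \<le> b" and ok: "rl_ok 1 f x" and x: "0 < x"
  shows "\<bar>rlint b f x\<bar> \<le> x powr (b - 1) / Gamma b * rlint 1 (\<lambda>t. \<bar>f t\<bar>) x"
proof -
  have i: "set_integrable lborel {0<..<x} f" using ok unfolding rl_ok_1_iff .
  have i': "rl_ok b f x" by (rule rl_ok_mono[OF ok b])
  have "\<bar>LBINT s:{0<..<x}. (x - s) powr (b - 1) * f s\<bar> \<le> (LBINT s:{0<..<x}. \<bar>(x - s) powr (b - 1) * f s\<bar>)"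
    using set_integral_norm_bound[OF i'] by simp
  also have "\<dots> \<le> (LBINT s:{0<..<x}. x powr (b - 1) * \<bar>f s\<bar>)"
  proof (rule set_integral_mono)
    show "set_integrable lborel {0<..<x} (\<lambda>s. \<bar>(x - s) powr (b - 1) * f s\<bar>)" by (rule set_integrable_abs[OF i'])
    show "set_integrable lborel {0<..<x} (\<lambda>s. x powr (b - 1) * \<bar>f s\<bar>)"
      using set_integrable_mult_right[OF set_integrable_abs[OF i]] by blast
    show "\<bar>(x - s) powr (b - 1) * f s\<bar> \<le> x powr (b - 1) * \<bar>f s\<bar>" if "s \<in> {0<..<x}" for s
      unfolding abs_mult using that b by (intro mult_right_mono) (auto intro!: powr_mono2)
  qed
  also have "\<dots> = x powr (b - 1) * rlint 1 (\<lambda>t. \<bar>f t\<bar>) x" by (simp add: rlint_1)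
  finally have "\<bar>LBINT s:{0<..<x}. (x - s) powr (b - 1) * f s\<bar> / Gamma b
      \<le> x powr (b - 1) * rlint 1 (\<lambda>t. \<bar>f t\<bar>) x / Gamma b"
    by (rule divide_right_mono) (use Gamma_real_pos[of b] b in auto)
  then show ?thesis using Gamma_real_pos[of b] b unfolding rlint_def abs_divide by simp
qed

text \<open>Cauchy-Schwarz, obtained from the nonnegative variance of |f| about its mean
  I/x.\<close>

lemma L1_sq_le_L2:
  assumes f: "continuous_on {0..1} f" and x: "x \<in> {0<..1}"
  shows "(rlint 1 (\<lambda>t. \<bar>f t\<bar>) x)\<^sup>2 \<le> x * rlint 1 (\<lambda>t. (f t)\<^sup>2) x"
proof -
  have x': "x \<in> {0..1}" "0 < x" using x by auto
  have c: "continuous_on {0..x} f" by (rule continuous_on_subset[OF f]) (use x in auto)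
  define I where "I = integral {0..x} (\<lambda>t. \<bar>f t\<bar>)"
  define Q where "Q = integral {0..x} (\<lambda>t. (f t)\<^sup>2)"
  have I: "rlint 1 (\<lambda>t. \<bar>f t\<bar>) x = I" "rlint 1 (\<lambda>t. (f t)\<^sup>2) x = Q"
    unfolding I_def Q_def by (intro rlint_1_eq_integral continuous_intros f x')+
  have "0 \<le> integral {0..x} (\<lambda>t. (\<bar>f t\<bar> - I / x)\<^sup>2)"
    by (intro Henstock_Kurzweil_Integration.integral_nonneg integrable_continuous_interval continuous_intros c) auto
  also have "integral {0..x} (\<lambda>t. (\<bar>f t\<bar> - I / x)\<^sup>2) = integral {0..x} (\<lambda>t. ((f t)\<^sup>2 - 2 * I / x * \<bar>f t\<bar>) + (I / x)\<^sup>2)"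
    by (simp add: power2_diff algebra_simps)
  also have "\<dots> = integral {0..x} (\<lambda>t. (f t)\<^sup>2 - 2 * I / x * \<bar>f t\<bar>) + integral {0..x} (\<lambda>t. (I / x)\<^sup>2)"
    by (intro integral_add integrable_continuous_interval continuous_intros c)
  also have "integral {0..x} (\<lambda>t. (f t)\<^sup>2 - 2 * I / x * \<bar>f t\<bar>) = Q - integral {0..x} (\<lambda>t. 2 * I / x * \<bar>f t\<bar>)"
    unfolding Q_def by (intro integral_diff integrable_continuous_interval continuous_intros c)
  also have "integral {0..x} (\<lambda>t. 2 * I / x * \<bar>f t\<bar>) = 2 * I / x * I" unfolding I_def by (rule integral_mult_right)
  finally have "0 \<le> Q - I\<^sup>2 / x" using x by (simp add: power2_eq_square field_simps)
  then show ?thesis unfolding I using x by (simp add: field_simps)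
qed

lemma weighted_square_integrable:
  fixes f :: "real \<Rightarrow> real"
  assumes "a < 1" and f: "continuous_on {0..1} f"
  shows "set_integrable lborel {0<..<1} (\<lambda>s. s powr (1 - 2 * a) * f s)"
proof -
  have "bounded (f ` {0..1})" by (intro compact_imp_bounded compact_continuous_image f) simp
  then obtain M where M: "\<And>s. s \<in> {0..1} \<Longrightarrow> \<bar>f s\<bar> \<le> M" unfolding bounded_iff by (metis imageI real_norm_def)
  have "set_integrable lborel {0<..<1} (\<lambda>s. (1 - s) powr (1 - 1) * (s - 0) powr ((2 - 2 * a) - 1))"
    by (rule beta_kernel(1)) (use assms in auto)
  then have "set_integrable lborel {0<..<1} (\<lambda>s. s powr (1 - 2 * a))"
    by (rule iffD1[OF set_integrable_cong, rotated -1]) auto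
  then show ?thesis
    by (rule set_integrable_bounded_mult[where M = M])
       (use M in \<open>auto intro!: continuous_set_borel_measurable continuous_on_subset[OF f]\<close>)
qed

text \<open>For a > 1/2 the weight s^(1-2a) decreases, so on (0, x) it is at least x^(1-2a). This
  converts the local L^1 norm into a weighted L^2 norm over (0, 1) that does not depend on
  x.\<close>

lemma L1_sq_le_weighted:
  assumes a: "1/2 < a" "a < 1" and f: "continuous_on {0..1} f" and x: "x \<in> {0<..1}"
  shows "(x powr (- 2 * a) * rlint 1 (\<lambda>t. \<bar>f t\<bar>) x)\<^sup>2 \<le> x powr (- 2 * a) * (LBINT s:{0<..<1}. s powr (1 - 2 * a) * (f s)\<^sup>2)"
proof -
  have c2: "continuous_on {0..1} (\<lambda>s. (f s)\<^sup>2)" by (intro continuous_intros f)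
  note w = weighted_square_integrable[OF a(2) c2]
  have i: "set_integrable lborel {0<..<x} (\<lambda>s. (f s)\<^sup>2)"
    using rl_ok_continuous[OF _ c2, of 1 x] x unfolding rl_ok_1_iff by auto
  have "x powr (1 - 2 * a) * rlint 1 (\<lambda>t. (f t)\<^sup>2) x = (LBINT s:{0<..<x}. x powr (1 - 2 * a) * (f s)\<^sup>2)"
    by (simp add: rlint_1)
  also have "\<dots> \<le> (LBINT s:{0<..<1}. s powr (1 - 2 * a) * (f s)\<^sup>2)"
    unfolding set_lebesgue_integral_def
  proof (rule integral_mono)
    show "integrable lborel (\<lambda>s. indicat_real {0<..<x} s *\<^sub>R (x powr (1 - 2 * a) * (f s)\<^sup>2))"
      using set_integrable_mult_right[of _ lborel "{0<..<x}", OF i] unfolding set_integrable_def .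
    show "integrable lborel (\<lambda>s. indicat_real {0<..<1} s *\<^sub>R (s powr (1 - 2 * a) * (f s)\<^sup>2))"
      using w unfolding set_integrable_def .
    show "indicat_real {0<..<x} s *\<^sub>R (x powr (1 - 2 * a) * (f s)\<^sup>2)
        \<le> indicat_real {0<..<1} s *\<^sub>R (s powr (1 - 2 * a) * (f s)\<^sup>2)" for s
    proof (cases "s \<in> {0<..<x}")
      case True
      then have "x powr (1 - 2 * a) \<le> s powr (1 - 2 * a)" using a by (intro powr_mono2') auto
      then show ?thesis using True x by (simp add: mult_right_mono)
    qed (auto simp: indicator_def)
  qed
  finally have 1: "x powr (1 - 2 * a) * rlint 1 (\<lambda>t. (f t)\<^sup>2) x \<le> (LBINT s:{0<..<1}. s powr (1 - 2 * a) * (f s)\<^sup>2)" .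
  have "(x powr (- 2 * a) * rlint 1 (\<lambda>t. \<bar>f t\<bar>) x)\<^sup>2 \<le> (x powr (- 2 * a))\<^sup>2 * (x * rlint 1 (\<lambda>t. (f t)\<^sup>2) x)"
    unfolding power_mult_distrib by (intro mult_left_mono L1_sq_le_L2 f x) auto
  also have "\<dots> = x powr (- 2 * a) * (x powr (1 - 2 * a) * rlint 1 (\<lambda>t. (f t)\<^sup>2) x)"
  proof -
    have "x powr (1 - 2 * a) = x * x powr (- 2 * a)" using powr_mult_base[of x "- 2 * a"] x by simp
    then show ?thesis by (simp add: power2_eq_square)
  qed
  also have "\<dots> \<le> x powr (- 2 * a) * (LBINT s:{0<..<1}. s powr (1 - 2 * a) * (f s)\<^sup>2)"
    by (intro mult_left_mono 1) auto
  finally show ?thesis .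
qed

text \<open>I^b applied term by term. A further integration gains powers of x that make the
  remainder small relative to the term in q.\<close>

lemma rlint_of_expansion:
  assumes a: "a < 1" and f: "continuous_on {0..1} f" and b: "0 < b"
    and eq: "\<And>x. x \<in> {0<..<1} \<Longrightarrow> rlint (2 - 2 * a) f x = q * x + B * x powr (2 - a) + k * rlint 2 g x"
    and x: "x \<in> {0<..1}" and ok: "rl_ok (b + 2) g x"
  shows "rlint (b + 2 - 2 * a) f x = q * x powr (b + 1) / Gamma (b + 2)
    + B * (Gamma (3 - a) / Gamma (b + 3 - a)) * x powr (b + 2 - a) + k * rlint (b + 2) g x"
proof -
  have x': "x \<in> {0..1}" "0 < x" using x by auto
  have p_eq: "(2::real) - 1 = 1" "b + 2 - 1 = b + 1" "3 - a - 1 = 2 - a" "b + 3 - a - 1 = b + 2 - a" "b + (3 - a) = b + 3 - a" by simp_all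
  have a3: "0 < 3 - a" using a by simp
  note p1 = rlint_power[OF b _ x'(2), of 2] and p2 = rlint_power[OF b a3 x'(2), unfolded p_eq]
  have ok1: "rl_ok b (\<lambda>t. t powr 1) x" and e1: "rlint b (\<lambda>t. t powr 1) x = x powr (b + 1) / Gamma (b + 2)"
    using p1 by (simp_all only: p_eq Gamma_numeral) simp
  have ok2: "rl_ok b (\<lambda>t. t powr (2 - a)) x"
    and e2: "rlint b (\<lambda>t. t powr (2 - a)) x = Gamma (3 - a) / Gamma (b + 3 - a) * x powr (b + 2 - a)"
    by (fact p2)+
  have ok3: "rl_ok b (rlint 2 g) x" and e3: "rlint b (rlint 2 g) x = rlint (b + 2) g x"
    using rlint_semigroup[OF b _ ok] by auto
  have "rlint (b + (2 - 2 * a)) f x = rlint b (rlint (2 - 2 * a) f) x"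
    using rlint_semigroup_continuous[OF b _ f x'(1), of "2 - 2 * a"] a by simp
  also have "\<dots> = rlint b (\<lambda>t. q * t powr 1 + (B * t powr (2 - a) + k * rlint 2 g t)) x"
    by (rule rlint_cong) (use eq x in auto)
  also have "\<dots> = q * rlint b (\<lambda>t. t powr 1) x + (B * rlint b (\<lambda>t. t powr (2 - a)) x + k * rlint b (rlint 2 g) x)"
    unfolding rlint_add(2)[OF rlint_cmult(1)[OF ok1] rlint_add(1)[OF rlint_cmult(1)[OF ok2] rlint_cmult(1)[OF ok3]]]
      rlint_add(2)[OF rlint_cmult(1)[OF ok2] rlint_cmult(1)[OF ok3]]
      rlint_cmult(2)[OF ok1] rlint_cmult(2)[OF ok2] rlint_cmult(2)[OF ok3] ..
  finally show ?thesis unfolding e1 e2 e3 by (simp add: algebra_simps)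
qed

text \<open>The case b = 1, where q x becomes q x^2/2. This is the origin of the factor 2/h^2 in the
  averages.\<close>

lemma rlint_of_expansion_1:
  assumes a: "a < 1" and f: "continuous_on {0..1} f"
    and eq: "\<And>x. x \<in> {0<..<1} \<Longrightarrow> rlint (2 - 2 * a) f x = q * x + B * x powr (2 - a) + k * rlint 2 g x"
    and x: "x \<in> {0<..1}" and ok: "rl_ok 3 g x"
  shows "rlint (3 - 2 * a) f x = q * x\<^sup>2 / 2 + B / (3 - a) * x powr (1 - a) * x\<^sup>2 + k * rlint 3 g x"
proof -
  have "rlint (1 + 2 - 2 * a) f x = q * x powr (1 + 1) / Gamma (1 + 2)
    + B * (Gamma (3 - a) / Gamma (1 + 3 - a)) * x powr (1 + 2 - a) + k * rlint (1 + 2) g x"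
    by (rule rlint_of_expansion[OF a f _ eq x]) (use ok in auto)
  moreover have "x powr (3 - a) = x powr (1 - a) * x\<^sup>2"
    using x powr_add[of x "1 - a" 2] by (simp add: powr_numeral)
  moreover have "Gamma (4 - a) = (3 - a) * Gamma (3 - a)" "0 < Gamma (3 - a)"
    using Gamma_plus1[of "3 - a"] a by (auto simp: nonpos_Ints_def add_ac intro!: Gamma_real_pos)
  ultimately show ?thesis using x by (simp add: powr_numeral Gamma_numeral)
qed

text \<open>
  At the scale \<open>h = \<mu>\<^bsup>-1/a\<^esup>\<close> both \<open>I\<^bsup>2-2a\<^esup> f\<close> and \<open>\<mu>\<^sup>2 I\<^sup>2 f\<close> are controlled by \<open>\<integral>\<bar>f\<bar>\<close> over \<open>(0, h)\<close>; applying
  \<open>I\<^sup>1\<close> and \<open>I\<^sup>2\<close> to the equation gives two independent linear conditions, which bound \<open>q\<close> and \<open>B\<close> separately.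
\<close>

lemma mode_coefficient_bounds:
  assumes a: "1/2 < a" "a < 1"
  shows "\<exists>C\<ge>0. \<forall>f q B \<mu> h. continuous_on {0..1} f \<longrightarrow> 1 \<le> \<mu> \<longrightarrow> h \<in> {0<..1} \<longrightarrow>
     (\<forall>x\<in>{0..1}. rlint (2 - 2 * a) f x = q * x + B * x powr (2 - a) + \<mu>\<^sup>2 * rlint 2 f x) \<longrightarrow>
     (2 / h\<^sup>2 * rlint (3 - 2 * a) f h)\<^sup>2 \<le> C * (\<mu>\<^sup>2 * (LBINT s:{0<..<1}. s powr (1 - 2 * a) * (f s)\<^sup>2))"
proof -
  define C1 where "C1 = 1 / Gamma (3 - 2 * a) + 1 / Gamma 3"
  define C2 where "C2 = 1 / Gamma (4 - 2 * a) + 1 / Gamma 4"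
  \<comment> \<open>Eliminating X from q/2 + X and q/6 + X/(4-a) leaves q (1-a)/(6(4-a)); the
    leading factor of \<open>D\<close> is its reciprocal.\<close>
  define D where "D = (6 * (4 - a) / (1 - a)) * (C1 / (4 - a) + C2)"
  define C where "C = D + 2 * (C1 + D / 2) + 1 + 2 / Gamma (3 - 2 * a)"
  have G: "0 < Gamma (3 - 2 * a)" "0 < Gamma (4 - 2 * a)" "0 < Gamma (3 - a)" using a by (auto intro!: Gamma_real_pos)
  have G3: "Gamma 3 = (2::real)" "Gamma 4 = (6::real)" by (simp_all add: Gamma_numeral fact_numeral)
  have G45: "Gamma (4 - a) = (3 - a) * Gamma (3 - a)" "Gamma (5 - a) = (4 - a) * ((3 - a) * Gamma (3 - a))"
    using Gamma_plus1[of "3 - a"] Gamma_plus1[of "4 - a"] a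
    by (auto simp: nonpos_Ints_def add_ac) 
  have C12: "0 \<le> C1" "0 \<le> C2" using G by (auto simp: C1_def C2_def G3)
  have D: "0 \<le> D" unfolding D_def using a C12 by (intro mult_nonneg_nonneg add_nonneg_nonneg divide_nonneg_nonneg) auto
  have C: "0 \<le> C" unfolding C_def using C12 D G by simp
  have main: "(2 / h\<^sup>2 * rlint (3 - 2 * a) f h)\<^sup>2 \<le> C\<^sup>2 * (\<mu>\<^sup>2 * (LBINT s:{0<..<1}. s powr (1 - 2 * a) * (f s)\<^sup>2))"
    if f: "continuous_on {0..1} f" and \<mu>: "1 \<le> \<mu>" and h: "h \<in> {0<..1}"
      and eq: "\<And>x. x \<in> {0..1} \<Longrightarrow> rlint (2 - 2 * a) f x = q * x + B * x powr (2 - a) + \<mu>\<^sup>2 * rlint 2 f x"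
    for f q B \<mu> h
  proof -
    define t where "t = (LBINT s:{0<..<1}. s powr (1 - 2 * a) * (f s)\<^sup>2)"
    define A where "A x = x powr (- 2 * a) * rlint 1 (\<lambda>t. \<bar>f t\<bar>) x" for x
    \<comment> \<open>The critical scale mu^(-1/a), in (0, 1] because mu >= 1, with g^(-2a) = mu^2.
      The \<open>h\<close> of the statement is an arbitrary averaging length.\<close>
    define g where "g = \<mu> powr (- (1 / a))"
    have g: "g \<in> {0<..1}" "g powr (- 2 * a) = \<mu>\<^sup>2"
    proof -
      show "g \<in> {0<..1}" unfolding g_def using \<mu> a powr_mono2[of "- (1/a)" \<mu> 1]
        using powr_mono[of "- (1 / a)" 0 \<mu>] by auto
      show "g powr (- 2 * a) = \<mu>\<^sup>2" unfolding g_def powr_powr using \<mu> a by (simp add: powr_numeral)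
    qed
    have I: "0 \<le> rlint 1 (\<lambda>t. \<bar>f t\<bar>) x" for x
      unfolding rlint_1 set_lebesgue_integral_def by (rule Bochner_Integration.integral_nonneg) simp
    have A: "0 \<le> A x" for x unfolding A_def using I by simp
    have At: "(A x)\<^sup>2 \<le> \<mu>\<^sup>2 * t" if "x \<in> {g..1}" for x
    proof -
      have x: "x \<in> {0<..1}" using that g by auto
      have "x powr (- 2 * a) \<le> \<mu>\<^sup>2" unfolding g(2)[symmetric] using that g a by (intro powr_mono2') auto
      moreover have "0 \<le> t" unfolding t_def set_lebesgue_integral_def by (rule Bochner_Integration.integral_nonneg) simp
      ultimately show ?thesis
        using L1_sq_le_weighted[OF a f x] unfolding A_def t_def[symmetric]
        by (meson mult_right_mono order_trans)
    qed
    have ok: "rl_ok 1 f x" if "x \<in> {0<..1}" for x by (rule rl_ok_continuous[OF _ f]) (use that in auto)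
    have L: "\<bar>rlint b f x\<bar> \<le> x powr (b - 1) / Gamma b * rlint 1 (\<lambda>t. \<bar>f t\<bar>) x" if "1 \<le> b" "x \<in> {0<..1}" for b x
      by (rule rlint_le_L1[OF that(1) ok[OF that(2)]]) (use that in auto)
    have ok': "rl_ok b f x" if "1 \<le> b" "x \<in> {0<..1}" for b x by (rule rl_ok_mono[OF ok that(1)]) (rule that)
    have R1: "rlint (3 - 2 * a) f x = q * x\<^sup>2 / 2 + B / (3 - a) * x powr (1 - a) * x\<^sup>2 + \<mu>\<^sup>2 * rlint 3 f x" if x: "x \<in> {0<..1}" for x
      by (rule rlint_of_expansion_1[OF a(2) f _ x ok'[OF _ x]]) (use eq in auto)
    have R2: "rlint (4 - 2 * a) f x = q * x ^ 3 / 6 + B / (3 - a) * x powr (1 - a) / (4 - a) * x ^ 3 + \<mu>\<^sup>2 * rlint 4 f x" if x: "x \<in> {0<..1}" for x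
    proof -
      have "rlint (2 + 2 - 2 * a) f x = q * x powr (2 + 1) / Gamma (2 + 2)
        + B * (Gamma (3 - a) / Gamma (2 + 3 - a)) * x powr (2 + 2 - a) + \<mu>\<^sup>2 * rlint (2 + 2) f x"
        by (rule rlint_of_expansion[OF a(2) f _ _ x ok'[OF _ x]]) (use eq in auto)
      moreover have "x powr (4 - a) = x powr (1 - a) * x ^ 3"
        using x powr_add[of x "1 - a" 3] by (simp add: powr_numeral)
      ultimately show ?thesis using x G by (simp add: powr_numeral G3 G45 mult_ac)
    qed
    have g2: "g powr (2 - 2 * a) = g\<^sup>2 * \<mu>\<^sup>2" "g powr (3 - 2 * a) = g ^ 3 * \<mu>\<^sup>2"
      using powr_add[of g 2 "- 2 * a"] powr_add[of g 3 "- 2 * a"] g by (simp_all add: powr_numeral)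
    define X where "X = B / (3 - a) * g powr (1 - a)"
    have E1: "\<bar>q / 2 + X\<bar> \<le> C1 * A g"
    proof -
      have "g\<^sup>2 * \<bar>q / 2 + X\<bar> = \<bar>g\<^sup>2 * (q / 2 + X)\<bar>" by (simp add: abs_mult)
      also have "\<dots> = \<bar>rlint (3 - 2 * a) f g - \<mu>\<^sup>2 * rlint 3 f g\<bar>"
        unfolding R1[OF g(1)] X_def by (simp add: algebra_simps)
      also have "\<dots> \<le> \<bar>rlint (3 - 2 * a) f g\<bar> + \<mu>\<^sup>2 * \<bar>rlint 3 f g\<bar>"
        using abs_triangle_ineq4[of "rlint (3 - 2 * a) f g" "\<mu>\<^sup>2 * rlint 3 f g"] by (simp add: abs_mult)
      also have "\<dots> \<le> g powr (2 - 2 * a) / Gamma (3 - 2 * a) * rlint 1 (\<lambda>t. \<bar>f t\<bar>) g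
          + \<mu>\<^sup>2 * (g powr 2 / Gamma 3 * rlint 1 (\<lambda>t. \<bar>f t\<bar>) g)"
        using L[of "3 - 2 * a" g] L[of 3 g] g a by (intro add_mono mult_left_mono) (auto simp: algebra_simps)
      also have "\<dots> = g\<^sup>2 * (C1 * A g)"
        unfolding g2 A_def g(2) C1_def using g by (simp add: powr_numeral algebra_simps)
      finally show ?thesis using g by simp
    qed
    have E2: "\<bar>q / 6 + X / (4 - a)\<bar> \<le> C2 * A g"
    proof -
      have "g ^ 3 * \<bar>q / 6 + X / (4 - a)\<bar> = \<bar>g ^ 3 * (q / 6 + X / (4 - a))\<bar>" using g by (simp add: abs_mult)
      also have "\<dots> = \<bar>rlint (4 - 2 * a) f g - \<mu>\<^sup>2 * rlint 4 f g\<bar>"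
        unfolding R2[OF g(1)] X_def by (simp add: algebra_simps)
      also have "\<dots> \<le> \<bar>rlint (4 - 2 * a) f g\<bar> + \<mu>\<^sup>2 * \<bar>rlint 4 f g\<bar>"
        using abs_triangle_ineq4[of "rlint (4 - 2 * a) f g" "\<mu>\<^sup>2 * rlint 4 f g"] by (simp add: abs_mult)
      also have "\<dots> \<le> g powr (3 - 2 * a) / Gamma (4 - 2 * a) * rlint 1 (\<lambda>t. \<bar>f t\<bar>) g
          + \<mu>\<^sup>2 * (g powr 3 / Gamma 4 * rlint 1 (\<lambda>t. \<bar>f t\<bar>) g)"
        using L[of "4 - 2 * a" g] L[of 4 g] g a by (intro add_mono mult_left_mono) (auto simp: algebra_simps)
      also have "\<dots> = g ^ 3 * (C2 * A g)"
        unfolding g2 A_def g(2) C2_def using g by (simp add: powr_numeral algebra_simps)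
      finally show ?thesis using g by simp
    qed
    have Dq: "\<bar>q\<bar> \<le> D * A g"
    proof -
      have "q / 2 / (4 - a) - q / 6 = - (q * ((1 - a) / (6 * (4 - a))))"
        using a by (simp add: divide_simps) (simp add: algebra_simps)
      then have "q * ((1 - a) / (6 * (4 - a))) = (q / 6 + X / (4 - a)) - (q / 2 + X) / (4 - a)"
        by (simp add: add_divide_distrib)
      then have "\<bar>q\<bar> * ((1 - a) / (6 * (4 - a))) = \<bar>(q / 6 + X / (4 - a)) - (q / 2 + X) / (4 - a)\<bar>"
        using a by (simp add: abs_mult flip: \<open>q * ((1 - a) / (6 * (4 - a))) = _\<close>)
      also have "\<dots> \<le> \<bar>q / 6 + X / (4 - a)\<bar> + \<bar>q / 2 + X\<bar> / (4 - a)"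
        using abs_triangle_ineq4[of "q / 6 + X / (4 - a)" "(q / 2 + X) / (4 - a)"] a by simp
      also have "\<dots> \<le> C2 * A g + C1 * A g / (4 - a)" using E1 E2 a by (intro add_mono divide_right_mono) auto
      also have "\<dots> = D * A g * ((1 - a) / (6 * (4 - a)))" 
      proof -
        have "6 * (4 - a) / (1 - a) * ((1 - a) / (6 * (4 - a))) = 1" using a by simp
        moreover have "D * A g * ((1 - a) / (6 * (4 - a)))
            = (6 * (4 - a) / (1 - a) * ((1 - a) / (6 * (4 - a)))) * ((C1 / (4 - a) + C2) * A g)"
          unfolding D_def by (simp only: mult_ac)
        ultimately have "D * A g * ((1 - a) / (6 * (4 - a))) = (C1 / (4 - a) + C2) * A g" by simp
        then show ?thesis by (simp add: algebra_simps)
      qed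
      finally have *: "\<bar>q\<bar> * ((1 - a) / (6 * (4 - a))) \<le> D * A g * ((1 - a) / (6 * (4 - a)))" .
      show ?thesis by (rule mult_right_le_imp_le[OF *]) (use a in auto)
    qed
    have DX: "\<bar>X\<bar> \<le> (C1 + D / 2) * A g" using E1 Dq by (simp add: algebra_simps)
    define Zh where "Zh = 2 / h\<^sup>2 * rlint (3 - 2 * a) f h"
    have hp: "0 < h" "0 < h\<^sup>2" using h by auto
    \<comment> \<open>Above the critical scale the average is bounded directly by the local L^1 norm
      at h. Below it the expansion is used with the bounds for q and B found at scale g.\<close>
    have "\<exists>x\<in>{g..1}. \<bar>Zh\<bar> \<le> C * A x"
    proof (cases "g \<le> h")
      case True
      have "h powr (2 - 2 * a) = h\<^sup>2 * h powr (- 2 * a)"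
        using powr_add[of h 2 "- 2 * a"] h by (simp add: powr_numeral)
      then have "\<bar>rlint (3 - 2 * a) f h\<bar> \<le> h\<^sup>2 / Gamma (3 - 2 * a) * A h"
        using L[of "3 - 2 * a" h] h a unfolding A_def by (simp add: algebra_simps)
      then have "\<bar>Zh\<bar> \<le> 2 / h\<^sup>2 * (h\<^sup>2 / Gamma (3 - 2 * a) * A h)"
        unfolding Zh_def abs_mult by (intro mult_mono) auto
      also have "\<dots> = 2 / Gamma (3 - 2 * a) * A h" using hp by simp
      also have "\<dots> \<le> C * A h" using C12 D by (intro mult_right_mono A) (auto simp: C_def)
      finally show ?thesis using True h by auto
    next
      case False
      have "Zh = q + 2 * (B / (3 - a) * h powr (1 - a)) + 2 / h\<^sup>2 * (\<mu>\<^sup>2 * rlint 3 f h)"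
        unfolding Zh_def R1[OF h] using hp by (simp add: field_simps)
      moreover have "\<bar>B / (3 - a) * h powr (1 - a)\<bar> \<le> \<bar>X\<bar>"
        unfolding X_def abs_mult using False h a by (intro mult_left_mono) (auto intro!: powr_mono2)
      moreover have "\<bar>2 / h\<^sup>2 * (\<mu>\<^sup>2 * rlint 3 f h)\<bar> \<le> A g"
      proof -
        have "rlint 1 (\<lambda>t. \<bar>f t\<bar>) h \<le> rlint 1 (\<lambda>t. \<bar>f t\<bar>) g"
          unfolding rlint_1 set_lebesgue_integral_def
        proof (rule integral_mono)
          have "set_integrable lborel {0<..<x} (\<lambda>s. \<bar>f s\<bar>)" if "x \<in> {0<..1}" for x
            by (rule set_integrable_abs) (use ok[OF that] in \<open>simp only: rl_ok_1_iff\<close>)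
          then show "integrable lborel (\<lambda>s. indicat_real {0<..<h} s *\<^sub>R \<bar>f s\<bar>)" "integrable lborel (\<lambda>s. indicat_real {0<..<g} s *\<^sub>R \<bar>f s\<bar>)"
            using h g(1) unfolding set_integrable_def by blast+
        qed (use False in \<open>auto simp: indicator_def\<close>)
        moreover have "\<bar>rlint 3 f h\<bar> \<le> h\<^sup>2 / 2 * rlint 1 (\<lambda>t. \<bar>f t\<bar>) h"
          using L[of 3 h] h by (simp add: powr_numeral G3)
        ultimately have "\<bar>rlint 3 f h\<bar> \<le> h\<^sup>2 / 2 * rlint 1 (\<lambda>t. \<bar>f t\<bar>) g"
          by (meson mult_left_mono order_trans divide_nonneg_nonneg zero_le_power2 zero_le_numeral)
        then have "2 / h\<^sup>2 * (\<mu>\<^sup>2 * \<bar>rlint 3 f h\<bar>) \<le> 2 / h\<^sup>2 * (\<mu>\<^sup>2 * (h\<^sup>2 / 2 * rlint 1 (\<lambda>t. \<bar>f t\<bar>) g))"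
          by (intro mult_left_mono) auto
        then show ?thesis unfolding A_def g(2) using hp by (simp add: abs_mult)
      qed
      ultimately have "\<bar>Zh\<bar> \<le> \<bar>q\<bar> + 2 * \<bar>X\<bar> + A g" by linarith
      also have "\<dots> \<le> D * A g + 2 * ((C1 + D / 2) * A g) + 1 * A g" using Dq DX by linarith
      also have "\<dots> = (D + 2 * (C1 + D / 2) + 1) * A g" by (simp only: distrib_right mult.assoc)
      also have "\<dots> \<le> C * A g" using G by (intro mult_right_mono A) (auto simp: C_def)
      finally show ?thesis using g by auto
    qed
    then obtain x where x: "x \<in> {g..1}" "\<bar>Zh\<bar> \<le> C * A x" by blast
    have "Zh\<^sup>2 \<le> (C * A x)\<^sup>2" using x(2) by (simp add: abs_le_square_iff[symmetric])
    also have "\<dots> \<le> C\<^sup>2 * (\<mu>\<^sup>2 * t)" unfolding power_mult_distrib by (intro mult_left_mono At x) auto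
    finally show ?thesis unfolding Zh_def t_def .
  qed
  show ?thesis by (rule exI[of _ "C\<^sup>2"]) (intro conjI allI impI main, auto)
qed

text \<open>A uniform L^2 bound gives equi-integrability: |f| <= min |f| M + f^2/M. The truncated
  part is handled by dominated convergence and the rest is at most K/M.\<close>

lemma ip_vanishes_of_bounded:
  assumes f: "\<And>j. cpi (f j)" and K: "\<And>j. ip (f j) (f j) \<le> K" and g: "cpi g" "\<And>y. y \<in> {- pi..pi} \<Longrightarrow> \<bar>g y\<bar> \<le> 1"
    and lim: "\<And>y. y \<in> {- pi<..<pi} \<Longrightarrow> (\<lambda>j. f j y) \<longlonglongrightarrow> 0"
  shows "(\<lambda>j. ip (f j) g) \<longlonglongrightarrow> 0"
proof (rule LIMSEQ_I)
  fix r :: real assume r: "0 < r"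
  define M where "M = 2 * (\<bar>K\<bar> + 1) / r"
  have M: "0 < M" using r by (simp add: M_def)
  have "K * r < (\<bar>K\<bar> + 1) * r" using r by (intro mult_strict_right_mono) auto
  then have KM: "K / M < r / 2" by (simp add: M_def field_simps)
  let ?h = "\<lambda>j y. min \<bar>f j y\<bar> M"
  have ch: "cpi (?h j)" for j by (intro continuous_intros f)
  have "(\<lambda>j. integral {- pi<..<pi} (?h j)) \<longlonglongrightarrow> integral {- pi<..<pi} (\<lambda>y. 0)"
  proof (rule dominated_convergence(2))
    show "?h j integrable_on {- pi<..<pi}" for j
      using int_cpi[OF ch[of j]] by (simp add: integrable_on_open_interval_real)
    show "(\<lambda>y. M) integrable_on {- pi<..<pi}"
      by (simp add: integrable_on_open_interval_real int_cpi)
    show "norm (?h j y) \<le> M" for j y using M by simp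
    show "(\<lambda>j. ?h j y) \<longlonglongrightarrow> 0" if "y \<in> {- pi<..<pi}" for y
    proof -
      have "(\<lambda>j. min \<bar>f j y\<bar> M) \<longlonglongrightarrow> min \<bar>0\<bar> M"
        by (intro tendsto_min tendsto_rabs lim that tendsto_const)
      then show ?thesis using M by simp
    qed
  qed
  then have "(\<lambda>j. integral {- pi..pi} (?h j)) \<longlonglongrightarrow> 0" by (simp add: integral_open_interval_real)
  from LIMSEQ_D[OF this, of "r / 2"] obtain N where N: "\<And>j. j \<ge> N \<Longrightarrow> \<bar>integral {- pi..pi} (?h j)\<bar> < r / 2"
    using r by auto
  have "\<bar>ip (f j) g\<bar> < r" if "j \<ge> N" for j
  proof -
    have "\<bar>ip (f j) g\<bar> \<le> integral {- pi..pi} (\<lambda>y. ?h j y + 1 / M * (f j y * f j y))"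
    proof (rule integral_norm_bound_integral[of "\<lambda>y. f j y * g y", unfolded real_norm_def])
      show "\<bar>f j y * g y\<bar> \<le> ?h j y + 1 / M * (f j y * f j y)" if y: "y \<in> {- pi..pi}" for y
      proof -
        have "\<bar>f j y * g y\<bar> \<le> \<bar>f j y\<bar>" using mult_left_mono[OF g(2)[OF y], of "\<bar>f j y\<bar>"] by (simp add: abs_mult)
        moreover have "\<bar>f j y\<bar> \<le> ?h j y + 1 / M * (f j y * f j y)"
        proof (cases "\<bar>f j y\<bar> \<le> M")
          case False
          then have "M * \<bar>f j y\<bar> \<le> \<bar>f j y\<bar> * \<bar>f j y\<bar>" by (intro mult_right_mono) auto
          then have "\<bar>f j y\<bar> \<le> f j y * f j y / M" using M by (simp add: field_simps)
          then show ?thesis using M False by simp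
        qed (use M in simp)
        ultimately show ?thesis by linarith
      qed
    qed (intro int_cpi continuous_intros f g ch)+
    also have "\<dots> = integral {- pi..pi} (?h j) + integral {- pi..pi} (\<lambda>y. 1 / M * (f j y * f j y))"
      by (intro integral_add int_cpi continuous_intros f ch)
    also have "integral {- pi..pi} (\<lambda>y. 1 / M * (f j y * f j y)) = 1 / M * ip (f j) (f j)" by (rule integral_mult_right)
    also have "\<dots> \<le> K / M" using K[of j] M by (simp add: divide_right_mono)
    finally show ?thesis using N[OF that] KM by linarith
  qed
  then show "\<exists>N. \<forall>j\<ge>N. norm (ip (f j) g - 0) < r" by auto
qed

text \<open>The shift by 2 keeps the averaging lengths in (0, 1/2].\<close>

definition hs :: "nat \<Rightarrow> real" where "hs j = 1 / real (j + 2)"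

lemma hs: "0 < hs j" "hs j \<le> 1 / 2" "hs \<longlonglongrightarrow> 0"
proof -
  show "0 < hs j" "hs j \<le> 1 / 2" by (auto simp: hs_def field_simps)
  show "hs \<longlonglongrightarrow> 0" using LIMSEQ_ignore_initial_segment[OF lim_1_over_n, of 2] by (simp add: hs_def[abs_def])
qed

lemma rlint_1_vanishes:
  assumes "set_integrable lborel {0<..<1/2} f"
  shows "(\<lambda>j. rlint 1 f (hs j)) \<longlonglongrightarrow> 0"
proof -
  have "(\<lambda>j. LINT s|lborel. indicator {0<..<hs j} s *\<^sub>R f s) \<longlonglongrightarrow> (LINT s|(lborel :: real measure). 0)"
  proof (rule integral_dominated_convergence)
    show "integrable lborel (\<lambda>s. indicator {0<..<1/2} s *\<^sub>R \<bar>f s\<bar>)"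
      using set_integrable_abs[OF assms] unfolding set_integrable_def .
    have "set_integrable lborel {0<..<hs j} f" for j
      by (rule set_integrable_subset[OF assms]) (use hs(2)[of j] in auto)
    then show "(\<lambda>s. indicator {0<..<hs j} s *\<^sub>R f s) \<in> borel_measurable lborel" for j
      unfolding set_integrable_def by blast
    show "AE s in lborel. (\<lambda>j. indicator {0<..<hs j} s *\<^sub>R f s) \<longlonglongrightarrow> 0"
    proof (rule AE_I2)
      fix s :: real
      show "(\<lambda>j. indicator {0<..<hs j} s *\<^sub>R f s) \<longlonglongrightarrow> 0"
      proof (cases "0 < s")
        case True
        have ev: "eventually (\<lambda>j. hs j < s) sequentially" by (rule order_tendstoD(2)[OF hs(3) True])
        show ?thesis by (rule tendsto_eventually, rule eventually_mono[OF ev]) (simp add: indicator_def)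
      qed (simp add: indicator_def)
    qed
    show "AE s in lborel. norm (indicator {0<..<hs j} s *\<^sub>R f s) \<le> indicator {0<..<1/2} s *\<^sub>R \<bar>f s\<bar>" for j
      using hs(2)[of j] by (intro AE_I2) (auto simp: indicator_def)
  qed simp
  then show ?thesis by (simp add: rlint_1 set_lebesgue_integral_def)
qed

text \<open>After multiplication by 2/h^2 the term in B is O(h^(1-a)), and the last term is at most
  |k| times the integral of |g| over (0, h). The lemma is applied for fixed y with g = H(., y) and q
  = 0, and for each mode with g = v_n.\<close>

lemma averaged_expansion_limit:
  assumes a: "a < 1" and f: "continuous_on {0..1} f"
    and eq: "\<And>x. x \<in> {0<..<1} \<Longrightarrow> rlint (2 - 2 * a) f x = q * x + B * x powr (2 - a) + k * rlint 2 g x"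
    and g: "set_integrable lborel {0<..<1/2} g"
  shows "(\<lambda>j. 2 / (hs j)\<^sup>2 * rlint (3 - 2 * a) f (hs j)) \<longlonglongrightarrow> q"
proof -
  define \<omega> where "\<omega> j = 2 * \<bar>B / (3 - a)\<bar> * hs j powr (1 - a) + \<bar>k\<bar> * rlint 1 (\<lambda>t. \<bar>g t\<bar>) (hs j)" for j
  have "(\<lambda>j. hs j powr (1 - a)) \<longlonglongrightarrow> 0"
    using tendsto_powr'[OF hs(3) tendsto_const, of "1 - a"] a hs(1) by (simp add: less_imp_le)
  then have \<omega>: "\<omega> \<longlonglongrightarrow> 2 * \<bar>B / (3 - a)\<bar> * 0 + \<bar>k\<bar> * 0"
    unfolding \<omega>_def by (intro tendsto_add tendsto_mult tendsto_const rlint_1_vanishes set_integrable_abs[OF g])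
  have b: "norm (2 / (hs j)\<^sup>2 * rlint (3 - 2 * a) f (hs j) - q) \<le> \<omega> j" for j
  proof -
    define h where "h = hs j"
    have h: "0 < h" "h \<le> 1 / 2" "h \<in> {0<..1}" using hs(1,2)[of j] by (auto simp: h_def)
    have "set_integrable lborel {0<..<h} g" by (rule set_integrable_subset[OF g]) (use h in auto)
    then have ok: "rl_ok 1 g h" unfolding rl_ok_1_iff .
    have ok3: "rl_ok 3 g h" by (rule rl_ok_mono[OF ok]) simp
    have aux: "\<bar>z\<bar> \<le> u + w" if "z = p + r" "\<bar>r\<bar> \<le> w" "\<bar>p\<bar> = u" for z p r u w :: real
      using that by linarith
    have "2 / h\<^sup>2 * rlint (3 - 2 * a) f h - q = 2 * (B / (3 - a)) * h powr (1 - a) + 2 / h\<^sup>2 * (k * rlint 3 g h)"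
    proof -
      have "rlint (3 - 2 * a) f h = q * h\<^sup>2 / 2 + B / (3 - a) * h powr (1 - a) * h\<^sup>2 + k * rlint 3 g h"
        by (rule rlint_of_expansion_1[OF a f eq h(3) ok3])
      then show ?thesis using h by (simp add: field_simps)
    qed
    moreover have "\<bar>2 / h\<^sup>2 * (k * rlint 3 g h)\<bar> \<le> \<bar>k\<bar> * rlint 1 (\<lambda>t. \<bar>g t\<bar>) h"
    proof -
      have "\<bar>rlint 3 g h\<bar> \<le> h\<^sup>2 / 2 * rlint 1 (\<lambda>t. \<bar>g t\<bar>) h"
        using rlint_le_L1[OF _ ok h(1), of 3] h by (simp add: powr_numeral Gamma_numeral)
      then have "2 / h\<^sup>2 * (\<bar>k\<bar> * \<bar>rlint 3 g h\<bar>) \<le> 2 / h\<^sup>2 * (\<bar>k\<bar> * (h\<^sup>2 / 2 * rlint 1 (\<lambda>t. \<bar>g t\<bar>) h))"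
        by (intro mult_left_mono) auto
      then show ?thesis using h by (simp add: abs_mult)
    qed
    moreover have "\<bar>2 * (B / (3 - a)) * h powr (1 - a)\<bar> = 2 * \<bar>B / (3 - a)\<bar> * h powr (1 - a)"
      by (simp add: abs_mult)
    ultimately show ?thesis unfolding \<omega>_def h_def[symmetric] real_norm_def by (rule aux)
  qed
  have "(\<lambda>j. 2 / (hs j)\<^sup>2 * rlint (3 - 2 * a) f (hs j) - q) \<longlonglongrightarrow> 0"
    by (rule Lim_null_comparison[of _ \<omega>]) (use b \<omega> in \<open>auto intro!: always_eventually\<close>)
  then show ?thesis by (simp add: LIM_zero_iff)
qed

section \<open>Vanishing of q and of all modes\<close>

context null_solution begin

text \<open>The boundary terms vanish in the pairing of v_y with Z n, which gives (n/2) v_n; Bessel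
  for the bounded function v_y does the rest.\<close>

lemma modes_bound: "\<exists>K. \<forall>N. \<forall>s\<in>{0..1}. (\<Sum>n\<in>{1..N}. (m n)\<^sup>2 * (vn n s)\<^sup>2) \<le> K"
proof -
  obtain M where M: "0 \<le> M" "\<And>x y. x \<in> {0..1} \<Longrightarrow> y \<in> {- pi..pi} \<Longrightarrow> \<bar>v x y\<bar> \<le> M \<and> \<bar>vy x y\<bar> \<le> M"
    using v_bounds by metis
  have "(\<Sum>n\<in>{1..N}. (m n)\<^sup>2 * (vn n s)\<^sup>2) \<le> 8 * (1 + c\<^sup>2) * (pi * (M\<^sup>2 * (2 * pi)))" if s: "s \<in> {0..1}" for N s
  proof -
    note cs = slices[OF s]
    have Z: "ip (vy s) (Z n) = real n / 2 * vn n s" for n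
    proof -
      have "ip (vy s) (Z n) = v s pi * Z n pi - v s (- pi) * Z n (- pi) - integral {- pi..pi} (\<lambda>y. v s y * (- (real n / 2 * Y n y)))"
        by (rule integral_parts[OF _ cs(2) _ dv[OF s] Z_has_derivative])
           (intro continuous_on_minus continuous_on_mult continuous_on_const cpi_YZ | simp)+
      also have "integral {- pi..pi} (\<lambda>y. v s y * (- (real n / 2 * Y n y))) = integral {- pi..pi} (\<lambda>y. - (real n / 2) * (v s y * Y n y))"
        by (simp add: mult_ac)
      also have "\<dots> = - (real n / 2) * vn n s" unfolding vn_def by (rule integral_mult_right)
      finally show ?thesis by (simp add: Z_pi)
    qed
    have "ip (vy s) (vy s) \<le> integral {- pi..pi} (\<lambda>y. M\<^sup>2)"
    proof (rule integral_le)
      show "vy s y * vy s y \<le> M\<^sup>2" if "y \<in> {- pi..pi}" for y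
        using M(2)[OF s that] M(1) abs_le_square_iff[of "vy s y" M] by (simp add: power2_eq_square)
    qed (intro int_cpi continuous_intros cs)+
    then have I: "ip (vy s) (vy s) \<le> M\<^sup>2 * (2 * pi)" by (simp add: mult.commute)
    \<comment> \<open>The 8 is 2 times 4: n^2 + 1 <= 2 n^2 for n >= 1, and n^2 = 4 (n/2)^2.\<close>
    have "(\<Sum>n\<in>{1..N}. (m n)\<^sup>2 * (vn n s)\<^sup>2) \<le> (\<Sum>n\<in>{1..N}. 8 * (1 + c\<^sup>2) * (ip (vy s) (Z n))\<^sup>2)"
    proof (rule sum_mono)
      fix n assume "n \<in> {1..N}"
      then have "1 \<le> (real n)\<^sup>2" by (simp add: one_le_power)
      then have "(1 + c\<^sup>2) * ((real n)\<^sup>2 + 1) \<le> (1 + c\<^sup>2) * (2 * (real n)\<^sup>2)" by (intro mult_left_mono) auto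
      with mu_sq_le[OF e, of c n] have "(m n)\<^sup>2 \<le> (1 + c\<^sup>2) * (2 * (real n)\<^sup>2)" by linarith
      then have "(m n)\<^sup>2 * (vn n s)\<^sup>2 \<le> (1 + c\<^sup>2) * (2 * (real n)\<^sup>2) * (vn n s)\<^sup>2" by (rule mult_right_mono) simp
      then show "(m n)\<^sup>2 * (vn n s)\<^sup>2 \<le> 8 * (1 + c\<^sup>2) * (ip (vy s) (Z n))\<^sup>2"
        unfolding Z by (simp add: power2_eq_square algebra_simps)
    qed
    also have "\<dots> = 8 * (1 + c\<^sup>2) * (\<Sum>n\<in>{1..N}. (ip (vy s) (Z n))\<^sup>2)" by (simp only: sum_distrib_left)
    also have "\<dots> \<le> 8 * (1 + c\<^sup>2) * (pi * ip (vy s) (vy s))"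
      by (intro mult_left_mono bessel(2) cs) auto
    also have "\<dots> \<le> 8 * (1 + c\<^sup>2) * (pi * (M\<^sup>2 * (2 * pi)))" using I by (intro mult_left_mono) auto
    finally show ?thesis .
  qed
  then show ?thesis by blast
qed

lemma averages:
  assumes h: "h \<in> {0<..<1}"
  shows "cpi (\<lambda>y. 2 / h\<^sup>2 * rlint (3 - 2 * a) (\<lambda>t. v t y) h)"
    and "ip (\<lambda>y. 2 / h\<^sup>2 * rlint (3 - 2 * a) (\<lambda>t. v t y) h) (Y n) = 2 / h\<^sup>2 * rlint (3 - 2 * a) (vn n) h"
proof -
  interpret kernel_product "\<lambda>s. (h - s) powr (3 - 2 * a - 1)" v "{0<..<h}" "{0..1}" "- pi" pi
  proof
    show "set_integrable lborel {0<..<h} (\<lambda>s. (h - s) powr (3 - 2 * a - 1))"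
      by (rule rl_ok_one) (use a h in auto)
  qed (use h v in auto)
  let ?k = "2 / h\<^sup>2 / Gamma (3 - 2 * a)"
  have W: "(\<lambda>y. 2 / h\<^sup>2 * rlint (3 - 2 * a) (\<lambda>t. v t y) h) = (\<lambda>y. ?k * (LBINT s:{0<..<h}. (h - s) powr (3 - 2 * a - 1) * v s y))"
    by (simp add: rlint_def)
  show "cpi (\<lambda>y. 2 / h\<^sup>2 * rlint (3 - 2 * a) (\<lambda>t. v t y) h)"
    unfolding W by (intro continuous_on_mult continuous continuous_on_const)
  have "ip (\<lambda>y. 2 / h\<^sup>2 * rlint (3 - 2 * a) (\<lambda>t. v t y) h) (Y n)
      = ?k * integral {- pi..pi} (\<lambda>y. (LBINT s:{0<..<h}. (h - s) powr (3 - 2 * a - 1) * v s y) * Y n y)"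
    unfolding integral_mult_right[symmetric] by (rule integral_cong) (simp add: rlint_def)
  also have "\<dots> = ?k * (LBINT s:{0<..<h}. (h - s) powr (3 - 2 * a - 1) * vn n s)"
    unfolding vn_def by (subst fubini(2)) (auto intro!: cpi_YZ)
  finally show "ip (\<lambda>y. 2 / h\<^sup>2 * rlint (3 - 2 * a) (\<lambda>t. v t y) h) (Y n) = 2 / h\<^sup>2 * rlint (3 - 2 * a) (vn n) h"
    by (simp add: rlint_def)
qed

text \<open>For each fixed y the function H(., y) is integrable at 0, so \<open>eq_lt\<close> has no
  linear term. Since this integrability is not known to be uniform in y, the conclusion does not
  pass directly to the coefficients.\<close>

lemma averages_vanish:
  assumes a1: "a < 1" and y: "y \<in> {- pi<..<pi}"
  shows "(\<lambda>j. 2 / (hs j)\<^sup>2 * rlint (3 - 2 * a) (\<lambda>t. v t y) (hs j)) \<longlonglongrightarrow> 0"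
proof -
  obtain B where B: "\<And>x. x \<in> {0<..<1} \<Longrightarrow> rlint (2 - 2 * a) (\<lambda>t. v t y) x = B * x powr (2 - a) + rlint 2 (\<lambda>t. H t y) x"
    using eq_lt[OF a1 y] unfolding H_def by blast
  have sub: "(\<lambda>x. (x, y)) ` {0..1} \<subseteq> {0..1} \<times> {- pi..pi}" using y by auto
  have c: "continuous_on {0..1} (\<lambda>x. (x, y))" by (intro continuous_on_Pair continuous_on_id continuous_on_const)
  have cv: "continuous_on {0..1} (\<lambda>t. v t y)" using continuous_on_compose2[OF v c sub] by simp
  show ?thesis
    by (rule averaged_expansion_limit[OF a1 cv, of 0 B 1 "\<lambda>t. H t y"]) (use B H_integrable[OF a1 y, of "1/2"] in auto)
qed

lemma modes_average_limit:
  assumes a1: "a < 1" and eq: "\<And>x. x \<in> {0..1} \<Longrightarrow> Wn n x = q * x + B * x powr (2 - a) + (m n)\<^sup>2 * rlint 2 (vn n) x"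
  shows "(\<lambda>j. 2 / (hs j)\<^sup>2 * rlint (3 - 2 * a) (vn n) (hs j)) \<longlonglongrightarrow> q"
proof (rule averaged_expansion_limit[OF a1 vn_continuous])
  show "rlint (2 - 2 * a) (vn n) x = q * x + B * x powr (2 - a) + (m n)\<^sup>2 * rlint 2 (vn n) x" if "x \<in> {0<..<1}" for x
    using eq[of x] that a1 by (simp add: Wn_def)
  show "set_integrable lborel {0<..<1/2} (vn n)"
    using rl_ok_continuous[OF _ vn_continuous, of 1 "1/2"] unfolding rl_ok_1_iff by auto
qed

text \<open>The average is at most a constant times h^(1-2a) times the supremum of |v_n| on (0, h).
  For a <= 1/2 the power is bounded, and v_n is continuous with v_n(0) = 0.\<close>

lemma linear_term_zero_small:
  assumes a2: "a \<le> 1/2" and eq: "\<And>x. x \<in> {0..1} \<Longrightarrow> Wn n x = q * x + B * x powr (2 - a) + (m n)\<^sup>2 * rlint 2 (vn n) x"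
  shows "q = 0"
proof -
  have a1: "a < 1" using a2 by simp
  note lim = modes_average_limit[OF a1 eq]
  have "(\<lambda>j. 2 / (hs j)\<^sup>2 * rlint (3 - 2 * a) (vn n) (hs j)) \<longlonglongrightarrow> 0"
  proof (rule LIMSEQ_I)
    fix r :: real assume r: "0 < r"
    have G: "0 < Gamma (4 - 2 * a)" using a2 by (intro Gamma_real_pos) simp
    define \<eta> where "\<eta> = r * Gamma (4 - 2 * a) / 4"
    have \<eta>: "0 < \<eta>" using r G by (simp add: \<eta>_def)
    obtain d where d: "0 < d" "\<And>s. s \<in> {0..1} \<Longrightarrow> dist s 0 < d \<Longrightarrow> dist (vn n s) (vn n 0) < \<eta>"
      using vn_continuous[of n] \<eta> unfolding continuous_on_iff by (metis atLeastAtMost_iff order_refl zero_le_one)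
    obtain N where N: "\<And>j. j \<ge> N \<Longrightarrow> hs j < d"
      using order_tendstoD(2)[OF hs(3) d(1)] unfolding eventually_sequentially by blast
    have "\<bar>2 / (hs j)\<^sup>2 * rlint (3 - 2 * a) (vn n) (hs j)\<bar> < r" if "j \<ge> N" for j
    proof -
      define h where "h = hs j"
      have h: "0 < h" "h \<le> 1 / 2" "h < d" using hs(1,2)[of j] N[OF that] by (auto simp: h_def)
      have "\<bar>rlint (3 - 2 * a) (vn n) h\<bar> \<le> \<eta> * h powr (3 - 2 * a) / Gamma (3 - 2 * a + 1)"
      proof (rule rl_ok_bounded(2))
        show "set_borel_measurable lborel {0<..<h} (vn n)"
          by (intro continuous_set_borel_measurable continuous_on_subset[OF vn_continuous]) (use h in auto)
        show "\<bar>vn n s\<bar> \<le> \<eta>" if "s \<in> {0<..<h}" for s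
          using d(2)[of s] that h by (auto simp: vn_0 dist_real_def)
      qed (use a2 h in auto)
      also have "h powr (3 - 2 * a) \<le> h powr 2" using a2 h by (intro powr_mono') auto
      finally have "\<bar>rlint (3 - 2 * a) (vn n) h\<bar> \<le> \<eta> * h\<^sup>2 / Gamma (4 - 2 * a)"
        using G h \<eta> by (simp add: powr_numeral divide_right_mono)
      then have "2 / h\<^sup>2 * \<bar>rlint (3 - 2 * a) (vn n) h\<bar> \<le> 2 / h\<^sup>2 * (\<eta> * h\<^sup>2 / Gamma (4 - 2 * a))"
        by (intro mult_left_mono) auto
      also have "\<dots> = r / 2" using h G by (simp add: \<eta>_def)
      finally show ?thesis using r by (simp add: abs_mult h_def)
    qed
    then show "\<exists>N. \<forall>j\<ge>N. norm (2 / (hs j)\<^sup>2 * rlint (3 - 2 * a) (vn n) (hs j) - 0) < r" by auto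
  qed
  with lim show "q = 0" by (rule LIMSEQ_unique)
qed

text \<open>The averages have two limits when paired with Y n: q by the equation of the mode, and 0
  by pointwise convergence in y. The second needs a uniform L^2 bound, supplied by
  \<open>parseval_le\<close>: finitely many low modes are bounded because each converges, the others
  share the bound C mu^2 t, summable by \<open>modes_bound\<close>.\<close>

lemma linear_term_zero_large:
  assumes a12: "1/2 < a" "a < 1"
    and eq: "\<And>x. x \<in> {0..1} \<Longrightarrow> Wn n x = q * x + B * x powr (2 - a) + (m n)\<^sup>2 * rlint 2 (vn n) x"
  shows "q = 0"
proof -
  define z where "z j y = 2 / (hs j)\<^sup>2 * rlint (3 - 2 * a) (\<lambda>t. v t y) (hs j)" for j y
  define zn where "zn k j = 2 / (hs j)\<^sup>2 * rlint (3 - 2 * a) (vn k) (hs j)" for k j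
  have hs': "hs j \<in> {0<..<1}" "hs j \<in> {0<..1}" for j using hs(1,2)[of j] by auto
  have cz: "cpi (z j)" and ipz: "ip (z j) (Y k) = zn k j" for j k
    using averages[OF hs'(1)] unfolding z_def[abs_def] zn_def by blast+
  define t where "t k = (LBINT s:{0<..<1}. s powr (1 - 2 * a) * (vn k s)\<^sup>2)" for k
  have t0: "0 \<le> t k" for k
    unfolding t_def set_lebesgue_integral_def by (rule Bochner_Integration.integral_nonneg) simp
  obtain K where K: "\<And>N s. s \<in> {0..1} \<Longrightarrow> (\<Sum>n\<in>{1..N}. (m n)\<^sup>2 * (vn n s)\<^sup>2) \<le> K" using modes_bound by blast
  have cvn2: "continuous_on {0..1} (\<lambda>s. (vn k s)\<^sup>2)" for k by (intro continuous_intros vn_continuous)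
  define J where "J = (LBINT s:{0<..<1}. s powr (1 - 2 * a) * K)"
  have tJ: "(\<Sum>k\<in>{1..N}. (m k)\<^sup>2 * t k) \<le> J" for N
  proof -
    have i: "set_integrable lborel {0<..<1} (\<lambda>s. (m k)\<^sup>2 * (s powr (1 - 2 * a) * (vn k s)\<^sup>2))" for k
      using set_integrable_mult_right[of _ lborel "{0<..<1}", OF weighted_square_integrable[OF a12(2) cvn2[of k]]] by blast
    have "(\<Sum>k\<in>{1..N}. (m k)\<^sup>2 * t k) = (\<Sum>k\<in>{1..N}. LBINT s:{0<..<1}. (m k)\<^sup>2 * (s powr (1 - 2 * a) * (vn k s)\<^sup>2))"
      unfolding t_def by simp
    also have "\<dots> = (LBINT s:{0<..<1}. \<Sum>k\<in>{1..N}. (m k)\<^sup>2 * (s powr (1 - 2 * a) * (vn k s)\<^sup>2))"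
      unfolding set_lebesgue_integral_def scaleR_sum_right
      by (rule Bochner_Integration.integral_sum[symmetric]) (use i in \<open>simp add: set_integrable_def\<close>)
    also have "\<dots> \<le> J"
      unfolding J_def
    proof (rule set_integral_mono)
      show "set_integrable lborel {0<..<1} (\<lambda>s. \<Sum>k\<in>{1..N}. (m k)\<^sup>2 * (s powr (1 - 2 * a) * (vn k s)\<^sup>2))"
        unfolding set_integrable_def scaleR_sum_right
        by (rule Bochner_Integration.integrable_sum) (use i in \<open>simp add: set_integrable_def\<close>)
      show "set_integrable lborel {0<..<1} (\<lambda>s. s powr (1 - 2 * a) * K)"
        by (rule weighted_square_integrable[OF a12(2)]) (rule continuous_on_const)
      fix s :: real assume "s \<in> {0<..<1}"
      then have s: "s \<in> {0..1}" by auto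
      have "(\<Sum>k\<in>{1..N}. (m k)\<^sup>2 * (s powr (1 - 2 * a) * (vn k s)\<^sup>2)) = s powr (1 - 2 * a) * (\<Sum>k\<in>{1..N}. (m k)\<^sup>2 * (vn k s)\<^sup>2)"
        unfolding sum_distrib_left by (simp only: mult.left_commute)
      also have "\<dots> \<le> s powr (1 - 2 * a) * K" by (intro mult_left_mono K[OF s]) simp
      finally show "(\<Sum>k\<in>{1..N}. (m k)\<^sup>2 * (s powr (1 - 2 * a) * (vn k s)\<^sup>2)) \<le> s powr (1 - 2 * a) * K" .
    qed
    finally show ?thesis .
  qed
  obtain C where C: "0 \<le> C" and Cz: "\<And>f q B \<mu> h. continuous_on {0..1} f \<Longrightarrow> 1 \<le> \<mu> \<Longrightarrow> h \<in> {0<..1} \<Longrightarrow>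
     (\<forall>x\<in>{0..1}. rlint (2 - 2 * a) f x = q * x + B * x powr (2 - a) + \<mu>\<^sup>2 * rlint 2 f x) \<Longrightarrow>
     (2 / h\<^sup>2 * rlint (3 - 2 * a) f h)\<^sup>2 \<le> C * (\<mu>\<^sup>2 * (LBINT s:{0<..<1}. s powr (1 - 2 * a) * (f s)\<^sup>2))"
    using mode_coefficient_bounds[OF a12] by blast
  have large: "(zn k j)\<^sup>2 \<le> C * ((m k)\<^sup>2 * t k)" if k: "1 \<le> m k" for k j
  proof -
    obtain q B where "\<forall>x\<in>{0..1}. Wn k x = q * x + B * x powr (2 - a) + (m k)\<^sup>2 * rlint 2 (vn k) x"
      using Wn_equation_closed[of k] by blast
    then have "\<forall>x\<in>{0..1}. rlint (2 - 2 * a) (vn k) x = q * x + B * x powr (2 - a) + (m k)\<^sup>2 * rlint 2 (vn k) x"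
      using a12 by (simp add: Wn_def)
    from Cz[OF vn_continuous k hs'(2) this] show ?thesis unfolding zn_def t_def .
  qed
  have "\<exists>b. \<forall>j. (zn k j)\<^sup>2 \<le> b" for k
  proof -
    obtain q B where "\<And>x. x \<in> {0..1} \<Longrightarrow> Wn k x = q * x + B * x powr (2 - a) + (m k)\<^sup>2 * rlint 2 (vn k) x"
      using Wn_equation_closed[of k] by blast
    then have "zn k \<longlonglongrightarrow> q" unfolding zn_def[abs_def] by (rule modes_average_limit[OF a12(2)])
    then have "Bseq (zn k)" by (rule convergent_imp_Bseq[OF convergentI])
    then obtain b where "\<And>j. \<bar>zn k j\<bar> \<le> b" by (auto simp: Bseq_def)
    then have "(zn k j)\<^sup>2 \<le> b\<^sup>2" for j by (meson abs_ge_zero abs_le_square_iff order_trans abs_of_nonneg abs_ge_self)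
    then show ?thesis by blast
  qed
  then obtain b where b: "\<And>k j. (zn k j)\<^sup>2 \<le> b k" by metis
  have b0: "0 \<le> b k" for k using b[of k 0] by (meson order_trans zero_le_power2)
  \<comment> \<open>\<open>mode_coefficient_bounds\<close> requires mu >= 1, which fails for at most
    finitely many modes.\<close>
  obtain N0 :: nat where N0: "\<And>k. k > N0 \<Longrightarrow> 1 \<le> m k"
  proof -
    have p: "0 < sqrt (1 - \<bar>e\<bar>) / 2" using e by simp
    obtain N0 :: nat where N0: "1 / (sqrt (1 - \<bar>e\<bar>) / 2) < real N0" using reals_Archimedean2 by blast
    have "1 \<le> m k" if "k > N0" for k
    proof -
      have "1 / (sqrt (1 - \<bar>e\<bar>) / 2) \<le> real k" using N0 that by linarith
      then have "1 \<le> sqrt (1 - \<bar>e\<bar>) / 2 * real k" using p by (simp add: field_simps)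
      then show ?thesis using mu_ge[OF e, of k c] by linarith
    qed
    then show ?thesis using that by blast
  qed
  have par: "(\<Sum>k\<le>N. (ip (z j) (Y k))\<^sup>2) \<le> (\<Sum>k\<le>N0. b k) + C * J" for N j
  proof -
    have "(\<Sum>k\<le>N. (zn k j)\<^sup>2) \<le> (\<Sum>k\<le>N0 + N. (zn k j)\<^sup>2)" by (rule sum_mono2) auto
    also have "\<dots> = (\<Sum>k\<le>N0. (zn k j)\<^sup>2) + (\<Sum>k\<in>{N0<..N0 + N}. (zn k j)\<^sup>2)"
      by (subst sum.union_disjoint[symmetric]) (auto intro!: sum.cong)
    also have "\<dots> \<le> (\<Sum>k\<le>N0. b k) + (\<Sum>k\<in>{N0<..N0 + N}. C * ((m k)\<^sup>2 * t k))"
      by (intro add_mono sum_mono b large N0) auto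
    also have "(\<Sum>k\<in>{N0<..N0 + N}. C * ((m k)\<^sup>2 * t k)) \<le> (\<Sum>k\<in>{1..N0 + N}. C * ((m k)\<^sup>2 * t k))"
      by (rule sum_mono2) (auto intro!: mult_nonneg_nonneg C t0)
    also have "\<dots> = C * (\<Sum>k\<in>{1..N0 + N}. (m k)\<^sup>2 * t k)" by (simp only: sum_distrib_left)
    also have "\<dots> \<le> C * J" by (intro mult_left_mono tJ C)
    finally show ?thesis unfolding ipz by simp
  qed
  have "(\<lambda>j. ip (z j) (Y n)) \<longlonglongrightarrow> 0"
  proof (rule ip_vanishes_of_bounded[OF cz _ cpi_YZ(1) abs_Y_le_1])
    show "ip (z j) (z j) \<le> ((\<Sum>k\<le>N0. b k) + C * J) / pi" for j by (rule parseval_le[OF cz par])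
    show "(\<lambda>j. z j y) \<longlonglongrightarrow> 0" if "y \<in> {- pi<..<pi}" for y
      unfolding z_def by (rule averages_vanish[OF a12(2) that])
  qed
  moreover have "(\<lambda>j. ip (z j) (Y n)) \<longlonglongrightarrow> q"
    unfolding ipz zn_def by (rule modes_average_limit[OF a12(2) eq])
  ultimately show "q = 0" using LIMSEQ_unique by blast
qed

lemma v_zero:
  assumes "x \<in> {0..1}" "y \<in> {- pi..pi}" shows "v x y = 0"
proof (rule Y_complete[OF slices(1)[OF assms(1)] _ assms(2)])
  fix n
  obtain q B where qB: "a = 1 \<longrightarrow> B = 0"
    "\<And>x. x \<in> {0..1} \<Longrightarrow> Wn n x = q * x + B * x powr (2 - a) + (m n)\<^sup>2 * rlint 2 (vn n) x"
    using Wn_equation_closed[of n] by blast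
  have "q = 0" if "a < 1"
    using linear_term_zero_small[OF _ qB(2)] linear_term_zero_large[OF _ that qB(2)] by (meson not_le)
  then have "vn n x = 0" using qB by (intro vn_zero assms(1)) blast
  then show "ip (v x) (Y n) = 0" by (simp only: vn_def)
qed

end

subsection \<open>Uniqueness and the main theorem\<close>

text \<open>Taylor's formula with integral remainder: s -> f(s) + f1(s)(x - s) has derivative h(s)(x
  - s). The absolute value in \<open>Jint\<close> accounts for the reversed orientation when x <
  1/2.\<close>

lemma Jint_taylor:
  assumes f: "\<And>x. x \<in> {0<..<1} \<Longrightarrow> (f has_real_derivative f1 x) (at x)"
    and f1: "\<And>x. x \<in> {0<..<1} \<Longrightarrow> (f1 has_real_derivative h x) (at x)"
    and h: "continuous_on {0<..<1} h" and x: "x \<in> {0<..<1}"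
  shows "f x = f (1/2) + f1 (1/2) * (x - 1/2) + Jint h x"
proof -
  let ?p = "min (1/2) x" and ?q = "max (1/2) x"
  have sub: "{?p..?q} \<subseteq> {0<..<1}" using x by (auto simp: min_def max_def split: if_splits)
  have F: "((\<lambda>s. f s + f1 s * (x - s)) has_real_derivative h s * (x - s)) (at s)" if "s \<in> {0<..<1}" for s
    by (rule DERIV_cong[OF DERIV_add[OF f[OF that] DERIV_mult[OF f1[OF that] DERIV_diff[OF DERIV_const DERIV_ident]]]]) simp
  have F': "((\<lambda>s. f s + f1 s * (x - s)) has_vector_derivative h s * (x - s)) (at s within {?p..?q})" if "s \<in> {?p..?q}" for s
    using F[of s] that sub has_field_derivative_at_within unfolding has_real_derivative_iff_has_vector_derivative[symmetric] by blast
  have c: "continuous_on {?p..?q} (\<lambda>s. h s * (x - s))" "continuous_on {?p..?q} (\<lambda>s. \<bar>x - s\<bar> * h s)"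
    by (intro continuous_intros continuous_on_subset[OF h sub])+
  have i: "integral {?p..?q} (\<lambda>s. h s * (x - s)) = f ?q + f1 ?q * (x - ?q) - (f ?p + f1 ?p * (x - ?p))"
    by (rule integral_unique[OF fundamental_theorem_of_calculus[OF _ F']]) auto
  have "set_integrable lborel {?p<..<?q} (\<lambda>s. \<bar>x - s\<bar> * h s)"
    by (rule set_integrable_subset[OF borel_integrable_atLeastAtMost'[OF c(2)]]) auto
  then have J: "Jint h x = integral {?p..?q} (\<lambda>s. \<bar>x - s\<bar> * h s)"
    unfolding Jint_def by (simp add: set_borel_integral_eq_integral(2) integral_open_interval_real)
  show ?thesis
  proof (cases "1/2 \<le> x")
    case True
    then have "Jint h x = integral {?p..?q} (\<lambda>s. h s * (x - s))"
      unfolding J by (intro integral_cong) (auto simp: mult.commute)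
    then show ?thesis using i True by (simp add: algebra_simps)
  next
    case False
    then have "Jint h x = integral {?p..?q} (\<lambda>s. - (h s * (x - s)))"
      unfolding J by (intro integral_cong) (auto simp: algebra_simps)
    then have "Jint h x = - integral {?p..?q} (\<lambda>s. h s * (x - s))" by simp
    then show ?thesis using i False by (simp add: algebra_simps)
  qed
qed

lemma dy_has_derivative:
  assumes "dy_exists u x y" shows "(u x has_real_derivative dy u x y) (at y within {- pi..pi})"
  using assms unfolding dy_exists_def dy_def has_real_derivative_iff_has_vector_derivative
  by (simp add: vector_derivative_works)

lemma unique_solution:
  assumes a: "0 < a" "a \<le> 1" and e: "\<bar>e\<bar> < 1"
    and reg: "regular_solution a e c u" "regular_solution a e c w"
    and dyc: "dy_continuous_closure u" "dy_continuous_closure w"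
    and bc: "boundary_conditions \<phi> \<psi> u" "boundary_conditions \<phi> \<psi> w"
    and xy: "x \<in> {0..1}" "y \<in> {- pi..pi}"
  shows "u x y = w x y"
proof -
  \<comment> \<open>The equation solved for D^a D^a f. It is linear in f, so the integrated
    equations of two solutions can be subtracted.\<close>
  define G where "G f t y = c\<^sup>2 * f t y - dy (dy f) t y + e * dy (dy f) t (- y)" for f t y
  have d1: "(f x has_real_derivative dy f x y) (at y within {- pi..pi})"
    if "dy_continuous_closure f" "x \<in> {0..1}" "y \<in> {- pi..pi}" for f x y
    by (rule dy_has_derivative) (use that in \<open>auto simp: dy_continuous_closure_def closure_Omega\<close>)
  have d2: "(dy f x has_real_derivative dy (dy f) x y) (at y)"
    if "regular_solution a e c f" "x \<in> {0<..<1}" "y \<in> {- pi<..<pi}" for f x y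
  proof -
    have "dy_exists (dy f) x y" using that by (auto simp: regular_solution_def Omega_def)
    moreover have "at y within {- pi..pi} = at y" by (rule at_within_Icc_at) (use that(3) in auto)
    ultimately show ?thesis using dy_has_derivative[of "dy f" x y] by simp
  qed
  have caputo: "continuous_on {0..1} (\<lambda>t. f t y)"
    "\<And>x. x \<in> {0<..<1} \<Longrightarrow> caputo_differentiable a (\<lambda>t. f t y) x"
    "\<And>x. x \<in> {0<..<1} \<Longrightarrow> caputo_differentiable a (caputo_deriv a (\<lambda>t. f t y)) x"
    "\<And>x. x \<in> {0<..<1} \<Longrightarrow> caputo_deriv a (caputo_deriv a (\<lambda>t. f t y)) x = G f x y"
    if f: "regular_solution a e c f" and y: "y \<in> {- pi<..<pi}" for f y
  proof -
    have c: "continuous_on {0..1} (\<lambda>x. (x, y))" by (intro continuous_on_Pair continuous_on_id continuous_on_const)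
    have sub: "(\<lambda>x. (x, y)) ` {0..1} \<subseteq> closure Omega" using y by (auto simp: closure_Omega)
    have "continuous_on (closure Omega) (\<lambda>(x, y). f x y)" using f by (simp add: regular_solution_def)
    from continuous_on_compose2[OF this c sub] show "continuous_on {0..1} (\<lambda>t. f t y)" by simp
    fix x :: real assume x: "x \<in> {0<..<1}"
    then have "(x, y) \<in> Omega" using y by (simp add: Omega_def)
    then have *: "caputo_differentiable a (\<lambda>t. f t y) x" "caputo_differentiable a (\<lambda>t. caputo_dx a f t y) x"
      "caputo_dx a (caputo_dx a f) x y + dy (dy f) x y - e * dy (dy f) x (- y) - c\<^sup>2 * f x y = 0"
      using f unfolding regular_solution_def by blast+
    then show "caputo_differentiable a (\<lambda>t. f t y) x" "caputo_differentiable a (caputo_deriv a (\<lambda>t. f t y)) x"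
      by (simp_all add: caputo_dx_def[abs_def])
    show "caputo_deriv a (caputo_deriv a (\<lambda>t. f t y)) x = G f x y"
      using *(3) unfolding G_def by (simp add: caputo_dx_def[abs_def])
  qed
  have G_diff: "c\<^sup>2 * (u t y - w t y) - (dy (dy u) t y - dy (dy w) t y) + e * (dy (dy u) t (- y) - dy (dy w) t (- y))
      = G u t y + - 1 * G w t y" for t y
    by (simp add: G_def algebra_simps)
  interpret null_solution a e c "\<lambda>x y. u x y - w x y" "\<lambda>x y. dy u x y - dy w x y" "\<lambda>x y. dy (dy u) x y - dy (dy w) x y"
  proof
    show "0 < a" "a \<le> 1" "\<bar>e\<bar> < 1" by fact+
    show "continuous_on ({0..1} \<times> {- pi..pi}) (\<lambda>(x, y). u x y - w x y)"
      using reg by (auto simp: regular_solution_def closure_Omega case_prod_unfold intro!: continuous_on_diff)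
    show "continuous_on ({0..1} \<times> {- pi..pi}) (\<lambda>(x, y). dy u x y - dy w x y)"
      using dyc by (auto simp: dy_continuous_closure_def closure_Omega case_prod_unfold intro!: continuous_on_diff)
    show "continuous_on ({0<..<1} \<times> {- pi<..<pi}) (\<lambda>(x, y). dy (dy u) x y - dy (dy w) x y)"
      using reg by (auto simp: regular_solution_def Omega_def case_prod_unfold intro!: continuous_on_diff)
    show "((\<lambda>y. u x y - w x y) has_real_derivative dy u x y - dy w x y) (at y within {- pi..pi})"
      if "x \<in> {0..1}" "y \<in> {- pi..pi}" for x y
      by (rule DERIV_diff[OF d1[OF dyc(1) that] d1[OF dyc(2) that]])
    show "((\<lambda>y. dy u x y - dy w x y) has_real_derivative dy (dy u) x y - dy (dy w) x y) (at y)"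
      if "x \<in> {0<..<1}" "y \<in> {- pi<..<pi}" for x y
      by (rule DERIV_diff[OF d2[OF reg(1) that] d2[OF reg(2) that]])
    show "u 0 y - w 0 y = 0" "u 1 y - w 1 y = 0" if "y \<in> {- pi..pi}" for y
      using bc that by (simp_all add: boundary_conditions_def)
    show "dy u x pi - dy w x pi = 0" "dy u x (- pi) - dy w x (- pi) = 0" if "x \<in> {0..1}" for x
      using bc that by (simp_all add: boundary_conditions_def)
  next
    fix y assume a1: "a < 1" and y: "y \<in> {- pi<..<pi}"
    have one: "\<exists>B. \<forall>x\<in>{0<..<1}. rl_ok 2 (\<lambda>t. G f t y) x \<and>
        rlint (2 - 2 * a) (\<lambda>t. f t y) x = \<phi> y * x powr (2 - 2 * a) / Gamma (3 - 2 * a) + B * x powr (2 - a) + rlint 2 (\<lambda>t. G f t y) x"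
      if f: "regular_solution a e c f" "boundary_conditions \<phi> \<psi> f" for f
    proof -
      note cp = caputo[OF f(1) y]
      \<comment> \<open>Both solutions start from the same value, so the term in x^(2-2a) cancels in
        their difference.\<close>
      have f0: "f 0 y = \<phi> y" using f(2) y by (simp add: boundary_conditions_def)
      have cong: "rl_ok 2 (caputo_deriv a (caputo_deriv a (\<lambda>t. f t y))) x \<longleftrightarrow> rl_ok 2 (\<lambda>t. G f t y) x"
        "rlint 2 (caputo_deriv a (caputo_deriv a (\<lambda>t. f t y))) x = rlint 2 (\<lambda>t. G f t y) x" if "x \<in> {0<..<1}" for x
        using rlint_cong[of x "caputo_deriv a (caputo_deriv a (\<lambda>t. f t y))" "\<lambda>t. G f t y" 2] cp(4) that by auto
      from caputo_twice_integrated[OF a(1) a1 cp(1-3)] obtain B where B: "\<And>x. x \<in> {0<..<1} \<Longrightarrow>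
          rl_ok 2 (caputo_deriv a (caputo_deriv a (\<lambda>t. f t y))) x \<and> rlint (2 - 2 * a) (\<lambda>t. f t y) x
            = f 0 y * x powr (2 - 2 * a) / Gamma (3 - 2 * a) + B * x powr (2 - a)
              + rlint 2 (caputo_deriv a (caputo_deriv a (\<lambda>t. f t y))) x" by blast
      show ?thesis
      proof (rule exI[of _ B], rule ballI)
        fix x :: real assume x: "x \<in> {0<..<1}"
        show "rl_ok 2 (\<lambda>t. G f t y) x \<and> rlint (2 - 2 * a) (\<lambda>t. f t y) x
            = \<phi> y * x powr (2 - 2 * a) / Gamma (3 - 2 * a) + B * x powr (2 - a) + rlint 2 (\<lambda>t. G f t y) x"
          by (rule B[OF x, unfolded f0 cong(1)[OF x] cong(2)[OF x]])
      qed
    qed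
    obtain B1 where B1: "\<And>x. x \<in> {0<..<1} \<Longrightarrow> rl_ok 2 (\<lambda>t. G u t y) x \<and>
        rlint (2 - 2 * a) (\<lambda>t. u t y) x = \<phi> y * x powr (2 - 2 * a) / Gamma (3 - 2 * a) + B1 * x powr (2 - a) + rlint 2 (\<lambda>t. G u t y) x"
      using one[OF reg(1) bc(1)] by blast
    obtain B2 where B2: "\<And>x. x \<in> {0<..<1} \<Longrightarrow> rl_ok 2 (\<lambda>t. G w t y) x \<and>
        rlint (2 - 2 * a) (\<lambda>t. w t y) x = \<phi> y * x powr (2 - 2 * a) / Gamma (3 - 2 * a) + B2 * x powr (2 - a) + rlint 2 (\<lambda>t. G w t y) x"
      using one[OF reg(2) bc(2)] by blast
    show "\<exists>B. \<forall>x\<in>{0<..<1}.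
        rl_ok 2 (\<lambda>t. c\<^sup>2 * (u t y - w t y) - (dy (dy u) t y - dy (dy w) t y) + e * (dy (dy u) t (- y) - dy (dy w) t (- y))) x \<and>
        rlint (2 - 2 * a) (\<lambda>t. u t y - w t y) x = B * x powr (2 - a)
          + rlint 2 (\<lambda>t. c\<^sup>2 * (u t y - w t y) - (dy (dy u) t y - dy (dy w) t y) + e * (dy (dy u) t (- y) - dy (dy w) t (- y))) x"
      unfolding G_diff
    proof (rule exI[of _ "B1 - B2"], intro ballI)
      fix x :: real assume x: "x \<in> {0<..<1}"
      note ok = conjunct1[OF B1[OF x]] rlint_cmult(1)[OF conjunct1[OF B2[OF x]], of "- 1"]
      have x': "x \<in> {0..1}" using x by auto
      have w: "0 < 2 - 2 * a" using a1 by simp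
      have oku: "rl_ok (2 - 2 * a) (\<lambda>t. u t y) x" and okw: "rl_ok (2 - 2 * a) (\<lambda>t. w t y) x"
        by (intro rl_ok_continuous[OF w _ x'] caputo(1)[OF _ y] reg)+
      have "rlint (2 - 2 * a) (\<lambda>t. u t y - w t y) x = rlint (2 - 2 * a) (\<lambda>t. u t y + - 1 * w t y) x" by simp
      also have "\<dots> = rlint (2 - 2 * a) (\<lambda>t. u t y) x + - 1 * rlint (2 - 2 * a) (\<lambda>t. w t y) x"
        unfolding rlint_add(2)[OF oku rlint_cmult(1)[OF okw]] rlint_cmult(2)[OF okw] ..
      also have "\<dots> = (B1 - B2) * x powr (2 - a) + (rlint 2 (\<lambda>t. G u t y) x + - 1 * rlint 2 (\<lambda>t. G w t y) x)"
        using B1[OF x] B2[OF x] by (simp add: left_diff_distrib)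
      also have "rlint 2 (\<lambda>t. G u t y) x + - 1 * rlint 2 (\<lambda>t. G w t y) x = rlint 2 (\<lambda>t. G u t y + - 1 * G w t y) x"
        unfolding rlint_add(2)[OF ok] rlint_cmult(2)[OF conjunct1[OF B2[OF x]]] ..
      finally show "rl_ok 2 (\<lambda>t. G u t y + - 1 * G w t y) x \<and>
          rlint (2 - 2 * a) (\<lambda>t. u t y - w t y) x = (B1 - B2) * x powr (2 - a) + rlint 2 (\<lambda>t. G u t y + - 1 * G w t y) x"
        using rlint_add(1)[OF ok] by blast
    qed
  next
    \<comment> \<open>Here the Caputo derivatives are ordinary ones, and Taylor's formula at 1/2
      replaces the integration from 0.\<close>
    fix y assume a1: "a = 1" and y: "y \<in> {- pi<..<pi}"
    have one: "(\<lambda>t. f t y) x = (\<lambda>t. f t y) (1/2) + deriv (\<lambda>t. f t y) (1/2) * (x - 1/2) + Jint (\<lambda>t. G f t y) x"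
      and cG: "continuous_on {0<..<1} (\<lambda>t. G f t y)"
      if f: "regular_solution a e c f" and x: "x \<in> {0<..<1}" for f x
    proof -
      note cp = caputo[OF f y, unfolded a1 caputo_deriv_def caputo_differentiable_def, simplified]
      have c: "continuous_on {0<..<1} (\<lambda>x. (x, y))" by (intro continuous_on_Pair continuous_on_id continuous_on_const)
      have sub: "(\<lambda>x. (x, y)) ` {0<..<1} \<subseteq> Omega" using y by (auto simp: Omega_def)
      have "continuous_on Omega (\<lambda>(x, y). caputo_dx a (caputo_dx a f) x y)" using f by (simp add: regular_solution_def)
      from continuous_on_compose2[OF this c sub]
      have "continuous_on {0<..<1} (\<lambda>x. caputo_dx a (caputo_dx a f) x y)" by simp
      then show cG: "continuous_on {0<..<1} (\<lambda>t. G f t y)"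
        by (rule continuous_on_eq) (use caputo(4)[OF f y] in \<open>simp add: caputo_dx_def[abs_def]\<close>)
      show "(\<lambda>t. f t y) x = (\<lambda>t. f t y) (1/2) + deriv (\<lambda>t. f t y) (1/2) * (x - 1/2) + Jint (\<lambda>t. G f t y) x"
      proof (rule Jint_taylor[OF _ _ cG x])
        fix s :: real assume s: "s \<in> {0<..<1}"
        show "((\<lambda>t. f t y) has_real_derivative deriv (\<lambda>t. f t y) s) (at s)"
          using cp(2) s by (auto simp: field_differentiable_derivI)
        show "(deriv (\<lambda>t. f t y) has_real_derivative G f s y) (at s)"
          using cp(3,4)[of s] s field_differentiable_derivI[of "deriv (\<lambda>t. f t y)" s] by auto
      qed
    qed
    have J: "Jint (\<lambda>t. G u t y) x - Jint (\<lambda>t. G w t y) x = Jint (\<lambda>t. G u t y + - 1 * G w t y) x" if x: "x \<in> {0<..<1}" for x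
    proof -
      let ?p = "min (1/2) x" and ?q = "max (1/2) x"
      have sub: "{?p..?q} \<subseteq> {0<..<1}" using x by (auto simp: min_def max_def split: if_splits)
      have i: "set_integrable lborel {?p<..<?q} (\<lambda>s. \<bar>x - s\<bar> * G f s y)" if "regular_solution a e c f" for f
      proof -
        have "continuous_on {?p..?q} (\<lambda>s. \<bar>x - s\<bar> * G f s y)"
          by (intro continuous_intros continuous_on_subset[OF cG[OF that x] sub])
        from borel_integrable_atLeastAtMost'[OF this] show ?thesis by (rule set_integrable_subset) auto
      qed
      show ?thesis
        unfolding Jint_def using set_integral_diff(2)[OF i[OF reg(1)] i[OF reg(2)]] by (simp add: algebra_simps)
    qed
    let ?P = "(u (1/2) y - w (1/2) y) - (deriv (\<lambda>t. u t y) (1/2) - deriv (\<lambda>t. w t y) (1/2)) / 2"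
    let ?Q = "deriv (\<lambda>t. u t y) (1/2) - deriv (\<lambda>t. w t y) (1/2)"
    show "\<exists>p q. \<forall>x\<in>{0<..<1}. u x y - w x y = p + q * x
        + Jint (\<lambda>t. c\<^sup>2 * (u t y - w t y) - (dy (dy u) t y - dy (dy w) t y) + e * (dy (dy u) t (- y) - dy (dy w) t (- y))) x"
      unfolding G_diff
    proof (rule exI[of _ ?P], rule exI[of _ ?Q], intro ballI)
      fix x :: real assume x: "x \<in> {0<..<1}"
      show "u x y - w x y = ?P + ?Q * x + Jint (\<lambda>t. G u t y + - 1 * G w t y) x"
        using one[OF reg(1) x] one[OF reg(2) x] unfolding J[OF x, symmetric] by (simp add: field_simps)
    qed
  qed
  show ?thesis using v_zero[OF xy] by simp
qed

text \<open>Uniqueness is asserted on the closure of \<open>Omega\<close>, since values elsewhere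
  are arbitrary. Convergence of both series is part of the claim because \<open>suminf\<close> has a
  value for divergent series as well.\<close>

theorem theorem2:
  fixes \<alpha> c \<epsilon> \<delta> :: real and \<phi> \<psi> :: "real \<Rightarrow> real"
  assumes "0 < \<alpha>" and "\<alpha> \<le> 1"
    and "\<bar>\<epsilon>\<bar> < 1"
    and "0 < \<delta>" and "\<delta> < 1"
    and "holder_space 3 \<delta> (- pi) pi \<phi>"
    and "holder_space 2 \<delta> (- pi) pi \<psi>"
    and "(\<phi> has_real_derivative 0) (at (- pi) within {- pi..pi})"
    and "(\<phi> has_real_derivative 0) (at pi within {- pi..pi})"
    and "(\<psi> has_real_derivative 0) (at (- pi) within {- pi..pi})"
    and "(\<psi> has_real_derivative 0) (at pi within {- pi..pi})"
  shows "\<exists>u :: real \<Rightarrow> real \<Rightarrow> real.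
    regular_solution \<alpha> \<epsilon> c u \<and> dy_continuous_closure u \<and> boundary_conditions \<phi> \<psi> u \<and>
    (\<forall>v. regular_solution \<alpha> \<epsilon> c v \<and> dy_continuous_closure v \<and> boundary_conditions \<phi> \<psi> v
         \<longrightarrow> (\<forall>(x, y)\<in>closure Omega. v x y = u x y)) \<and>
    (\<forall>(x, y)\<in>closure Omega.
       summable (\<lambda>k. (fourier_coeff \<phi> (2 * k + 1) * C_fun \<alpha> (mu \<epsilon> c (2 * k + 1)) x
                    + fourier_coeff \<psi> (2 * k + 1) * S_fun \<alpha> (mu \<epsilon> c (2 * k + 1)) x)
                   * Y (2 * k + 1) y) \<and>
       summable (\<lambda>k. (fourier_coeff \<phi> (2 * Suc k) * C_fun \<alpha> (mu \<epsilon> c (2 * Suc k)) x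
                    + fourier_coeff \<psi> (2 * Suc k) * S_fun \<alpha> (mu \<epsilon> c (2 * Suc k)) x)
                   * Y (2 * Suc k) y) \<and>
       u x y =
         zero_mode \<alpha> c (fourier_coeff \<phi> 0) (fourier_coeff \<psi> 0) x
         + (\<Sum>k. (fourier_coeff \<phi> (2 * k + 1) * C_fun \<alpha> (mu \<epsilon> c (2 * k + 1)) x
                  + fourier_coeff \<psi> (2 * k + 1) * S_fun \<alpha> (mu \<epsilon> c (2 * k + 1)) x)
                 * Y (2 * k + 1) y)
         + (\<Sum>k. (fourier_coeff \<phi> (2 * Suc k) * C_fun \<alpha> (mu \<epsilon> c (2 * Suc k)) x
                  + fourier_coeff \<psi> (2 * Suc k) * S_fun \<alpha> (mu \<epsilon> c (2 * Suc k)) x)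
                 * Y (2 * Suc k) y))"
proof -
  note phi = holder3_coeffs[OF assms(4,6,8,9)] and psi = holder2_coeffs[OF assms(4,7,10,11)]
  interpret series_data \<alpha> \<epsilon> c "fourier_coeff \<phi>" "fourier_coeff \<psi>"
    by unfold_locales (use assms(1-3) phi(2) psi(2) in auto)
  note sol = u_regular u_dy_continuous u_boundary[OF phi(1) psi(1) refl refl]
  show ?thesis
  proof (rule exI[of _ u], intro conjI)
    show "\<forall>v. regular_solution \<alpha> \<epsilon> c v \<and> dy_continuous_closure v \<and> boundary_conditions \<phi> \<psi> v
        \<longrightarrow> (\<forall>(x, y)\<in>closure Omega. v x y = u x y)"
    proof (intro allI impI ballI, clarify)
      fix v x y
      assume "regular_solution \<alpha> \<epsilon> c v" "dy_continuous_closure v" "boundary_conditions \<phi> \<psi> v"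
        and xy: "(x, y) \<in> closure Omega"
      then show "v x y = u x y"
        using unique_solution[OF assms(1-3) _ sol(1) _ sol(2) _ sol(3)] xy[unfolded closure_Omega] by blast
    qed
  qed ((rule sol)+, rule ballI, clarify, intro conjI u_series, auto simp: closure_Omega)
qed

end
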